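(* Let $p=p_n$ be a sequence of positive integers and suppose the following hold. (T1) $c_n := p/n \to c \in (0,\infty)$. (T2) For each $n$, $Z_1=Z_1^{(n)}$ and $Z_2=Z_2^{(n)}$ are independent random matrices in $\mathbb{C}^{p\times n}$ with independent entries having zero mean, unit variance ($\mathbb{E}|z_{ij}^{(k)}|^2=1$), and moments of order $4+\eta_0$ bounded uniformly (over all entries, $k\in\{1,2\}$ and all $n$) for some $\eta_0>0$. (T3) $\Sigma_n\in\mathbb{C}^{p\times p}$ is a sequence of (possibly random) positive semi-definite matrices, independent of $Z_1^{(n)},Z_2^{(n)}$, whose empirical spectral distributions $F^{\Sigma_n}$ converge weakly, almost surely, to a (non-random) probability distribution $H\neq\delta_0$ on $[0,\infty)$. (T4) There exists $C>0$ such that $\limsup_{n\to\infty}\frac1p\operatorname{trace}(\Sigma_n)<C$ (almost surely). Let $X_k=\Sigma_n^{1/2}Z_k$ for $k=1,2$ and $S_n=\frac1n(X_1X_2^*-X_2X_1^* )$. Then, almost surely, $F^{S_n}$ converges weakly to $F$, where $F$ is a non-random probability distribution on the imaginary axis whose Stieltjes transform at $z\in\mathbb{C}_L$ is $$s(z)=\frac1z\Big(\frac2c-1\Big)+\frac{1}{\mathrm{i}cz}\Big(\frac{1}{\mathrm{i}+ch(z)}-\frac{1}{-\mathrm{i}+ch(z)}\Big),$$ where $h(z)\in\mathbb{C}_R$ is the unique number in $\mathbb{C}_R$ such that $$h(z)=\int\frac{\lambda\,dH(\lambda)}{-z+\lambda\Big(\dfrac{1}{\mathrm{i}+ch(z)}+\dfrac{1}{-\mathrm{i}+ch(z)}\Big)}.$$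 Further, $h$ is analytic on $\mathbb{C}_L$, and has a continuous dependence on $H$ (for fixed $c$ and $z$, with respect to the Lévy metric on distribution functions).
   Context: $\mathrm{i}=\sqrt{-1}$; $\mathbb{C}_L=\{z\in\mathbb{C}:\Re z<0\}$, $\mathbb{C}_R=\{z\in\mathbb{C}:\Re z>0\}$. $A^*$ is the conjugate transpose of $A$. For a Hermitian $p\times p$ matrix $A$ with eigenvalues $\lambda_1,\dots,\lambda_p$, the empirical spectral distribution is $F^A(x)=\frac1p\sum_j 1_{\{\lambda_j\le x\}}$, $x\in\mathbb{R}$. For a skew-Hermitian $p\times p$ matrix $S$ with eigenvalues $\mathrm{i}\lambda_1,\dots,\mathrm{i}\lambda_p$ ($\lambda_j\in\mathbb{R}$), the empirical spectral distribution is the distribution function on $\mathrm{i}\mathbb{R}$ given by $F^S(\mathrm{i}x)=\frac1p\sum_j 1_{\{\lambda_j\le x\}}$. Weak convergence of distributions on $\mathrm{i}\mathbb{R}$ means weak convergence of the corresponding distributions on $\mathbb{R}$ under the identification $\mathrm{i}x\leftrightarrow x$. The Stieltjes transform of a probability measure $\mu$ on the imaginary axis is $s_\mu(z)=\int_{\mathbb{R}}\frac{\mu(dt)}{\mathrm{i}t-z}$ for $z\notin\operatorname{supp}(\mu)$, where $\mu(dt)$ refers to the mass at $\mathrm{i}t$. *)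

theory Defs
  imports
    "HOL-Probability.Probability"
    "HOL-Computational_Algebra.Fundamental_Theorem_Algebra"
    "Jordan_Normal_Form.Char_Poly"
    "Jordan_Normal_Form.Schur_Decomposition"
begin

text \<open>The Borel structure on r x c complex matrices: the coarsest one making all entries
  measurable.  A random matrix of this size is a measurable map into it; in particular it takes
  its values in \<^term>\<open>carrier_mat r c\<close>.\<close>

definition mat_borel :: "nat \<Rightarrow> nat \<Rightarrow> complex mat measure" where
  "mat_borel r c =
     vimage_algebra (carrier_mat r c)
       (\<lambda>A. \<lambda>ij\<in>{..<r} \<times> {..<c}. A $$ ij)
       (Pi\<^sub>M ({..<r} \<times> {..<c}) (\<lambda>_. borel))"

text \<open>Independence of two random elements whose ranges may have different types
  (the library's \<^const>\<open>prob_space.indep_var\<close> needs equal ones).\<close>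

definition indep_elems ::
    "'w measure \<Rightarrow> 'a measure \<Rightarrow> ('w \<Rightarrow> 'a) \<Rightarrow> 'b measure \<Rightarrow> ('w \<Rightarrow> 'b) \<Rightarrow> bool" where
  "indep_elems M N X N' Y \<longleftrightarrow>
     X \<in> M \<rightarrow>\<^sub>M N \<and> Y \<in> M \<rightarrow>\<^sub>M N' \<and>
     prob_space.indep_set M {X -` A \<inter> space M | A. A \<in> sets N} {Y -` B \<inter> space M | B. B \<in> sets N'}"

definition psd_mat :: "complex mat \<Rightarrow> bool" where
  "psd_mat A \<longleftrightarrow> square_mat A \<and> mat_adjoint A = A \<and>
     (\<forall>v \<in> carrier_vec (dim_row A). 0 \<le> Re ((A *\<^sub>v v) \<bullet>c v))"

definition mat_sqrt :: "complex mat \<Rightarrow> complex mat" where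
  "mat_sqrt A = (THE B. B \<in> carrier_mat (dim_row A) (dim_row A) \<and> psd_mat B \<and> B * B = A)"

definition mat_tr :: "complex mat \<Rightarrow> complex" where
  "mat_tr A = (\<Sum>i<dim_row A. A $$ (i, i))"

definition eigenvalues :: "complex mat \<Rightarrow> complex multiset" where
  "eigenvalues A = proots (char_poly A)"

text \<open>Empirical spectral distribution functions of a Hermitian matrix (eigenvalues
  \<open>\<lambda>\<^sub>j = Re \<lambda>\<^sub>j\<close>) and of a skew-Hermitian matrix (eigenvalues \<open>\<i> \<lambda>\<^sub>j\<close>, so that
  \<open>\<lambda>\<^sub>j = Im (\<i> \<lambda>\<^sub>j)\<close>).  Distributions on the imaginary axis are throughout represented by the
  corresponding distributions on the real line, \<open>\<i> x\<close> being identified with \<open>x\<close>.\<close>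

definition esd_herm :: "complex mat \<Rightarrow> real \<Rightarrow> real" where
  "esd_herm A x = real (size {# l \<in># eigenvalues A. Re l \<le> x #}) / real (dim_row A)"

definition esd_skew :: "complex mat \<Rightarrow> real \<Rightarrow> real" where
  "esd_skew S x = real (size {# l \<in># eigenvalues S. Im l \<le> x #}) / real (dim_row S)"

definition stieltjes_imag :: "real measure \<Rightarrow> complex \<Rightarrow> complex" where
  "stieltjes_imag F z = (LINT t|F. 1 / (\<i> * complex_of_real t - z))"

definition commutator_mat :: "nat \<Rightarrow> complex mat \<Rightarrow> complex mat \<Rightarrow> complex mat \<Rightarrow> complex mat" where
  "commutator_mat n \<Sigma> Z1 Z2 =
     (let X1 = mat_sqrt \<Sigma> * Z1; X2 = mat_sqrt \<Sigma> * Z2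
      in complex_of_real (1 / real n) \<cdot>\<^sub>m (X1 * mat_adjoint X2 - X2 * mat_adjoint X1))"

definition population_dist :: "real measure \<Rightarrow> bool" where
  "population_dist H \<longleftrightarrow> real_distribution H \<and> (AE t in H. 0 \<le> t) \<and> H \<noteq> return borel 0"

text \<open>For \<open>Re z < 0 < Re w\<close>, \<open>c > 0\<close> and \<open>t \<ge> 0\<close> the denominator does not vanish and the integrand is
  bounded in \<open>t\<close>, so the Bochner integral below is a genuine one for every \<open>H\<close> on \<open>[0, \<infinity>)\<close>.\<close>

definition is_h :: "real \<Rightarrow> real measure \<Rightarrow> complex \<Rightarrow> complex \<Rightarrow> bool" where
  "is_h c H z w \<longleftrightarrow> Re w > 0 \<and>
     w = (LINT t|H. complex_of_real t /
            (- z + complex_of_real t *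
                (1 / (\<i> + complex_of_real c * w) + 1 / (- \<i> + complex_of_real c * w))))"

definition h_fun :: "real \<Rightarrow> real measure \<Rightarrow> complex \<Rightarrow> complex" where
  "h_fun c H z = (THE w. is_h c H z w)"

definition levy_dist :: "(real \<Rightarrow> real) \<Rightarrow> (real \<Rightarrow> real) \<Rightarrow> real" where
  "levy_dist F G = Inf {e. 0 < e \<and> (\<forall>x. F (x - e) - e \<le> G x \<and> G x \<le> F (x + e) + e)}"

end

(*
  Write u = -z and Q = (S + u)^-1.  Removing one column from each of the two matrices changes S by a
  skew-Hermitian rank two term; solving the resulting 2x2 system and replacing quadratic forms by
  traces shows that E tr (A Q) is close to tr (A (u + rho Sigma)^-1), where rho = 2 m / (1 + m^2) and
  m = E tr (Sigma Q) / n.  With A = Sigma (u + rho Sigma)^-1 this says that m n / p is an approximate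
  solution of the equation for h.  The kernel of that equation satisfies a strict Cauchy-Schwarz
  contraction estimate at every solution, hence h is unique, and approximate solutions converge to
  it by compactness, also along varying H; existence, analyticity and continuity of h follow.
  Eigenvalues of Sigma above a slowly growing level are removed first: each one costs a bounded
  change of tr Q, and there are few of them because the normalised trace is bounded.

  Conditionally on Sigma, tr Q has bounded differences in the columns, so it concentrates
  exponentially, and Borel-Cantelli gives almost sure convergence of the Stieltjes transforms at a
  countable dense set of points, hence everywhere.  Since H has finite mean, h(-T) tends to 0 as
  T grows, so no mass is lost in the limit and the transforms determine a limiting probability law.
*)
theory Submission
  imports Defs "HOL-Complex_Analysis.Complex_Analysis" "HOL-Real_Asymp.Real_Asymp"
begin

text \<open>Nothing keeps m away from the boundary of the half-plane: only Re m >= 0 is known, and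
  \<rho> has its poles there, at m = i and m = - i. They are excluded by the test matrix A = 1 in
  the same estimate. Up to the error it reads c (1 - u s) (1 + m^2) = 2 m^2, with s the normalised
  mean trace of Q, and s is bounded, so 1 + m^2 cannot be small. Solved for s, the same relation
  gives the formula of the theorem.

  The estimates cost powers of the largest eigenvalue of Sigma, of which only the mean is
  controlled. This bounds the growth of the truncation level from above, while m itself is bounded
  through the trace alone.

  Sigma is random, and its eigenbasis and square root are not visibly measurable. The estimates are
  therefore made for a frozen Sigma, with bounds that do not depend on it. Only the trace of the
  resolvent is regarded as a function of Sigma, through an expression that is rational in the
  entries, so that Fubini's theorem applies.\<close>

subsection \<open>Finitely supported matrices\<close>

text \<open>Matrices of all sizes live in the single ring of finitely supported infinite matrices, so that
  products need no dimension side conditions; \<open>proj p\<close> below plays the role of the identity.\<close>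
typedef fmat = "{f :: nat \<Rightarrow> nat \<Rightarrow> complex. \<exists>N. \<forall>i j. f i j \<noteq> 0 \<longrightarrow> i < N \<and> j < N}"
  morphisms ent Abs_fmat
  by (rule exI[of _ "\<lambda>i j. 0"]) auto

definition supp_le :: "nat \<Rightarrow> fmat \<Rightarrow> bool" where
  "supp_le N A \<longleftrightarrow> (\<forall>i j. ent A i j \<noteq> 0 \<longrightarrow> i < N \<and> j < N)"

lemma supp_le_ex: "\<exists>N. supp_le N A"
  using ent[of A] unfolding supp_le_def by auto

lemma supp_le_mono: "supp_le N A \<Longrightarrow> N \<le> M \<Longrightarrow> supp_le M A"
  unfolding supp_le_def by fastforce

lemma supp_le_ex2: "\<exists>N. supp_le N A \<and> supp_le N B"
  by (metis supp_le_ex supp_le_mono max.cobounded1 max.cobounded2)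

lemma supp_le_ex3: "\<exists>N. supp_le N A \<and> supp_le N B \<and> supp_le N C"
  by (meson supp_le_ex supp_le_ex2 supp_le_mono nat_le_linear)

lemma ent_Abs: "(\<And>i j. f i j \<noteq> 0 \<Longrightarrow> i < N \<and> j < N) \<Longrightarrow> ent (Abs_fmat f) = f"
  by (intro Abs_fmat_inverse) auto

lemma fmat_eqI: "(\<And>i j. ent A i j = ent B i j) \<Longrightarrow> A = B"
  using ent_inject by blast

instantiation fmat :: ring
begin
definition "zero_fmat = Abs_fmat (\<lambda>i j. 0)"
definition "plus_fmat A B = Abs_fmat (\<lambda>i j. ent A i j + ent B i j)"
definition "minus_fmat A B = Abs_fmat (\<lambda>i j. ent A i j - ent B i j)"
definition "uminus_fmat A = Abs_fmat (\<lambda>i j. - ent A i j)"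
text \<open>Summing over the support of row \<open>i\<close> keeps the sum finite without naming a
  size; \<open>ent_mult\<close> replaces the index set by any bound on the support of
  \<open>A\<close>.\<close>

definition "times_fmat A B = Abs_fmat (\<lambda>i j. \<Sum>k | ent A i k \<noteq> 0. ent A i k * ent B k j)"

lemma ent_zero [simp]: "ent 0 i j = 0"
  unfolding zero_fmat_def by (subst ent_Abs) auto

lemma ent_add [simp]: "ent (A + B) i j = ent A i j + ent B i j"
proof -
  obtain N where "supp_le N A" "supp_le N B" using supp_le_ex2 by blast
  then show ?thesis unfolding plus_fmat_def
    by (subst ent_Abs[of _ N]) (metis add_0 supp_le_def, rule refl)
qed

lemma ent_diff [simp]: "ent (A - B) i j = ent A i j - ent B i j"
proof -
  obtain N where "supp_le N A" "supp_le N B" using supp_le_ex2 by blast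
  then show ?thesis unfolding minus_fmat_def
    by (subst ent_Abs[of _ N]) (metis diff_0_right supp_le_def, rule refl)
qed

lemma ent_uminus [simp]: "ent (- A) i j = - ent A i j"
proof -
  obtain N where "supp_le N A" using supp_le_ex by blast
  then show ?thesis unfolding uminus_fmat_def
    by (subst ent_Abs[of _ N]) (auto simp: supp_le_def)
qed

lemma ent_mult_aux: "ent (A * B) i j = (\<Sum>k | ent A i k \<noteq> 0. ent A i k * ent B k j)"
proof -
  obtain N where N: "supp_le N A" "supp_le N B" using supp_le_ex2 by blast
  show ?thesis unfolding times_fmat_def
  proof (subst ent_Abs[of _ N])
    fix i j assume a: "(\<Sum>k | ent A i k \<noteq> 0. ent A i k * ent B k j) \<noteq> 0"
    then obtain k where "ent A i k * ent B k j \<noteq> 0" by (meson sum.neutral)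
    then show "i < N \<and> j < N" using N unfolding supp_le_def by auto
  qed simp
qed

lemma ent_mult: "supp_le N A \<Longrightarrow> ent (A * B) i j = (\<Sum>k<N. ent A i k * ent B k j)"
  unfolding ent_mult_aux
  by (rule sum.mono_neutral_left) (auto simp: supp_le_def)

lemma supp_le_mult: "supp_le N A \<Longrightarrow> supp_le N B \<Longrightarrow> supp_le N (A * B)"
  unfolding supp_le_def[of _ "A*B"]
proof (intro allI impI)
  fix i j assume N: "supp_le N A" "supp_le N B" and a: "ent (A * B) i j \<noteq> 0"
  then obtain k where "ent A i k * ent B k j \<noteq> 0" unfolding ent_mult[OF N(1)] by (meson sum.neutral)
  then show "i < N \<and> j < N" using N unfolding supp_le_def by auto
qed

instance
proof
  fix A B C :: fmat
  show "A + B + C = A + (B + C)" by (rule fmat_eqI) simp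
  show "A + B = B + A" by (rule fmat_eqI) simp
  show "0 + A = A" by (rule fmat_eqI) simp
  show "- A + A = 0" by (rule fmat_eqI) simp
  show "A - B = A + - B" by (rule fmat_eqI) simp
  obtain N where N: "supp_le N A" "supp_le N B" "supp_le N C" using supp_le_ex3 by blast
  show "A * B * C = A * (B * C)"
  proof (rule fmat_eqI)
    fix i j
    have "ent (A * B * C) i j = (\<Sum>k<N. \<Sum>l<N. ent A i l * ent B l k * ent C k j)"
      by (simp add: ent_mult[of N] N supp_le_mult sum_distrib_right)
    also have "\<dots> = (\<Sum>l<N. \<Sum>k<N. ent A i l * ent B l k * ent C k j)" by (rule sum.swap)
    also have "\<dots> = ent (A * (B * C)) i j"
      by (simp add: ent_mult[of N] N supp_le_mult sum_distrib_left mult.assoc)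
    finally show "ent (A * B * C) i j = ent (A * (B * C)) i j" .
  qed
  have "supp_le N (A + B)" using N unfolding supp_le_def by (metis add_0 ent_add)
  then show "(A + B) * C = A * C + B * C"
    by (intro fmat_eqI) (simp add: ent_mult[of N] N ring_distribs sum.distrib)
  show "A * (B + C) = A * B + A * C"
    by (intro fmat_eqI) (simp add: ent_mult[of N] N ring_distribs sum.distrib)
qed

end

lemma ent_sum: "ent (sum f I) i j = (\<Sum>k\<in>I. ent (f k) i j)"
  by (induction I rule: infinite_finite_induct) auto

section \<open>Scalar multiples, adjoint, corner projections and trace\<close>

definition sm :: "complex \<Rightarrow> fmat \<Rightarrow> fmat" where
  "sm c A = Abs_fmat (\<lambda>i j. c * ent A i j)"

definition adj :: "fmat \<Rightarrow> fmat" where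
  "adj A = Abs_fmat (\<lambda>i j. cnj (ent A j i))"

definition proj :: "nat \<Rightarrow> fmat" where
  "proj p = Abs_fmat (\<lambda>i j. if i = j \<and> i < p then 1 else 0)"

definition tr :: "fmat \<Rightarrow> complex" where
  "tr A = (\<Sum>i | ent A i i \<noteq> 0. ent A i i)"

lemma ent_sm [simp]: "ent (sm c A) i j = c * ent A i j"
proof -
  obtain N where "supp_le N A" using supp_le_ex by blast
  then show ?thesis unfolding sm_def
    by (subst ent_Abs[of _ N]) (auto simp: supp_le_def)
qed

lemma ent_adj [simp]: "ent (adj A) i j = cnj (ent A j i)"
proof -
  obtain N where "supp_le N A" using supp_le_ex by blast
  then show ?thesis unfolding adj_def
    by (subst ent_Abs[of _ N]) (auto simp: supp_le_def)
qed

lemma ent_proj [simp]: "ent (proj p) i j = (if i = j \<and> i < p then 1 else 0)"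
  unfolding proj_def by (subst ent_Abs[of _ p]) (auto split: if_splits)

lemma tr_eq: "supp_le N A \<Longrightarrow> tr A = (\<Sum>i<N. ent A i i)"
  unfolding tr_def by (rule sum.mono_neutral_left) (auto simp: supp_le_def)

lemma sm_add_right: "sm c (A + B) = sm c A + sm c B"
  by (rule fmat_eqI) (simp add: ring_distribs)
lemma sm_sm [simp]: "sm c (sm d A) = sm (c * d) A"
  by (rule fmat_eqI) simp
lemma sm_one [simp]: "sm 1 A = A"
  by (rule fmat_eqI) simp
lemma sm_zero [simp]: "sm 0 A = 0" "sm c 0 = 0"
  by (rule fmat_eqI; simp)+
lemma sm_minus: "sm (- c) A = - sm c A" "sm c (- A) = - sm c A"
  by (rule fmat_eqI; simp)+
lemma sm_minus_one: "sm (- 1) A = - A"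
  by (rule fmat_eqI; simp)
lemma supp_le_sm: "supp_le N A \<Longrightarrow> supp_le N (sm c A)"
  by (auto simp: supp_le_def)
lemma sm_mult_left [simp]: "sm c A * B = sm c (A * B)"
proof -
  obtain N where N: "supp_le N A" using supp_le_ex by blast
  show ?thesis by (rule fmat_eqI) (simp add: ent_mult[of N] N supp_le_sm sum_distrib_left mult.assoc)
qed
lemma sm_mult_right [simp]: "A * sm c B = sm c (A * B)"
proof -
  obtain N where N: "supp_le N A" using supp_le_ex by blast
  show ?thesis by (rule fmat_eqI) (simp add: ent_mult[of N] N supp_le_sm sum_distrib_left mult_ac)
qed
lemma adj_adj [simp]: "adj (adj A) = A" by (rule fmat_eqI) simp
lemma adj_add [simp]: "adj (A + B) = adj A + adj B" by (rule fmat_eqI) simp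
lemma adj_diff [simp]: "adj (A - B) = adj A - adj B" by (rule fmat_eqI) simp
lemma adj_uminus [simp]: "adj (- A) = - adj A" by (rule fmat_eqI) simp
lemma adj_zero [simp]: "adj 0 = 0" by (rule fmat_eqI) simp
lemma adj_sm [simp]: "adj (sm c A) = sm (cnj c) (adj A)" by (rule fmat_eqI) simp
lemma adj_proj [simp]: "adj (proj p) = proj p" by (rule fmat_eqI) auto
lemma supp_le_adj: "supp_le N A \<Longrightarrow> supp_le N (adj A)"
  by (auto simp: supp_le_def)
lemma adj_mult [simp]: "adj (A * B) = adj B * adj A"
proof -
  obtain N where N: "supp_le N A" "supp_le N B" using supp_le_ex2 by blast
  show ?thesis by (rule fmat_eqI) (simp add: ent_mult[of N] N supp_le_adj mult.commute)
qed
lemma supp_le_proj: "supp_le p (proj p)" by (auto simp: supp_le_def split: if_splits)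

lemma ent_proj_mult [simp]: "ent (proj p * A) i j = (if i < p then ent A i j else 0)"
proof -
  have "ent (proj p * A) i j = (\<Sum>k<p. (if i = k \<and> i < p then ent A k j else 0))"
    unfolding ent_mult[OF supp_le_proj] by (intro sum.cong) auto
  also have "\<dots> = (if i < p then ent A i j else 0)" by (cases "i < p") (auto simp: sum.delta')
  finally show ?thesis .
qed
lemma ent_mult_proj [simp]: "ent (A * proj p) i j = (if j < p then ent A i j else 0)"
proof -
  have "ent (A * proj p) i j = cnj (ent (proj p * adj A) j i)"
    by (metis ent_adj adj_mult adj_adj adj_proj complex_cnj_cnj)
  then show ?thesis by simp
qed
lemma proj_idem [simp]: "proj p * proj p = proj p" by (rule fmat_eqI) auto

text \<open>Shapes are upper bounds for the support, so a matrix has many. They amount to absorbing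
  \<open>proj r\<close> on the left and \<open>proj c\<close> on the right, which makes products and
  inverses within a corner purely algebraic.\<close>

definition dims :: "nat \<Rightarrow> nat \<Rightarrow> fmat \<Rightarrow> bool" where
  "dims r c A \<longleftrightarrow> (\<forall>i j. ent A i j \<noteq> 0 \<longrightarrow> i < r \<and> j < c)"

lemma dims_projL: "dims r c A \<Longrightarrow> proj r * A = A" by (rule fmat_eqI) (auto simp: dims_def)
lemma dims_projR: "dims r c A \<Longrightarrow> A * proj c = A" by (rule fmat_eqI) (auto simp: dims_def)
lemma dimsI: "proj r * A = A \<Longrightarrow> A * proj c = A \<Longrightarrow> dims r c A"
  unfolding dims_def by (metis ent_proj_mult ent_mult_proj)
lemma dims_mult: "dims r c A \<Longrightarrow> dims c d B \<Longrightarrow> dims r d (A * B)"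
  by (rule dimsI) (metis dims_projL mult.assoc, metis dims_projR mult.assoc)
lemma dims_add: "dims r c A \<Longrightarrow> dims r c B \<Longrightarrow> dims r c (A + B)" unfolding dims_def by (metis add_0 ent_add)
lemma dims_diff: "dims r c A \<Longrightarrow> dims r c B \<Longrightarrow> dims r c (A - B)" unfolding dims_def by (metis diff_0_right ent_diff)
lemma dims_uminus: "dims r c A \<Longrightarrow> dims r c (- A)" by (auto simp: dims_def)
lemma dims_sm: "dims r c A \<Longrightarrow> dims r c (sm k A)" by (auto simp: dims_def)
lemma dims_adj: "dims r c A \<Longrightarrow> dims c r (adj A)" by (auto simp: dims_def)
lemma dims_proj: "dims p p (proj p)" by (auto simp: dims_def split: if_splits)
lemma dims_zero: "dims r c 0" by (auto simp: dims_def)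
lemma dims_sum: "(\<And>i. i \<in> I \<Longrightarrow> dims r c (f i)) \<Longrightarrow> dims r c (sum f I)"
  by (induction I rule: infinite_finite_induct) (auto simp: dims_zero dims_add)
lemma dims_supp: "dims p p A \<longleftrightarrow> supp_le p A" by (auto simp: dims_def supp_le_def)
lemmas dims_intros = dims_mult dims_add dims_diff dims_uminus dims_sm dims_adj dims_proj dims_zero

lemma ent_mult_dims: "dims r c A \<Longrightarrow> ent (A * B) i j = (\<Sum>k<c. ent A i k * ent B k j)"
  unfolding ent_mult_aux by (rule sum.mono_neutral_left) (auto simp: dims_def)
lemma ent_mult_dims': "dims c d B \<Longrightarrow> ent (A * B) i j = (\<Sum>k<c. ent A i k * ent B k j)"
proof -
  assume a: "dims c d B"
  obtain N where N: "supp_le N A" "c \<le> N" by (metis supp_le_ex supp_le_mono nat_le_linear)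
  show ?thesis unfolding ent_mult[OF N(1)]
    by (rule sum.mono_neutral_right) (use a N in \<open>auto simp: dims_def not_less[symmetric]\<close>)
qed
lemma tr_dims: "dims p p A \<Longrightarrow> tr A = (\<Sum>i<p. ent A i i)"
  by (simp add: tr_eq dims_supp)

lemma tr_add [simp]: "tr (A + B) = tr A + tr B"
proof -
  obtain N where N: "supp_le N A" "supp_le N B" using supp_le_ex2 by blast
  then have "supp_le N (A + B)" unfolding supp_le_def by (metis add_0 ent_add)
  with N show ?thesis by (simp add: tr_eq[of N] sum.distrib)
qed
lemma tr_sm [simp]: "tr (sm c A) = c * tr A"
proof -
  obtain N where N: "supp_le N A" using supp_le_ex by blast
  then show ?thesis by (simp add: tr_eq[of N] supp_le_sm sum_distrib_left)
qed
lemma tr_zero [simp]: "tr 0 = 0" by (simp add: tr_def)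
lemma tr_uminus [simp]: "tr (- A) = - tr A" by (metis sm_minus_one tr_sm mult_minus1)
lemma tr_diff [simp]: "tr (A - B) = tr A - tr B"
  by (metis tr_add tr_uminus diff_conv_add_uminus)
lemma tr_sum: "tr (sum f I) = (\<Sum>i\<in>I. tr (f i))"
  by (induction I rule: infinite_finite_induct) auto
lemma tr_adj [simp]: "tr (adj A) = cnj (tr A)"
proof -
  obtain N where N: "supp_le N A" using supp_le_ex by blast
  then show ?thesis by (simp add: tr_eq[of N] supp_le_adj)
qed
lemma tr_proj [simp]: "tr (proj p) = of_nat p"
  by (simp add: tr_eq[OF supp_le_proj])
lemma tr_mult_eq: "supp_le N A \<Longrightarrow> supp_le N B \<Longrightarrow> tr (A * B) = (\<Sum>i<N. \<Sum>k<N. ent A i k * ent B k i)"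
  by (simp add: tr_eq[of N] supp_le_mult ent_mult[of N])
lemma tr_commute: "tr (A * B) = tr (B * A)"
proof -
  obtain N where N: "supp_le N A" "supp_le N B" using supp_le_ex2 by blast
  then show ?thesis by (simp add: tr_mult_eq[of N] mult.commute)
       (subst sum.swap, rule refl)
qed

section \<open>Frobenius norm and operator norm bounds\<close>

definition nrm2 :: "fmat \<Rightarrow> real" where "nrm2 A = Re (tr (adj A * A))"

lemma nrm2_eq: "dims r c A \<Longrightarrow> nrm2 A = (\<Sum>i<r. \<Sum>j<c. (cmod (ent A i j))\<^sup>2)"
proof -
  assume d: "dims r c A"
  then have d': "dims c c (adj A * A)" by (intro dims_intros)
  have "tr (adj A * A) = (\<Sum>j<c. \<Sum>i<r. cnj (ent A i j) * ent A i j)"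
    unfolding tr_dims[OF d'] by (simp add: ent_mult_dims[OF dims_adj[OF d]])
  also have "\<dots> = (\<Sum>j<c. \<Sum>i<r. of_real ((cmod (ent A i j))\<^sup>2))"
    by (intro sum.cong refl) (metis complex_norm_square mult.commute)
  finally show ?thesis unfolding nrm2_def
    by (simp del: of_real_power) (rule sum.swap)
qed
lemma dims_ex: "\<exists>N. dims N N A" using supp_le_ex dims_supp by blast
lemma nrm2_nonneg [simp]: "0 \<le> nrm2 A"
proof -
  obtain N where "dims N N A" using dims_ex by blast
  then show ?thesis by (simp add: nrm2_eq sum_nonneg)
qed
lemma tr_adj_mult_self: "tr (adj A * A) = of_real (nrm2 A)"
proof -
  have "cnj (tr (adj A * A)) = tr (adj A * A)" by (metis tr_adj adj_mult adj_adj)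
  then show ?thesis unfolding nrm2_def by (simp add: complex_eq_iff)
qed
lemma nrm2_eq_0: "nrm2 A = 0 \<longleftrightarrow> A = 0"
proof
  assume a: "nrm2 A = 0"
  obtain N where N: "dims N N A" using dims_ex by blast
  have "\<forall>i<N. \<forall>j<N. ent A i j = 0"
    using a unfolding nrm2_eq[OF N] by (simp add: sum_nonneg_eq_0_iff sum_nonneg)
  then show "A = 0" using N by (intro fmat_eqI) (metis dims_def ent_zero)
qed (simp add: nrm2_def)
lemma nrm2_zero [simp]: "nrm2 0 = 0" by (simp add: nrm2_def)
lemma nrm2_adj [simp]: "nrm2 (adj A) = nrm2 A"
  unfolding nrm2_def by (metis adj_adj tr_commute)
lemma nrm2_sm: "nrm2 (sm c A) = (cmod c)\<^sup>2 * nrm2 A"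
proof -
  obtain N where N: "dims N N A" using dims_ex by blast
  show ?thesis unfolding nrm2_eq[OF N] nrm2_eq[OF dims_sm[OF N]]
    by (simp add: norm_mult power_mult_distrib sum_distrib_left)
qed
lemma tr_CS: "(cmod (tr (adj A * B)))\<^sup>2 \<le> nrm2 A * nrm2 B"
proof (cases "nrm2 A = 0")
  case True
  then show ?thesis by (simp add: nrm2_eq_0)
next
  case False
  then have pos: "nrm2 A > 0" using nrm2_nonneg[of A] by linarith
  \<comment> \<open>The coefficient of the projection of \<open>B\<close> onto \<open>A\<close> for
    the trace inner product; \<open>B - sm c A\<close> is orthogonal to \<open>A\<close>.\<close>
  define c where "c = tr (adj A * B) / of_real (nrm2 A)"
  have "0 \<le> nrm2 (B - sm c A)" by simp
  also have "nrm2 (B - sm c A) = Re (tr (adj B * B) - c * tr (adj B * A) - cnj c * tr (adj A * B)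
      + cnj c * c * tr (adj A * A))"
    unfolding nrm2_def by (simp add: algebra_simps)
  also have "tr (adj B * A) = cnj (tr (adj A * B))" by (metis tr_adj adj_mult adj_adj)
  also have "cnj c * c * tr (adj A * A) = cnj c * tr (adj A * B)"
    using False by (simp add: c_def tr_adj_mult_self)
  also have "Re (tr (adj B * B) - c * cnj (tr (adj A * B)) - cnj c * tr (adj A * B) + cnj c * tr (adj A * B))
     = nrm2 B - Re (c * cnj (tr (adj A * B)))" by (simp add: nrm2_def)
  also have "c * cnj (tr (adj A * B)) = of_real ((cmod (tr (adj A * B)))\<^sup>2 / nrm2 A)"
    unfolding c_def by (simp add: complex_norm_square flip: of_real_power)
  finally have "(cmod (tr (adj A * B)))\<^sup>2 / nrm2 A \<le> nrm2 B" by simp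
  then show ?thesis using pos by (simp add: field_simps)
qed

lemma tr_CS': "cmod (tr (adj A * B)) \<le> sqrt (nrm2 A) * sqrt (nrm2 B)"
  using tr_CS[of A B] by (metis real_le_rsqrt real_sqrt_mult)

lemma tr_CS_mult: "cmod (tr (A * B)) \<le> sqrt (nrm2 A) * sqrt (nrm2 B)"
  using tr_CS'[of "adj A" B] by simp

text \<open>\<open>op_bound a A\<close>: the operator norm of \<open>A\<close> is at most \<open>a\<close>.\<close>
definition op_bound :: "real \<Rightarrow> fmat \<Rightarrow> bool" where
  "op_bound a A \<longleftrightarrow> 0 \<le> a \<and> (\<forall>X. nrm2 (A * X) \<le> a\<^sup>2 * nrm2 X)"

lemma op_bound_nonneg: "op_bound a A \<Longrightarrow> 0 \<le> a" by (simp add: op_bound_def)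
lemma op_boundD: "op_bound a A \<Longrightarrow> nrm2 (A * X) \<le> a\<^sup>2 * nrm2 X" by (simp add: op_bound_def)
lemma opbD': "op_bound a A \<Longrightarrow> sqrt (nrm2 (A * X)) \<le> a * sqrt (nrm2 X)"
  using real_sqrt_le_mono[OF op_boundD[of a A X]] by (simp add: real_sqrt_mult op_bound_nonneg)
lemma op_bound_mult: "op_bound a A \<Longrightarrow> op_bound b B \<Longrightarrow> op_bound (a * b) (A * B)"
  unfolding op_bound_def
proof (intro conjI allI; elim conjE)
  fix X assume a: "0 \<le> a" "\<forall>X. nrm2 (A * X) \<le> a\<^sup>2 * nrm2 X" "\<forall>X. nrm2 (B * X) \<le> b\<^sup>2 * nrm2 X"
  have "nrm2 (A * (B * X)) \<le> a\<^sup>2 * nrm2 (B * X)" using a by blast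
  also have "\<dots> \<le> a\<^sup>2 * (b\<^sup>2 * nrm2 X)" using a by (intro mult_left_mono) auto
  finally show "nrm2 (A * B * X) \<le> (a * b)\<^sup>2 * nrm2 X" by (simp add: mult.assoc power_mult_distrib)
qed simp
text \<open>With Y = adj A X, the square |Y|^2 is the trace of adj X A Y, hence at most |X| a |Y| by
  Cauchy-Schwarz; one factor |Y| cancels.\<close>

lemma op_bound_adj: assumes "op_bound a A" shows "op_bound a (adj A)"
  unfolding op_bound_def
proof (intro conjI allI)
  show "0 \<le> a" using assms by (rule op_bound_nonneg)
  fix X
  have "of_real (nrm2 (adj A * X)) = tr (adj X * (A * (adj A * X)))"
    by (simp flip: tr_adj_mult_self add: mult.assoc)
  then have "nrm2 (adj A * X) \<le> cmod (tr (adj X * (A * (adj A * X))))"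
    by (metis norm_of_real abs_ge_self)
  also have "\<dots> \<le> sqrt (nrm2 X) * sqrt (nrm2 (A * (adj A * X)))" by (rule tr_CS')
  also have "\<dots> \<le> sqrt (nrm2 X) * (a * sqrt (nrm2 (adj A * X)))"
    by (intro mult_left_mono opbD' assms) simp
  finally have *: "nrm2 (adj A * X) \<le> sqrt (nrm2 X) * a * sqrt (nrm2 (adj A * X))" by (simp add: mult.assoc)
  show "nrm2 (adj A * X) \<le> a\<^sup>2 * nrm2 X"
  proof (cases "nrm2 (adj A * X) = 0")
    case False
    then have p: "sqrt (nrm2 (adj A * X)) > 0" using nrm2_nonneg[of "adj A * X"] by (simp add: less_le)
    have "sqrt (nrm2 (adj A * X)) * sqrt (nrm2 (adj A * X)) \<le> (sqrt (nrm2 X) * a) * sqrt (nrm2 (adj A * X))"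
      using * by simp
    then have "sqrt (nrm2 (adj A * X)) \<le> sqrt (nrm2 X) * a" using p by (simp only: mult_le_cancel_right_pos)
    then have "(sqrt (nrm2 (adj A * X)))\<^sup>2 \<le> (sqrt (nrm2 X) * a)\<^sup>2" using p by (intro power_mono) auto
    then show ?thesis by (simp add: power_mult_distrib mult.commute)
  qed simp
qed
lemma op_bound_proj: "op_bound 1 (proj p)"
  unfolding op_bound_def
proof (intro conjI allI)
  fix X
  obtain N where N: "dims N N X" using dims_ex by blast
  then have N': "dims N N (proj p * X)" by (auto simp: dims_def split: if_splits)
  show "nrm2 (proj p * X) \<le> 1\<^sup>2 * nrm2 X" unfolding nrm2_eq[OF N] nrm2_eq[OF N']
    by (auto intro!: sum_mono)
qed simp
lemma nrm2_proj [simp]: "nrm2 (proj p) = p" by (simp add: nrm2_def)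
lemma nrm2_le_dims: assumes "op_bound a A" "dims p p A" shows "nrm2 A \<le> a\<^sup>2 * p"
  using op_boundD[OF assms(1), of "proj p"] assms(2) by (simp add: dims_projR)
lemma tr_quad_op_bound: "op_bound a A \<Longrightarrow> cmod (tr (adj X * (A * Y))) \<le> a * (sqrt (nrm2 X) * sqrt (nrm2 Y))"
proof -
  assume a: "op_bound a A"
  have "cmod (tr (adj X * (A * Y))) \<le> sqrt (nrm2 X) * sqrt (nrm2 (A * Y))" by (rule tr_CS')
  also have "\<dots> \<le> sqrt (nrm2 X) * (a * sqrt (nrm2 Y))" by (intro mult_left_mono opbD' a) simp
  finally show ?thesis by (simp add: mult_ac)
qed
lemma op_bound_sm: "op_bound a A \<Longrightarrow> op_bound (cmod c * a) (sm c A)"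
  unfolding op_bound_def by (simp add: nrm2_sm power_mult_distrib mult.assoc mult_left_mono)

text \<open>Quadratic forms appear throughout as traces of products of 1 x 1 matrices. Such matrices
  are scalars, so the trace of a product of two of them factorises
  (\<open>tr11_mult\<close>).\<close>

lemma dims11: "dims 1 1 A \<Longrightarrow> A = sm (tr A) (proj 1)"
  using tr_dims[of 1 A] by (intro fmat_eqI) (auto simp: dims_def)
lemma tr11_mult: "dims 1 1 A \<Longrightarrow> dims 1 1 B \<Longrightarrow> tr (A * B) = tr A * tr B"
  by (subst dims11[of A], assumption) (simp add: dims_projL)

subsection \<open>Resolvents of skew-Hermitian matrices\<close>

definition tomat :: "nat \<Rightarrow> fmat \<Rightarrow> complex mat" where
  "tomat p A = mat p p (\<lambda>(i,j). ent A i j)"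

definition ofmat :: "complex mat \<Rightarrow> fmat" where
  "ofmat A = Abs_fmat (\<lambda>i j. if i < dim_row A \<and> j < dim_col A then A $$ (i,j) else 0)"

lemma ent_ofmat: "ent (ofmat A) i j = (if i < dim_row A \<and> j < dim_col A then A $$ (i,j) else 0)"
  unfolding ofmat_def by (subst ent_Abs[of _ "max (dim_row A) (dim_col A)"]) (auto split: if_splits)

lemma dims_ofmat: "A \<in> carrier_mat r c \<Longrightarrow> dims r c (ofmat A)"
  by (auto simp: dims_def ent_ofmat split: if_splits)

lemma tomat_carrier [simp]: "tomat p A \<in> carrier_mat p p" "dim_row (tomat p A) = p" "dim_col (tomat p A) = p"
  by (auto simp: tomat_def)

lemma tomat_ofmat: "A \<in> carrier_mat p p \<Longrightarrow> tomat p (ofmat A) = A"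
  by (rule eq_matI) (auto simp: tomat_def ent_ofmat)

lemma ofmat_tomat: "dims p p A \<Longrightarrow> ofmat (tomat p A) = A"
  by (rule fmat_eqI) (auto simp: tomat_def ent_ofmat dims_def)

lemma ofmat_mult: "A \<in> carrier_mat r c \<Longrightarrow> B \<in> carrier_mat c d \<Longrightarrow> ofmat (A * B) = ofmat A * ofmat B"
proof (rule fmat_eqI)
  fix i j assume A: "A \<in> carrier_mat r c" and B: "B \<in> carrier_mat c d"
  show "ent (ofmat (A * B)) i j = ent (ofmat A * ofmat B) i j"
    unfolding ent_mult_dims[OF dims_ofmat[OF A]] using A B
    by (auto simp: ent_ofmat scalar_prod_def atLeast0LessThan intro!: sum.cong)
qed

lemma ofmat_diff: "A \<in> carrier_mat r c \<Longrightarrow> B \<in> carrier_mat r c \<Longrightarrow> ofmat (A - B) = ofmat A - ofmat B"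
  by (rule fmat_eqI) (auto simp: ent_ofmat)
lemma ofmat_smult: "ofmat (k \<cdot>\<^sub>m A) = sm k (ofmat A)"
  by (rule fmat_eqI) (auto simp: ent_ofmat)
lemma ofmat_one: "ofmat (1\<^sub>m p) = proj p"
  by (rule fmat_eqI) (auto simp: ent_ofmat)

lemma mat_adjoint_index: "i < dim_col A \<Longrightarrow> j < dim_row A \<Longrightarrow> mat_adjoint A $$ (i, j) = cnj ((A::complex mat) $$ (j, i))"
  unfolding mat_adjoint_def by (simp add: mat_of_rows_def)
lemma mat_adjoint_dims [simp]: "dim_row (mat_adjoint A) = dim_col A" "dim_col (mat_adjoint A) = dim_row A"
  unfolding mat_adjoint_def by auto
lemma mat_adjoint_carrier: "A \<in> carrier_mat r c \<Longrightarrow> mat_adjoint A \<in> carrier_mat c r"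
  by auto
lemma ofmat_adjoint: "ofmat (mat_adjoint A) = adj (ofmat A)"
  by (rule fmat_eqI) (auto simp: ent_ofmat mat_adjoint_index)

lemma ofmat_inject: "A \<in> carrier_mat p p \<Longrightarrow> B \<in> carrier_mat p p \<Longrightarrow> ofmat A = ofmat B \<Longrightarrow> A = B"
  by (metis tomat_ofmat)

section \<open>Skew-Hermitian matrices and the inverse of S + u\<close>

definition skew :: "nat \<Rightarrow> fmat \<Rightarrow> bool" where
  "skew p S \<longleftrightarrow> dims p p S \<and> adj S = - S"

text \<open>The inverse of S + u on the corner of size \<open>p\<close>, written by Cramer's rule:
  this is total, and its entries are visibly measurable functions of those of
  \<open>S\<close>.\<close>

definition res :: "nat \<Rightarrow> complex \<Rightarrow> fmat \<Rightarrow> fmat" where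
  "res p u S = (let M = tomat p (S + sm u (proj p)) in ofmat ((1 / det M) \<cdot>\<^sub>m adj_mat M))"

lemma Re_tr_skew: "adj S = - S \<Longrightarrow> Re (tr (adj X * (S * X))) = 0"
proof -
  assume "adj S = - S"
  then have "cnj (tr (adj X * (S * X))) = - tr (adj X * (S * X))"
    by (simp flip: tr_adj add: mult.assoc)
  then show ?thesis by (simp add: complex_eq_iff)
qed

lemma coercive_eq: assumes "skew p S" "proj p * X = X"
  shows "Re (tr (adj X * ((S + sm u (proj p)) * X))) = Re u * nrm2 X"
  using assms Re_tr_skew[of S X]
  by (simp add: skew_def ring_distribs tr_adj_mult_self)

text \<open>A skew-Hermitian form is purely imaginary, so the form of S + u has real part exactly Re
  u |X|^2 (\<open>coercive_eq\<close>), and Cauchy-Schwarz turns this into a lower bound for the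
  image. Invertibility and the norm bound of the resolvent both rest on it.\<close>

lemma coercive: assumes "skew p S" "proj p * X = X" "Re u > 0"
  shows "(Re u)\<^sup>2 * nrm2 X \<le> nrm2 ((S + sm u (proj p)) * X)"
proof -
  let ?B = "S + sm u (proj p)"
  have "Re u * nrm2 X \<le> cmod (tr (adj X * (?B * X)))"
    using complex_Re_le_cmod[of "tr (adj X * (?B * X))"] coercive_eq[OF assms(1,2), of u] by linarith
  then have "(Re u * nrm2 X)\<^sup>2 \<le> (cmod (tr (adj X * (?B * X))))\<^sup>2"
    using assms by (intro power_mono) auto
  also have "\<dots> \<le> nrm2 X * nrm2 (?B * X)" by (rule tr_CS)
  finally have *: "nrm2 X * ((Re u)\<^sup>2 * nrm2 X) \<le> nrm2 X * nrm2 (?B * X)"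
    by (simp add: power2_eq_square mult_ac)
  show ?thesis
  proof (cases "nrm2 X = 0")
    case False
    then have "nrm2 X > 0" by (simp add: less_le)
    then show ?thesis using * by simp
  qed simp
qed

lemma skew_dims: "skew p S \<Longrightarrow> dims p p S" by (simp add: skew_def)
lemma skew_add: "skew p S \<Longrightarrow> skew p T \<Longrightarrow> skew p (S + T)" by (simp add: skew_def dims_add)
lemma skew_diff: "skew p S \<Longrightarrow> skew p T \<Longrightarrow> skew p (S - T)" by (simp add: skew_def dims_diff)
lemma skew_zero: "skew p 0" by (simp add: skew_def dims_zero)
lemma skew_sm: "skew p S \<Longrightarrow> skew p (sm (of_real k) S)" by (simp add: skew_def dims_sm sm_minus)
lemma skew_sum: "(\<And>i. i \<in> I \<Longrightarrow> skew p (f i)) \<Longrightarrow> skew p (sum f I)"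
  by (induction I rule: infinite_finite_induct) (auto simp: skew_zero skew_add)

context
  fixes p u S
  assumes S: "skew p S" and u: "Re u > 0"
begin

lemma dims_res: "dims p p (res p u S)"
  unfolding res_def Let_def by (intro dims_ofmat smult_carrier_mat adj_mat) simp

lemma res_det: "det (tomat p (S + sm u (proj p))) \<noteq> 0"
proof
  let ?M = "tomat p (S + sm u (proj p))"
  assume "det ?M = 0"
  then obtain v where v: "v \<in> carrier_vec p" "v \<noteq> 0\<^sub>v p" "?M *\<^sub>v v = 0\<^sub>v p"
    using det_0_iff_vec_prod_zero[of ?M p] by auto
  define X where "X = ofmat (mat p 1 (\<lambda>(i,j). v $ i))"
  have X: "dims p 1 X" unfolding X_def by (rule dims_ofmat) simp
  have "(S + sm u (proj p)) * X = 0"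
  proof (rule fmat_eqI)
    fix i j
    have d: "dims p p (S + sm u (proj p))" using S by (intro dims_intros skew_dims)
    have d1: "dims p 1 ((S + sm u (proj p)) * X)" by (intro dims_mult[OF d X])
    show "ent ((S + sm u (proj p)) * X) i j = ent 0 i j"
    proof (cases "i < p \<and> j = 0")
      case True
      then have "ent ((S + sm u (proj p)) * X) i j = (?M *\<^sub>v v) $ i"
        unfolding ent_mult_dims[OF d] using v(1)
        by (auto simp: X_def ent_ofmat tomat_def scalar_prod_def atLeast0LessThan intro!: sum.cong)
      then show ?thesis using v True by simp
    next
      case False
      then show ?thesis using d1 by (auto simp: dims_def)
    qed
  qed
  then have "(Re u)\<^sup>2 * nrm2 X \<le> 0" using coercive[OF S dims_projL[OF X] u] by simp
  then have "nrm2 X = 0" using u nrm2_nonneg[of X] by (simp add: mult_le_0_iff)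
  then have "X = 0" by (simp add: nrm2_eq_0)
  have "v $ i = 0" if "i < p" for i
    using ent_ofmat[of "mat p 1 (\<lambda>(i,j). v $ i)" i 0] that \<open>X = 0\<close> by (simp add: X_def)
  then have "v = 0\<^sub>v p" using v(1) by (intro eq_vecI) auto
  with v show False by simp
qed

lemma res_right: "(S + sm u (proj p)) * res p u S = proj p"
  and res_left: "res p u S * (S + sm u (proj p)) = proj p"
proof -
  define M where "M = tomat p (S + sm u (proj p))"
  have M: "M \<in> carrier_mat p p" by (simp add: M_def)
  have d: "dims p p (S + sm u (proj p))" using S by (intro dims_intros skew_dims)
  have eq: "S + sm u (proj p) = ofmat M" unfolding M_def by (simp add: ofmat_tomat d)
  have D: "det M \<noteq> 0" using res_det M_def by simp
  note am = adj_mat[OF M]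
  have "ofmat M * res p u S = ofmat (M * ((1 / det M) \<cdot>\<^sub>m adj_mat M))"
    unfolding res_def Let_def eq[symmetric] M_def[symmetric]
    unfolding eq by (rule ofmat_mult[symmetric, OF M smult_carrier_mat[OF am(1)]])
  also have "M * ((1 / det M) \<cdot>\<^sub>m adj_mat M) = (1 / det M) \<cdot>\<^sub>m (M * adj_mat M)"
    by (rule mult_smult_distrib[OF M am(1)])
  also have "ofmat \<dots> = proj p" unfolding am(2) ofmat_smult ofmat_one using D by simp
  finally show "(S + sm u (proj p)) * res p u S = proj p" unfolding eq .
  have "res p u S * ofmat M = ofmat (((1 / det M) \<cdot>\<^sub>m adj_mat M) * M)"
    unfolding res_def Let_def eq[symmetric] M_def[symmetric]
    unfolding eq by (rule ofmat_mult[symmetric, OF smult_carrier_mat[OF am(1)] M])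
  also have "((1 / det M) \<cdot>\<^sub>m adj_mat M) * M = (1 / det M) \<cdot>\<^sub>m (adj_mat M * M)"
    by (rule mult_smult_assoc_mat[OF am(1) M])
  also have "ofmat \<dots> = proj p" unfolding am(3) ofmat_smult ofmat_one using D by simp
  finally show "res p u S * (S + sm u (proj p)) = proj p" unfolding eq .
qed

lemma proj_res [simp]: "proj p * res p u S = res p u S" "res p u S * proj p = res p u S"
  using dims_res by (auto simp: dims_projL dims_projR)

lemma S_res: "S * res p u S = proj p - sm u (res p u S)"
  using res_right by (simp add: ring_distribs algebra_simps)
lemma res_S: "res p u S * S = proj p - sm u (res p u S)"
  using res_left by (simp add: ring_distribs algebra_simps)

lemma res_unique:
  assumes "proj p * R = R" "(S + sm u (proj p)) * R = proj p"
  shows "R = res p u S"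
proof -
  have "R = res p u S * (S + sm u (proj p)) * R" using assms by (simp add: res_left)
  also have "\<dots> = res p u S" using assms by (simp add: mult.assoc)
  finally show ?thesis .
qed

lemma op_bound_res: "op_bound (1 / Re u) (res p u S)"
  unfolding op_bound_def
proof (intro conjI allI)
  show "0 \<le> 1 / Re u" using u by simp
  fix X
  have "(Re u)\<^sup>2 * nrm2 (res p u S * X) \<le> nrm2 ((S + sm u (proj p)) * (res p u S * X))"
    by (rule coercive[OF S _ u]) (simp flip: mult.assoc)
  also have "\<dots> = nrm2 (proj p * X)" by (simp flip: mult.assoc add: res_right)
  also have "\<dots> \<le> nrm2 X" using op_boundD[OF op_bound_proj, of p X] by simp
  finally show "nrm2 (res p u S * X) \<le> (1 / Re u)\<^sup>2 * nrm2 X"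
    using u by (simp add: field_simps)
qed

text \<open>Substitute X = (S + u) Q X, or its adjoint version, and use \<open>coercive_eq\<close>.
  Being an equality, it expresses |Q X|^2 through the form of Q itself, which is what cancels in
  \<open>rank1_ineq\<close>.\<close>

lemma Re_quad_res: assumes v: "proj p * X = X"
  shows "Re (tr (adj X * (res p u S * X))) = Re u * nrm2 (res p u S * X)"
    "Re (tr (adj X * (res p u S * X))) = Re u * nrm2 (adj (res p u S) * X)"
proof -
  let ?Q = "res p u S" and ?B = "S + sm u (proj p)"
  have 1: "X = ?B * (?Q * X)" using v by (simp flip: mult.assoc add: res_right)
  have "tr (adj X * (?Q * X)) = tr (adj (?B * (?Q * X)) * (?Q * X))" using 1 by simp
  also have "\<dots> = tr (adj (adj (?Q * X) * (?B * (?Q * X))))" by (simp add: mult.assoc)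
  also have "\<dots> = cnj (tr (adj (?Q * X) * (?B * (?Q * X))))" by (simp only: tr_adj)
  finally show "Re (tr (adj X * (?Q * X))) = Re u * nrm2 (?Q * X)"
    using coercive_eq[OF S, of "?Q * X" u] by (simp flip: mult.assoc)
  have "X = adj ?B * (adj ?Q * X)" using v
    by (metis (no_types) adj_mult adj_proj mult.assoc res_left)
  then have "tr (adj X * (?Q * X)) = tr (adj X * (?Q * (adj ?B * (adj ?Q * X))))" by simp
  also have "\<dots> = tr (adj (adj (adj ?Q * X) * (?B * (adj ?Q * X))))" by (simp only: adj_mult adj_adj mult.assoc)
  also have "\<dots> = cnj (tr (adj (adj ?Q * X) * (?B * (adj ?Q * X))))" by (simp only: tr_adj)
  finally have "Re (tr (adj X * (?Q * X))) = Re (tr (adj (adj ?Q * X) * (?B * (adj ?Q * X))))" by simp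
  then show "Re (tr (adj X * (?Q * X))) = Re u * nrm2 (adj ?Q * X)"
    using coercive_eq[OF S, of "adj ?Q * X" u]
    by (metis adj_mult adj_proj proj_res(2) mult.assoc)
qed

end

lemma res_diff:
  assumes "skew p S" "skew p S'" "Re u > 0"
  shows "res p u S - res p u S' = res p u S * (S' - S) * res p u S'"
proof -
  let ?Q = "res p u S" and ?Q' = "res p u S'" and ?P = "proj p"
  have "?Q * (S' - S) * ?Q' = ?Q * (S' * ?Q') - ?Q * S * ?Q'" by (simp add: ring_distribs mult.assoc)
  also have "\<dots> = ?Q * (?P - sm u ?Q') - (?P - sm u ?Q) * ?Q'" using assms by (simp add: S_res res_S)
  also have "\<dots> = ?Q - ?Q'" using assms by (simp add: ring_distribs)
  finally show ?thesis by simp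
qed

section \<open>Traces under perturbations of rank one and two\<close>

lemma skew_rank1: "dims p 1 v \<Longrightarrow> skew p (sm (\<i> * of_real k) (v * adj v))"
  unfolding skew_def by (auto intro!: dims_intros simp: sm_minus)

text \<open>The resolvent identity gives (1 + i k w) X = Y with w the form of Q at v. Cauchy-Schwarz
  and \<open>Re_quad_res\<close> bound |Y| by a Re w / Re u, while |1 + i k w| >= |k| Re w. The
  resulting bound for |k X| is free of \<open>k\<close>, \<open>v\<close> and \<open>p\<close>: a
  column changes a trace by a bounded amount however long it is.\<close>

lemma rank1_ineq:
  assumes S: "skew p S" and u: "Re u > 0" and v: "dims p 1 v" and A: "op_bound a A"
  shows "cmod (tr (A * (res p u S - res p u (S + sm (\<i> * of_real k) (v * adj v))))) \<le> a / Re u"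
proof -
  define S' where "S' = S + sm (\<i> * of_real k) (v * adj v)"
  let ?Q = "res p u S" and ?Q' = "res p u S'"
  have S': "skew p S'" unfolding S'_def by (intro skew_add S skew_rank1 v)
  have d: "?Q - ?Q' = sm (\<i> * k) (?Q * v * adj v * ?Q')"
    using res_diff[OF S S' u] by (simp add: S'_def mult.assoc)
  define X where "X = tr (adj v * ?Q' * A * ?Q * v)"
  define Y where "Y = tr (adj v * (?Q * A * ?Q * v))"
  define w where "w = tr (adj v * (?Q * v))"
  have e: "tr (A * (?Q - ?Q')) = \<i> * k * X"
    unfolding d X_def by (simp add: mult.assoc) (metis mult.assoc tr_commute)
  note di = dims_res[OF S u] dims_res[OF S' u] v dims_adj[OF v]
  have "adj v * ?Q' * A * ?Q * v = adj v * (?Q - (?Q - ?Q')) * A * ?Q * v" by simp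
  also have "\<dots> = adj v * ?Q * A * ?Q * v - sm (\<i> * k) ((adj v * ?Q * v) * (adj v * ?Q' * A * ?Q * v))"
    unfolding d by (simp add: ring_distribs mult.assoc)
  finally have "X = Y - \<i> * k * tr ((adj v * ?Q * v) * (adj v * ?Q' * A * ?Q * v))"
    unfolding X_def Y_def by (metis (no_types, lifting) mult.assoc tr_diff tr_sm)
  also have "tr ((adj v * ?Q * v) * (adj v * ?Q' * A * ?Q * v)) = w * X"
    unfolding w_def X_def
  proof (subst tr11_mult)
    show "dims 1 1 (adj v * ?Q * v)" by (meson dims_mult di)
    have "proj 1 * adj v = adj v" "v * proj 1 = v"
      using dims_projL[OF dims_adj[OF v]] dims_projR[OF v] by auto
    then show "dims 1 1 (adj v * ?Q' * A * ?Q * v)"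
      by (intro dimsI) (metis mult.assoc)+
  qed (simp add: mult.assoc)
  finally have XY: "(1 + \<i> * k * w) * X = Y" by (simp add: algebra_simps)
  have "cmod Y \<le> a * (sqrt (nrm2 (adj ?Q * v)) * sqrt (nrm2 (?Q * v)))"
    using tr_quad_op_bound[OF A, of "adj ?Q * v" "?Q * v"] unfolding Y_def by (simp add: mult.assoc)
  also have "nrm2 (adj ?Q * v) = Re w / Re u" "nrm2 (?Q * v) = Re w / Re u"
    using Re_quad_res[OF S u dims_projL[OF v]] u by (auto simp: w_def field_simps)
  moreover have w0: "Re w \<ge> 0"
    using Re_quad_res(1)[OF S u dims_projL[OF v]] u by (simp add: w_def)
  ultimately have Yb: "cmod Y \<le> a * (Re w / Re u)" using u by simp
  have "cmod (\<i> * k * X) \<le> a / Re u"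
  \<comment> \<open>If Re w = 0 there is nothing to divide by, but then Q v = 0 and X
    vanishes.\<close>
  proof (cases "Re w = 0")
    case True
    then have "nrm2 (?Q * v) = 0" using Re_quad_res(1)[OF S u dims_projL[OF v]] u by (auto simp: w_def)
    then have "?Q * v = 0" by (simp add: nrm2_eq_0)
    then have "X = 0" unfolding X_def by (simp add: mult.assoc)
    then show ?thesis using op_bound_nonneg[OF A] u by simp
  next
    case False
    have "\<bar>k\<bar> * Re w \<le> cmod (1 + \<i> * k * w)"
      using abs_Im_le_cmod[of "1 + \<i> * k * w"] w0 by (simp add: abs_mult)
    then have "\<bar>k\<bar> * Re w * cmod X \<le> cmod Y" unfolding XY[symmetric] norm_mult by (rule mult_right_mono) simp
    also note Yb
    finally have "Re w * (\<bar>k\<bar> * cmod X) \<le> Re w * (a / Re u)" by (simp add: mult_ac)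
    then have "\<bar>k\<bar> * cmod X \<le> a / Re u" using False w0 by (subst (asm) mult_le_cancel_left_pos) auto
    then show ?thesis by (simp add: norm_mult)
  qed
  then show ?thesis using e unfolding S'_def[symmetric] by simp
qed

definition skew_pair :: "fmat \<Rightarrow> fmat \<Rightarrow> fmat" where "skew_pair x y = x * adj y - y * adj x"

lemma skew_skew_pair: "dims p k x \<Longrightarrow> dims p k y \<Longrightarrow> skew p (skew_pair x y)"
  unfolding skew_def skew_pair_def by (auto intro!: dims_intros)

text \<open>A rank two skew-Hermitian matrix is a difference of two rank one steps.\<close>
lemma skew_pair_rank1: "sm (of_real k) (skew_pair x y) =
   sm (\<i> * of_real (k / 2)) ((x + sm \<i> y) * adj (x + sm \<i> y))
   + sm (\<i> * of_real (- k / 2)) ((x - sm \<i> y) * adj (x - sm \<i> y))"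
  unfolding skew_pair_def
  by (rule fmat_eqI) (simp add: ring_distribs algebra_simps)

lemma rank2_ineq:
  assumes S: "skew p S" and u: "Re u > 0" and v: "dims p 1 x" "dims p 1 y" and A: "op_bound a A"
  shows "cmod (tr (A * (res p u S - res p u (S + sm (of_real k) (skew_pair x y))))) \<le> 2 * a / Re u"
proof -
  let ?v = "x + sm \<i> y" and ?w = "x - sm \<i> y"
  let ?S = "S + sm (\<i> * of_real (k / 2)) (?v * adj ?v)"
  let ?S2 = "?S + sm (\<i> * of_real (- k / 2)) (?w * adj ?w)"
  have d: "dims p 1 ?v" "dims p 1 ?w" using v by (auto intro!: dims_intros)
  have s1: "skew p ?S" by (intro skew_add S skew_rank1 d)
  have eq: "S + sm (of_real k) (skew_pair x y) = ?S2" unfolding skew_pair_rank1 by (simp only: add.assoc)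
  have "tr (A * (res p u S - res p u ?S2)) = tr (A * (res p u S - res p u ?S)) + tr (A * (res p u ?S - res p u ?S2))"
    by (simp add: ring_distribs)
  also have "cmod \<dots> \<le> a / Re u + a / Re u"
    by (intro norm_triangle_mono rank1_ineq S u d A s1)
  finally show ?thesis unfolding eq by simp
qed

subsection \<open>The spectral theorem and empirical spectral distributions\<close>

definition unitary :: "nat \<Rightarrow> fmat \<Rightarrow> bool" where
  "unitary p V \<longleftrightarrow> dims p p V \<and> adj V * V = proj p \<and> V * adj V = proj p"

definition diag_fmat :: "nat \<Rightarrow> (nat \<Rightarrow> complex) \<Rightarrow> fmat" where
  "diag_fmat p f = Abs_fmat (\<lambda>i j. if i = j \<and> i < p then f i else 0)"

text \<open>\<open>spectral_fun p V f\<close> is the matrix with eigenvalues \<open>f 0, \<dots>, f (p - 1)\<close> in the orthonormal basis given by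
  the columns of \<open>V\<close>.\<close>
definition spectral_fun :: "nat \<Rightarrow> fmat \<Rightarrow> (nat \<Rightarrow> complex) \<Rightarrow> fmat" where
  "spectral_fun p V f = V * diag_fmat p f * adj V"

definition unit_col :: "nat \<Rightarrow> fmat" where
  "unit_col q = Abs_fmat (\<lambda>i j. if i = q \<and> j = 0 then 1 else 0)"

lemma ent_diag_fmat [simp]: "ent (diag_fmat p f) i j = (if i = j \<and> i < p then f i else 0)"
  unfolding diag_fmat_def by (subst ent_Abs[of _ p]) (auto split: if_splits)
lemma ent_unit_col [simp]: "ent (unit_col q) i j = (if i = q \<and> j = 0 then 1 else 0)"
  unfolding unit_col_def by (subst ent_Abs[of _ "Suc q"]) (auto split: if_splits)
lemma dims_diag_fmat: "dims p p (diag_fmat p f)" by (auto simp: dims_def split: if_splits)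
lemma dims_unit_col: "q < p \<Longrightarrow> dims p 1 (unit_col q)" by (auto simp: dims_def split: if_splits)
lemma ent_mult_diag_fmat: "ent (A * diag_fmat p f) i j = (if j < p then ent A i j * f j else 0)"
  unfolding ent_mult_dims'[OF dims_diag_fmat] by (auto simp: if_distrib[of "(*) _"] sum.delta' cong: if_cong)
lemma diag_fmat_mult: "diag_fmat p f * diag_fmat p g = diag_fmat p (\<lambda>i. f i * g i)"
  by (rule fmat_eqI) (auto simp: ent_mult_diag_fmat)
lemma diag_fmat_adj: "adj (diag_fmat p f) = diag_fmat p (\<lambda>i. cnj (f i))" by (rule fmat_eqI) auto
lemma diag_fmat_add: "diag_fmat p f + diag_fmat p g = diag_fmat p (\<lambda>i. f i + g i)" by (rule fmat_eqI) auto
lemma diag_fmat_sm: "sm c (diag_fmat p f) = diag_fmat p (\<lambda>i. c * f i)" by (rule fmat_eqI) auto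
lemma diag_fmat_one: "diag_fmat p (\<lambda>i. 1) = proj p" by (rule fmat_eqI) auto
lemma tr_diag_fmat: "tr (diag_fmat p f) = (\<Sum>i<p. f i)" by (simp add: tr_dims[OF dims_diag_fmat])
lemma op_bound_diag_fmat: assumes "\<And>i. i < p \<Longrightarrow> cmod (f i) \<le> a" "0 \<le> a" shows "op_bound a (diag_fmat p f)"
  unfolding op_bound_def
proof (intro conjI allI assms)
  fix X
  obtain N where N: "dims N N X" using dims_ex by blast
  have e: "ent (diag_fmat p f * X) i j = (if i < p then f i * ent X i j else 0)" for i j
    unfolding ent_mult_dims[OF dims_diag_fmat] by (auto simp: if_distrib[of "\<lambda>x. x * _"] sum.delta cong: if_cong)
  then have N': "dims N N (diag_fmat p f * X)" using N by (auto simp: dims_def)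
  show "nrm2 (diag_fmat p f * X) \<le> a\<^sup>2 * nrm2 X"
    unfolding nrm2_eq[OF N] nrm2_eq[OF N'] sum_distrib_left e
    by (intro sum_mono) (auto simp: norm_mult power_mult_distrib assms intro!: mult_right_mono power_mono)
qed

section \<open>Calculus of matrices diagonal in a given orthonormal basis\<close>

lemma unitary_dims: "unitary p V \<Longrightarrow> dims p p V" by (simp add: unitary_def)
lemma unitary_left: "unitary p V \<Longrightarrow> adj V * (V * X) = proj p * X"
  by (metis mult.assoc unitary_def)
lemma unitary_right: "unitary p V \<Longrightarrow> V * (adj V * X) = proj p * X"
  by (metis mult.assoc unitary_def)
lemma unitary_mult: assumes "unitary p V" "unitary p W" shows "unitary p (V * W)"
proof -
  have "proj p * W = W" "proj p * adj V = adj V"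
    using assms dims_projL dims_adj unitary_dims by blast+
  then show ?thesis using assms
    by (auto simp: unitary_def dims_mult mult.assoc unitary_left unitary_right)
qed
lemma op_bound_unitary: "unitary p V \<Longrightarrow> op_bound 1 V"
proof -
  assume V: "unitary p V"
  have "nrm2 (V * X) = nrm2 (proj p * X)" for X
    unfolding nrm2_def using V by (simp add: mult.assoc unitary_left) (metis mult.assoc proj_idem)
  then show ?thesis using op_bound_proj[of p] by (simp add: op_bound_def)
qed

lemma dims_spectral_fun: "unitary p V \<Longrightarrow> dims p p (spectral_fun p V f)"
  unfolding spectral_fun_def by (meson dims_mult dims_adj dims_diag_fmat unitary_dims)
lemma spectral_fun_mult: assumes "unitary p V" shows "spectral_fun p V f * spectral_fun p V g = spectral_fun p V (\<lambda>i. f i * g i)"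
proof -
  have "spectral_fun p V f * spectral_fun p V g = V * (diag_fmat p f * ((adj V * V) * diag_fmat p g)) * adj V"
    by (simp add: spectral_fun_def mult.assoc)
  also have "(adj V * V) * diag_fmat p g = diag_fmat p g" using assms by (simp add: unitary_def dims_projL[OF dims_diag_fmat])
  finally show ?thesis by (simp add: spectral_fun_def diag_fmat_mult)
qed
lemma spectral_fun_adj: "adj (spectral_fun p V f) = spectral_fun p V (\<lambda>i. cnj (f i))" by (simp add: spectral_fun_def diag_fmat_adj mult.assoc)
lemma spectral_fun_add: "spectral_fun p V f + spectral_fun p V g = spectral_fun p V (\<lambda>i. f i + g i)"
  by (simp add: spectral_fun_def flip: diag_fmat_add ring_distribs)
lemma spectral_fun_sm: "sm c (spectral_fun p V f) = spectral_fun p V (\<lambda>i. c * f i)" by (simp add: spectral_fun_def flip: diag_fmat_sm)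
lemma spectral_fun_one: "unitary p V \<Longrightarrow> spectral_fun p V (\<lambda>i. 1) = proj p"
  by (simp add: spectral_fun_def diag_fmat_one) (metis dims_projR unitary_def)
lemma tr_spectral_fun: assumes "unitary p V" shows "tr (spectral_fun p V f) = (\<Sum>i<p. f i)"
proof -
  have "tr (spectral_fun p V f) = tr (adj V * V * diag_fmat p f)" by (metis spectral_fun_def mult.assoc tr_commute)
  also have "\<dots> = tr (diag_fmat p f)" using assms by (simp add: unitary_def dims_projL[OF dims_diag_fmat])
  finally show ?thesis by (simp add: tr_diag_fmat)
qed
lemma op_bound_spectral_fun: assumes "unitary p V" "\<And>i. i < p \<Longrightarrow> cmod (f i) \<le> a" "0 \<le> a" shows "op_bound a (spectral_fun p V f)"
  using op_bound_mult[OF op_bound_mult[OF op_bound_unitary[OF assms(1)] op_bound_diag_fmat[OF assms(2,3)]] op_bound_adj[OF op_bound_unitary[OF assms(1)]]]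
  by (simp add: spectral_fun_def)
lemma spectral_fun_cong: "(\<And>i. i < p \<Longrightarrow> f i = g i) \<Longrightarrow> spectral_fun p V f = spectral_fun p V g"
  unfolding spectral_fun_def by (rule arg_cong[of _ _ "\<lambda>D. V * D * adj V"], rule fmat_eqI) auto

lemma eigenvector_ex:
  assumes A: "dims p p A" and p: "p > 0"
  shows "\<exists>v l. dims p 1 v \<and> nrm2 v = 1 \<and> A * v = sm l v"
proof -
  have c: "tomat p A \<in> carrier_mat p p" by simp
  have "degree (char_poly (tomat p A)) = p" using degree_monic_char_poly[OF c] by simp
  then have "\<not> constant (poly (char_poly (tomat p A)))" using p by (simp add: constant_degree)
  from Fundamental_Theorem_Algebra.fundamental_theorem_of_algebra[OF this] obtain l where "poly (char_poly (tomat p A)) l = 0" by (elim exE)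
  then have "eigenvalue (tomat p A) l" using eigenvalue_root_char_poly[OF c] by simp
  then obtain v where v: "v \<in> carrier_vec p" "v \<noteq> 0\<^sub>v p" "tomat p A *\<^sub>v v = l \<cdot>\<^sub>v v"
    unfolding eigenvalue_def eigenvector_def by auto
  define X where "X = ofmat (mat p 1 (\<lambda>(i,j). v $ i))"
  have X: "dims p 1 X" unfolding X_def by (rule dims_ofmat) simp
  have "A * X = sm l X"
  proof (rule fmat_eqI)
    fix i j
    have d1: "dims p 1 (A * X)" by (intro dims_mult[OF A X])
    show "ent (A * X) i j = ent (sm l X) i j"
    proof (cases "i < p \<and> j = 0")
      case True
      then have "ent (A * X) i j = (tomat p A *\<^sub>v v) $ i"
        unfolding ent_mult_dims[OF A] using v(1)
        by (auto simp: X_def ent_ofmat tomat_def scalar_prod_def atLeast0LessThan intro!: sum.cong)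
      then show ?thesis using v True by (simp add: X_def ent_ofmat)
    next
      case False
      then have "ent (A * X) i j = 0" "ent X i j = 0" using d1 X unfolding dims_def by (metis less_one)+
      then show ?thesis by simp
    qed
  qed
  moreover have "X \<noteq> 0"
  proof
    assume "X = 0"
    have "v $ i = 0" if "i < p" for i
      using ent_ofmat[of "mat p 1 (\<lambda>(i,j). v $ i)" i 0] that \<open>X = 0\<close> by (simp add: X_def)
    then have "v = 0\<^sub>v p" using v(1) by (intro eq_vecI) auto
    with v show False by simp
  qed
  then have n: "nrm2 X > 0" by (metis less_le nrm2_eq_0 nrm2_nonneg)
  define c where "c = complex_of_real (1 / sqrt (nrm2 X))"
  have "nrm2 (sm c X) = 1" using n by (simp add: nrm2_sm c_def power_divide norm_divide)
  moreover have "A * sm c X = sm l (sm c X)" using \<open>A * X = sm l X\<close> by (simp add: mult.commute)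
  ultimately show ?thesis using X dims_sm by blast
qed

lemma dims_1_1_unit: "dims p 1 v \<Longrightarrow> adj v * v = sm (of_real (nrm2 v)) (proj 1)"
  using dims11[OF dims_mult[OF dims_adj]] tr_adj_mult_self by metis

text \<open>A reflection exchanges the unit vectors w and e only if their inner product is real;
  this is why \<open>v\<close> is first turned by a phase \<open>c\<close>.\<close>

lemma householder:
  assumes v: "dims (Suc q) 1 v" "nrm2 v = 1"
  shows "\<exists>H c. unitary (Suc q) H \<and> cmod c = 1 \<and> H * unit_col q = sm c v"
proof -
  define t where "t = ent v q 0"
  \<comment> \<open>Turns the last coordinate \<open>t\<close> of \<open>v\<close> into |t|; any
    phase will do if \<open>t\<close> vanishes.\<close>
  define c where "c = (if t = 0 then 1 else cnj t / of_real (cmod t))"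
  have c1: "cmod c = 1" by (auto simp: c_def norm_divide)
  define w where "w = sm c v"
  have ct: "c * t = of_real (cmod t)"
    by (auto simp: c_def mult.commute[of "cnj t"] complex_norm_square[symmetric] power2_eq_square)
  have dw: "dims (Suc q) 1 w" unfolding w_def by (intro dims_intros v)
  have dv: "dims (Suc q) 1 (unit_col q)" by (rule dims_unit_col) simp
  have nw: "nrm2 w = 1" by (simp add: w_def nrm2_sm c1 v)
  have nuv: "nrm2 (unit_col q) = 1" by (simp add: nrm2_eq[OF dv])
  define a where "a = w - unit_col q"
  have da: "dims (Suc q) 1 a" unfolding a_def by (intro dims_intros dw dv)
  have e1: "adj (unit_col q) * w = sm (of_real (cmod t)) (proj 1)"
  proof -
    have "tr (adj (unit_col q) * w) = of_real (cmod t)"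
      unfolding tr_dims[OF dims_mult[OF dims_adj[OF dv] dw]]
      by (simp add: ent_mult_dims[OF dims_adj[OF dv]] w_def ct[unfolded t_def] if_distrib[of cnj] if_distrib[of "\<lambda>x. x * _"] t_def cong: if_cong)
    then show ?thesis using dims11[OF dims_mult[OF dims_adj[OF dv] dw]] by simp
  qed
  then have e2: "adj w * unit_col q = sm (of_real (cmod t)) (proj 1)"
    by (metis adj_adj adj_mult adj_proj adj_sm complex_cnj_complex_of_real)
  define b where "b = 2 - 2 * cmod t"
  have aa: "adj a * a = sm (of_real b) (proj 1)"
    unfolding a_def b_def using dims_1_1_unit[OF dw] dims_1_1_unit[OF dv] e1 e2 nw nuv
    by (simp add: ring_distribs) (rule fmat_eqI, auto)
  have ae: "adj a * unit_col q = sm (of_real (- b / 2)) (proj 1)"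
    unfolding a_def b_def using dims_1_1_unit[OF dv] e2 nuv
    by (simp add: ring_distribs) (rule fmat_eqI, auto)
  have nb: "nrm2 a = b" unfolding nrm2_def aa by simp
  show ?thesis
  proof (cases "b = 0")
    case True
    then have "a = 0" using nb by (simp add: nrm2_eq_0)
    then have "w = unit_col q" by (simp add: a_def)
    moreover have "unitary (Suc q) (proj (Suc q))" by (simp add: unitary_def dims_proj)
    ultimately show ?thesis using c1 dims_projL[OF dv] w_def by metis
  next
    case False
    define H where "H = proj (Suc q) - sm (of_real (2 / b)) (a * adj a)"
    have Pa: "proj (Suc q) * a = a" "adj a * proj (Suc q) = adj a" "a * proj 1 = a"
      using dims_projL[OF da] dims_projR[OF da] dims_projR[OF dims_adj[OF da]] by auto
    have aH: "adj H = H" by (simp add: H_def)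
    have "a * adj a * (a * adj a) = a * (adj a * a) * adj a" by (simp only: mult.assoc)
    also have "\<dots> = sm (of_real b) (a * adj a)" unfolding aa using Pa by (simp add: mult.assoc)
    finally have aaa: "a * (adj a * (a * adj a)) = sm (of_real b) (a * adj a)" by (simp only: mult.assoc)
    have "proj (Suc q) * (a * adj a) = a * adj a" "a * (adj a * proj (Suc q)) = a * adj a"
      using Pa by (metis mult.assoc)+
    then have "H * H = proj (Suc q)" using False
      by (simp add: H_def ring_distribs mult.assoc aaa)
         (rule fmat_eqI, simp add: field_simps)
    then have "unitary (Suc q) H" unfolding unitary_def aH
      by (auto simp: H_def intro!: dims_intros da)
    moreover have "H * unit_col q = sm c v"
    proof -
      have "H * unit_col q = unit_col q - sm (of_real (2 / b)) (a * (adj a * unit_col q))"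
        by (simp add: H_def ring_distribs mult.assoc dims_projL[OF dv])
      also have "\<dots> = unit_col q + a" unfolding ae using False Pa by (simp add: sm_minus)
      finally show ?thesis by (simp add: a_def w_def)
    qed
    ultimately show ?thesis using c1 by blast
  qed
qed

text \<open>Deflation: conjugate so that the last basis vector is an eigenvector and subtract its
  part; the remainder \<open>C\<close> has a zero last row and column, hence lives in the corner of
  size \<open>q\<close>.\<close>

lemma spectral_hermitian:
  "dims p p A \<Longrightarrow> adj A = A \<Longrightarrow> \<exists>V d. unitary p V \<and> A = spectral_fun p V (\<lambda>i. complex_of_real (d i))"
proof (induction p arbitrary: A)
  case 0
  then have "A = 0" by (intro fmat_eqI) (auto simp: dims_def)
  then show ?case by (intro exI[of _ 0]) (auto simp: unitary_def spectral_fun_def dims_zero intro!: fmat_eqI)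
next
  case (Suc q)
  obtain v l where v: "dims (Suc q) 1 v" "nrm2 v = 1" "A * v = sm l v"
    using eigenvector_ex[OF Suc.prems(1)] by auto
  obtain H c where H: "unitary (Suc q) H" "cmod c = 1" "H * unit_col q = sm c v"
    using householder[OF v(1,2)] by blast
  let ?e = "unit_col q" and ?P = "proj (Suc q)"
  have de: "dims (Suc q) 1 ?e" by (rule dims_unit_col) simp
  define B where "B = adj H * A * H"
  have dH: "dims (Suc q) (Suc q) H" using H(1) by (rule unitary_dims)
  have dB: "dims (Suc q) (Suc q) B" unfolding B_def by (meson dims_mult dims_adj dH Suc.prems)
  have aB: "adj B = B" by (simp add: B_def Suc.prems mult.assoc)
  have "B * ?e = adj H * (A * sm c v)" by (simp add: B_def mult.assoc H)
  also have "\<dots> = sm l (adj H * (H * ?e))" by (simp add: H v mult.commute)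
  also have "\<dots> = sm l ?e" using H(1) de by (simp add: unitary_left dims_projL)
  finally have Be: "B * ?e = sm l ?e" .
  have ee: "adj ?e * ?e = proj 1" using dims_1_1_unit[OF de] nrm2_eq[OF de] by simp
  have "tr (adj ?e * (B * ?e)) = l" by (simp add: Be ee)
  moreover have "cnj (tr (adj ?e * (B * ?e))) = tr (adj ?e * (B * ?e))"
    by (simp flip: tr_adj add: mult.assoc aB)
  ultimately have "cnj l = l" by simp
  then obtain r where r: "l = of_real r" by (metis Reals_cnj_iff Reals_cases)
  define C where "C = B - sm l (?e * adj ?e)"
  have aC: "adj C = C" by (simp add: C_def aB r)
  have dC: "dims (Suc q) (Suc q) C" unfolding C_def by (meson dims_diff dims_sm dims_mult dims_adj dB de)
  have eP: "?e * proj 1 = ?e" using de by (simp add: dims_projR)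
  have Ce: "C * ?e = 0" by (simp add: C_def ring_distribs Be mult.assoc ee) (simp add: eP[simplified])
  have Cq: "ent C i q = 0" for i
  proof -
    have "ent (C * ?e) i 0 = ent C i q"
      unfolding ent_mult_dims[OF dC] by (simp add: if_distrib[of "(*) _"] cong: if_cong)
    then show ?thesis by (simp add: Ce)
  qed
  have Cq': "ent C q i = 0" for i using Cq[of i] aC by (metis complex_cnj_zero ent_adj)
  have "dims q q C" using dC unfolding dims_def by (metis Cq Cq' less_Suc_eq)
  then obtain V d where V: "unitary q V" "C = spectral_fun q V (\<lambda>i. complex_of_real (d i))"
    using Suc.IH[OF _ aC] by blast
  have dV: "dims q q V" using V(1) by (rule unitary_dims)
  have Ve: "V * ?e = 0"
    by (rule fmat_eqI) (auto simp: ent_mult_dims[OF dV])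
  have aVe: "adj V * ?e = 0"
    by (rule fmat_eqI) (auto simp: ent_mult_dims[OF dims_adj[OF dV]])
  have eV: "adj ?e * V = 0" "adj ?e * adj V = 0" using aVe Ve by (metis adj_adj adj_mult adj_zero)+
  \<comment> \<open>\<open>V\<close> acts on the first \<open>q\<close> coordinates only; the added
    diagonal entry makes it unitary in size \<open>Suc q\<close>.\<close>
  define W where "W = V + ?e * adj ?e"
  have dV': "dims (Suc q) (Suc q) V" using dV by (auto simp: dims_def less_Suc_eq)
  have dW: "dims (Suc q) (Suc q) W" unfolding W_def by (meson dims_add dims_mult dims_adj dV' de)
  have z: "V * (?e * X) = 0" "adj V * (?e * X) = 0" "adj ?e * (V * X) = 0" "adj ?e * (adj V * X) = 0"
    "adj ?e * (?e * X) = proj 1 * X" for X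
    using Ve aVe eV ee by (metis mult.assoc mult_zero_left)+
  have Pe: "proj 1 * adj ?e = adj ?e" using dims_projL[OF dims_adj[OF de]] .
  have PS: "proj q + ?e * adj ?e = ?P"
  proof (rule fmat_eqI)
    fix i j show "ent (proj q + ?e * adj ?e) i j = ent ?P i j"
      by (auto simp: ent_mult_dims[OF de] less_Suc_eq)
  qed
  have uW: "unitary (Suc q) W"
    unfolding unitary_def using dW V(1) PS Pe
    by (simp add: W_def ring_distribs mult.assoc z Ve aVe eV unitary_def)
  let ?d = "\<lambda>i. complex_of_real ((d(q := r)) i)"
  have eD: "diag_fmat (Suc q) ?d = diag_fmat q (\<lambda>i. of_real (d i)) + sm l (?e * adj ?e)"
    by (rule fmat_eqI) (auto simp: ent_mult_dims[OF de] less_Suc_eq r)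
  have De: "diag_fmat q f * ?e = 0" "adj ?e * diag_fmat q f = 0" for f
    by (rule fmat_eqI; auto simp: ent_mult_dims[OF dims_diag_fmat] ent_mult_diag_fmat ent_mult_dims[OF dims_adj[OF de]])+
  have zD: "diag_fmat q f * (?e * X) = 0" "adj ?e * (diag_fmat q f * X) = 0" for f X
    using De by (metis mult.assoc mult_zero_left)+
  have "spectral_fun (Suc q) W ?d = spectral_fun q V (\<lambda>i. of_real (d i)) + sm l (?e * adj ?e)"
    unfolding spectral_fun_def eD W_def using Pe
    by (simp add: ring_distribs mult.assoc z zD De Ve aVe eV)
  also have "\<dots> = B" by (simp add: C_def flip: V(2))
  finally have B: "B = spectral_fun (Suc q) W ?d" by simp
  have "A = ?P * A * ?P" using Suc.prems by (simp add: dims_projL dims_projR)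
  also have "\<dots> = H * B * adj H" using H(1) by (simp add: B_def unitary_def mult.assoc) (metis mult.assoc unitary_def)
  also have "\<dots> = spectral_fun (Suc q) (H * W) ?d" unfolding B by (simp add: spectral_fun_def mult.assoc)
  finally show ?case using unitary_mult[OF H(1) uW] by blast
qed

section \<open>Eigenvalues and empirical laws\<close>

lemma eigenvalues_spectral_fun:
  assumes A: "A \<in> carrier_mat p p" and V: "unitary p V" and eq: "ofmat A = spectral_fun p V f"
  shows "eigenvalues A = image_mset f (mset_set {..<p})"
proof -
  let ?D = "mat p p (\<lambda>(i,j). if i = j then f i else 0)"
  have D: "?D \<in> carrier_mat p p" "ofmat ?D = diag_fmat p f"
    by (auto intro!: fmat_eqI simp: ent_ofmat)
  have tV: "ofmat (tomat p V) = V" "ofmat (tomat p (adj V)) = adj V"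
    using V by (auto simp: ofmat_tomat unitary_dims dims_adj)
  have cV: "tomat p V \<in> carrier_mat p p" "tomat p (adj V) \<in> carrier_mat p p" by simp_all
  note om = ofmat_mult[of _ p p _ p] mult_carrier_mat[of _ p p _ p]
  have "similar_mat A ?D"
  proof -
    have 1: "tomat p V * tomat p (adj V) = 1\<^sub>m p"
      by (rule ofmat_inject[of _ p]) (use V in \<open>auto simp: om tV ofmat_one unitary_def\<close>)
    have 2: "tomat p (adj V) * tomat p V = 1\<^sub>m p"
      by (rule ofmat_inject[of _ p]) (use V in \<open>auto simp: om tV ofmat_one unitary_def\<close>)
    have 3: "A = tomat p V * ?D * tomat p (adj V)"
      by (rule ofmat_inject[of _ p]) (use A V eq D in \<open>auto simp: om tV spectral_fun_def\<close>)
    show ?thesis unfolding similar_mat_def using similar_mat_witI[OF 1 2 3 A D(1) cV] by blast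
  qed
  then have "char_poly A = char_poly ?D" by (rule char_poly_similar)
  also have "\<dots> = (\<Prod>a\<leftarrow>diag_mat ?D. [:- a, 1:])"
    by (rule char_poly_upper_triangular[OF D(1)]) auto
  also have "diag_mat ?D = map f [0..<p]" by (auto simp: diag_mat_def)
  finally have cp: "char_poly A = (\<Prod>a\<leftarrow>map f [0..<p]. [:- a, 1:])" .
  have nz: "(\<Prod>a\<leftarrow>xs. [:- a, 1:]) \<noteq> 0" for xs :: "complex list"
    by (induction xs) (simp_all del: mult_pCons_left)
  have "proots (\<Prod>a\<leftarrow>xs. [:- a, 1:]) = mset xs" for xs :: "complex list"
  proof (induction xs)
    case (Cons a xs)
    have "proots (\<Prod>a\<leftarrow>a # xs. [:- a, 1:]) = proots [:- a, 1:] + proots (\<Prod>a\<leftarrow>xs. [:- a, 1:])"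
      unfolding list.map prod_list.Cons by (rule proots_mult) (use nz[of xs] in simp_all)
    then show ?case unfolding Cons.IH proots_linear_factor by simp
  qed simp
  then have "eigenvalues A = mset (map f [0..<p])" unfolding eigenvalues_def cp by blast
  then show ?thesis by (simp add: atLeast0LessThan flip: mset_set_upto_eq_mset_upto)
qed

lemma size_filter_image:
  fixes p :: nat
  shows "size {# l \<in># image_mset f (mset_set {..<p}). Q l #} = card {i. i < p \<and> Q (f i)}"
proof -
  have "{# l \<in># image_mset f (mset_set {..<p}). Q l #} = image_mset f {#i \<in># mset_set {..<p}. Q (f i)#}"
    by (simp add: filter_mset_image_mset)
  also have "size \<dots> = card {i \<in> {..<p}. Q (f i)}" by simp
  finally show ?thesis by simp
qed

text \<open>For \<open>p = 0\<close> the uniform law on the empty set is unspecified, hence the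
  assumptions \<open>p > 0\<close> below; it is a probability law in any case.\<close>

definition emp :: "nat \<Rightarrow> (nat \<Rightarrow> real) \<Rightarrow> real measure" where
  "emp p d = distr (measure_pmf (pmf_of_set {..<p})) borel d"

lemma real_distribution_emp: "real_distribution (emp p d)"
  unfolding emp_def by (intro prob_space.real_distribution_distr measure_pmf.prob_space_axioms) simp

lemma set_pmf_emp: "p > 0 \<Longrightarrow> {..<p} \<noteq> {} \<and> finite {..<p}" for p :: nat
  by auto

lemma cdf_emp: "p > 0 \<Longrightarrow> cdf (emp p d) x = card {i. i < p \<and> d i \<le> x} / p"
  unfolding cdf_def emp_def using set_pmf_emp[of p]
  by (subst measure_distr) (auto simp: measure_pmf_of_set intro!: arg_cong[of _ _ card])

lemma integral_emp:
  fixes f :: "real \<Rightarrow> 'b :: {banach, second_countable_topology}"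
  assumes "p > 0" "f \<in> borel_measurable borel"
  shows "integral\<^sup>L (emp p d) f = (\<Sum>i<p. f (d i)) /\<^sub>R p"
  unfolding emp_def using set_pmf_emp[of p] assms
  by (subst integral_distr, simp, simp, subst integral_measure_pmf[of "{..<p}"])
     (auto simp: set_pmf_of_set scaleR_sum_right inverse_eq_divide intro!: sum.cong)

lemma integrable_emp:
  fixes f :: "real \<Rightarrow> 'b :: {banach, second_countable_topology}"
  assumes "p > 0" "f \<in> borel_measurable borel"
  shows "integrable (emp p d) f"
  unfolding emp_def using set_pmf_emp[of p] assms
  by (subst integrable_distr_eq) (simp_all add: integrable_measure_pmf_finite set_pmf_of_set)

lemma esd_herm_spectral_fun:
  assumes "A \<in> carrier_mat p p" "unitary p V" "ofmat A = spectral_fun p V (\<lambda>i. of_real (d i))" "p > 0"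
  shows "esd_herm A = cdf (emp p d)"
  unfolding esd_herm_def eigenvalues_spectral_fun[OF assms(1-3)] size_filter_image using assms
  by (auto simp: cdf_emp)

lemma esd_skew_spectral_fun:
  assumes "A \<in> carrier_mat p p" "unitary p V" "ofmat A = spectral_fun p V (\<lambda>i. \<i> * of_real (d i))" "p > 0"
  shows "esd_skew A = cdf (emp p d)"
  unfolding esd_skew_def eigenvalues_spectral_fun[OF assms(1-3)] size_filter_image using assms
  by (auto simp: cdf_emp)

lemma spectral_skew:
  assumes "skew p S"
  shows "\<exists>V d. unitary p V \<and> S = spectral_fun p V (\<lambda>i. \<i> * complex_of_real (d i))"
proof -
  have "dims p p (sm (- \<i>) S)" "adj (sm (- \<i>) S) = sm (- \<i>) S"
    using assms dims_sm[of p p S "- \<i>"] by (auto simp: skew_def sm_minus)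
  then obtain V d where V: "unitary p V" "sm (- \<i>) S = spectral_fun p V (\<lambda>i. complex_of_real (d i))"
    using spectral_hermitian by blast
  have "S = sm \<i> (sm (- \<i>) S)" by simp
  then have "S = spectral_fun p V (\<lambda>i. \<i> * complex_of_real (d i))" unfolding V(2) spectral_fun_sm .
  with V(1) show ?thesis by blast
qed

lemma tr_res_spectral_fun:
  assumes V: "unitary p V" and S: "S = spectral_fun p V (\<lambda>i. \<i> * complex_of_real (d i))" and u: "Re u > 0"
  shows "tr (res p u S) = (\<Sum>i<p. 1 / (\<i> * of_real (d i) + u))"
proof -
  have s: "skew p S" unfolding skew_def S spectral_fun_adj sm_minus_one[symmetric] spectral_fun_sm using dims_spectral_fun[OF V] by simp
  have nz: "\<i> * of_real (d i) + u \<noteq> 0" for i using u by (auto simp: complex_eq_iff)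
  have "spectral_fun p V (\<lambda>i. 1 / (\<i> * of_real (d i) + u)) = res p u S"
  proof (rule res_unique[OF s u])
    show "proj p * spectral_fun p V (\<lambda>i. 1 / (\<i> * complex_of_real (d i) + u)) = spectral_fun p V (\<lambda>i. 1 / (\<i> * complex_of_real (d i) + u))"
      by (rule dims_projL[OF dims_spectral_fun[OF V]])
    show "(S + sm u (proj p)) * spectral_fun p V (\<lambda>i. 1 / (\<i> * of_real (d i) + u)) = proj p"
      unfolding S spectral_fun_one[OF V, symmetric] spectral_fun_sm spectral_fun_add spectral_fun_mult[OF V] using nz by simp
  qed
  then show ?thesis by (metis tr_spectral_fun[OF V])
qed

lemma stieltjes_emp:
  assumes "p > 0" "Re z < 0"
  shows "stieltjes_imag (emp p d) z = (\<Sum>i<p. 1 / (\<i> * of_real (d i) + (- z))) / p"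
  unfolding stieltjes_imag_def using assms by (subst integral_emp) (auto simp: scaleR_conv_of_real field_simps)

text \<open>One list \<open>d\<close> has to serve the distribution function and the transform at
  every \<open>z\<close>, so it is chosen before \<open>z\<close>; which eigenbasis produced it is
  irrelevant for what follows.\<close>

lemma stieltjes_esd:
  assumes "A \<in> carrier_mat p p" "skew p (ofmat A)" "p > 0"
  shows "\<exists>d. esd_skew A = cdf (emp p d) \<and> (\<forall>z. Re z < 0 \<longrightarrow> stieltjes_imag (emp p d) z = tr (res p (- z) (ofmat A)) / p)"
proof -
  obtain V d where V: "unitary p V" "ofmat A = spectral_fun p V (\<lambda>i. \<i> * complex_of_real (d i))"
    using spectral_skew[OF assms(2)] by blast
  show ?thesis
    using esd_skew_spectral_fun[OF assms(1) V assms(3)] stieltjes_emp[OF assms(3)] tr_res_spectral_fun[OF V] by (intro exI[of _ d]) auto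
qed

section \<open>Positive semi-definite matrices and their square roots\<close>

definition ofvec :: "complex vec \<Rightarrow> fmat" where
  "ofvec v = ofmat (mat (dim_vec v) 1 (\<lambda>(i,j). v $ i))"

lemma ent_ofvec: "ent (ofvec v) i j = (if i < dim_vec v \<and> j = 0 then v $ i else 0)"
  unfolding ofvec_def by (simp add: ent_ofmat)

lemma dims_ofvec: "v \<in> carrier_vec p \<Longrightarrow> dims p 1 (ofvec v)"
  by (auto simp: dims_def ent_ofvec split: if_splits)

lemma quad_ofvec:
  assumes "A \<in> carrier_mat p p" "v \<in> carrier_vec p"
  shows "(A *\<^sub>v v) \<bullet>c v = tr (adj (ofvec v) * (ofmat A * ofvec v))"
proof -
  have d: "dims p p (ofmat A)" "dims p 1 (ofvec v)" using assms(1) dims_ofvec[OF assms(2)] by (auto intro: dims_ofmat)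
  have "ent (ofmat A * ofvec v) i 0 = (A *\<^sub>v v) $ i" if "i < p" for i
    unfolding ent_mult_dims[OF d(1)] using assms that
    by (auto simp: scalar_prod_def ent_ofmat ent_ofvec atLeast0LessThan intro!: sum.cong)
  then have "tr (adj (ofvec v) * (ofmat A * ofvec v)) = (\<Sum>i<p. cnj (v $ i) * (A *\<^sub>v v) $ i)"
    using assms(2)
    by (simp add: tr_dims[OF dims_mult[OF dims_adj[OF d(2)] dims_mult[OF d]]] ent_mult_dims[OF dims_adj[OF d(2)]] ent_ofvec)
  also have "\<dots> = (A *\<^sub>v v) \<bullet>c v" using assms
    by (auto simp: scalar_prod_def atLeast0LessThan mult.commute intro!: sum.cong)
  finally show ?thesis ..
qed

lemma psd_spectral:
  assumes A: "A \<in> carrier_mat p p" "psd_mat A"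
  shows "\<exists>V d. unitary p V \<and> (\<forall>i. 0 \<le> d i) \<and> ofmat A = spectral_fun p V (\<lambda>i. complex_of_real (d i))"
proof -
  have a: "dims p p (ofmat A)" "adj (ofmat A) = ofmat A"
    using A unfolding psd_mat_def by (auto intro: dims_ofmat simp flip: ofmat_adjoint)
  obtain V d where V: "unitary p V" "ofmat A = spectral_fun p V (\<lambda>i. complex_of_real (d i))"
    using spectral_hermitian[OF a] by blast
  \<comment> \<open>Test positivity on the \<open>i\<close>-th column of \<open>V\<close>, where the
    quadratic form takes the value \<open>d i\<close>.\<close>
  have d: "0 \<le> d i" if i: "i < p" for i
  proof -
    define v where "v = vec p (\<lambda>k. ent V k i)"
    have dv: "dims p 1 (unit_col i)" using i by (rule dims_unit_col)
    have "ent V k i = 0" if "\<not> k < p" for k using unitary_dims[OF V(1)] that by (auto simp: dims_def)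
    then have "ofvec v = V * unit_col i"
      by (intro fmat_eqI) (use i in
        \<open>auto simp: ent_ofvec v_def ent_mult_dims[OF unitary_dims[OF V(1)]] if_distrib[of "(*) _"] sum.delta cong: if_cong\<close>)
    then have "adj (ofvec v) * (ofmat A * ofvec v) = adj (unit_col i) * ((adj V * V) * diag_fmat p (\<lambda>i. of_real (d i)) * ((adj V * V) * unit_col i))"
      by (simp add: V(2) spectral_fun_def mult.assoc)
    also have "\<dots> = adj (unit_col i) * (diag_fmat p (\<lambda>i. of_real (d i)) * unit_col i)"
      using V(1) by (simp add: unitary_def dims_projL[OF dims_diag_fmat] dims_projL[OF dv])
    also have "tr \<dots> = of_real (d i)"
      using i by (simp add: tr_dims[OF dims_mult[OF dims_adj[OF dv] dims_mult[OF dims_diag_fmat dv]]]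
         ent_mult_dims[OF dims_adj[OF dv]] ent_mult_dims[OF dims_diag_fmat] if_distrib[of cnj] if_distrib[of "(*) _"] if_distrib[of "\<lambda>x. x * _"] sum.delta sum.delta' cong: if_cong)
    finally have "(A *\<^sub>v v) \<bullet>c v = of_real (d i)"
      using quad_ofvec[OF A(1), of v] by (simp add: v_def)
    moreover have "0 \<le> Re ((A *\<^sub>v v) \<bullet>c v)" using A unfolding psd_mat_def by (auto simp: v_def)
    ultimately show ?thesis by simp
  qed
  \<comment> \<open>\<open>spectral_fun\<close> sees only indices below \<open>p\<close>; the others
    are set to 0 so that non-negativity holds for all \<open>i\<close>.\<close>
  have "ofmat A = spectral_fun p V (\<lambda>i. complex_of_real (if i < p then d i else 0))"
    unfolding V(2) by (rule spectral_fun_cong) simp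
  then show ?thesis using V(1) d by (intro exI[of _ V] exI[of _ "\<lambda>i. if i < p then d i else 0"]) auto
qed

lemma mat_tr_ofmat: "A \<in> carrier_mat p p \<Longrightarrow> mat_tr A = tr (ofmat A)"
  unfolding mat_tr_def by (subst tr_dims[OF dims_ofmat]) (auto simp: ent_ofmat)

lemma psd_mat_spectral_fun:
  assumes "unitary p V" "\<And>i. 0 \<le> d i"
  shows "psd_mat (tomat p (spectral_fun p V (\<lambda>i. complex_of_real (d i))))"
  unfolding psd_mat_def
proof (intro conjI ballI)
  let ?B = "spectral_fun p V (\<lambda>i. complex_of_real (d i))"
  let ?R = "spectral_fun p V (\<lambda>i. complex_of_real (sqrt (d i)))"
  have dB: "dims p p ?B" using assms(1) by (rule dims_spectral_fun)
  show "square_mat (tomat p ?B)" by simp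
  show "mat_adjoint (tomat p ?B) = tomat p ?B"
    by (rule ofmat_inject[of _ p]) (auto simp: ofmat_adjoint ofmat_tomat dB spectral_fun_adj mat_adjoint_carrier)
  fix v :: "complex Matrix.vec" assume "v \<in> carrier_vec (dim_row (tomat p ?B))"
  then have v: "v \<in> carrier_vec p" by simp
  have "(tomat p ?B *\<^sub>v v) \<bullet>c v = tr (adj (ofvec v) * (?B * ofvec v))"
    by (subst quad_ofvec[OF _ v]) (auto simp: ofmat_tomat dB)
  also have "\<dots> = tr (adj (ofvec v) * (adj ?R * ?R * ofvec v))"
    unfolding spectral_fun_adj spectral_fun_mult[OF assms(1)] using assms(2) by (simp flip: of_real_mult)
  also have "tr (adj (ofvec v) * (adj ?R * ?R * ofvec v)) = of_real (nrm2 (?R * ofvec v))"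
    by (simp flip: tr_adj_mult_self add: mult.assoc)
  finally show "0 \<le> Re ((tomat p ?B *\<^sub>v v) \<bullet>c v)" by simp
qed

text \<open>For two roots B and C of the same matrix, T = B - C satisfies B T + T C = 0. Pairing
  with T gives the sum of the squared norms of B^(1/2) T and C^(1/2) T, so B T = C T = 0, T T = 0
  and T = 0.\<close>

lemma sqrt_unique_spectral_fun:
  assumes V: "unitary p V" "\<And>i. 0 \<le> d i" and W: "unitary p W" "\<And>i. 0 \<le> e i"
    and eq: "spectral_fun p V (\<lambda>i. complex_of_real (d i)) * spectral_fun p V (\<lambda>i. of_real (d i)) = spectral_fun p W (\<lambda>i. of_real (e i)) * spectral_fun p W (\<lambda>i. of_real (e i))"
  shows "spectral_fun p V (\<lambda>i. complex_of_real (d i)) = spectral_fun p W (\<lambda>i. of_real (e i))"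
proof -
  let ?B = "spectral_fun p V (\<lambda>i. complex_of_real (d i))" and ?C = "spectral_fun p W (\<lambda>i. complex_of_real (e i))"
  let ?R = "spectral_fun p V (\<lambda>i. complex_of_real (sqrt (d i)))" and ?U = "spectral_fun p W (\<lambda>i. complex_of_real (sqrt (e i)))"
  have B: "?B = adj ?R * ?R"
    unfolding spectral_fun_adj spectral_fun_mult[OF V(1)] using V(2) by (intro spectral_fun_cong) (simp flip: of_real_mult)
  have C: "?C = adj ?U * ?U"
    unfolding spectral_fun_adj spectral_fun_mult[OF W(1)] using W(2) by (intro spectral_fun_cong) (simp flip: of_real_mult)
  define T where "T = ?B - ?C"
  have aT: "adj T = T" by (simp add: T_def spectral_fun_adj)
  have "?B * T + T * ?C = 0" by (simp add: T_def ring_distribs eq)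
  then have "tr (T * (?B * T + T * ?C)) = 0" by simp
  then have "tr (T * (?B * T)) + tr (T * (T * ?C)) = 0" by (simp add: ring_distribs)
  also have "tr (T * (T * ?C)) = tr (T * (?C * T))" by (metis mult.assoc tr_commute)
  also have "tr (T * (?B * T)) = of_real (nrm2 (?R * T))" unfolding B
    by (simp flip: tr_adj_mult_self add: mult.assoc aT)
  also have "tr (T * (?C * T)) = of_real (nrm2 (?U * T))" unfolding C
    by (simp flip: tr_adj_mult_self add: mult.assoc aT)
  finally have "nrm2 (?R * T) + nrm2 (?U * T) = 0" by (metis of_real_add of_real_eq_0_iff)
  then have "nrm2 (?R * T) = 0" "nrm2 (?U * T) = 0" using nrm2_nonneg[of "?R * T"] nrm2_nonneg[of "?U * T"] by linarith+
  then have "?B * T = 0" "?C * T = 0" unfolding B C nrm2_eq_0 by (auto simp: mult.assoc)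
  then have "adj T * T = 0" unfolding aT by (subst T_def) (simp add: ring_distribs)
  then have "nrm2 T = 0" by (simp add: nrm2_def)
  then show ?thesis by (simp add: nrm2_eq_0 T_def)
qed

text \<open>Existence and uniqueness make the definite description in \<open>mat_sqrt\<close> proper
  and identify it with the spectral square root, whatever eigenbasis is used.\<close>

lemma mat_sqrt_spectral_fun:
  assumes A: "A \<in> carrier_mat p p" and V: "unitary p V" "\<And>i. 0 \<le> d i"
    and eq: "ofmat A = spectral_fun p V (\<lambda>i. complex_of_real (d i))"
  shows "mat_sqrt A = tomat p (spectral_fun p V (\<lambda>i. of_real (sqrt (d i))))"
  unfolding mat_sqrt_def
proof (rule the_equality)
  let ?R = "spectral_fun p V (\<lambda>i. complex_of_real (sqrt (d i)))"
  have RR: "?R * ?R = ofmat A" unfolding eq spectral_fun_mult[OF V(1)] using V(2) by (intro spectral_fun_cong) (simp flip: of_real_mult)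
  have oR: "ofmat (tomat p ?R) = ?R" by (rule ofmat_tomat[OF dims_spectral_fun[OF V(1)]])
  have "psd_mat (tomat p ?R)" using psd_mat_spectral_fun[OF V(1), of "\<lambda>i. sqrt (d i)"] V(2) by simp
  moreover have "tomat p ?R * tomat p ?R = A"
    by (rule ofmat_inject[of _ p]) (auto simp: ofmat_mult[of _ p p _ p] oR RR A)
  ultimately show "tomat p ?R \<in> carrier_mat (dim_row A) (dim_row A) \<and> psd_mat (tomat p ?R) \<and> tomat p ?R * tomat p ?R = A"
    using A by auto
  fix B assume B: "B \<in> carrier_mat (dim_row A) (dim_row A) \<and> psd_mat B \<and> B * B = A"
  then have Bc: "B \<in> carrier_mat p p" using A by auto
  obtain W e where W: "unitary p W" "\<forall>i. 0 \<le> e i" "ofmat B = spectral_fun p W (\<lambda>i. complex_of_real (e i))"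
    using psd_spectral[OF Bc] B by blast
  have "ofmat B * ofmat B = ofmat A" using B ofmat_mult[OF Bc Bc] by simp
  then have "?R = ofmat B" unfolding W(3) RR[symmetric]
    using sqrt_unique_spectral_fun[OF V(1) _ W(1), of "\<lambda>i. sqrt (d i)" e] V(2) W(2) by simp
  then show "B = tomat p ?R" using tomat_ofmat[OF Bc] by simp
qed

subsection \<open>Bounded differences\<close>

lemma (in prob_space) Hoeffding_centered:
  fixes f :: "'a \<Rightarrow> real"
  assumes f: "f \<in> borel_measurable M" and l: "l > 0"
    and c: "\<And>x. x \<in> space M \<Longrightarrow> \<bar>f x - expectation f\<bar> \<le> c"
  shows "(\<integral>\<^sup>+x. ennreal (exp (l * (f x - expectation f))) \<partial>M) \<le> ennreal (exp (l\<^sup>2 * (2 * c)\<^sup>2 / 8))"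
proof -
  have "f x \<in> {expectation f - c..expectation f + c}" if "x \<in> space M" for x
    using c[OF that] by (auto simp: abs_le_iff)
  then interpret interval_bounded_random_variable M f "expectation f - c" "expectation f + c"
    by unfold_locales (use f in auto)
  show ?thesis using Hoeffdings_lemma_nn_integral[OF l] by simp
qed

lemma exp_half_diff: "(exp (x / 2) - exp (- (x / 2)))\<^sup>2 = exp x + exp (- x) - 2" for x :: real
proof -
  have "exp x = exp (x / 2) * exp (x / 2)" by (simp flip: exp_add)
  then show ?thesis by (simp add: exp_minus power2_eq_square field_simps)
qed

text \<open>In hyperbolic terms: 2 cosh t - 2 = (2 sinh (t / 2))^2 and sinh s >= s for s >= 0. It
  lets the two exponential moments control the variance.\<close>

lemma exp_plus_exp_minus_ge: "t\<^sup>2 + 2 \<le> exp t + exp (- t)" for t :: real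
proof -
  have *: "2 * s \<le> exp s - exp (- s)" if "s \<ge> 0" for s :: real
  proof -
    have "exp 0 - exp (- 0) - 2 * 0 \<le> exp s - exp (- s) - 2 * s"
    proof (rule DERIV_nonneg_imp_nondecreasing[OF that])
      fix x :: real
      have "0 \<le> (exp (x / 2) - exp (- (x / 2)))\<^sup>2" by simp
      then have "0 \<le> exp x + exp (- x) - 2" unfolding exp_half_diff .
      moreover have "((\<lambda>s. exp s - exp (- s) - 2 * s) has_real_derivative exp x + exp (- x) - 2) (at x)"
        by (auto intro!: derivative_eq_intros)
      ultimately show "\<exists>y. ((\<lambda>s. exp s - exp (- s) - 2 * s) has_real_derivative y) (at x) \<and> 0 \<le> y" by blast
    qed
    then show ?thesis by simp
  qed
  have "(2 * (\<bar>t\<bar> / 2))\<^sup>2 \<le> (exp (\<bar>t\<bar> / 2) - exp (- (\<bar>t\<bar> / 2)))\<^sup>2"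
    by (rule power_mono[OF *]) auto
  also have "\<dots> = exp \<bar>t\<bar> + exp (- \<bar>t\<bar>) - 2"
    by (rule exp_half_diff)
  also have "\<dots> = exp t + exp (- t) - 2" by (cases "t \<ge> 0") auto
  finally show ?thesis by simp
qed

locale bounded_diff =
  fixes M :: "'i \<Rightarrow> 'a measure"
  assumes prob_M: "\<And>i. prob_space (M i)"
begin

sublocale product_sigma_finite M
  unfolding product_sigma_finite_def by (auto intro: prob_space_imp_sigma_finite prob_M)

lemma measurable_upd:
  assumes "f \<in> borel_measurable (Pi\<^sub>M (insert i I) M)" "x \<in> space (Pi\<^sub>M I M)"
  shows "(\<lambda>y. f (x(i := y))) \<in> borel_measurable (M i)"
proof -
  have "(\<lambda>y. x(i := y)) \<in> M i \<rightarrow>\<^sub>M Pi\<^sub>M (insert i I) M"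
    using measurable_compose[OF measurable_Pair1'[OF assms(2)] measurable_add_dim] by simp
  then show ?thesis using assms(1) by (rule measurable_compose)
qed

lemma upd_space: "x \<in> space (Pi\<^sub>M I M) \<Longrightarrow> y \<in> space (M i) \<Longrightarrow> x(i := y) \<in> space (Pi\<^sub>M (insert i I) M)"
  by (auto simp: space_PiM PiE_iff extensional_def)

text \<open>McDiarmid's martingale argument as an induction on the index set: averaging out
  coordinate \<open>i\<close> gives \<open>F\<close>, which inherits the bounds in the other
  coordinates, and Hoeffding's lemma applies to the fibre over \<open>x\<close>. The fibre stays
  within \<open>c i\<close> of its mean, an interval of length 2 \<open>c i\<close>, whence the
  contribution l^2 (c i)^2 / 2.\<close>

lemma mgf_bounded_diff:
  fixes f :: "('i \<Rightarrow> 'a) \<Rightarrow> real"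
  assumes "finite I" and "f \<in> borel_measurable (Pi\<^sub>M I M)"
    and "\<And>x. x \<in> space (Pi\<^sub>M I M) \<Longrightarrow> \<bar>f x\<bar> \<le> B"
    and "\<And>i x y. i \<in> I \<Longrightarrow> x \<in> space (Pi\<^sub>M I M) \<Longrightarrow> y \<in> space (M i) \<Longrightarrow> \<bar>f (x(i := y)) - f x\<bar> \<le> c i"
    and l: "l > 0"
  shows "(\<integral>\<^sup>+x. ennreal (exp (l * (f x - (\<integral>x. f x \<partial>Pi\<^sub>M I M)))) \<partial>Pi\<^sub>M I M) \<le> ennreal (exp (l\<^sup>2 * (\<Sum>i\<in>I. (c i)\<^sup>2) / 2))"
  using assms(1-4)
proof (induction I arbitrary: f rule: finite_induct)
  case empty
  then show ?case by (simp add: PiM_empty emeasure_count_space lebesgue_integral_count_space_finite nn_integral_count_space_finite)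
next
  case (insert i I)
  note f [measurable] = insert.prems(1)
  interpret Mi: prob_space "M i" by (rule prob_M)
  interpret PI: prob_space "Pi\<^sub>M I M" by (intro prob_space_PiM prob_M)
  interpret PiI: prob_space "Pi\<^sub>M (insert i I) M" by (intro prob_space_PiM prob_M)
  define F where "F = (\<lambda>x. \<integral>y. f (x(i := y)) \<partial>M i)"
  have mp: "(\<lambda>(x, y). f (x(i := y))) \<in> borel_measurable (Pi\<^sub>M I M \<Otimes>\<^sub>M M i)"
    using measurable_compose[OF measurable_add_dim f] by (simp add: case_prod_beta')
  have F [measurable]: "F \<in> borel_measurable (Pi\<^sub>M I M)"
    unfolding F_def using mp by (intro borel_measurable_lebesgue_integral) simp
  have B: "\<bar>f (x(i := y))\<bar> \<le> B" if "x \<in> space (Pi\<^sub>M I M)" "y \<in> space (M i)" for x y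
    using insert.prems(2) upd_space[OF that] by blast
  have int: "integrable (M i) (\<lambda>y. f (x(i := y)))" if "x \<in> space (Pi\<^sub>M I M)" for x
    by (rule Mi.integrable_const_bound[of _ B, OF AE_I2 measurable_upd[OF f that]]) (unfold real_norm_def, rule B[OF that])
  have avg: "\<bar>(\<integral>y. g y \<partial>M i) - h\<bar> \<le> k" if "integrable (M i) g" "\<And>y. y \<in> space (M i) \<Longrightarrow> \<bar>g y - h\<bar> \<le> k"
    for g :: "'a \<Rightarrow> real" and h k
  proof -
    have "(\<integral>y. g y \<partial>M i) - h = (\<integral>y. g y - h \<partial>M i)" using that(1) by (simp add: Mi.prob_space)
    also have "\<bar>\<dots>\<bar> \<le> (\<integral>y. \<bar>g y - h\<bar> \<partial>M i)" by (rule integral_abs_bound)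
    also have "\<dots> \<le> (\<integral>y. k \<partial>M i)" using that by (intro integral_mono) auto
    finally show ?thesis by (simp add: Mi.prob_space)
  qed
  have FB: "\<bar>F x\<bar> \<le> B" if "x \<in> space (Pi\<^sub>M I M)" for x
    using avg[OF int[OF that], of 0 B] B[OF that] by (simp add: F_def)
  have Fd: "\<bar>F (x(j := z)) - F x\<bar> \<le> c j" if "j \<in> I" "x \<in> space (Pi\<^sub>M I M)" "z \<in> space (M j)" for j x z
  proof -
    have xz: "x(j := z) \<in> space (Pi\<^sub>M I M)" using upd_space[OF that(2,3)] that(1) by (simp add: insert_absorb)
    have ji: "j \<noteq> i" using that(1) insert.hyps by auto
    have "\<bar>(\<integral>y. f ((x(j := z))(i := y)) - f (x(i := y)) \<partial>M i) - 0\<bar> \<le> c j"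
    proof (rule avg)
      show "integrable (M i) (\<lambda>y. f ((x(j := z))(i := y)) - f (x(i := y)))"
        using int[OF xz] int[OF that(2)] by auto
      fix y assume y: "y \<in> space (M i)"
      have "\<bar>f ((x(i := y))(j := z)) - f (x(i := y))\<bar> \<le> c j"
        by (rule insert.prems(3)[OF insertI2[OF that(1)] upd_space[OF that(2) y] that(3)])
      then show "\<bar>f ((x(j := z))(i := y)) - f (x(i := y)) - 0\<bar> \<le> c j"
        using ji by (simp add: fun_upd_twist)
    qed
    then show ?thesis using int[OF xz] int[OF that(2)] by (simp add: F_def)
  qed
  have intf: "integrable (Pi\<^sub>M (insert i I) M) f"
    using insert.prems(2) by (intro PiI.integrable_const_bound[of _ B]) auto
  have EF: "(\<integral>x. f x \<partial>Pi\<^sub>M (insert i I) M) = (\<integral>x. F x \<partial>Pi\<^sub>M I M)"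
    unfolding F_def by (rule product_integral_insert[OF insert.hyps(1,2) intf])
  define \<mu> where "\<mu> = (\<integral>x. F x \<partial>Pi\<^sub>M I M)"
  have "(\<integral>\<^sup>+x. ennreal (exp (l * (f x - \<mu>))) \<partial>Pi\<^sub>M (insert i I) M)
      = (\<integral>\<^sup>+x. \<integral>\<^sup>+y. ennreal (exp (l * (f (x(i := y)) - \<mu>))) \<partial>M i \<partial>Pi\<^sub>M I M)"
    by (rule product_nn_integral_insert[OF insert.hyps(1,2)]) simp
  also have "\<dots> \<le> (\<integral>\<^sup>+x. ennreal (exp (l * (F x - \<mu>))) * ennreal (exp (l\<^sup>2 * (c i)\<^sup>2 / 2)) \<partial>Pi\<^sub>M I M)"
  proof (rule nn_integral_mono)
    fix x assume x: "x \<in> space (Pi\<^sub>M I M)"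
    note [measurable] = measurable_upd[OF f x]
    have "(\<integral>\<^sup>+y. ennreal (exp (l * (f (x(i := y)) - \<mu>))) \<partial>M i)
       = (\<integral>\<^sup>+y. ennreal (exp (l * (F x - \<mu>))) * ennreal (exp (l * (f (x(i := y)) - F x))) \<partial>M i)"
      by (intro nn_integral_cong) (simp add: field_simps flip: ennreal_mult exp_add)
    also have "\<dots> = ennreal (exp (l * (F x - \<mu>))) * (\<integral>\<^sup>+y. ennreal (exp (l * (f (x(i := y)) - F x))) \<partial>M i)"
      by (rule nn_integral_cmult) simp
    also have "(\<integral>\<^sup>+y. ennreal (exp (l * (f (x(i := y)) - F x))) \<partial>M i) \<le> ennreal (exp (l\<^sup>2 * (2 * c i)\<^sup>2 / 8))"
      unfolding F_def
    proof (rule Mi.Hoeffding_centered[OF _ l])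
      fix y assume y: "y \<in> space (M i)"
      have "\<bar>(\<integral>z. f (x(i := z)) \<partial>M i) - f (x(i := y))\<bar> \<le> c i"
      proof (rule avg[OF int[OF x]])
        fix z assume z: "z \<in> space (M i)"
        show "\<bar>f (x(i := z)) - f (x(i := y))\<bar> \<le> c i"
          using insert.prems(3)[OF insertI1 upd_space[OF x y] z] by (simp only: fun_upd_upd)
      qed
      then show "\<bar>f (x(i := y)) - (\<integral>z. f (x(i := z)) \<partial>M i)\<bar> \<le> c i" by (simp add: abs_minus_commute)
    qed simp
    finally show "(\<integral>\<^sup>+y. ennreal (exp (l * (f (x(i := y)) - \<mu>))) \<partial>M i)
       \<le> ennreal (exp (l * (F x - \<mu>))) * ennreal (exp (l\<^sup>2 * (c i)\<^sup>2 / 2))"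
      by (simp add: power_mult_distrib mult_left_mono)
  qed
  also have "\<dots> = (\<integral>\<^sup>+x. ennreal (exp (l * (F x - \<mu>))) \<partial>Pi\<^sub>M I M) * ennreal (exp (l\<^sup>2 * (c i)\<^sup>2 / 2))"
    by (rule nn_integral_multc) simp
  also have "\<dots> \<le> ennreal (exp (l\<^sup>2 * (\<Sum>i\<in>I. (c i)\<^sup>2) / 2)) * ennreal (exp (l\<^sup>2 * (c i)\<^sup>2 / 2))"
    unfolding \<mu>_def by (intro mult_right_mono insert.IH F FB Fd) auto
  also have "\<dots> = ennreal (exp (l\<^sup>2 * (\<Sum>i\<in>insert i I. (c i)\<^sup>2) / 2))"
    using insert.hyps by (simp add: field_simps flip: ennreal_mult exp_add)
  finally show ?case unfolding EF \<mu>_def .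
qed

section \<open>Variance and tails of real functions with bounded differences\<close>

context
  fixes I :: "'i set" and f :: "('i \<Rightarrow> 'a) \<Rightarrow> real" and B v :: real and c
  assumes fin: "finite I" and f [measurable]: "f \<in> borel_measurable (Pi\<^sub>M I M)"
    and B: "\<And>x. x \<in> space (Pi\<^sub>M I M) \<Longrightarrow> \<bar>f x\<bar> \<le> B"
    and d: "\<And>i x y. i \<in> I \<Longrightarrow> x \<in> space (Pi\<^sub>M I M) \<Longrightarrow> y \<in> space (M i) \<Longrightarrow> \<bar>f (x(i := y)) - f x\<bar> \<le> c i"
    and v: "(\<Sum>i\<in>I. (c i)\<^sup>2) \<le> v" "v > 0"
begin

interpretation P: prob_space "Pi\<^sub>M I M" by (intro prob_space_PiM prob_M)

lemma mgf_both:
  assumes "\<bar>s\<bar> = 1" "l > 0"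
  shows "(\<integral>\<^sup>+x. ennreal (exp (l * (s * (f x - P.expectation f)))) \<partial>Pi\<^sub>M I M) \<le> ennreal (exp (l\<^sup>2 * v / 2))"
proof -
  have "(\<integral>\<^sup>+x. ennreal (exp (l * ((s * f x) - (\<integral>x. s * f x \<partial>Pi\<^sub>M I M)))) \<partial>Pi\<^sub>M I M) \<le> ennreal (exp (l\<^sup>2 * (\<Sum>i\<in>I. (c i)\<^sup>2) / 2))"
    by (rule mgf_bounded_diff[OF fin, of _ B])
       (use B d assms in \<open>auto simp: abs_mult simp flip: right_diff_distrib\<close>)
  also have "\<dots> \<le> ennreal (exp (l\<^sup>2 * v / 2))" using v by (intro ennreal_leI) (auto intro: mult_left_mono)
  finally show ?thesis by (simp add: right_diff_distrib)
qed

lemma variance_bounded_diff: "P.expectation (\<lambda>x. (f x - P.expectation f)\<^sup>2) \<le> 2 * v"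
proof -
  define g where "g = (\<lambda>x. f x - P.expectation f)"
  have [measurable]: "g \<in> borel_measurable (Pi\<^sub>M I M)" by (simp add: g_def)
  \<comment> \<open>Makes the exponent l^2 v / 2 equal to 1, so that the two exponential moments add
    up to at most 2 e <= 6; then (6 - 2) / l^2 = 2 v.\<close>
  define l where "l = sqrt (2 / v)"
  have l: "l > 0" "l\<^sup>2 = 2 / v" using v by (auto simp: l_def)
  note key = exp_plus_exp_minus_ge
  have "(\<integral>\<^sup>+x. ennreal (l\<^sup>2 * (g x)\<^sup>2) + 2 \<partial>Pi\<^sub>M I M) \<le> (\<integral>\<^sup>+x. ennreal (exp (l * (1 * g x))) + ennreal (exp (l * (- 1 * g x))) \<partial>Pi\<^sub>M I M)"
  proof (rule nn_integral_mono)
    fix x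
    have "ennreal (l\<^sup>2 * (g x)\<^sup>2) + 2 = ennreal ((l * g x)\<^sup>2 + 2)"
      by (simp add: power_mult_distrib ennreal_plus)
    also have "\<dots> \<le> ennreal (exp (l * g x) + exp (- (l * g x)))" by (intro ennreal_leI key)
    finally show "ennreal (l\<^sup>2 * (g x)\<^sup>2) + 2 \<le> ennreal (exp (l * (1 * g x))) + ennreal (exp (l * (- 1 * g x)))" by simp
  qed
  also have "\<dots> = (\<integral>\<^sup>+x. ennreal (exp (l * (1 * g x))) \<partial>Pi\<^sub>M I M) + (\<integral>\<^sup>+x. ennreal (exp (l * (- 1 * g x))) \<partial>Pi\<^sub>M I M)"
    by (rule nn_integral_add) auto
  also have "\<dots> \<le> ennreal (exp (l\<^sup>2 * v / 2)) + ennreal (exp (l\<^sup>2 * v / 2))"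
    unfolding g_def using l by (intro add_mono mgf_both) auto
  also have "\<dots> = ennreal (2 * exp 1)" using v by (simp add: l(2) flip: ennreal_plus)
  also have "\<dots> \<le> ennreal 6" using exp_le by (intro ennreal_leI) simp
  finally have *: "(\<integral>\<^sup>+x. ennreal (l\<^sup>2 * (g x)\<^sup>2) + 2 \<partial>Pi\<^sub>M I M) \<le> ennreal 6" .
  have intg: "integrable (Pi\<^sub>M I M) (\<lambda>x. l\<^sup>2 * (g x)\<^sup>2 + 2)"
  proof (rule P.integrable_const_bound[of _ "l\<^sup>2 * (B + B)\<^sup>2 + 2"])
    have "\<bar>P.expectation f\<bar> \<le> B"
    proof -
      have "integrable (Pi\<^sub>M I M) f" using B by (intro P.integrable_const_bound[of _ B]) auto
      then have "\<bar>P.expectation f\<bar> \<le> P.expectation (\<lambda>x. B)"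
        using B by (intro order_trans[OF integral_abs_bound] integral_mono) auto
      then show ?thesis by (simp add: P.prob_space)
    qed
    then have "\<bar>g x\<bar> \<le> B + B" if "x \<in> space (Pi\<^sub>M I M)" for x using B[OF that] by (auto simp: g_def)
    then have "(g x)\<^sup>2 \<le> (B + B)\<^sup>2" if "x \<in> space (Pi\<^sub>M I M)" for x
      using that by (metis abs_ge_self abs_le_square_iff order_trans power2_abs)
    then show "AE x in Pi\<^sub>M I M. norm (l\<^sup>2 * (g x)\<^sup>2 + 2) \<le> l\<^sup>2 * (B + B)\<^sup>2 + 2"
      by (intro AE_I2) (auto intro!: mult_left_mono)
  qed simp
  have "ennreal (P.expectation (\<lambda>x. l\<^sup>2 * (g x)\<^sup>2 + 2)) = (\<integral>\<^sup>+x. ennreal (l\<^sup>2 * (g x)\<^sup>2 + 2) \<partial>Pi\<^sub>M I M)"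
    by (rule nn_integral_eq_integral[symmetric, OF intg]) auto
  also have "\<dots> = (\<integral>\<^sup>+x. ennreal (l\<^sup>2 * (g x)\<^sup>2) + 2 \<partial>Pi\<^sub>M I M)" by (intro nn_integral_cong) (simp add: ennreal_plus)
  also note *
  finally have "P.expectation (\<lambda>x. l\<^sup>2 * (g x)\<^sup>2 + 2) \<le> 6" by (subst (asm) ennreal_le_iff) auto
  also have "P.expectation (\<lambda>x. l\<^sup>2 * (g x)\<^sup>2 + 2) = l\<^sup>2 * P.expectation (\<lambda>x. (g x)\<^sup>2) + 2"
  proof -
    have "integrable (Pi\<^sub>M I M) (\<lambda>x. l\<^sup>2 * (g x)\<^sup>2)" using Bochner_Integration.integrable_diff[OF intg P.integrable_const[of 2]] by simp
    then show ?thesis by (subst Bochner_Integration.integral_add) (auto simp: P.prob_space)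
  qed
  finally have "2 / v * P.expectation (\<lambda>x. (g x)\<^sup>2) \<le> 4" by (simp add: l)
  then show ?thesis using v by (simp add: g_def field_simps)
qed

lemma tail_bounded_diff:
  assumes e: "e > 0"
  shows "P.prob {x \<in> space (Pi\<^sub>M I M). \<bar>f x - P.expectation f\<bar> \<ge> e} \<le> 2 * exp (- e\<^sup>2 / (2 * v))"
proof -
  \<comment> \<open>The minimiser of - l e + l^2 v / 2.\<close>
  define l where "l = e / v"
  have l: "l > 0" using e v by (simp add: l_def)
  have one: "P.prob {x \<in> space (Pi\<^sub>M I M). s * (f x - P.expectation f) \<ge> e} \<le> exp (- e\<^sup>2 / (2 * v))" if s: "\<bar>s\<bar> = 1" for s
  proof -
    have "emeasure (Pi\<^sub>M I M) {x \<in> space (Pi\<^sub>M I M). s * (f x - P.expectation f) \<ge> e}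
       \<le> (\<integral>\<^sup>+x. ennreal (exp (- l * e)) * ennreal (exp (l * (s * (f x - P.expectation f)))) \<partial>Pi\<^sub>M I M)"
    proof (subst nn_integral_indicator[symmetric], measurable, rule nn_integral_mono)
      fix x
      have "1 \<le> ennreal (exp (- l * e)) * ennreal (exp (l * (s * (f x - P.expectation f))))"
        if "e \<le> s * (f x - P.expectation f)"
      proof -
        have "1 = exp (- l * e) * exp (l * e)" by (simp flip: exp_add)
        also have "\<dots> \<le> exp (- l * e) * exp (l * (s * (f x - P.expectation f)))"
          using that l by (intro mult_left_mono) auto
        finally show ?thesis by (subst ennreal_mult[symmetric]) (auto simp flip: ennreal_1 intro: ennreal_leI)
      qed
      then show "indicator {x \<in> space (Pi\<^sub>M I M). e \<le> s * (f x - P.expectation f)} x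
        \<le> ennreal (exp (- l * e)) * ennreal (exp (l * (s * (f x - P.expectation f))))"
        by (auto simp: indicator_def)
    qed
    also have "\<dots> = ennreal (exp (- l * e)) * (\<integral>\<^sup>+x. ennreal (exp (l * (s * (f x - P.expectation f)))) \<partial>Pi\<^sub>M I M)"
      by (rule nn_integral_cmult) simp
    also have "\<dots> \<le> ennreal (exp (- l * e)) * ennreal (exp (l\<^sup>2 * v / 2))"
      by (intro mult_left_mono mgf_both s l) simp
    also have "\<dots> = ennreal (exp (- e\<^sup>2 / (2 * v)))"
    proof -
      have "- l * e + l\<^sup>2 * v / 2 = - e\<^sup>2 / (2 * v)"
        using v by (simp add: l_def power2_eq_square field_simps)
      then have "exp (- l * e) * exp (l\<^sup>2 * v / 2) = exp (- e\<^sup>2 / (2 * v))" by (metis exp_add)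
      then show ?thesis by (metis ennreal_mult exp_ge_zero)
    qed
    finally show ?thesis by (simp add: P.emeasure_eq_measure)
  qed
  define m where "m = P.expectation f"
  let ?A = "\<lambda>s. {x \<in> space (Pi\<^sub>M I M). s * (f x - m) \<ge> e}"
  have [measurable]: "?A s \<in> sets (Pi\<^sub>M I M)" for s by measurable
  have "{x \<in> space (Pi\<^sub>M I M). \<bar>f x - m\<bar> \<ge> e} \<subseteq> ?A 1 \<union> ?A (- 1)"
    by (rule subsetI) (simp add: abs_real_def split: if_splits)
  then have "P.prob {x \<in> space (Pi\<^sub>M I M). \<bar>f x - m\<bar> \<ge> e} \<le> P.prob (?A 1 \<union> ?A (- 1))"
    by (rule P.finite_measure_mono) simp
  also have "\<dots> \<le> P.prob (?A 1) + P.prob (?A (- 1))"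
    by (rule measure_Un_le) simp_all
  also have "\<dots> \<le> exp (- e\<^sup>2 / (2 * v)) + exp (- e\<^sup>2 / (2 * v))"
    unfolding m_def by (intro add_mono one) auto
  finally show ?thesis by (simp add: m_def)
qed

end

section \<open>The complex case, by real and imaginary parts\<close>

context
  fixes I :: "'i set" and f :: "('i \<Rightarrow> 'a) \<Rightarrow> complex" and B v :: real and c
  assumes fin: "finite I" and f [measurable]: "f \<in> borel_measurable (Pi\<^sub>M I M)"
    and B: "\<And>x. x \<in> space (Pi\<^sub>M I M) \<Longrightarrow> cmod (f x) \<le> B"
    and d: "\<And>i x y. i \<in> I \<Longrightarrow> x \<in> space (Pi\<^sub>M I M) \<Longrightarrow> y \<in> space (M i) \<Longrightarrow> cmod (f (x(i := y)) - f x) \<le> c i"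
    and v: "(\<Sum>i\<in>I. (c i)\<^sup>2) \<le> v" "v > 0"
begin

interpretation P: prob_space "Pi\<^sub>M I M" by (intro prob_space_PiM prob_M)

lemma integrable_bounded_cmplx: "integrable (Pi\<^sub>M I M) f"
  using B by (intro P.integrable_const_bound[of _ B]) auto

lemma bounded_diff_Re:
  "x \<in> space (Pi\<^sub>M I M) \<Longrightarrow> \<bar>Re (f x)\<bar> \<le> B"
  "i \<in> I \<Longrightarrow> x \<in> space (Pi\<^sub>M I M) \<Longrightarrow> y \<in> space (M i) \<Longrightarrow> \<bar>Re (f (x(i := y))) - Re (f x)\<bar> \<le> c i"
  using B[of x] abs_Re_le_cmod[of "f x"] d[of i x y] abs_Re_le_cmod[of "f (x(i := y)) - f x"] by auto

lemma bounded_diff_Im: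
  "x \<in> space (Pi\<^sub>M I M) \<Longrightarrow> \<bar>Im (f x)\<bar> \<le> B"
  "i \<in> I \<Longrightarrow> x \<in> space (Pi\<^sub>M I M) \<Longrightarrow> y \<in> space (M i) \<Longrightarrow> \<bar>Im (f (x(i := y))) - Im (f x)\<bar> \<le> c i"
  using B[of x] abs_Im_le_cmod[of "f x"] d[of i x y] abs_Im_le_cmod[of "f (x(i := y)) - f x"] by auto

lemma variance_bounded_diff_cmplx: "P.expectation (\<lambda>x. (cmod (f x - P.expectation f))\<^sup>2) \<le> 4 * v"
proof -
  have "P.expectation (\<lambda>x. (cmod (f x - P.expectation f))\<^sup>2)
     = P.expectation (\<lambda>x. (Re (f x) - P.expectation (\<lambda>x. Re (f x)))\<^sup>2 + (Im (f x) - P.expectation (\<lambda>x. Im (f x)))\<^sup>2)"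
    by (intro Bochner_Integration.integral_cong refl) (simp add: cmod_power2 integrable_bounded_cmplx)
  also have "\<dots> = P.expectation (\<lambda>x. (Re (f x) - P.expectation (\<lambda>x. Re (f x)))\<^sup>2) + P.expectation (\<lambda>x. (Im (f x) - P.expectation (\<lambda>x. Im (f x)))\<^sup>2)"
  proof (rule Bochner_Integration.integral_add)
    have b: "integrable (Pi\<^sub>M I M) (\<lambda>x. (g x - m)\<^sup>2)" if g: "g \<in> borel_measurable (Pi\<^sub>M I M)" "\<And>x. x \<in> space (Pi\<^sub>M I M) \<Longrightarrow> \<bar>g x\<bar> \<le> B" for g :: "_ \<Rightarrow> real" and m
    proof (rule P.integrable_const_bound[of _ "(B + \<bar>m\<bar>)\<^sup>2"])
      show "AE x in Pi\<^sub>M I M. norm ((g x - m)\<^sup>2) \<le> (B + \<bar>m\<bar>)\<^sup>2"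
      proof (intro AE_I2)
        fix x assume x: "x \<in> space (Pi\<^sub>M I M)"
        then have "\<bar>g x - m\<bar> \<le> B + \<bar>m\<bar>" using g(2)[OF x] by linarith
        then have "\<bar>g x - m\<bar>\<^sup>2 \<le> (B + \<bar>m\<bar>)\<^sup>2" by (intro power_mono) auto
        then show "norm ((g x - m)\<^sup>2) \<le> (B + \<bar>m\<bar>)\<^sup>2" by simp
      qed
    qed (use g in simp)
    show "integrable (Pi\<^sub>M I M) (\<lambda>x. (Re (f x) - P.expectation (\<lambda>x. Re (f x)))\<^sup>2)" by (intro b bounded_diff_Re) simp
    show "integrable (Pi\<^sub>M I M) (\<lambda>x. (Im (f x) - P.expectation (\<lambda>x. Im (f x)))\<^sup>2)" by (intro b bounded_diff_Im) simp
  qed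
  also have "\<dots> \<le> 2 * v + 2 * v"
    by (intro add_mono variance_bounded_diff[OF fin _ _ _ v, where B = B] bounded_diff_Re bounded_diff_Im) auto
  finally show ?thesis by simp
qed

lemma tail_bounded_diff_cmplx:
  assumes e: "e > 0"
  shows "P.prob {x \<in> space (Pi\<^sub>M I M). cmod (f x - P.expectation f) \<ge> e} \<le> 4 * exp (- e\<^sup>2 / (8 * v))"
proof -
  let ?R = "{x \<in> space (Pi\<^sub>M I M). \<bar>Re (f x) - P.expectation (\<lambda>x. Re (f x))\<bar> \<ge> e / 2}"
  let ?I = "{x \<in> space (Pi\<^sub>M I M). \<bar>Im (f x) - P.expectation (\<lambda>x. Im (f x))\<bar> \<ge> e / 2}"
  have "{x \<in> space (Pi\<^sub>M I M). cmod (f x - P.expectation f) \<ge> e} \<subseteq> ?R \<union> ?I"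
  proof
    fix x assume x: "x \<in> {x \<in> space (Pi\<^sub>M I M). cmod (f x - P.expectation f) \<ge> e}"
    have "cmod (f x - P.expectation f) \<le> \<bar>Re (f x) - P.expectation (\<lambda>x. Re (f x))\<bar> + \<bar>Im (f x) - P.expectation (\<lambda>x. Im (f x))\<bar>"
      using cmod_le[of "f x - P.expectation f"] by (simp add: integrable_bounded_cmplx)
    then show "x \<in> ?R \<union> ?I" using x by auto
  qed
  then have "P.prob {x \<in> space (Pi\<^sub>M I M). cmod (f x - P.expectation f) \<ge> e} \<le> P.prob (?R \<union> ?I)"
    by (intro P.finite_measure_mono) auto
  also have "\<dots> \<le> P.prob ?R + P.prob ?I" by (rule measure_Un_le) auto
  also have "\<dots> \<le> 2 * exp (- (e / 2)\<^sup>2 / (2 * v)) + 2 * exp (- (e / 2)\<^sup>2 / (2 * v))"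
    using e by (intro add_mono tail_bounded_diff[OF fin _ _ _ v, where B = B] bounded_diff_Re bounded_diff_Im) auto
  finally show ?thesis by (simp add: power_divide)
qed

end

end

subsection \<open>Quadratic forms in independent variables\<close>

definition std_moments :: "real \<Rightarrow> complex measure \<Rightarrow> bool" where
  "std_moments K N \<longleftrightarrow> prob_space N \<and> sets N = sets borel \<and> integrable N (\<lambda>y. (cmod y) ^ 4) \<and>
     (\<integral>y. y \<partial>N) = 0 \<and> (\<integral>y. (cmod y)\<^sup>2 \<partial>N) = 1 \<and> (\<integral>y. (cmod y) ^ 4 \<partial>N) \<le> K"

lemma cmod_add_sq: "(cmod (a + b))\<^sup>2 = (cmod a)\<^sup>2 + 2 * Re (cnj a * b) + (cmod b)\<^sup>2"
  unfolding cmod_power2 by (simp add: power2_eq_square algebra_simps)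

lemma measurable_cnj [measurable (raw)]:
  "f \<in> borel_measurable M \<Longrightarrow> (\<lambda>x. cnj (f x)) \<in> borel_measurable M"
  by (rule measurable_compose[of f M borel]) (auto intro!: borel_measurable_continuous_onI continuous_intros)

lemma three_mult_ennreal: "3 * ennreal t = ennreal (3 * t)"
  by (subst ennreal_mult') auto

lemma cmod_sum3_sq: "(cmod (a + b + c))\<^sup>2 \<le> 3 * ((cmod a)\<^sup>2 + (cmod b)\<^sup>2 + (cmod c)\<^sup>2)"
proof -
  have "(cmod (a + b + c))\<^sup>2 \<le> (cmod a + cmod b + cmod c)\<^sup>2"
    by (intro power_mono order_trans[OF norm_triangle_ineq] add_mono norm_triangle_ineq) auto
  also have "\<dots> \<le> 3 * ((cmod a)\<^sup>2 + (cmod b)\<^sup>2 + (cmod c)\<^sup>2)"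
  proof -
    have "0 \<le> (cmod a - cmod b)\<^sup>2 + (cmod b - cmod c)\<^sup>2 + (cmod a - cmod c)\<^sup>2" by simp
    then show ?thesis by (simp add: power2_eq_square algebra_simps)
  qed
  finally show ?thesis .
qed

context
  fixes K N assumes N: "std_moments K N"
begin

interpretation N: prob_space N using N by (simp add: std_moments_def)

lemma std_moments_sets [measurable_cong]: "sets N = sets borel" using N by (simp add: std_moments_def)

lemma std_moments_integrable4: "integrable N (\<lambda>y. (cmod y) ^ 4)" using N by (simp add: std_moments_def)

lemma std_moments_integrable2: "integrable N (\<lambda>y. (cmod y)\<^sup>2)"
proof (rule Bochner_Integration.integrable_bound[OF Bochner_Integration.integrable_add[OF N.integrable_const[of 1] std_moments_integrable4]])
  show "AE x in N. norm ((cmod x)\<^sup>2) \<le> norm (1 + (cmod x) ^ 4)"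
  proof (intro AE_I2)
    fix x :: complex
    have "0 \<le> ((cmod x)\<^sup>2 - 1)\<^sup>2" by simp
    then have "2 * (cmod x)\<^sup>2 \<le> 1 + (cmod x) ^ 4" by (simp add: power2_eq_square algebra_simps eval_nat_numeral)
    then show "norm ((cmod x)\<^sup>2) \<le> norm (1 + (cmod x) ^ 4)" using zero_le_power2[of "cmod x"] unfolding real_norm_def abs_power2 by linarith
  qed
qed measurable

lemma std_moments_integrable1: "integrable N (\<lambda>y. y)"
proof (rule Bochner_Integration.integrable_bound[OF Bochner_Integration.integrable_add[OF N.integrable_const[of 1] std_moments_integrable2]])
  show "AE x in N. norm x \<le> norm (1 + (cmod x)\<^sup>2)"
  proof (intro AE_I2)
    fix x :: complex
    have "0 \<le> (cmod x - 1)\<^sup>2" by simp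
    then have "2 * cmod x \<le> 1 + (cmod x)\<^sup>2" by (simp add: power2_eq_square algebra_simps)
    then show "norm x \<le> norm (1 + (cmod x)\<^sup>2)" using norm_ge_zero[of x] unfolding real_norm_def by linarith
  qed
qed measurable

lemma std_moments_linear_step: "(\<integral>\<^sup>+y. ennreal ((cmod (X + a * y))\<^sup>2) \<partial>N) = ennreal ((cmod X)\<^sup>2 + (cmod a)\<^sup>2)"
proof -
  define r where "r = (\<lambda>y. Re (cnj X * a * y))"
  have e: "(cmod (X + a * y))\<^sup>2 = (cmod X)\<^sup>2 + 2 * r y + (cmod a)\<^sup>2 * (cmod y)\<^sup>2" for y
    unfolding r_def by (subst cmod_add_sq) (simp add: norm_mult power_mult_distrib mult.assoc)
  have i: "integrable N r" unfolding r_def using std_moments_integrable1 by (intro integrable_Re integrable_mult_right)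
  have "(\<integral>y. (cmod (X + a * y))\<^sup>2 \<partial>N) = (cmod X)\<^sup>2 + 2 * (\<integral>y. r y \<partial>N) + (cmod a)\<^sup>2 * (\<integral>y. (cmod y)\<^sup>2 \<partial>N)"
    unfolding e using i std_moments_integrable2 by (simp add: N.prob_space)
  also have "(\<integral>y. r y \<partial>N) = Re (\<integral>y. cnj X * a * y \<partial>N)" unfolding r_def using std_moments_integrable1 by (intro integral_Re) auto
  finally have "(\<integral>y. (cmod (X + a * y))\<^sup>2 \<partial>N) = (cmod X)\<^sup>2 + (cmod a)\<^sup>2" using N by (simp add: std_moments_def)
  moreover have "integrable N (\<lambda>y. (cmod (X + a * y))\<^sup>2)" unfolding e using i std_moments_integrable2 by auto
  ultimately show ?thesis by (subst nn_integral_eq_integral) auto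
qed

text \<open>The increment has mean zero, so its square adds to |X|^2 without a mixed term. Its three
  summands are separated at the price of a factor 3, because the mean of y^2 that enters their mixed
  terms is not fixed by \<open>std_moments\<close>. The first contributes E (|y|^2 - 1)^2 = E |y|^4
  - 1 <= K.\<close>

lemma std_moments_quadratic_step:
  "(\<integral>\<^sup>+y. ennreal ((cmod (X + (\<beta> * (of_real ((cmod y)\<^sup>2) - 1) + cnj y * a + b * y)))\<^sup>2) \<partial>N)
     \<le> ennreal ((cmod X)\<^sup>2 + 3 * ((cmod \<beta>)\<^sup>2 * K + (cmod a)\<^sup>2 + (cmod b)\<^sup>2))"
proof -
  define D where "D = (\<lambda>y. \<beta> * (of_real ((cmod y)\<^sup>2) - 1) + cnj y * a + b * y)"
  have i1: "integrable N (\<lambda>y. complex_of_real ((cmod y)\<^sup>2))" using std_moments_integrable2 by (rule integrable_of_real)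
  have i2: "integrable N (\<lambda>y. cnj y)" using std_moments_integrable1 by simp
  have iD: "integrable N D" unfolding D_def
    by (intro Bochner_Integration.integrable_add integrable_mult_right integrable_mult_left
      Bochner_Integration.integrable_diff i1 i2 std_moments_integrable1 N.integrable_const)
  have "(\<integral>y. D y \<partial>N) = \<beta> * ((\<integral>y. complex_of_real ((cmod y)\<^sup>2) \<partial>N) - 1) + (\<integral>y. cnj y \<partial>N) * a + b * (\<integral>y. y \<partial>N)"
    unfolding D_def using i1 i2 std_moments_integrable1 by (simp add: N.prob_space del: of_real_power)
  also have "\<dots> = 0" using N std_moments_integrable1 by (simp add: std_moments_def del: of_real_power)
  finally have ED: "(\<integral>y. D y \<partial>N) = 0" .
  define G where "G = (\<lambda>y. 3 * ((cmod \<beta>)\<^sup>2 * ((cmod y)^4 - 2 * (cmod y)\<^sup>2 + 1) + (cmod y)\<^sup>2 * (cmod a)\<^sup>2 + (cmod b)\<^sup>2 * (cmod y)\<^sup>2))"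
  have DG: "(cmod (D y))\<^sup>2 \<le> G y" for y
  proof -
    have "(cmod (complex_of_real ((cmod y)\<^sup>2) - 1))\<^sup>2 = (cmod y)^4 - 2 * (cmod y)\<^sup>2 + 1"
    proof -
      have "cmod (complex_of_real ((cmod y)\<^sup>2) - 1) = \<bar>(cmod y)\<^sup>2 - 1\<bar>"
        by (metis norm_of_real of_real_1 of_real_diff)
      then show ?thesis by (simp add: power2_diff)
    qed
    then show ?thesis unfolding D_def G_def
      using cmod_sum3_sq[of "\<beta> * (of_real ((cmod y)\<^sup>2) - 1)" "cnj y * a" "b * y"]
      by (simp add: norm_mult power_mult_distrib del: of_real_power)
  qed
  have iG: "integrable N G" unfolding G_def using std_moments_integrable4 std_moments_integrable2 by auto
  have EG: "(\<integral>y. G y \<partial>N) \<le> 3 * ((cmod \<beta>)\<^sup>2 * K + (cmod a)\<^sup>2 + (cmod b)\<^sup>2)"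
  proof -
    have "(\<integral>y. G y \<partial>N) = 3 * ((cmod \<beta>)\<^sup>2 * ((\<integral>y. (cmod y)^4 \<partial>N) - 2 * (\<integral>y. (cmod y)\<^sup>2 \<partial>N) + 1) + (\<integral>y. (cmod y)\<^sup>2 \<partial>N) * (cmod a)\<^sup>2 + (cmod b)\<^sup>2 * (\<integral>y. (cmod y)\<^sup>2 \<partial>N))"
      unfolding G_def using std_moments_integrable4 std_moments_integrable2 by (simp add: N.prob_space)
    also have "\<dots> \<le> 3 * ((cmod \<beta>)\<^sup>2 * K + (cmod a)\<^sup>2 + (cmod b)\<^sup>2)"
      using N unfolding std_moments_def by (auto intro!: mult_left_mono)
    finally show ?thesis .
  qed
  have [measurable]: "D \<in> borel_measurable N" using iD by auto
  have iD2: "integrable N (\<lambda>y. (cmod (D y))\<^sup>2)"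
    by (rule Bochner_Integration.integrable_bound[OF iG]) (auto intro!: AE_I2 order_trans[OF DG abs_ge_self])
  define r where "r = (\<lambda>y. Re (cnj X * D y))"
  have iX: "integrable N r" unfolding r_def using iD by (intro integrable_Re integrable_mult_right)
  have e: "(cmod (X + D y))\<^sup>2 = (cmod X)\<^sup>2 + 2 * r y + (cmod (D y))\<^sup>2" for y
    unfolding r_def by (rule cmod_add_sq)
  have i: "integrable N (\<lambda>y. (cmod (X + D y))\<^sup>2)" unfolding e using iD2 iX by auto
  have "(\<integral>\<^sup>+y. ennreal ((cmod (X + D y))\<^sup>2) \<partial>N) = ennreal (\<integral>y. (cmod (X + D y))\<^sup>2 \<partial>N)"
    using i by (intro nn_integral_eq_integral) auto
  also have "(\<integral>y. (cmod (X + D y))\<^sup>2 \<partial>N) = (cmod X)\<^sup>2 + 2 * (\<integral>y. r y \<partial>N) + (\<integral>y. (cmod (D y))\<^sup>2 \<partial>N)"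
    unfolding e using iD2 iX by (simp add: N.prob_space)
  also have "(\<integral>y. r y \<partial>N) = 0"
    unfolding r_def by (subst integral_Re) (use iD ED in simp_all)
  also have "(cmod X)\<^sup>2 + 2 * 0 + (\<integral>y. (cmod (D y))\<^sup>2 \<partial>N) \<le> (cmod X)\<^sup>2 + 3 * ((cmod \<beta>)\<^sup>2 * K + (cmod a)\<^sup>2 + (cmod b)\<^sup>2)"
    using order_trans[OF integral_mono[OF iD2 iG DG] EG] by simp
  finally show ?thesis unfolding D_def by (simp add: ennreal_leI)
qed

text \<open>From |y|^4 >= 2 |y|^2 - 1. It lets the linear terms of \<open>quad_form\<close> be
  absorbed into the constant 3 K.\<close>

lemma std_moments_ge_1: "1 \<le> K"
proof -
  have "2 * 1 - 1 \<le> (\<integral>y. (cmod y) ^ 4 \<partial>N)"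
  proof -
    have "(\<integral>y. 2 * (cmod y)\<^sup>2 - 1 \<partial>N) \<le> (\<integral>y. (cmod y) ^ 4 \<partial>N)"
    proof (rule integral_mono)
      fix x :: complex
      have "0 \<le> ((cmod x)\<^sup>2 - 1)\<^sup>2" by simp
      then show "2 * (cmod x)\<^sup>2 - 1 \<le> (cmod x) ^ 4" by (simp add: power2_eq_square algebra_simps eval_nat_numeral)
    qed (use std_moments_integrable2 std_moments_integrable4 in auto)
    then show ?thesis using N std_moments_integrable2 by (simp add: std_moments_def N.prob_space)
  qed
  then show ?thesis using N by (simp add: std_moments_def)
qed

end

locale std_product =
  fixes N :: "'i \<Rightarrow> complex measure" and K :: real
  assumes std: "\<And>i. std_moments K (N i)"
begin

sublocale bounded_diff N
  by (rule bounded_diff.intro) (use std in \<open>simp add: std_moments_def\<close>)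

lemma sets_N [measurable_cong]: "sets (N i) = sets borel" using std by (simp add: std_moments_def)

lemma measurable_coord [measurable]: "i \<in> I \<Longrightarrow> (\<lambda>x. x i) \<in> borel_measurable (Pi\<^sub>M I N)"
  using measurable_component_singleton[of i I N] by (simp cong: measurable_cong_sets add: sets_N)

lemma linear_form:
  assumes "finite I"
  shows "(\<integral>\<^sup>+x. ennreal ((cmod (\<Sum>j\<in>I. a j * x j))\<^sup>2) \<partial>Pi\<^sub>M I N) = ennreal (\<Sum>j\<in>I. (cmod (a j))\<^sup>2)"
  using assms
proof (induction I rule: finite_induct)
  case empty
  then show ?case by simp
next
  case (insert i I)
  interpret P: prob_space "Pi\<^sub>M I N" by (intro prob_space_PiM prob_M)
  have s: "(\<Sum>j\<in>insert i I. a j * (x(i := y)) j) = (\<Sum>j\<in>I. a j * x j) + a i * y" for x y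
    using insert.hyps by (simp add: add.commute) (intro sum.cong, auto)
  have "(\<integral>\<^sup>+x. ennreal ((cmod (\<Sum>j\<in>insert i I. a j * x j))\<^sup>2) \<partial>Pi\<^sub>M (insert i I) N)
     = (\<integral>\<^sup>+x. \<integral>\<^sup>+y. ennreal ((cmod (\<Sum>j\<in>insert i I. a j * (x(i := y)) j))\<^sup>2) \<partial>N i \<partial>Pi\<^sub>M I N)"
    by (rule product_nn_integral_insert[OF insert.hyps]) measurable
  also have "\<dots> = (\<integral>\<^sup>+x. ennreal ((cmod (\<Sum>j\<in>I. a j * x j))\<^sup>2) + ennreal ((cmod (a i))\<^sup>2) \<partial>Pi\<^sub>M I N)"
    unfolding s std_moments_linear_step[OF std] by (simp add: ennreal_plus)
  also have "\<dots> = ennreal (\<Sum>j\<in>I. (cmod (a j))\<^sup>2) + ennreal ((cmod (a i))\<^sup>2)"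
    by (subst nn_integral_add) (auto simp: insert.IH P.emeasure_space_1)
  finally show ?case using insert.hyps by (simp add: add.commute sum_nonneg flip: ennreal_plus)
qed

text \<open>A new variable changes the centred form by an increment of mean zero given the others,
  so the squares add up as for martingale differences; the linear coefficients \<open>A\<close> and
  \<open>C\<close> of the new variable are controlled by \<open>linear_form\<close>.\<close>

lemma quad_form:
  assumes "finite I"
  shows "(\<integral>\<^sup>+x. ennreal ((cmod ((\<Sum>i\<in>I. \<Sum>j\<in>I. cnj (x i) * b i j * x j) - (\<Sum>i\<in>I. b i i)))\<^sup>2) \<partial>Pi\<^sub>M I N)
     \<le> ennreal (3 * K * (\<Sum>i\<in>I. \<Sum>j\<in>I. (cmod (b i j))\<^sup>2))"
  using assms
proof (induction I rule: finite_induct)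
  case empty
  then show ?case by simp
next
  case (insert i I)
  interpret P: prob_space "Pi\<^sub>M I N" by (intro prob_space_PiM prob_M)
  have K: "1 \<le> K" using std_moments_ge_1[OF std] .
  define X where "X = (\<lambda>x. (\<Sum>i\<in>I. \<Sum>j\<in>I. cnj (x i) * b i j * x j) - (\<Sum>i\<in>I. b i i))"
  define A where "A = (\<lambda>x. \<Sum>j\<in>I. b i j * x j)"
  define C where "C = (\<lambda>x. \<Sum>j\<in>I. cnj (x j) * b j i)"
  have s: "(\<Sum>k\<in>insert i I. \<Sum>j\<in>insert i I. cnj ((x(i := y)) k) * b k j * (x(i := y)) j) - (\<Sum>k\<in>insert i I. b k k)
     = X x + (b i i * (of_real ((cmod y)\<^sup>2) - 1) + cnj y * A x + C x * y)" for x y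
  proof -
    define x' where "x' = x(i := y)"
    have x': "x' i = y" "\<And>j. j \<in> I \<Longrightarrow> x' j = x j" using insert.hyps by (auto simp: x'_def)
    have "(\<Sum>k\<in>insert i I. \<Sum>j\<in>insert i I. cnj (x' k) * b k j * x' j)
       = cnj y * b i i * y + (\<Sum>j\<in>I. cnj y * b i j * x j) + (\<Sum>k\<in>I. cnj (x k) * b k i * y) + (\<Sum>k\<in>I. \<Sum>j\<in>I. cnj (x k) * b k j * x j)"
      using insert.hyps by (simp add: x' sum.distrib algebra_simps cong: sum.cong)
    then show ?thesis using insert.hyps unfolding x'_def
      by (simp add: X_def A_def C_def sum_distrib_left sum_distrib_right algebra_simps complex_norm_square del: of_real_power)
  qed
  have IH3: "(\<integral>\<^sup>+x. ennreal ((cmod (X x))\<^sup>2) \<partial>Pi\<^sub>M I N) \<le> ennreal (3 * K * (\<Sum>i\<in>I. \<Sum>j\<in>I. (cmod (b i j))\<^sup>2))"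
    unfolding X_def by (rule insert.IH)
  have t3: "3 * ennreal t \<le> ennreal (3 * K * t)" if "t \<ge> 0" for t
    unfolding three_mult_ennreal using K that by (intro ennreal_leI mult_right_mono) auto
  have [measurable]: "X \<in> borel_measurable (Pi\<^sub>M I N)" "A \<in> borel_measurable (Pi\<^sub>M I N)" "C \<in> borel_measurable (Pi\<^sub>M I N)"
    unfolding X_def A_def C_def by measurable
  have EA: "(\<integral>\<^sup>+x. ennreal ((cmod (A x))\<^sup>2) \<partial>Pi\<^sub>M I N) = ennreal (\<Sum>j\<in>I. (cmod (b i j))\<^sup>2)"
    unfolding A_def by (rule linear_form[OF insert.hyps(1)])
  have "(cmod (C x))\<^sup>2 = (cmod (\<Sum>j\<in>I. cnj (b j i) * x j))\<^sup>2" for x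
  proof -
    have "cnj (C x) = (\<Sum>j\<in>I. cnj (b j i) * x j)" by (simp add: C_def mult.commute)
    then show ?thesis by (metis complex_mod_cnj)
  qed
  then have EC: "(\<integral>\<^sup>+x. ennreal ((cmod (C x))\<^sup>2) \<partial>Pi\<^sub>M I N) = ennreal (\<Sum>j\<in>I. (cmod (b j i))\<^sup>2)"
    by (simp add: linear_form[OF insert.hyps(1)])
  have "(\<integral>\<^sup>+x. ennreal ((cmod ((\<Sum>k\<in>insert i I. \<Sum>j\<in>insert i I. cnj (x k) * b k j * x j) - (\<Sum>k\<in>insert i I. b k k)))\<^sup>2) \<partial>Pi\<^sub>M (insert i I) N)
     = (\<integral>\<^sup>+x. \<integral>\<^sup>+y. ennreal ((cmod (X x + (b i i * (of_real ((cmod y)\<^sup>2) - 1) + cnj y * A x + C x * y)))\<^sup>2) \<partial>N i \<partial>Pi\<^sub>M I N)"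
    unfolding s[symmetric] by (rule product_nn_integral_insert[OF insert.hyps]) measurable
  also have "\<dots> \<le> (\<integral>\<^sup>+x. ennreal ((cmod (X x))\<^sup>2) + (ennreal (3 * K * (cmod (b i i))\<^sup>2) + 3 * ennreal ((cmod (A x))\<^sup>2) + 3 * ennreal ((cmod (C x))\<^sup>2)) \<partial>Pi\<^sub>M I N)"
  proof (rule nn_integral_mono)
    fix x
    show "(\<integral>\<^sup>+y. ennreal ((cmod (X x + (b i i * (of_real ((cmod y)\<^sup>2) - 1) + cnj y * A x + C x * y)))\<^sup>2) \<partial>N i)
       \<le> ennreal ((cmod (X x))\<^sup>2) + (ennreal (3 * K * (cmod (b i i))\<^sup>2) + 3 * ennreal ((cmod (A x))\<^sup>2) + 3 * ennreal ((cmod (C x))\<^sup>2))"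
    proof -
      have "ennreal ((cmod (X x))\<^sup>2) + (ennreal (3 * K * (cmod (b i i))\<^sup>2) + 3 * ennreal ((cmod (A x))\<^sup>2) + 3 * ennreal ((cmod (C x))\<^sup>2))
        = ennreal ((cmod (X x))\<^sup>2 + 3 * ((cmod (b i i))\<^sup>2 * K + (cmod (A x))\<^sup>2 + (cmod (C x))\<^sup>2))"
        unfolding three_mult_ennreal using K by (simp add: algebra_simps flip: ennreal_plus)
      then show ?thesis
        using std_moments_quadratic_step[OF std[of i], where X = "X x" and \<beta> = "b i i" and a = "A x" and b = "C x"] by (simp only:)
    qed
  qed
  also have "\<dots> = (\<integral>\<^sup>+x. ennreal ((cmod (X x))\<^sup>2) \<partial>Pi\<^sub>M I N) + (ennreal (3 * K * (cmod (b i i))\<^sup>2)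
      + 3 * ennreal (\<Sum>j\<in>I. (cmod (b i j))\<^sup>2) + 3 * ennreal (\<Sum>j\<in>I. (cmod (b j i))\<^sup>2))"
    using EA EC by (simp add: nn_integral_add nn_integral_cmult P.emeasure_space_1)
  also have "\<dots> \<le> ennreal (3 * K * (\<Sum>i\<in>I. \<Sum>j\<in>I. (cmod (b i j))\<^sup>2)) + (ennreal (3 * K * (cmod (b i i))\<^sup>2)
      + ennreal (3 * K * (\<Sum>j\<in>I. (cmod (b i j))\<^sup>2)) + ennreal (3 * K * (\<Sum>j\<in>I. (cmod (b j i))\<^sup>2)))"
    by (intro add_mono IH3 t3 order_refl sum_nonneg) auto
  also have "\<dots> = ennreal (3 * K * ((\<Sum>i\<in>I. \<Sum>j\<in>I. (cmod (b i j))\<^sup>2) + (cmod (b i i))\<^sup>2 + (\<Sum>j\<in>I. (cmod (b i j))\<^sup>2) + (\<Sum>j\<in>I. (cmod (b j i))\<^sup>2)))"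
    using K by (simp add: sum_nonneg algebra_simps flip: ennreal_plus)
  also have "(\<Sum>i\<in>I. \<Sum>j\<in>I. (cmod (b i j))\<^sup>2) + (cmod (b i i))\<^sup>2 + (\<Sum>j\<in>I. (cmod (b i j))\<^sup>2) + (\<Sum>j\<in>I. (cmod (b j i))\<^sup>2)
     = (\<Sum>k\<in>insert i I. \<Sum>j\<in>insert i I. (cmod (b k j))\<^sup>2)"
    using insert.hyps by (simp add: sum.distrib algebra_simps)
  finally show ?case .
qed

end

subsection \<open>The leave-one-out equation\<close>

definition random_fmat :: "'w measure \<Rightarrow> nat \<Rightarrow> nat \<Rightarrow> ('w \<Rightarrow> fmat) \<Rightarrow> bool" where
  "random_fmat M r c F \<longleftrightarrow> (\<forall>\<omega>. dims r c (F \<omega>)) \<and> (\<forall>i j. (\<lambda>\<omega>. ent (F \<omega>) i j) \<in> borel_measurable M)"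

lemma random_fmat_dims: "random_fmat M r c F \<Longrightarrow> dims r c (F \<omega>)" by (simp add: random_fmat_def)
lemma random_fmat_const: "dims r c A \<Longrightarrow> random_fmat M r c (\<lambda>\<omega>. A)" by (simp add: random_fmat_def)
lemma random_fmat_add: "random_fmat M r c F \<Longrightarrow> random_fmat M r c G \<Longrightarrow> random_fmat M r c (\<lambda>\<omega>. F \<omega> + G \<omega>)"
  unfolding random_fmat_def by (auto intro!: dims_add borel_measurable_add)
lemma random_fmat_diff: "random_fmat M r c F \<Longrightarrow> random_fmat M r c G \<Longrightarrow> random_fmat M r c (\<lambda>\<omega>. F \<omega> - G \<omega>)"
  unfolding random_fmat_def by (auto intro!: dims_diff borel_measurable_diff)
lemma random_fmat_sm: "random_fmat M r c F \<Longrightarrow> random_fmat M r c (\<lambda>\<omega>. sm k (F \<omega>))"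
  unfolding random_fmat_def by (auto intro!: dims_sm borel_measurable_times borel_measurable_const)
lemma random_fmat_adj: "random_fmat M r c F \<Longrightarrow> random_fmat M c r (\<lambda>\<omega>. adj (F \<omega>))"
  unfolding random_fmat_def by (auto intro!: dims_adj measurable_cnj)
lemma random_fmat_mult: assumes "random_fmat M r c F" "random_fmat M c d G" shows "random_fmat M r d (\<lambda>\<omega>. F \<omega> * G \<omega>)"
  unfolding random_fmat_def
proof (intro conjI allI)
  show "dims r d (F \<omega> * G \<omega>)" for \<omega> using assms by (meson dims_mult random_fmat_dims)
  have "ent (F \<omega> * G \<omega>) i j = (\<Sum>k<c. ent (F \<omega>) i k * ent (G \<omega>) k j)" for \<omega> i j
    by (rule ent_mult_dims[OF random_fmat_dims[OF assms(1)]])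
  then show "(\<lambda>\<omega>. ent (F \<omega> * G \<omega>) i j) \<in> borel_measurable M" for i j
    using assms by (auto simp: random_fmat_def intro!: borel_measurable_sum borel_measurable_times)
qed
lemma random_fmat_sum: "(\<And>k. k \<in> I \<Longrightarrow> random_fmat M r c (F k)) \<Longrightarrow> random_fmat M r c (\<lambda>\<omega>. \<Sum>k\<in>I. F k \<omega>)"
  unfolding random_fmat_def by (auto simp: ent_sum intro!: dims_sum borel_measurable_sum)
lemma random_fmat_tr: assumes "random_fmat M p p F" shows "(\<lambda>\<omega>. tr (F \<omega>)) \<in> borel_measurable M"
proof -
  have "tr (F \<omega>) = (\<Sum>i<p. ent (F \<omega>) i i)" for \<omega> using assms by (intro tr_dims) (simp add: random_fmat_def)
  then show ?thesis using assms by (auto simp: random_fmat_def intro!: borel_measurable_sum)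
qed
lemma random_fmat_compose: "random_fmat N r c F \<Longrightarrow> g \<in> M \<rightarrow>\<^sub>M N \<Longrightarrow> random_fmat M r c (\<lambda>\<omega>. F (g \<omega>))"
  unfolding random_fmat_def by (auto intro: measurable_compose)

lemma measurable_det:
  assumes "\<And>i j. i < n \<Longrightarrow> j < n \<Longrightarrow> (\<lambda>\<omega>. f \<omega> i j) \<in> borel_measurable M"
  shows "(\<lambda>\<omega>. Determinant.det (mat n n (\<lambda>(i, j). f \<omega> i j)) :: complex) \<in> borel_measurable M"
proof -
  have "Determinant.det (mat n n (\<lambda>(i, j). f \<omega> i j)) = (\<Sum>\<pi> | \<pi> permutes {0..<n}. signof \<pi> * (\<Prod>i = 0..<n. f \<omega> i (\<pi> i)))" for \<omega>
    unfolding Determinant.det_def by (auto intro!: sum.cong prod.cong simp: permutes_in_image[of _ "{0..<n}", simplified])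
  then show ?thesis using assms
    by (auto intro!: borel_measurable_sum borel_measurable_times borel_measurable_prod simp: permutes_in_image[of _ "{0..<n}", simplified])
qed

text \<open>Determinant and cofactors are polynomials in the entries, and division is total, so the
  quotient is measurable also across the zero set of the determinant.\<close>

lemma random_fmat_inv:
  assumes "random_fmat M p p F"
  shows "random_fmat M p p (\<lambda>\<omega>. ofmat ((1 / Determinant.det (tomat p (F \<omega>))) \<cdot>\<^sub>m adj_mat (tomat p (F \<omega>))))"
    and "(\<lambda>\<omega>. Determinant.det (tomat p (F \<omega>))) \<in> borel_measurable M"
proof -
  have e: "(\<lambda>\<omega>. ent (F \<omega>) i j) \<in> borel_measurable M" for i j using assms by (simp add: random_fmat_def)
  show D: "(\<lambda>\<omega>. Determinant.det (tomat p (F \<omega>))) \<in> borel_measurable M"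
    unfolding tomat_def by (rule measurable_det) (rule e)
  have C: "(\<lambda>\<omega>. cofactor (tomat p (F \<omega>)) i j) \<in> borel_measurable M" for i j
  proof -
    have "mat_delete (tomat p (F \<omega>)) i j = mat (p - 1) (p - 1)
      (\<lambda>(i', j'). if (if i' < i then i' else Suc i') < p \<and> (if j' < j then j' else Suc j') < p then ent (F \<omega>) (if i' < i then i' else Suc i') (if j' < j then j' else Suc j') else 0)" for \<omega>
      unfolding mat_delete_def by (rule eq_matI) (auto simp: tomat_def)
    moreover have "(\<lambda>\<omega>. if b then ent (F \<omega>) i j else 0) \<in> borel_measurable M" for b i j
      using e by (cases b) auto
    ultimately show ?thesis unfolding cofactor_def
      by (simp only:) (intro borel_measurable_times measurable_det borel_measurable_const)
  qed
  show "random_fmat M p p (\<lambda>\<omega>. ofmat ((1 / Determinant.det (tomat p (F \<omega>))) \<cdot>\<^sub>m adj_mat (tomat p (F \<omega>))))"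
    unfolding random_fmat_def
  proof (intro conjI allI)
    fix \<omega> show "dims p p (ofmat ((1 / Determinant.det (tomat p (F \<omega>))) \<cdot>\<^sub>m adj_mat (tomat p (F \<omega>))))"
      by (intro dims_ofmat smult_carrier_mat adj_mat) simp
  next
    fix i j
    have "ent (ofmat ((1 / Determinant.det (tomat p (F \<omega>))) \<cdot>\<^sub>m adj_mat (tomat p (F \<omega>)))) i j
      = (if i < p \<and> j < p then (1 / Determinant.det (tomat p (F \<omega>))) * cofactor (tomat p (F \<omega>)) j i else 0)" for \<omega>
      by (auto simp: ent_ofmat adj_mat_def)
    then show "(\<lambda>\<omega>. ent (ofmat ((1 / Determinant.det (tomat p (F \<omega>))) \<cdot>\<^sub>m adj_mat (tomat p (F \<omega>)))) i j) \<in> borel_measurable M"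
      using C D by simp
  qed
qed

lemma random_fmat_res: "random_fmat M p p F \<Longrightarrow> random_fmat M p p (\<lambda>\<omega>. res p u (F \<omega>))"
  unfolding res_def Let_def by (rule random_fmat_inv(1)) (intro random_fmat_add random_fmat_const dims_sm dims_proj)

section \<open>Algebra of removing one pair of columns\<close>

lemma norm_mult_split: "s > 0 \<Longrightarrow> cmod (a * b) \<le> s * (cmod a)\<^sup>2 + (1 / s) * (cmod b)\<^sup>2"
proof -
  assume s: "s > 0"
  have "0 \<le> (s * cmod a - cmod b)\<^sup>2 / s" using s by simp
  also have "\<dots> = s * (cmod a)\<^sup>2 + (1 / s) * (cmod b)\<^sup>2 - 2 * (cmod a * cmod b)"
    using s by (simp add: power2_eq_square field_simps)
  finally have "2 * (cmod a * cmod b) \<le> s * (cmod a)\<^sup>2 + (1 / s) * (cmod b)\<^sup>2" by simp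
  then show ?thesis using mult_nonneg_nonneg[OF norm_ge_zero[of a] norm_ge_zero[of b]]
    unfolding norm_mult by linarith
qed

text \<open>Solving the two \<open>2 \<times> 2\<close> systems for \<open>a - b\<close> up to the small coefficients.\<close>
lemma leave_one_scalar:
  fixes a a' b b' \<alpha> \<beta> \<gamma> \<delta> qxx qxy qyx qyy m t :: complex
  assumes e1: "a = qyx - \<gamma> * a + \<delta> * a'" and e2: "a' = qxx - \<alpha> * a + \<beta> * a'"
    and e3: "b' = qyy - \<gamma> * b' + \<delta> * b" and e4: "b = qxy - \<alpha> * b' + \<beta> * b" and s: "s > 0"
  shows "cmod ((1 + m\<^sup>2) * (a - b) - 2 * m * t) \<le> (1 + cmod m) *
    (s * ((cmod qyx)\<^sup>2 + (cmod qxy)\<^sup>2 + (cmod (qxx - t))\<^sup>2 + (cmod (qyy - t))\<^sup>2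
          + 2 * (cmod \<beta>)\<^sup>2 + 2 * (cmod \<gamma>)\<^sup>2 + 2 * (cmod (\<alpha> - m))\<^sup>2 + 2 * (cmod (\<delta> - m))\<^sup>2)
     + (1 / s) * (4 + 2 * (cmod a)\<^sup>2 + 2 * (cmod a')\<^sup>2 + 2 * (cmod b)\<^sup>2 + 2 * (cmod b')\<^sup>2))"
proof -
  \<comment> \<open>The residuals left when \<open>\<alpha>\<close> and \<open>\<delta>\<close> are
    replaced by \<open>m\<close>, \<open>qxx\<close> and \<open>qyy\<close> by \<open>t\<close>, and
    the other given quantities by 0.\<close>
  define f1 where "f1 = qyx - \<gamma> * a + (\<delta> - m) * a'"
  define f2 where "f2 = (qxx - t) - (\<alpha> - m) * a + \<beta> * a'"
  define f3 where "f3 = (qyy - t) - \<gamma> * b' + (\<delta> - m) * b"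
  define f4 where "f4 = qxy - (\<alpha> - m) * b' + \<beta> * b"
  have "a - m * a' = f1" "m * a + a' = t + f2" "b' - m * b = t + f3" "m * b' + b = f4"
    using e1 e2 e3 e4 by (simp_all add: f1_def f2_def f3_def f4_def algebra_simps)
  \<comment> \<open>The combination of the four equations in which \<open>a'\<close> and
    \<open>b'\<close> cancel.\<close>
  moreover have "(1 + m\<^sup>2) * (a - b) = (a - m * a') + m * (m * a + a') - (m * b' + b) + m * (b' - m * b)"
    by (simp add: power2_eq_square algebra_simps)
  ultimately have eq: "(1 + m\<^sup>2) * (a - b) - 2 * m * t = (f1 - f4) + m * (f2 + f3)"
    by (simp add: algebra_simps)
  have one: "cmod x \<le> s * (cmod x)\<^sup>2 + 1 / s" for x using norm_mult_split[OF s, of x 1] by simp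
  have tri: "cmod (x - y1 * z1 + y2 * z2) \<le> s * ((cmod x)\<^sup>2 + (cmod y1)\<^sup>2 + (cmod y2)\<^sup>2) + (1 / s) * (1 + (cmod z1)\<^sup>2 + (cmod z2)\<^sup>2)" for x y1 y2 z1 z2
  proof -
    have "cmod (x - y1 * z1 + y2 * z2) \<le> cmod x + cmod (y1 * z1) + cmod (y2 * z2)"
      by (meson add_mono norm_triangle_ineq norm_triangle_ineq4 order_refl order_trans)
    then show ?thesis using one[of x] norm_mult_split[OF s, of y1 z1] norm_mult_split[OF s, of y2 z2]
      by (simp add: algebra_simps)
  qed
  define X where "X = s * ((cmod qyx)\<^sup>2 + (cmod qxy)\<^sup>2 + (cmod (qxx - t))\<^sup>2 + (cmod (qyy - t))\<^sup>2
          + 2 * (cmod \<beta>)\<^sup>2 + 2 * (cmod \<gamma>)\<^sup>2 + 2 * (cmod (\<alpha> - m))\<^sup>2 + 2 * (cmod (\<delta> - m))\<^sup>2)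
     + (1 / s) * (4 + 2 * (cmod a)\<^sup>2 + 2 * (cmod a')\<^sup>2 + 2 * (cmod b)\<^sup>2 + 2 * (cmod b')\<^sup>2)"
  have tot: "cmod f1 + cmod f2 + cmod f3 + cmod f4 \<le> X"
    using tri[of qyx \<gamma> a "\<delta> - m" a'] tri[of "qxx - t" "\<alpha> - m" a \<beta> a'] tri[of "qyy - t" \<gamma> b' "\<delta> - m" b] tri[of qxy "\<alpha> - m" b' \<beta> b]
    unfolding X_def f1_def f2_def f3_def f4_def by (simp add: algebra_simps)
  have "cmod ((1 + m\<^sup>2) * (a - b) - 2 * m * t) \<le> (cmod f1 + cmod f4) + cmod m * (cmod f2 + cmod f3)"
  proof -
    have "cmod (m * (f2 + f3)) \<le> cmod m * (cmod f2 + cmod f3)"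
      unfolding norm_mult by (intro mult_left_mono norm_triangle_ineq) simp
    then show ?thesis unfolding eq
      using norm_triangle_ineq[of "f1 - f4" "m * (f2 + f3)"] norm_triangle_ineq4[of f1 f4] by linarith
  qed
  also have "\<dots> \<le> 1 * X + cmod m * X"
  proof (intro add_mono mult_left_mono)
    show "cmod f1 + cmod f4 \<le> 1 * X" using tot norm_ge_zero[of f2] norm_ge_zero[of f3] by linarith
    show "cmod f2 + cmod f3 \<le> X" using tot norm_ge_zero[of f1] norm_ge_zero[of f4] by linarith
  qed simp
  finally show ?thesis unfolding X_def[symmetric] by (simp add: algebra_simps)
qed

text \<open>The resolvent identity is used with \<open>Qj\<close> on the left: the scalars in front
  then contain the removed pair only outside \<open>Qj\<close>, whereas those with the full
  \<open>Q\<close> are the unknowns. With \<open>w\<close> and \<open>z\<close> among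
  \<open>x\<close> and \<open>y\<close> it yields the four equations of
  \<open>leave_one_scalar\<close>.\<close>

lemma leave_one_identity:
  fixes k :: real
  assumes S: "skew p S" and u: "Re u > 0" and x: "dims p 1 x" and y: "dims p 1 y" and A: "dims p p A"
    and w: "dims p 1 w" and z: "dims p 1 z"
  defines "Q \<equiv> res p u S" and "Qj \<equiv> res p u (S - sm (of_real k) (skew_pair x y))"
  shows "k * tr (adj w * (Q * A * z)) = k * tr (adj w * (Qj * A * z))
    - (k * tr (adj w * (Qj * x))) * (k * tr (adj y * (Q * A * z))) + (k * tr (adj w * (Qj * y))) * (k * tr (adj x * (Q * A * z)))"
proof -
  have sk: "skew p (S - sm (of_real k) (skew_pair x y))" by (intro skew_diff S skew_sm skew_skew_pair[OF x y])
  have "Qj - Q = sm (of_real k) (Qj * skew_pair x y * Q)"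
    using res_diff[OF sk S u] unfolding Q_def Qj_def by simp
  then have Q: "Q = Qj - sm (of_real k) (Qj * skew_pair x y * Q)" by (simp add: algebra_simps)
  have dQ: "dims p p Q" "dims p p Qj" unfolding Q_def Qj_def by (auto intro!: dims_res S u sk)
  have d1: "dims 1 1 (adj w * Qj * v)" if "dims p 1 v" for v
    by (meson dims_mult dims_adj w dQ that)
  have d2: "dims 1 1 (adj v * Q * A * z)" if "dims p 1 v" for v
    by (meson dims_mult dims_adj z A dQ that)
  have "adj w * Q * A * z = adj w * (Qj - sm (of_real k) (Qj * skew_pair x y * Q)) * A * z" using Q by simp
  also have "\<dots> = adj w * Qj * A * z - sm (of_real k) ((adj w * Qj * x) * (adj y * Q * A * z) - (adj w * Qj * y) * (adj x * Q * A * z))"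
    by (simp add: skew_pair_def ring_distribs mult.assoc)
  finally have "tr (adj w * Q * A * z) = tr (adj w * Qj * A * z)
     - k * (tr (adj w * Qj * x) * tr (adj y * Q * A * z) - tr (adj w * Qj * y) * tr (adj x * Q * A * z))"
    unfolding tr11_mult[OF d1[OF x] d2[OF y], symmetric] tr11_mult[OF d1[OF y] d2[OF x], symmetric]
    by simp
  moreover have "T = T' - k * (a * b - c * d) \<Longrightarrow> k * T = k * T' - (k * a) * (k * b) + (k * c) * (k * d)"
    for T T' a b c d :: complex
    by (erule ssubst) (simp add: algebra_simps)
  ultimately show ?thesis by (simp only: mult.assoc[of "adj _"] mult.assoc[of Q] mult.assoc[of Qj])
qed

lemma tr_op_bound: assumes "op_bound b B" "dims p p B" shows "cmod (tr B) \<le> b * p"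
proof -
  have "cmod (tr B) = cmod (tr (proj p * B))" using assms by (simp add: dims_projL)
  also have "\<dots> \<le> sqrt p * sqrt (nrm2 B)" using tr_CS_mult[of "proj p" B] by simp
  also have "\<dots> \<le> sqrt p * sqrt (b\<^sup>2 * p)" using nrm2_le_dims[OF assms] by (intro mult_left_mono real_sqrt_le_mono) auto
  also have "\<dots> = b * p" using op_bound_nonneg[OF assms(1)] by (simp add: real_sqrt_mult)
  finally show ?thesis .
qed

section \<open>The column model and concentration of traces\<close>

text \<open>The population matrix is frozen through its eigenbasis \<open>V\<close> and eigenvalues
  \<open>d\<close>, and \<open>C j\<close> is the law of the \<open>j\<close>-th pair of columns.
  Apart from measurability, the entries enter only through the second moment bounds for quadratic
  forms.\<close>

locale rmt =
  fixes p n :: nat and u :: complex and V :: fmat and d :: "nat \<Rightarrow> real"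
    and C :: "nat \<Rightarrow> 'b measure" and z1 z2 :: "nat \<Rightarrow> 'b \<Rightarrow> fmat" and K :: real
  assumes p: "p > 0" and n: "n > 0" and u: "Re u > 0" and V: "unitary p V" and d: "\<And>i. 0 \<le> d i"
    and prob_C: "\<And>j. prob_space (C j)" and K: "0 \<le> K"
    and z1: "\<And>j. random_fmat (C j) p 1 (z1 j)" and z2: "\<And>j. random_fmat (C j) p 1 (z2 j)"
    and q11: "\<And>j B. dims p p B \<Longrightarrow>
      (\<integral>\<^sup>+b. ennreal ((cmod (tr (adj (z1 j b) * (B * z1 j b)) - tr B))\<^sup>2) \<partial>C j) \<le> ennreal (K * nrm2 B)"
    and q22: "\<And>j B. dims p p B \<Longrightarrow>
      (\<integral>\<^sup>+b. ennreal ((cmod (tr (adj (z2 j b) * (B * z2 j b)) - tr B))\<^sup>2) \<partial>C j) \<le> ennreal (K * nrm2 B)"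
    and q12: "\<And>j B. dims p p B \<Longrightarrow>
      (\<integral>\<^sup>+b. ennreal ((cmod (tr (adj (z1 j b) * (B * z2 j b))))\<^sup>2) \<partial>C j) \<le> ennreal (K * nrm2 B)"
begin

sublocale bounded_diff C by (rule bounded_diff.intro) (rule prob_C)

definition "PC = Pi\<^sub>M {..<n} C"
definition "R = spectral_fun p V (\<lambda>i. of_real (sqrt (d i)))"
definition "Sg = spectral_fun p V (\<lambda>i. of_real (d i))"
definition "xc j w = R * z1 j (w j)"
definition "yc j w = R * z2 j (w j)"
text \<open>A product of two matrices is the sum of the rank one products of their columns, so the
  commutator splits into \<open>n\<close> terms, the \<open>j\<close>-th depending on coordinate
  \<open>j\<close> alone.\<close>

definition "S w = sm (of_real (1 / n)) (\<Sum>j<n. skew_pair (xc j w) (yc j w))"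
definition "Sm j w = sm (of_real (1 / n)) (\<Sum>k\<in>{..<n} - {j}. skew_pair (xc k w) (yc k w))"
definition "Q w = res p u (S w)"
definition "Qm j w = res p u (Sm j w)"

sublocale PC: prob_space PC unfolding PC_def by (intro prob_space_PiM prob_C)

lemma q21: "dims p p B \<Longrightarrow>
      (\<integral>\<^sup>+b. ennreal ((cmod (tr (adj (z2 j b) * (B * z1 j b))))\<^sup>2) \<partial>C j) \<le> ennreal (K * nrm2 B)"
proof -
  assume B: "dims p p B"
  have "cmod (tr (adj (z2 j b) * (B * z1 j b))) = cmod (tr (adj (z1 j b) * (adj B * z2 j b)))" for b
    by (metis adj_adj adj_mult complex_mod_cnj mult.assoc tr_adj)
  then show ?thesis using q12[OF dims_adj[OF B]] by simp
qed

lemma dims_R: "dims p p R" and dims_Sg: "dims p p Sg" unfolding R_def Sg_def by (auto intro: dims_spectral_fun V)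
lemma adj_R: "adj R = R" by (simp add: R_def spectral_fun_adj)
lemma R_R: "R * R = Sg" unfolding R_def Sg_def spectral_fun_mult[OF V] using d by (simp flip: of_real_mult)

lemma measurable_comp [measurable]: "j < n \<Longrightarrow> (\<lambda>w. w j) \<in> PC \<rightarrow>\<^sub>M C j"
  unfolding PC_def by (rule measurable_component_singleton) simp

lemma random_fmat_x: "j < n \<Longrightarrow> random_fmat PC p 1 (xc j)" and random_fmat_y: "j < n \<Longrightarrow> random_fmat PC p 1 (yc j)"
  unfolding xc_def yc_def
  by (rule random_fmat_mult[OF random_fmat_const[OF dims_R] random_fmat_compose[OF z1 measurable_comp]], assumption)
     (rule random_fmat_mult[OF random_fmat_const[OF dims_R] random_fmat_compose[OF z2 measurable_comp]], assumption)

lemma dims_x: "dims p 1 (xc j w)" and dims_y: "dims p 1 (yc j w)"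
  unfolding xc_def yc_def
  by (rule dims_mult[OF dims_R random_fmat_dims[OF z1]], rule dims_mult[OF dims_R random_fmat_dims[OF z2]])

lemma random_fmat_skew_pair: "random_fmat M a b f \<Longrightarrow> random_fmat M a b g \<Longrightarrow> random_fmat M a a (\<lambda>w. skew_pair (f w) (g w))"
  unfolding skew_pair_def by (intro random_fmat_diff random_fmat_mult random_fmat_adj) 

lemma random_fmat_S: "random_fmat PC p p S" unfolding S_def by (intro random_fmat_sm random_fmat_sum random_fmat_skew_pair[of _ _ 1] random_fmat_x random_fmat_y; blast)
lemma random_fmat_Sm: "random_fmat PC p p (Sm j)" unfolding Sm_def by (intro random_fmat_sm random_fmat_sum random_fmat_skew_pair[of _ _ 1] random_fmat_x random_fmat_y; blast)
lemma random_fmat_Q: "random_fmat PC p p Q" unfolding Q_def by (intro random_fmat_res random_fmat_S)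
lemma random_fmat_Qm: "random_fmat PC p p (Qm j)" unfolding Qm_def by (intro random_fmat_res random_fmat_Sm)
lemma skew_S: "skew p (S w)" unfolding S_def by (intro skew_sm skew_sum skew_skew_pair[of _ 1] dims_x dims_y)
lemma skew_Sm: "skew p (Sm j w)" unfolding Sm_def by (intro skew_sm skew_sum skew_skew_pair[of _ 1] dims_x dims_y)
lemma op_bound_Q: "op_bound (1 / Re u) (Q w)" unfolding Q_def by (rule op_bound_res[OF skew_S u])
lemma op_bound_Qm: "op_bound (1 / Re u) (Qm j w)" unfolding Qm_def by (rule op_bound_res[OF skew_Sm u])
lemma dims_Q: "dims p p (Q w)" by (rule random_fmat_dims[OF random_fmat_Q])
lemma dims_Qm: "dims p p (Qm j w)" by (rule random_fmat_dims[OF random_fmat_Qm])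

lemma S_Sm: "j < n \<Longrightarrow> S w = Sm j w + sm (of_real (1 / n)) (skew_pair (xc j w) (yc j w))"
  unfolding S_def Sm_def by (subst sum.remove[of _ j]) (auto simp: sm_add_right add.commute)

lemma Sm_upd: "Sm j (w(j := b)) = Sm j w"
  unfolding Sm_def xc_def yc_def by (intro arg_cong[of _ _ "sm _"] sum.cong) auto

lemma Qm_upd: "Qm j (w(j := b)) = Qm j w" unfolding Qm_def Sm_upd ..

lemma tr_Qm_Q: assumes "op_bound a A" "j < n" shows "cmod (tr (A * (Qm j w - Q w))) \<le> 2 * a / Re u"
  unfolding Q_def Qm_def S_Sm[OF assms(2)]
  by (rule rank2_ineq[OF skew_Sm u dims_x dims_y assms(1)])

text \<open>Both resolvents are compared with \<open>Qm j\<close>, which does not see coordinate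
  \<open>j\<close>; this costs the rank two bound twice.\<close>

lemma tr_Q_upd: assumes A: "op_bound a A" "j < n" shows "cmod (tr (A * Q (w(j := b))) - tr (A * Q w)) \<le> 4 * a / Re u"
proof -
  have "tr (A * Q (w(j := b))) - tr (A * Q w) = tr (A * (Qm j w - Q w)) - tr (A * (Qm j (w(j := b)) - Q (w(j := b))))"
    by (simp add: ring_distribs Qm_upd)
  also have "cmod \<dots> \<le> 2 * a / Re u + 2 * a / Re u"
    by (rule order_trans[OF norm_triangle_ineq4 add_mono[OF tr_Qm_Q[OF A] tr_Qm_Q[OF A]]])
  finally show ?thesis by simp
qed

lemma tr_AQ_bound: assumes "op_bound a A" "dims p p A" shows "cmod (tr (A * Q w)) \<le> a * p / Re u"
  using tr_op_bound[OF op_bound_mult[OF assms(1) op_bound_Q] dims_mult[OF assms(2) dims_Q]] by simp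

lemma tr_SgQ: "tr (Sg * Q w) = tr (adj R * (Q w * R))"
  unfolding R_R[symmetric] adj_R by (metis mult.assoc tr_commute)

lemma nrm2_R: "nrm2 R = (\<Sum>i<p. d i)"
  unfolding nrm2_def adj_R R_R Sg_def tr_spectral_fun[OF V] by simp

lemma tr_SgQ_bound: "cmod (tr (Sg * Q w)) \<le> (\<Sum>i<p. d i) / Re u"
  using tr_quad_op_bound[OF op_bound_Q, of R w R] by (simp add: tr_SgQ nrm2_R sum_nonneg d)

lemma Re_tr_SgQ: "0 \<le> Re (tr (Sg * Q w))"
  using Re_quad_res(1)[OF skew_S u dims_projL[OF dims_R], of w] u unfolding tr_SgQ by (simp add: Q_def)

lemma measurable_trAQ: "dims p p A \<Longrightarrow> (\<lambda>w. tr (A * Q w)) \<in> borel_measurable PC"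
  by (intro random_fmat_tr[of _ p] random_fmat_mult[of _ p p _ p] random_fmat_const random_fmat_Q)

lemma integrable_trAQ: assumes "op_bound a A" "dims p p A" shows "integrable PC (\<lambda>w. tr (A * Q w))"
  using tr_AQ_bound[OF assms] by (intro PC.integrable_const_bound[of _ "a * p / Re u"] measurable_trAQ assms) auto

text \<open>Each of the \<open>n\<close> coordinates moves the trace by at most 4 a / Re u, so a
  quantity of order \<open>p\<close> fluctuates only at order sqrt n.\<close>

lemma concentration_trAQ:
  assumes A: "op_bound a A" "dims p p A" and a: "a > 0"
  defines "f \<equiv> \<lambda>w. tr (A * Q w)" and "v \<equiv> real n * (4 * a / Re u)\<^sup>2"
  shows "PC.expectation (\<lambda>w. (cmod (f w - PC.expectation f))\<^sup>2) \<le> 4 * v"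
    and "e > 0 \<Longrightarrow> PC.prob {w \<in> space PC. cmod (f w - PC.expectation f) \<ge> e} \<le> 4 * exp (- e\<^sup>2 / (8 * v))"
proof -
  have v: "(\<Sum>j\<in>{..<n}. (4 * a / Re u)\<^sup>2) \<le> v" "v > 0" using n a u by (auto simp: v_def)
  have f: "f \<in> borel_measurable (Pi\<^sub>M {..<n} C)" unfolding f_def PC_def[symmetric] by (rule measurable_trAQ[OF A(2)])
  note b = tr_AQ_bound[OF A, folded f_def] 
  have du: "cmod (f (x(i := y)) - f x) \<le> 4 * a / Re u" if "i \<in> {..<n}" for i x y
    unfolding f_def using that by (intro tr_Q_upd A) auto
  show "PC.expectation (\<lambda>w. (cmod (f w - PC.expectation f))\<^sup>2) \<le> 4 * v"
    unfolding PC_def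
    by (rule variance_bounded_diff_cmplx[where B = "a * p / Re u" and c = "\<lambda>_. 4 * a / Re u", OF _ f _ _ v])
       (use tr_AQ_bound[OF A] du in \<open>auto simp: f_def\<close>)
  show "PC.prob {w \<in> space PC. cmod (f w - PC.expectation f) \<ge> e} \<le> 4 * exp (- e\<^sup>2 / (8 * v))" if "e > 0"
    unfolding PC_def
    by (rule tail_bounded_diff_cmplx[where B = "a * p / Re u" and c = "\<lambda>_. 4 * a / Re u", OF _ f _ _ v that])
       (use tr_AQ_bound[OF A] du in \<open>auto simp: f_def\<close>)
qed

text \<open>A bound on a mean, packed with measurability and signs and stated for the non-negative
  integral, so that sums of error terms can be estimated without integrability side
  conditions.\<close>

definition "expect_le f c \<longleftrightarrow> f \<in> borel_measurable PC \<and> (\<forall>w. 0 \<le> f w) \<and> 0 \<le> c \<and> (\<integral>\<^sup>+w. ennreal (f w) \<partial>PC) \<le> ennreal c"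

lemma expect_le_add: assumes "expect_le f a" "expect_le g b" shows "expect_le (\<lambda>w. f w + g w) (a + b)"
proof -
  have [measurable]: "f \<in> borel_measurable PC" "g \<in> borel_measurable PC" using assms by (auto simp: expect_le_def)
  have "(\<integral>\<^sup>+w. ennreal (f w + g w) \<partial>PC) = (\<integral>\<^sup>+w. ennreal (f w) \<partial>PC) + (\<integral>\<^sup>+w. ennreal (g w) \<partial>PC)"
    using assms by (subst nn_integral_add[symmetric]) (auto simp: expect_le_def ennreal_plus intro!: nn_integral_cong)
  also have "\<dots> \<le> ennreal a + ennreal b" using assms by (intro add_mono) (auto simp: expect_le_def)
  finally show ?thesis using assms by (auto simp: expect_le_def ennreal_plus)
qed
lemma expect_le_cmult: assumes "expect_le f a" "0 \<le> k" shows "expect_le (\<lambda>w. k * f w) (k * a)"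
proof -
  have [measurable]: "f \<in> borel_measurable PC" using assms by (auto simp: expect_le_def)
  have "(\<integral>\<^sup>+w. ennreal (k * f w) \<partial>PC) = ennreal k * (\<integral>\<^sup>+w. ennreal (f w) \<partial>PC)"
    using assms by (subst nn_integral_cmult[symmetric]) (auto simp: expect_le_def ennreal_mult intro!: nn_integral_cong)
  also have "\<dots> \<le> ennreal k * ennreal a" using assms by (intro mult_left_mono) (auto simp: expect_le_def)
  finally show ?thesis using assms by (auto simp: expect_le_def ennreal_mult)
qed
lemma expect_le_const: "0 \<le> k \<Longrightarrow> expect_le (\<lambda>w. k) k" by (auto simp: expect_le_def PC.emeasure_space_1)
lemma expect_le_mono: assumes "expect_le g b" "f \<in> borel_measurable PC" "\<And>w. 0 \<le> f w" "\<And>w. f w \<le> g w" "b \<le> c"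
  shows "expect_le f c"
proof -
  have "(\<integral>\<^sup>+w. ennreal (f w) \<partial>PC) \<le> (\<integral>\<^sup>+w. ennreal (g w) \<partial>PC)" using assms by (intro nn_integral_mono ennreal_leI) auto
  also have "\<dots> \<le> ennreal b" using assms by (auto simp: expect_le_def)
  also have "\<dots> \<le> ennreal c" using assms by (intro ennreal_leI) auto
  finally show ?thesis using assms by (auto simp: expect_le_def)
qed
lemma expect_le_le: "expect_le f b \<Longrightarrow> b \<le> c \<Longrightarrow> expect_le f c"
  by (rule expect_le_mono[of f b f c]) (auto simp: expect_le_def)
lemma expect_le_sum: "finite I \<Longrightarrow> (\<And>i. i \<in> I \<Longrightarrow> expect_le (f i) (a i)) \<Longrightarrow> expect_le (\<lambda>w. \<Sum>i\<in>I. f i w) (\<Sum>i\<in>I. a i)"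
proof (induction I rule: finite_induct)
  case empty then show ?case using expect_le_const[of 0] by simp
next
  case (insert i I) then show ?case using expect_le_add[of "f i" "a i"] by simp
qed
lemma expect_le_expectation:
  assumes "expect_le (\<lambda>w. cmod (f w)) c" "integrable PC f" shows "cmod (PC.expectation f) \<le> c"
proof -
  have "ennreal (PC.expectation (\<lambda>w. cmod (f w))) = (\<integral>\<^sup>+w. ennreal (cmod (f w)) \<partial>PC)"
    using assms by (intro nn_integral_eq_integral[symmetric]) auto
  also have "\<dots> \<le> ennreal c" using assms by (auto simp: expect_le_def)
  finally have "PC.expectation (\<lambda>w. cmod (f w)) \<le> c" using assms by (subst (asm) ennreal_le_iff) (auto simp: expect_le_def)
  then show ?thesis using integral_norm_bound[of PC f] by linarith
qed

text \<open>Fubini in coordinate \<open>j\<close>: as \<open>B\<close> ignores it,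
  \<open>B w\<close> is constant for the inner integral and the hypothesis for fixed matrices
  applies.\<close>

lemma fiber:
  assumes j: "j < n" and F: "\<And>B. dims p p B \<Longrightarrow> (\<integral>\<^sup>+b. ennreal (F B b) \<partial>C j) \<le> ennreal (K * nrm2 B)"
    and F0: "\<And>B b. 0 \<le> F B b"
    and m: "(\<lambda>w. F (B w) (w j)) \<in> borel_measurable PC"
    and upd: "\<And>w b. B (w(j := b)) = B w" and B: "\<And>w. dims p p (B w)" and \<beta>: "\<And>w. nrm2 (B w) \<le> \<beta>"
  shows "expect_le (\<lambda>w. F (B w) (w j)) (K * \<beta>)"
proof -
  have ins: "insert j ({..<n} - {j}) = {..<n}" using j by auto
  interpret P: prob_space "Pi\<^sub>M ({..<n} - {j}) C" by (intro prob_space_PiM prob_C)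
  have "0 \<le> \<beta>" using \<beta> nrm2_nonneg order_trans by blast
  have "(\<integral>\<^sup>+w. ennreal (F (B w) (w j)) \<partial>PC)
     = (\<integral>\<^sup>+w. \<integral>\<^sup>+b. ennreal (F (B (w(j := b))) ((w(j := b)) j)) \<partial>C j \<partial>Pi\<^sub>M ({..<n} - {j}) C)"
    unfolding PC_def using product_nn_integral_insert[of "{..<n} - {j}" j, unfolded ins, of "\<lambda>w. ennreal (F (B w) (w j))"] m
    by (simp add: PC_def)
  also have "\<dots> \<le> (\<integral>\<^sup>+w. ennreal (K * \<beta>) \<partial>Pi\<^sub>M ({..<n} - {j}) C)"
    
  proof (rule nn_integral_mono)
    fix w
    have "(\<integral>\<^sup>+b. ennreal (F (B w) b) \<partial>C j) \<le> ennreal (K * nrm2 (B w))" by (rule F[OF B])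
    also have "\<dots> \<le> ennreal (K * \<beta>)" using K \<beta> by (intro ennreal_leI mult_left_mono)
    finally show "(\<integral>\<^sup>+b. ennreal (F (B (w(j := b))) ((w(j := b)) j)) \<partial>C j) \<le> ennreal (K * \<beta>)"
      by (simp add: upd)
  qed
  also have "\<dots> = ennreal (K * \<beta>)" by (simp add: P.emeasure_space_1)
  finally show ?thesis using m F0 K \<open>0 \<le> \<beta>\<close> by (auto simp: expect_le_def)
qed

end

lemma power2_add_le: "(a + b)\<^sup>2 \<le> 2 * a\<^sup>2 + 2 * b\<^sup>2" for a b :: real
proof -
  have "0 \<le> (a - b)\<^sup>2" by simp
  then show ?thesis by (simp add: power2_eq_square algebra_simps)
qed

lemma cmod_diff_sq_le: "(cmod (a - c))\<^sup>2 \<le> 2 * (cmod (a - b))\<^sup>2 + 2 * (cmod (b - c))\<^sup>2"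
proof -
  have "cmod (a - c) \<le> cmod (a - b) + cmod (b - c)" using norm_triangle_ineq[of "a - b" "b - c"] by simp
  then have "(cmod (a - c))\<^sup>2 \<le> (cmod (a - b) + cmod (b - c))\<^sup>2" by (rule power_mono) simp
  then show ?thesis using power2_add_le[of "cmod (a - b)" "cmod (b - c)"] by linarith
qed

section \<open>Quadratic forms of one pair of columns\<close>

context rmt
begin

text \<open>The matrix seen by the raw columns: forms in \<open>xc j\<close> and \<open>yc j\<close>
  with \<open>Qm j\<close> become forms in \<open>z1 j\<close> and \<open>z2 j\<close> with
  \<open>Bq\<close>, because \<open>R\<close> is self-adjoint.\<close>

definition "Bq B j w = sm (of_real (1 / n)) (R * Qm j w * B * R)"
definition "qQ B j f g w = tr (adj (f j w) * (Q w * B * g j w)) / n"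

text \<open>The common scale of all error terms.\<close>
definition "W \<tau> = \<tau>\<^sup>2 / (Re u)\<^sup>2 * (K + 1) * (1 + p / n)\<^sup>2"

definition "qf f g j B w = tr (adj (f j w) * (Qm j w * B * g j w)) / n"
definition "tt B w = tr (B * Sg * Q w) / n"
definition "tm j B w = tr (B * Sg * Qm j w) / n"

context
  fixes \<tau> \<kappa> :: real and B :: fmat and j :: nat
  assumes \<tau>: "\<And>i. i < p \<Longrightarrow> d i \<le> \<tau>" "0 < \<tau>" and B: "op_bound \<kappa> B" "dims p p B" and j: "j < n"
begin

lemma op_bound_R: "op_bound (sqrt \<tau>) R" unfolding R_def using \<tau> d by (intro op_bound_spectral_fun[OF V]) auto
lemma op_bound_Sg: "op_bound \<tau> Sg" unfolding Sg_def using \<tau> d by (intro op_bound_spectral_fun[OF V]) auto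


lemma dims_Bq: "dims p p (Bq B j w)"
  unfolding Bq_def by (intro dims_sm) (meson dims_mult dims_R dims_Qm B)
lemma random_fmat_Bq: "random_fmat PC p p (Bq B j)"
  unfolding Bq_def by (intro random_fmat_sm random_fmat_mult[of _ p p _ p] random_fmat_const random_fmat_Qm dims_R B)
lemma Bq_upd: "Bq B j (w(j := b)) = Bq B j w" unfolding Bq_def Qm_upd ..
text \<open>An operator norm of order 1 / n in dimension \<open>p\<close> makes the squared
  Frobenius norm of order 1 / n for bounded p / n. This is the size of the variance of all forms
  below.\<close>

lemma nrm2_Bq: "nrm2 (Bq B j w) \<le> (\<tau> * \<kappa> / (Re u * n))\<^sup>2 * p"
proof -
  have "op_bound (1 / n * (sqrt \<tau> * (1 / Re u) * \<kappa> * sqrt \<tau>)) (Bq B j w)"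
    using op_bound_sm[OF op_bound_mult[OF op_bound_mult[OF op_bound_mult[OF op_bound_R op_bound_Qm[of j w]] B(1)] op_bound_R], of "of_real (1 / n)"]
    by (simp add: Bq_def norm_divide)
  from nrm2_le_dims[OF this dims_Bq] show ?thesis
    using \<tau>(2) by (simp add: power_mult_distrib power_divide real_sqrt_pow2 algebra_simps power4_eq_xxxx power2_eq_square)
qed

lemma qf_eq: "qf xc xc j B w = tr (adj (z1 j (w j)) * (Bq B j w * z1 j (w j)))"
  "qf yc yc j B w = tr (adj (z2 j (w j)) * (Bq B j w * z2 j (w j)))"
  "qf xc yc j B w = tr (adj (z1 j (w j)) * (Bq B j w * z2 j (w j)))"
  "qf yc xc j B w = tr (adj (z2 j (w j)) * (Bq B j w * z1 j (w j)))"
  by (simp_all add: qf_def xc_def yc_def Bq_def adj_R mult.assoc)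

lemma tr_Bq: "tr (Bq B j w) = tm j B w"
proof -
  have "tr (R * Qm j w * B * R) = tr (B * (R * R) * Qm j w)"
    by (metis mult.assoc tr_commute)
  then show ?thesis by (simp add: Bq_def tm_def R_R)
qed

lemma random_fmat_z: "random_fmat PC p 1 (\<lambda>w. z1 j (w j))" "random_fmat PC p 1 (\<lambda>w. z2 j (w j))"
  by (rule random_fmat_compose[OF z1 measurable_comp[OF j]], rule random_fmat_compose[OF z2 measurable_comp[OF j]])

lemma meas_quad: "random_fmat PC p 1 f \<Longrightarrow> random_fmat PC p 1 g \<Longrightarrow> (\<lambda>w. tr (adj (f w) * (Bq B j w * g w))) \<in> borel_measurable PC"
  by (intro random_fmat_tr[of _ 1] random_fmat_mult[of _ 1 p _ 1] random_fmat_mult[of _ p p _ 1] random_fmat_adj random_fmat_Bq)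

lemma meas_tt: "tt B \<in> borel_measurable PC"
  unfolding tt_def by (intro borel_measurable_divide measurable_trAQ dims_mult[OF B(2) dims_Sg]) simp

lemma expect_le_quad:
  "expect_le (\<lambda>w. (cmod (qf xc xc j B w - tm j B w))\<^sup>2) (K * ((\<tau> * \<kappa> / (Re u * n))\<^sup>2 * p))"
  "expect_le (\<lambda>w. (cmod (qf yc yc j B w - tm j B w))\<^sup>2) (K * ((\<tau> * \<kappa> / (Re u * n))\<^sup>2 * p))"
  "expect_le (\<lambda>w. (cmod (qf xc yc j B w))\<^sup>2) (K * ((\<tau> * \<kappa> / (Re u * n))\<^sup>2 * p))"
  "expect_le (\<lambda>w. (cmod (qf yc xc j B w))\<^sup>2) (K * ((\<tau> * \<kappa> / (Re u * n))\<^sup>2 * p))"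
proof -
  note m = meas_quad[OF random_fmat_z(1) random_fmat_z(1)] meas_quad[OF random_fmat_z(2) random_fmat_z(2)] meas_quad[OF random_fmat_z(1) random_fmat_z(2)] meas_quad[OF random_fmat_z(2) random_fmat_z(1)]
  note mt = random_fmat_tr[OF random_fmat_Bq]
  note f = fiber[OF j _ _ _ Bq_upd dims_Bq nrm2_Bq]
  show "expect_le (\<lambda>w. (cmod (qf xc xc j B w - tm j B w))\<^sup>2) (K * ((\<tau> * \<kappa> / (Re u * n))\<^sup>2 * p))"
    unfolding qf_eq tr_Bq[symmetric]
    by (rule f[of "\<lambda>B b. (cmod (tr (adj (z1 j b) * (B * z1 j b)) - tr B))\<^sup>2"]) (use q11 m mt in auto)
  show "expect_le (\<lambda>w. (cmod (qf yc yc j B w - tm j B w))\<^sup>2) (K * ((\<tau> * \<kappa> / (Re u * n))\<^sup>2 * p))"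
    unfolding qf_eq tr_Bq[symmetric]
    by (rule f[of "\<lambda>B b. (cmod (tr (adj (z2 j b) * (B * z2 j b)) - tr B))\<^sup>2"]) (use q22 m mt in auto)
  show "expect_le (\<lambda>w. (cmod (qf xc yc j B w))\<^sup>2) (K * ((\<tau> * \<kappa> / (Re u * n))\<^sup>2 * p))"
    unfolding qf_eq
    by (rule f[of "\<lambda>B b. (cmod (tr (adj (z1 j b) * (B * z2 j b))))\<^sup>2"]) (use q12 m mt in auto)
  show "expect_le (\<lambda>w. (cmod (qf yc xc j B w))\<^sup>2) (K * ((\<tau> * \<kappa> / (Re u * n))\<^sup>2 * p))"
    unfolding qf_eq
    by (rule f[of "\<lambda>B b. (cmod (tr (adj (z2 j b) * (B * z1 j b))))\<^sup>2"]) (use q21 m mt in auto)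
qed

lemma tm_tt: "cmod (tm j B w - tt B w) \<le> 2 * (\<kappa> * \<tau>) / (Re u * n)"
proof -
  have "tm j B w - tt B w = tr (B * Sg * (Qm j w - Q w)) / n"
    by (simp add: tm_def tt_def ring_distribs diff_divide_distrib)
  also have "cmod \<dots> \<le> (2 * (\<kappa> * \<tau>) / Re u) / n"
    unfolding norm_divide norm_of_nat by (intro divide_right_mono tr_Qm_Q[OF op_bound_mult[OF B(1) op_bound_Sg] j]) simp
  finally show ?thesis by simp
qed


lemma W_pos: "0 < W \<tau>" 
proof -
  have "0 < 1 + real p / n" by (simp add: add_pos_nonneg)
  then show ?thesis unfolding W_def using \<tau>(2) u K by (intro mult_pos_pos divide_pos_pos zero_less_power) auto
qed

lemma Kp_le_W: "K * ((\<tau> * \<kappa> / (Re u * n))\<^sup>2 * p) \<le> \<kappa>\<^sup>2 * W \<tau> / n"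
proof -
  have "K * (p / n) \<le> (K + 1) * (1 + p / n)\<^sup>2"
  proof (rule mult_mono)
    have "0 \<le> real p / n" by simp
    then have "p / n \<le> (1 + p / n) * 1" "(1 + p / n) * 1 \<le> (1 + p / n) * (1 + p / n)" by (simp, intro mult_left_mono) auto
    then show "p / n \<le> (1 + p / n)\<^sup>2" by (simp add: power2_eq_square)
  qed (use K in auto)
  then have "(\<kappa>\<^sup>2 * (\<tau>\<^sup>2 / (Re u)\<^sup>2) / n) * (K * (p / n)) \<le> (\<kappa>\<^sup>2 * (\<tau>\<^sup>2 / (Re u)\<^sup>2) / n) * ((K + 1) * (1 + p / n)\<^sup>2)"
    by (intro mult_left_mono) auto
  moreover have "K * ((\<tau> * \<kappa> / (Re u * n))\<^sup>2 * p) = (\<kappa>\<^sup>2 * (\<tau>\<^sup>2 / (Re u)\<^sup>2) / n) * (K * (p / n))"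
    by (simp add: power_mult_distrib power_divide power2_eq_square mult_ac)
  moreover have "\<kappa>\<^sup>2 * W \<tau> / n = (\<kappa>\<^sup>2 * (\<tau>\<^sup>2 / (Re u)\<^sup>2) / n) * ((K + 1) * (1 + p / n)\<^sup>2)"
    by (simp add: W_def)
  ultimately show ?thesis by simp
qed

lemma base_le_W: "\<tau>\<^sup>2 / (Re u)\<^sup>2 \<le> W \<tau>"
proof -
  have "1 * 1 \<le> (K + 1) * (1 + p / n)\<^sup>2" using K by (intro mult_mono) (auto intro!: one_le_power)
  then have "\<tau>\<^sup>2 / (Re u)\<^sup>2 * 1 \<le> \<tau>\<^sup>2 / (Re u)\<^sup>2 * ((K + 1) * (1 + p / n)\<^sup>2)"
    by (intro mult_left_mono) auto
  then show ?thesis by (simp add: W_def mult.assoc)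
qed

lemma tm_tt_sq: "(cmod (tm j B w - tt B w))\<^sup>2 \<le> 4 * \<kappa>\<^sup>2 * W \<tau> / n"
proof -
  have "(cmod (tm j B w - tt B w))\<^sup>2 \<le> (2 * (\<kappa> * \<tau>) / (Re u * n))\<^sup>2"
    using tm_tt by (intro power_mono) auto
  also have "\<dots> = 4 * \<kappa>\<^sup>2 * (\<tau>\<^sup>2 / (Re u)\<^sup>2) * (1 / (real n)\<^sup>2)"
    by (simp add: power_mult_distrib power_divide)
  also have "\<dots> \<le> 4 * \<kappa>\<^sup>2 * W \<tau> * (1 / n)"
  proof (intro mult_mono base_le_W)
    show "1 / (real n)\<^sup>2 \<le> 1 / n" using n by (simp add: power2_eq_square frac_le)
  qed (use W_pos in auto)
  finally show ?thesis by simp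
qed

text \<open>The diagonal forms concentrate at the trace with \<open>Qm j\<close>; the passage to the
  trace with \<open>Q\<close>, which does not depend on \<open>j\<close>, costs the rank two bound.
  The constant is 10 = 2 + 2 * 4.\<close>

lemma expect_le_quad_W:
  "expect_le (\<lambda>w. (cmod (qf xc xc j B w - tt B w))\<^sup>2) (10 * \<kappa>\<^sup>2 * W \<tau> / n)"
  "expect_le (\<lambda>w. (cmod (qf yc yc j B w - tt B w))\<^sup>2) (10 * \<kappa>\<^sup>2 * W \<tau> / n)"
  "expect_le (\<lambda>w. (cmod (qf xc yc j B w))\<^sup>2) (\<kappa>\<^sup>2 * W \<tau> / n)"
  "expect_le (\<lambda>w. (cmod (qf yc xc j B w))\<^sup>2) (\<kappa>\<^sup>2 * W \<tau> / n)"
proof -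
  have g: "expect_le (\<lambda>w. (cmod (q w - tt B w))\<^sup>2) (10 * \<kappa>\<^sup>2 * W \<tau> / n)"
    if q: "expect_le (\<lambda>w. (cmod (q w - tm j B w))\<^sup>2) (K * ((\<tau> * \<kappa> / (Re u * n))\<^sup>2 * p))"
      and m: "q \<in> borel_measurable PC" for q
  proof (rule expect_le_mono[OF expect_le_add[OF expect_le_cmult[OF expect_le_le[OF q Kp_le_W], of 2] expect_le_const[of "2 * (4 * \<kappa>\<^sup>2 * W \<tau> / n)"]]])
    show "(cmod (q w - tt B w))\<^sup>2 \<le> 2 * (cmod (q w - tm j B w))\<^sup>2 + 2 * (4 * \<kappa>\<^sup>2 * W \<tau> / n)" for w
      using cmod_diff_sq_le[of "q w" "tt B w" "tm j B w"] tm_tt_sq[of w] by linarith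
  qed (use m meas_tt W_pos in auto)
  show "expect_le (\<lambda>w. (cmod (qf xc xc j B w - tt B w))\<^sup>2) (10 * \<kappa>\<^sup>2 * W \<tau> / n)"
    by (rule g[OF expect_le_quad(1)]) (unfold qf_eq, rule meas_quad[OF random_fmat_z(1) random_fmat_z(1)])
  show "expect_le (\<lambda>w. (cmod (qf yc yc j B w - tt B w))\<^sup>2) (10 * \<kappa>\<^sup>2 * W \<tau> / n)"
    by (rule g[OF expect_le_quad(2)]) (unfold qf_eq, rule meas_quad[OF random_fmat_z(2) random_fmat_z(2)])
  show "expect_le (\<lambda>w. (cmod (qf xc yc j B w))\<^sup>2) (\<kappa>\<^sup>2 * W \<tau> / n)" by (rule expect_le_le[OF expect_le_quad(3) Kp_le_W])
  show "expect_le (\<lambda>w. (cmod (qf yc xc j B w))\<^sup>2) (\<kappa>\<^sup>2 * W \<tau> / n)" by (rule expect_le_le[OF expect_le_quad(4) Kp_le_W])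
qed

lemma nrm2_x: "nrm2 (xc j w) = Re (tr (adj (z1 j (w j)) * (Sg * z1 j (w j))))"
  "nrm2 (yc j w) = Re (tr (adj (z2 j (w j)) * (Sg * z2 j (w j))))"
  unfolding nrm2_def xc_def yc_def R_R[symmetric] by (simp_all add: adj_R mult.assoc)

text \<open>The squared length is a quadratic form in \<open>Sg\<close>: its centre, the trace of
  \<open>Sg\<close>, is at most \<tau> p and its variance at most K \<tau>^2 p, so its second moment
  is of order p^2.\<close>

lemma expect_le_nrm2: "expect_le (\<lambda>w. (nrm2 (xc j w))\<^sup>2) (2 * (K + 1) * \<tau>\<^sup>2 * (real p)\<^sup>2)"
  "expect_le (\<lambda>w. (nrm2 (yc j w))\<^sup>2) (2 * (K + 1) * \<tau>\<^sup>2 * (real p)\<^sup>2)"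
proof -
  have trSg: "cmod (tr Sg) \<le> \<tau> * p" by (rule tr_op_bound[OF op_bound_Sg dims_Sg])
  have nSg: "nrm2 Sg \<le> \<tau>\<^sup>2 * p" by (rule nrm2_le_dims[OF op_bound_Sg dims_Sg])
  have c: "2 * (K * (\<tau>\<^sup>2 * real p)) + 2 * (\<tau> * real p)\<^sup>2 \<le> 2 * (K + 1) * \<tau>\<^sup>2 * (real p)\<^sup>2"
  proof -
    have "real p * 1 \<le> real p * real p" using p by (intro mult_left_mono) auto
    then have "(2 * K * \<tau>\<^sup>2) * real p \<le> (2 * K * \<tau>\<^sup>2) * (real p * real p)" using K by (intro mult_left_mono) auto
    then show ?thesis by (simp add: power2_eq_square algebra_simps)
  qed
  have pw: "(Re t)\<^sup>2 \<le> 2 * (cmod (t - tr Sg))\<^sup>2 + 2 * (\<tau> * p)\<^sup>2" for t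
  proof -
    have "(Re t)\<^sup>2 \<le> (cmod t)\<^sup>2" by (simp add: cmod_power2)
    also have "\<dots> \<le> 2 * (cmod (t - tr Sg))\<^sup>2 + 2 * (cmod (tr Sg))\<^sup>2"
      using cmod_diff_sq_le[of t 0 "tr Sg"] by simp
    also have "(cmod (tr Sg))\<^sup>2 \<le> (\<tau> * p)\<^sup>2" using trSg by (intro power_mono) auto
    finally show ?thesis by simp
  qed
  have m: "(\<lambda>w. tr (adj (f w) * (Sg * f w))) \<in> borel_measurable PC" if "random_fmat PC p 1 f" for f
    using that by (intro random_fmat_tr[of _ 1] random_fmat_mult[of _ 1 p _ 1] random_fmat_mult[of _ p p _ 1] random_fmat_adj random_fmat_const dims_Sg)
  note f = fiber[OF j _ _ _ refl dims_Sg nSg]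
  have g: "expect_le (\<lambda>w. (Re (t w))\<^sup>2) (2 * (K + 1) * \<tau>\<^sup>2 * (real p)\<^sup>2)"
    if t: "expect_le (\<lambda>w. (cmod (t w - tr Sg))\<^sup>2) (K * (\<tau>\<^sup>2 * p))" "t \<in> borel_measurable PC" for t
  proof (rule expect_le_mono[OF expect_le_add[OF expect_le_cmult[OF t(1), of 2] expect_le_const[of "2 * (\<tau> * real p)\<^sup>2"]]])
    show "(\<lambda>w. (Re (t w))\<^sup>2) \<in> borel_measurable PC" using t(2) by measurable
  qed (use pw c in simp_all)
  have "expect_le (\<lambda>w. (cmod (tr (adj (z1 j (w j)) * (Sg * z1 j (w j))) - tr Sg))\<^sup>2) (K * (\<tau>\<^sup>2 * p))"
    by (rule f[of "\<lambda>B b. (cmod (tr (adj (z1 j b) * (B * z1 j b)) - tr B))\<^sup>2"]) (use q11 m[OF random_fmat_z(1)] in auto)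
  then show "expect_le (\<lambda>w. (nrm2 (xc j w))\<^sup>2) (2 * (K + 1) * \<tau>\<^sup>2 * (real p)\<^sup>2)"
    unfolding nrm2_x by (rule g[OF _ m[OF random_fmat_z(1)]])
  have "expect_le (\<lambda>w. (cmod (tr (adj (z2 j (w j)) * (Sg * z2 j (w j))) - tr Sg))\<^sup>2) (K * (\<tau>\<^sup>2 * p))"
    by (rule f[of "\<lambda>B b. (cmod (tr (adj (z2 j b) * (B * z2 j b)) - tr B))\<^sup>2"]) (use q22 m[OF random_fmat_z(2)] in auto)
  then show "expect_le (\<lambda>w. (nrm2 (yc j w))\<^sup>2) (2 * (K + 1) * \<tau>\<^sup>2 * (real p)\<^sup>2)"
    unfolding nrm2_x by (rule g[OF _ m[OF random_fmat_z(2)]])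
qed


text \<open>Forms with the full \<open>Q\<close> are not independent of the columns, so only the
  operator norm and the column lengths are available. A bound of order 1 suffices, since these forms
  get multiplied by small coefficients.\<close>

lemma expect_le_big:
  assumes f: "f \<in> {xc, yc}" and g: "g \<in> {xc, yc}"
  shows "expect_le (\<lambda>w. (cmod (qQ B j f g w))\<^sup>2) (2 * \<kappa>\<^sup>2 * W \<tau>)"
proof -
  have fg: "expect_le (\<lambda>w. (nrm2 (f j w))\<^sup>2) (2 * (K + 1) * \<tau>\<^sup>2 * (real p)\<^sup>2)"
    "expect_le (\<lambda>w. (nrm2 (g j w))\<^sup>2) (2 * (K + 1) * \<tau>\<^sup>2 * (real p)\<^sup>2)" "random_fmat PC p 1 (f j)" "random_fmat PC p 1 (g j)"
    using expect_le_nrm2 f g random_fmat_x[OF j] random_fmat_y[OF j] by auto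
  define c where "c = (\<kappa> / (Re u * n))\<^sup>2"
  define k where "k = c / 2"
  have k: "0 \<le> k" by (simp add: k_def c_def)
  show ?thesis
  proof (rule expect_le_mono[OF expect_le_add[OF expect_le_cmult[OF fg(1) k] expect_le_cmult[OF fg(2) k]]])
    show "(\<lambda>w. (cmod (qQ B j f g w))\<^sup>2) \<in> borel_measurable PC"
    proof -
      have [measurable]: "(\<lambda>w. tr (adj (f j w) * (Q w * B * g j w))) \<in> borel_measurable PC"
        using fg(3,4) by (intro random_fmat_tr[of _ 1] random_fmat_mult[of _ 1 p _ 1] random_fmat_mult[of _ p p _ 1] random_fmat_mult[of _ p p _ p] random_fmat_adj random_fmat_const random_fmat_Q B(2))
      show ?thesis unfolding qQ_def by measurable
    qed
    fix w
    show "0 \<le> (cmod (qQ B j f g w))\<^sup>2" by simp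
    have "cmod (qQ B j f g w) \<le> (1 / Re u * \<kappa>) * (sqrt (nrm2 (f j w)) * sqrt (nrm2 (g j w))) / n"
      unfolding qQ_def norm_divide norm_of_nat
      by (intro divide_right_mono tr_quad_op_bound op_bound_mult op_bound_Q B(1)) simp
    then have "(cmod (qQ B j f g w))\<^sup>2 \<le> ((1 / Re u * \<kappa>) * (sqrt (nrm2 (f j w)) * sqrt (nrm2 (g j w))) / n)\<^sup>2"
      by (rule power_mono) simp
    also have "\<dots> = c * (nrm2 (f j w) * nrm2 (g j w))"
      by (simp add: c_def power_mult_distrib power_divide)
    also have "\<dots> \<le> c * (((nrm2 (f j w))\<^sup>2 + (nrm2 (g j w))\<^sup>2) / 2)"
    proof (rule mult_left_mono)
      have "0 \<le> (nrm2 (f j w) - nrm2 (g j w))\<^sup>2" by simp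
      then show "nrm2 (f j w) * nrm2 (g j w) \<le> ((nrm2 (f j w))\<^sup>2 + (nrm2 (g j w))\<^sup>2) / 2"
        by (simp add: power2_eq_square algebra_simps)
    qed (simp add: c_def)
    finally show "(cmod (qQ B j f g w))\<^sup>2 \<le> k * (nrm2 (f j w))\<^sup>2 + k * (nrm2 (g j w))\<^sup>2"
      by (simp only: k_def times_divide_eq_left times_divide_eq_right distrib_left add_divide_distrib)
  next
    have "k * (2 * (K + 1) * \<tau>\<^sup>2 * (real p)\<^sup>2) + k * (2 * (K + 1) * \<tau>\<^sup>2 * (real p)\<^sup>2)
      = c * (2 * (K + 1) * \<tau>\<^sup>2 * (real p)\<^sup>2)"
      unfolding k_def by (simp only: distrib_right[symmetric] field_sum_of_halves)
    also have "\<dots> = (2 * \<kappa>\<^sup>2 * (\<tau>\<^sup>2 / (Re u)\<^sup>2 * (K + 1))) * (p / n)\<^sup>2"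
    proof -
      have "c = \<kappa>\<^sup>2 / (Re u)\<^sup>2 / (real n)\<^sup>2" unfolding c_def by (simp add: power_mult_distrib power_divide)
      moreover have "\<kappa>\<^sup>2 / U / N * (2 * k1 * T * P) = (2 * \<kappa>\<^sup>2 * (T / U * k1)) * (P / N)" for U N k1 T P :: real
        by simp
      ultimately show ?thesis unfolding power_divide by simp
    qed
    also have "\<dots> \<le> (2 * \<kappa>\<^sup>2 * (\<tau>\<^sup>2 / (Re u)\<^sup>2 * (K + 1))) * (1 + p / n)\<^sup>2"
    proof (rule mult_left_mono)
      show "(real p / n)\<^sup>2 \<le> (1 + real p / n)\<^sup>2" by (rule power_mono) simp_all
      show "0 \<le> 2 * \<kappa>\<^sup>2 * (\<tau>\<^sup>2 / (Re u)\<^sup>2 * (K + 1))"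
        using K by (intro mult_nonneg_nonneg divide_nonneg_nonneg) simp_all
    qed
    finally show "k * (2 * (K + 1) * \<tau>\<^sup>2 * (real p)\<^sup>2) + k * (2 * (K + 1) * \<tau>\<^sup>2 * (real p)\<^sup>2) \<le> 2 * \<kappa>\<^sup>2 * W \<tau>"
      unfolding W_def by (simp only: mult.assoc)
  qed
qed

end

end

section \<open>The leave-one-out equation in mean\<close>

context rmt
begin

definition "mm = PC.expectation (\<lambda>w. tr (Sg * Q w)) / n"
text \<open>The defect of the scalar equation for pair \<open>j\<close>, in which the random
  coefficient tr (Sg Q) / n is already replaced by its mean \<open>mm\<close>.\<close>

definition "D A j w = (1 + mm\<^sup>2) * (qQ A j yc xc w - qQ A j xc yc w) - 2 * mm * tt A w"

context
  fixes \<tau> \<kappa> :: real and A :: fmat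
  assumes \<tau>: "\<And>i. i < p \<Longrightarrow> d i \<le> \<tau>" "0 < \<tau>" and A: "op_bound \<kappa> A" "dims p p A"
begin

lemma oSg: "op_bound \<tau> Sg" by (rule op_bound_Sg[OF _ \<tau>(2) A n]) (rule \<tau>(1))

lemma measurable_mm: "(\<lambda>w. tr (Sg * Q w) / n - mm) \<in> borel_measurable PC"
proof -
  note [measurable] = measurable_trAQ[OF dims_Sg]
  show ?thesis by measurable
qed

lemma expect_le_mm: "expect_le (\<lambda>w. (cmod (tr (Sg * Q w) / n - mm))\<^sup>2) (64 * W \<tau> / n)"
proof -
  note o = oSg
  let ?f = "\<lambda>w. tr (Sg * Q w)"
  let ?g = "\<lambda>w. (cmod (tr (Sg * Q w) / n - mm))\<^sup>2"
  have m: "?f \<in> borel_measurable PC" by (rule measurable_trAQ[OF dims_Sg])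
  have e: "?g w = (cmod (?f w - PC.expectation ?f))\<^sup>2 / n\<^sup>2" for w
    by (simp add: mm_def norm_divide power_divide flip: diff_divide_distrib)
  have "integrable PC (\<lambda>w. (cmod (?f w - PC.expectation ?f))\<^sup>2)"
  proof (rule PC.integrable_const_bound[of _ "(\<tau> * p / Re u + cmod (PC.expectation ?f))\<^sup>2"])
    show "AE w in PC. norm ((cmod (?f w - PC.expectation ?f))\<^sup>2) \<le> (\<tau> * p / Re u + cmod (PC.expectation ?f))\<^sup>2"
    proof (intro AE_I2)
      fix w
      have "cmod (?f w - PC.expectation ?f) \<le> \<tau> * p / Re u + cmod (PC.expectation ?f)"
        using norm_triangle_ineq4[of "?f w" "PC.expectation ?f"] tr_AQ_bound[OF o dims_Sg, where w = w] by linarith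
      then show "norm ((cmod (?f w - PC.expectation ?f))\<^sup>2) \<le> (\<tau> * p / Re u + cmod (PC.expectation ?f))\<^sup>2"
        by (simp add: power_mono)
    qed
    show "(\<lambda>w. (cmod (?f w - PC.expectation ?f))\<^sup>2) \<in> borel_measurable PC" using m by measurable
  qed
  then have "(\<integral>\<^sup>+w. ennreal (?g w) \<partial>PC) = ennreal (PC.expectation (\<lambda>w. (cmod (?f w - PC.expectation ?f))\<^sup>2) / n\<^sup>2)"
    unfolding e by (subst nn_integral_eq_integral) auto
  also have "\<dots> \<le> ennreal (64 * W \<tau> / n)"
  proof (rule ennreal_leI)
    have "PC.expectation (\<lambda>w. (cmod (?f w - PC.expectation ?f))\<^sup>2) / n\<^sup>2 \<le> (4 * (real n * (4 * \<tau> / Re u)\<^sup>2)) / n\<^sup>2"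
      by (rule divide_right_mono[OF concentration_trAQ(1)[OF o dims_Sg \<tau>(2)]]) (rule of_nat_0_le_iff)
    also have "\<dots> = 64 * (\<tau>\<^sup>2 / (Re u)\<^sup>2) / n"
      using n by (simp add: power_mult_distrib power_divide) (simp add: power2_eq_square)
    also have "\<dots> \<le> 64 * W \<tau> / n"
      by (intro divide_right_mono mult_left_mono base_le_W[OF \<tau> A n]) auto
    finally show "PC.expectation (\<lambda>w. (cmod (?f w - PC.expectation ?f))\<^sup>2) / n\<^sup>2 \<le> 64 * W \<tau> / n" .
  qed
  finally show ?thesis using W_pos[OF \<tau> A n] m unfolding expect_le_def by (auto intro!: borel_measurable_power borel_measurable_norm measurable_mm)
qed


text \<open>Every error is a product of a coefficient with second moment O(1 / n) and a form with
  second moment O(1); \<open>leave_one_scalar\<close> separates them by a weighted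
  inequality.\<close>

lemma expect_le_D:
  assumes j: "j < n"
  shows "expect_le (\<lambda>w. cmod (D A j w)) ((1 + cmod mm) * ((38 * \<kappa>\<^sup>2 + 596) * W \<tau> + 4) / sqrt n)"
proof -
  let ?P = "proj p" and ?W = "W \<tau>"
  note P = op_bound_proj[of p] dims_proj[of p]
  have ttP: "tt ?P w = tr (Sg * Q w) / n" for w
    unfolding tt_def by (simp add: dims_projL[OF dims_Sg])
  note qA = expect_le_quad_W[OF \<tau> A j] and qP = expect_le_quad_W[OF \<tau> P j, simplified]
  note big = expect_le_big[OF \<tau> A j]
  \<comment> \<open>148 = 2 * 10 + 2 * 64: from the form to the trace, then from the trace to its
    mean.\<close>
  have dm: "expect_le (\<lambda>w. (cmod (q w - mm))\<^sup>2) (148 * ?W / n)"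
    if q: "expect_le (\<lambda>w. (cmod (q w - tt ?P w))\<^sup>2) (10 * ?W / n)" "q \<in> borel_measurable PC" for q
  proof (rule expect_le_mono[OF expect_le_add[OF expect_le_cmult[OF q(1), of 2] expect_le_cmult[OF expect_le_mm, of 2]]])
    show "(\<lambda>w. (cmod (q w - mm))\<^sup>2) \<in> borel_measurable PC" using q(2) by measurable
    show "(cmod (q w - mm))\<^sup>2 \<le> 2 * (cmod (q w - tt ?P w))\<^sup>2 + 2 * (cmod (tr (Sg * Q w) / n - mm))\<^sup>2" for w
      using cmod_diff_sq_le[of "q w" mm "tt ?P w"] by (simp add: ttP)
  qed (simp_all add: add_divide_distrib[symmetric])
  have mq: "qf xc xc j ?P \<in> borel_measurable PC" "qf yc yc j ?P \<in> borel_measurable PC"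
  proof -
    have "qf xc xc j ?P = (\<lambda>w. tr (adj (z1 j (w j)) * (Bq ?P j w * z1 j (w j))))"
      "qf yc yc j ?P = (\<lambda>w. tr (adj (z2 j (w j)) * (Bq ?P j w * z2 j (w j))))"
      by (rule ext, rule qf_eq(1)[OF _ \<tau>(2) P j], erule \<tau>(1), rule ext, rule qf_eq(2)[OF _ \<tau>(2) P j], erule \<tau>(1))
    then show "qf xc xc j ?P \<in> borel_measurable PC" "qf yc yc j ?P \<in> borel_measurable PC"
    using meas_quad[OF \<tau> P j random_fmat_z(1)[OF \<tau> P j] random_fmat_z(1)[OF \<tau> P j]] meas_quad[OF \<tau> P j random_fmat_z(2)[OF \<tau> P j] random_fmat_z(2)[OF \<tau> P j]]
      by simp_all
  qed
  note d = dm[OF qP(1) mq(1)] dm[OF qP(2) mq(2)]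
  \<comment> \<open>With this weight both s times \<open>small\<close> and \<open>large\<close> over
    s are of order 1 / sqrt n in mean.\<close>
  define s where "s = sqrt n"
  have s: "s > 0" "s * s = n" using n by (auto simp: s_def)
  define small where "small = (\<lambda>w. (cmod (qf yc xc j A w))\<^sup>2 + (cmod (qf xc yc j A w))\<^sup>2 + (cmod (qf xc xc j A w - tt A w))\<^sup>2
     + (cmod (qf yc yc j A w - tt A w))\<^sup>2 + 2 * (cmod (qf xc yc j ?P w))\<^sup>2 + 2 * (cmod (qf yc xc j ?P w))\<^sup>2
     + 2 * (cmod (qf xc xc j ?P w - mm))\<^sup>2 + 2 * (cmod (qf yc yc j ?P w - mm))\<^sup>2)"
  define large where "large = (\<lambda>w. 4 + 2 * (cmod (qQ A j yc xc w))\<^sup>2 + 2 * (cmod (qQ A j xc xc w))\<^sup>2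
     + 2 * (cmod (qQ A j xc yc w))\<^sup>2 + 2 * (cmod (qQ A j yc yc w))\<^sup>2)"
  \<comment> \<open>The terms with \<kappa> give 1 + 1 + 10 + 10 = 22, the others 2 + 2 + 296 + 296
    = 596. The 16 from \<open>large\<close> later raises 22 to 38.\<close>
  have Es: "expect_le small ((22 * \<kappa>\<^sup>2 + 596) * ?W / n)"
  proof -
    have "expect_le small (\<kappa>\<^sup>2 * ?W / n + \<kappa>\<^sup>2 * ?W / n + 10 * \<kappa>\<^sup>2 * ?W / n + 10 * \<kappa>\<^sup>2 * ?W / n + 2 * (?W / n) + 2 * (?W / n) + 2 * (148 * ?W / n) + 2 * (148 * ?W / n))"
      unfolding small_def by (intro expect_le_add expect_le_cmult qA qP d) simp_all
    then show ?thesis by (rule expect_le_le) (simp add: algebra_simps add_divide_distrib)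
  qed
  have El: "expect_le large (4 + 16 * \<kappa>\<^sup>2 * ?W)"
  proof -
    have "expect_le large (4 + 2 * (2 * \<kappa>\<^sup>2 * ?W) + 2 * (2 * \<kappa>\<^sup>2 * ?W) + 2 * (2 * \<kappa>\<^sup>2 * ?W) + 2 * (2 * \<kappa>\<^sup>2 * ?W))"
      unfolding large_def by (intro expect_le_add expect_le_cmult expect_le_const big) simp_all
    then show ?thesis by (rule expect_le_le) simp
  qed
  have pw: "cmod (D A j w) \<le> (1 + cmod mm) * (s * small w + (1 / s) * large w)" for w
  proof -
    have Sm: "S w - sm (of_real (1 / n)) (skew_pair (xc j w) (yc j w)) = Sm j w" using S_Sm[OF j, of w] by simp
    have id: "qQ A j f g w = qf f g j A w - qf f xc j ?P w * qQ A j yc g w + qf f yc j ?P w * qQ A j xc g w"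
      if "dims p 1 (f j w)" "dims p 1 (g j w)" for f g
    proof -
      have QP: "Qm j w * ?P * X = Qm j w * X" for X by (simp add: dims_projR[OF dims_Qm])
      show ?thesis
        using leave_one_identity[OF skew_S[of w] u dims_x[of j w] dims_y[of j w] A(2) that, of "1 / n", unfolded Sm]
        by (simp add: qQ_def qf_def QP Q_def[symmetric] Qm_def[symmetric])
    qed
    show ?thesis unfolding D_def small_def large_def
      by (rule leave_one_scalar[OF id id id id s(1)]) (rule dims_x dims_y)+
  qed
  have mD: "(\<lambda>w. cmod (D A j w)) \<in> borel_measurable PC"
  proof -
    have "random_fmat PC p 1 f \<Longrightarrow> random_fmat PC p 1 g \<Longrightarrow> (\<lambda>w. tr (adj (f w) * (Q w * A * g w))) \<in> borel_measurable PC" for f g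
      by (intro random_fmat_tr[of _ 1] random_fmat_mult[of _ 1 p _ 1] random_fmat_mult[of _ p p _ 1] random_fmat_mult[of _ p p _ p] random_fmat_adj random_fmat_const random_fmat_Q A(2))
    from this[OF random_fmat_x[OF j] random_fmat_y[OF j]] this[OF random_fmat_y[OF j] random_fmat_x[OF j]] meas_tt[OF \<tau> A j]
    show ?thesis unfolding D_def qQ_def by measurable
  qed
  have "expect_le (\<lambda>w. (1 + cmod mm) * (s * small w + (1 / s) * large w))
     ((1 + cmod mm) * (s * ((22 * \<kappa>\<^sup>2 + 596) * ?W / n) + (1 / s) * (4 + 16 * \<kappa>\<^sup>2 * ?W)))"
    using s by (intro expect_le_cmult expect_le_add Es El) auto
  moreover have "s * (X / n) = X / s" for X using s n by (simp add: field_simps flip: s(2))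
  then have "(1 + cmod mm) * (s * ((22 * \<kappa>\<^sup>2 + 596) * ?W / n) + (1 / s) * (4 + 16 * \<kappa>\<^sup>2 * ?W))
     = (1 + cmod mm) * ((38 * \<kappa>\<^sup>2 + 596) * ?W + 4) / sqrt n"
    by (simp add: s_def[symmetric]) (simp add: add_divide_distrib[symmetric] algebra_simps)
  ultimately show ?thesis by (intro expect_le_mono[OF _ mD _ pw]) auto
qed

text \<open>The forms summed over the columns rebuild tr (A S Q), and S Q = 1 - u Q; this closes the
  equation in terms of traces of \<open>Q\<close> only.\<close>

lemma sum_D: "(\<Sum>j<n. D A j w) / n = (1 + mm\<^sup>2) * (tr A - u * tr (A * Q w)) / n - 2 * mm * tt A w"
proof -
  have "tr (A * (S w * Q w)) = (\<Sum>j<n. qQ A j yc xc w - qQ A j xc yc w)"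
  proof -
    have "tr (A * (skew_pair x y * Q w)) = tr (adj y * (Q w * A * x)) - tr (adj x * (Q w * A * y))" for x y
    proof -
      have "tr (A * (x * adj y) * Q w) = tr (adj y * (Q w * A * x))" for x y
        by (metis mult.assoc tr_commute)
      then show ?thesis by (simp add: skew_pair_def ring_distribs mult.assoc)
    qed
    moreover have "A * (S w * Q w) = sm (of_real (1 / n)) (\<Sum>j<n. A * (skew_pair (xc j w) (yc j w) * Q w))"
      by (simp add: S_def sum_distrib_left sum_distrib_right)
    ultimately show ?thesis by (simp add: tr_sum qQ_def sum_divide_distrib diff_divide_distrib)
  qed
  moreover have "S w * Q w = proj p - sm u (Q w)" unfolding Q_def by (rule S_res[OF skew_S u])
  ultimately have e: "(\<Sum>j<n. qQ A j yc xc w - qQ A j xc yc w) = tr A - u * tr (A * Q w)"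
    by (simp add: ring_distribs dims_projR[OF A(2)])
  have "(\<Sum>j<n. D A j w) = (1 + mm\<^sup>2) * (\<Sum>j<n. qQ A j yc xc w - qQ A j xc yc w) - n * (2 * mm * tt A w)"
    unfolding D_def sum_subtractf[of _ "\<lambda>_. 2 * mm * tt A w"] sum_distrib_left by simp
  then show ?thesis unfolding e using n by (simp add: diff_divide_distrib)
qed

text \<open>With \<open>\<rho> = 2 mm / (1 + mm\<^sup>2)\<close> the left-hand side is \<open>1 + mm\<^sup>2\<close> times the normalised mean of
  \<open>tr (A (1 - (u + \<rho> Sg) Q))\<close>: the resolvent \<open>Q\<close> is close to \<open>(u + \<rho> Sg)\<^sup>-\<^sup>1\<close>.\<close>
theorem core_estimate:
  "cmod ((1 + mm\<^sup>2) * (tr A - u * PC.expectation (\<lambda>w. tr (A * Q w))) / n - 2 * mm * PC.expectation (\<lambda>w. tr (A * Sg * Q w)) / n)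
     \<le> (1 + cmod mm) * ((38 * \<kappa>\<^sup>2 + 596) * W \<tau> + 4) / sqrt n"
proof -
  let ?E = "(1 + cmod mm) * ((38 * \<kappa>\<^sup>2 + 596) * W \<tau> + 4) / sqrt n"
  define f where "f = (\<lambda>w. (1 + mm\<^sup>2) * (tr A - u * tr (A * Q w)) / n - 2 * mm * (tr (A * Sg * Q w) / n))"
  have i1: "integrable PC (\<lambda>w. tr (A * Q w))" by (rule integrable_trAQ[OF A])
  have i2: "integrable PC (\<lambda>w. tr (A * Sg * Q w))"
    by (rule integrable_trAQ[OF op_bound_mult[OF A(1) oSg] dims_mult[OF A(2) dims_Sg]])
  have i: "integrable PC f" unfolding f_def using i1 i2
    by (intro Bochner_Integration.integrable_diff integrable_divide_zero integrable_mult_right PC.integrable_const) simp_all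
  have Ef: "PC.expectation f = (1 + mm\<^sup>2) * (tr A - u * PC.expectation (\<lambda>w. tr (A * Q w))) / n - 2 * mm * PC.expectation (\<lambda>w. tr (A * Sg * Q w)) / n"
    unfolding f_def using i1 i2 by (simp add: PC.prob_space)
  have "expect_le (\<lambda>w. (1 / n) * (\<Sum>j<n. cmod (D A j w))) ((1 / n) * (\<Sum>j<n. ?E))"
    by (intro expect_le_cmult expect_le_sum expect_le_D) auto
  then have "expect_le (\<lambda>w. cmod (f w)) ?E"
  proof (rule expect_le_mono)
    show "(\<lambda>w. cmod (f w)) \<in> borel_measurable PC" using i by auto
    fix w
    have "f w = (\<Sum>j<n. D A j w) / n" unfolding sum_D f_def tt_def by simp
    then show "cmod (f w) \<le> (1 / n) * (\<Sum>j<n. cmod (D A j w))"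
      by (simp add: norm_divide divide_right_mono norm_sum)
  qed (use n in auto)
  from expect_le_expectation[OF this i] show ?thesis unfolding Ef .
qed

end

end

subsection \<open>The fixed point equation\<close>

text \<open>With m = c w this is 2 m / (1 + m^2), see \<open>rho_eq\<close>; its poles m = i and m =
  - i lie on the boundary of the right half-plane.\<close>

definition rho :: "real \<Rightarrow> complex \<Rightarrow> complex" where
  "rho c w = 1 / (\<i> + of_real c * w) + 1 / (- \<i> + of_real c * w)"

definition h_map :: "real \<Rightarrow> real measure \<Rightarrow> complex \<Rightarrow> complex \<Rightarrow> complex" where
  "h_map c H u w = (LINT t|H. of_real t / (u + of_real t * rho c w))"

lemma is_h_h_map: "is_h c H z w \<longleftrightarrow> Re w > 0 \<and> w = h_map c H (- z) w"
  by (simp add: is_h_def h_map_def rho_def)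

text \<open>The ratio of Re rho to c Re w, by \<open>Re_rho\<close>; up to conjugation of one
  argument it is the diagonal of \<open>Pbil\<close> below.\<close>

definition Psq :: "real \<Rightarrow> complex \<Rightarrow> real" where
  "Psq c w = 1 / (cmod (\<i> + of_real c * w))\<^sup>2 + 1 / (cmod (- \<i> + of_real c * w))\<^sup>2"

lemma Re_inverse_eq: "Re (1 / z) = Re z / (cmod z)\<^sup>2"
  by (simp add: Re_divide cmod_power2)

lemma Re_rho: "Re (rho c w) = c * Re w * Psq c w"
  unfolding rho_def Psq_def plus_complex.sel Re_inverse_eq by (simp add: algebra_simps)

lemma Re_rho_nonneg: "0 \<le> c \<Longrightarrow> 0 \<le> Re w \<Longrightarrow> 0 \<le> Re (rho c w)"
  unfolding Re_rho Psq_def by simp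

lemma rho_denoms_nonzero:
  assumes "1 + (of_real c * w)\<^sup>2 \<noteq> 0"
  shows "\<i> + of_real c * w \<noteq> 0" "- \<i> + of_real c * w \<noteq> 0"
proof -
  have "(\<i> + of_real c * w) * (- \<i> + of_real c * w) = 1 + (of_real c * w)\<^sup>2"
    by (simp add: algebra_simps power2_eq_square)
  then show "\<i> + of_real c * w \<noteq> 0" "- \<i> + of_real c * w \<noteq> 0" using assms by auto
qed

lemma denoms_nonzero_Re:
  assumes "0 < c" "0 < Re w"
  shows "1 + (of_real c * w)\<^sup>2 \<noteq> 0"
proof -
  have "Re (\<i> + of_real c * w) > 0" "Re (- \<i> + of_real c * w) > 0" using assms by auto
  then have "\<i> + of_real c * w \<noteq> 0" "- \<i> + of_real c * w \<noteq> 0" by (metis less_irrefl zero_complex.sel(1))+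
  moreover have "(\<i> + of_real c * w) * (- \<i> + of_real c * w) = 1 + (of_real c * w)\<^sup>2"
    by (simp add: algebra_simps power2_eq_square)
  ultimately show ?thesis by (metis mult_eq_0_iff)
qed

lemma rho_eq:
  assumes "1 + (of_real c * w)\<^sup>2 \<noteq> 0"
  shows "rho c w = 2 * (of_real c * w) / (1 + (of_real c * w)\<^sup>2)"
proof -
  have "(\<i> + of_real c * w) * (- \<i> + of_real c * w) = 1 + (of_real c * w)\<^sup>2"
    by (simp add: algebra_simps power2_eq_square)
  then show ?thesis unfolding rho_def using rho_denoms_nonzero[OF assms]
    by (simp add: add_frac_eq)
qed

lemma rho_diff:
  assumes "1 + (of_real c * w1)\<^sup>2 \<noteq> 0" "1 + (of_real c * w2)\<^sup>2 \<noteq> 0"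
  shows "rho c w2 - rho c w1 = of_real c * (w1 - w2) *
    (1 / ((\<i> + of_real c * w1) * (\<i> + of_real c * w2)) + 1 / ((- \<i> + of_real c * w1) * (- \<i> + of_real c * w2)))"
proof -
  have e: "1 / b - 1 / a = (a - b) * (1 / (a * b))" if "a \<noteq> 0" "b \<noteq> 0" for a b :: complex
    using that by (simp add: field_simps)
  have "rho c w2 - rho c w1 = (1 / (\<i> + of_real c * w2) - 1 / (\<i> + of_real c * w1)) + (1 / (- \<i> + of_real c * w2) - 1 / (- \<i> + of_real c * w1))"
    by (simp add: rho_def)
  also have "\<dots> = of_real c * (w1 - w2) * (1 / ((\<i> + of_real c * w1) * (\<i> + of_real c * w2))) + of_real c * (w1 - w2) * (1 / ((- \<i> + of_real c * w1) * (- \<i> + of_real c * w2)))"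
    using rho_denoms_nonzero[OF assms(1)] rho_denoms_nonzero[OF assms(2)] by (subst (1 2) e) (auto simp: algebra_simps)
  finally show ?thesis by (simp add: distrib_left)
qed

lemma den_Re: "0 \<le> t \<Longrightarrow> 0 \<le> Re r \<Longrightarrow> Re u \<le> Re (u + of_real t * r)"
  by simp

lemma den_bound1:
  assumes "0 < Re u" "0 \<le> t" "0 \<le> Re r"
  shows "cmod (of_real t / (u + of_real t * r)) \<le> t / Re u"
proof -
  have "Re u \<le> cmod (u + of_real t * r)" using den_Re[OF assms(2,3), of u] complex_Re_le_cmod order_trans by blast
  then show ?thesis using assms by (simp add: norm_divide frac_le)
qed

lemma den_nonzero: "0 < Re u \<Longrightarrow> 0 \<le> t \<Longrightarrow> 0 \<le> Re r \<Longrightarrow> u + of_real t * r \<noteq> 0"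
  using den_Re[of t r u] by fastforce

text \<open>If t |r| <= 2 |u| the real part Re u alone is large enough; otherwise t r dominates u
  and at most half of it is lost.\<close>

lemma den_bound2:
  assumes "0 < Re u" "0 \<le> t" "0 \<le> Re r"
  shows "Re u / (2 * cmod u) * (t * cmod r) \<le> cmod (u + of_real t * r)"
proof -
  have u: "0 < cmod u" "Re u \<le> cmod u" using assms complex_Re_le_cmod[of u] by auto
  show ?thesis
  proof (cases "t * cmod r \<le> 2 * cmod u")
    case True
    have "Re u / (2 * cmod u) * (t * cmod r) \<le> Re u / (2 * cmod u) * (2 * cmod u)"
      using True assms by (intro mult_left_mono) auto
    also have "\<dots> = Re u" using u by auto
    also have "\<dots> \<le> cmod (u + of_real t * r)" using den_Re[OF assms(2,3), of u] complex_Re_le_cmod order_trans by blast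
    finally show ?thesis .
  next
    case False
    have "Re u / (2 * cmod u) * (t * cmod r) \<le> 1 / 2 * (t * cmod r)"
      using u assms by (intro mult_right_mono) (auto simp: field_simps)
    also have "\<dots> \<le> t * cmod r - cmod u" using False by simp
    also have "\<dots> = cmod (of_real t * r) - cmod u" using assms by (simp add: norm_mult)
    also have "\<dots> \<le> cmod (u + of_real t * r)" by (metis add.commute norm_diff_ineq)
    finally show ?thesis .
  qed
qed

text \<open>The bound is uniform in \<open>t\<close>: this is what makes the integrals converge and
  depend continuously on the law, however heavy its tail.\<close>

lemma den_bound3:
  assumes "0 < Re u" "0 \<le> t" "0 \<le> Re r" "r \<noteq> 0"
  shows "cmod (of_real t / (u + of_real t * r)) \<le> 2 * cmod u / (Re u * cmod r)"
proof (cases "t = 0")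
  case False
  have u: "0 < cmod u" using assms by auto
  have pos: "0 < Re u / (2 * cmod u) * (t * cmod r)" using assms u False by (intro mult_pos_pos divide_pos_pos) auto
  have "cmod (of_real t / (u + of_real t * r)) = t / cmod (u + of_real t * r)" using assms by (simp add: norm_divide)
  also have "\<dots> \<le> t / (Re u / (2 * cmod u) * (t * cmod r))"
    using less_le_trans[OF pos den_bound2[OF assms(1-3)]] assms(2)
    by (intro divide_left_mono[OF den_bound2[OF assms(1-3)]] mult_pos_pos[OF _ pos])
  also have "\<dots> = 2 * cmod u / (Re u * cmod r)" using False u by (simp add: field_simps)
  finally show ?thesis .
qed (use assms in simp)

lemma integral_lin2:
  fixes f g :: "'a \<Rightarrow> 'b :: {real_normed_field, second_countable_topology, banach}"
  assumes "integrable M f" "integrable M g"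
  shows "(LINT t|M. a * f t + b * g t) = a * (LINT t|M. f t) + b * (LINT t|M. g t)"
  using assms by simp

definition nonneg_dist :: "real measure \<Rightarrow> bool" where
  "nonneg_dist H \<longleftrightarrow> real_distribution H \<and> (AE t in H. 0 \<le> t)"

lemma population_dist_iff: "population_dist H \<longleftrightarrow> nonneg_dist H \<and> H \<noteq> return borel 0"
  by (simp add: population_dist_def nonneg_dist_def)

lemma population_dist_not_AE_0:
  assumes "population_dist H" shows "\<not> (AE t in H. t = 0)"
proof
  assume a: "AE t in H. t = 0"
  interpret real_distribution H using assms by (simp add: population_dist_def)
  have "H = return borel 0"
  proof (rule measure_eqI)
    fix A assume "A \<in> sets H"
    then have A: "A \<in> sets borel" by simp
    have "emeasure H A = (\<integral>\<^sup>+t. indicator A t \<partial>H)" using A by simp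
    also have "\<dots> = (\<integral>\<^sup>+t. indicator A (0::real) \<partial>H)" using a by (intro nn_integral_cong_AE) auto
    also have "\<dots> = indicator A 0" using emeasure_space_1 by simp
    finally show "emeasure H A = emeasure (return borel 0) A" using A by simp
  qed simp
  then show False using assms by (simp add: population_dist_def)
qed

text \<open>A vanishing integral would concentrate \<open>H\<close> on the zeros of \<open>f\<close>
  in the half-line, that is at the point 0, which \<open>population_dist\<close> excludes.\<close>

lemma integral_pos_population:
  assumes H: "population_dist H" and f: "integrable H f" and p: "\<And>t. 0 \<le> t \<Longrightarrow> 0 \<le> f t" "\<And>t. 0 < t \<Longrightarrow> 0 < f t"
  shows "0 < (LINT t|H. f t :: real)"
proof -
  have n: "AE t in H. 0 \<le> t" using H by (simp add: population_dist_def)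
  then have nn: "AE t in H. 0 \<le> f t" using p(1) by auto
  have "(LINT t|H. f t) \<noteq> 0"
  proof
    assume "(LINT t|H. f t) = 0"
    then have "AE t in H. f t = 0" using integral_nonneg_eq_0_iff_AE[OF f nn] by simp
    with n have "AE t in H. t = 0" 
    proof eventually_elim
      case (elim t)
      then show ?case using p(2)[of t] by (cases "t = 0") auto
    qed
    then show False using population_dist_not_AE_0[OF H] by simp
  qed
  then show ?thesis using integral_nonneg_AE[OF nn] by linarith
qed

context
  fixes H c u w r
  assumes H: "nonneg_dist H" and u: "0 < Re u" and r: "0 \<le> Re r" "r \<noteq> 0"
begin

interpretation H: real_distribution H using H by (simp add: nonneg_dist_def)

lemma AE_nonneg: "AE t in H. 0 \<le> t" using H by (simp add: nonneg_dist_def)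

lemma integrable_kernel: "integrable H (\<lambda>t. of_real t / (u + of_real t * r))"
  using AE_nonneg den_bound3[OF u _ r]
  by (intro H.integrable_const_bound[of _ "2 * cmod u / (Re u * cmod r)"]) (auto elim!: eventually_mono)

lemma integrable_kernel2:
  "integrable H (\<lambda>t. t\<^sup>2 / (cmod (u + of_real t * r))\<^sup>2)"
  "integrable H (\<lambda>t. t / (cmod (u + of_real t * r))\<^sup>2)"
proof -
  let ?M = "2 * cmod u / (Re u * cmod r)"
  have k: "t / cmod (u + of_real t * r) \<le> ?M" if "0 \<le> t" for t
    using den_bound3[OF u that r] that by (simp add: norm_divide)
  have l: "1 / cmod (u + of_real t * r) \<le> 1 / Re u" if "0 \<le> t" for t
    using den_Re[OF that r(1), of u] complex_Re_le_cmod[of "u + of_real t * r"] u by (intro divide_left_mono) (auto intro!: mult_pos_pos)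
  show "integrable H (\<lambda>t. t\<^sup>2 / (cmod (u + of_real t * r))\<^sup>2)"
  proof (rule H.integrable_const_bound[of _ "?M\<^sup>2"])
    show "AE t in H. norm (t\<^sup>2 / (cmod (u + of_real t * r))\<^sup>2) \<le> ?M\<^sup>2"
      using AE_nonneg
    proof eventually_elim
      case (elim t)
      have "(t / cmod (u + of_real t * r))\<^sup>2 \<le> ?M\<^sup>2" using k[OF elim] elim by (intro power_mono) auto
      then show ?case by (simp add: power_divide)
    qed
  qed simp
  show "integrable H (\<lambda>t. t / (cmod (u + of_real t * r))\<^sup>2)"
  proof (rule H.integrable_const_bound[of _ "?M * (1 / Re u)"])
    show "AE t in H. norm (t / (cmod (u + of_real t * r))\<^sup>2) \<le> ?M * (1 / Re u)"
      using AE_nonneg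
    proof eventually_elim
      case (elim t)
      have "t / cmod (u + of_real t * r) * (1 / cmod (u + of_real t * r)) \<le> ?M * (1 / Re u)"
        using k[OF elim] l[OF elim] elim u by (intro mult_mono) auto
      then show ?case using elim by (simp add: power2_eq_square)
    qed
  qed simp
qed

lemma Re_kernel_integral:
  "Re (LINT t|H. of_real t / (u + of_real t * r))
     = Re u * (LINT t|H. t / (cmod (u + of_real t * r))\<^sup>2) + Re r * (LINT t|H. t\<^sup>2 / (cmod (u + of_real t * r))\<^sup>2)"
proof -
  have e: "Re (of_real t / (u + of_real t * r)) = Re u * (t / (cmod (u + of_real t * r))\<^sup>2) + Re r * (t\<^sup>2 / (cmod (u + of_real t * r))\<^sup>2)" for t
  proof -
    have "Re (of_real t / (u + of_real t * r)) = t * Re (1 / (u + of_real t * r))"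
      by (metis Re_complex_of_real mult.right_neutral times_divide_eq_right Re_divide_of_real complex_of_real_def scaleR_complex.sel(1) scaleR_conv_of_real)
    also have "\<dots> = t * (Re u + t * Re r) / (cmod (u + of_real t * r))\<^sup>2" unfolding Re_inverse_eq by simp
    finally show ?thesis by (simp add: power2_eq_square algebra_simps add_divide_distrib)
  qed
  have "Re (LINT t|H. of_real t / (u + of_real t * r)) = (LINT t|H. Re (of_real t / (u + of_real t * r)))"
    using integrable_kernel by (rule integral_Re[symmetric])
  also have "\<dots> = (LINT t|H. Re u * (t / (cmod (u + of_real t * r))\<^sup>2) + Re r * (t\<^sup>2 / (cmod (u + of_real t * r))\<^sup>2))"
    unfolding e ..
  also have "\<dots> = Re u * (LINT t|H. t / (cmod (u + of_real t * r))\<^sup>2) + Re r * (LINT t|H. t\<^sup>2 / (cmod (u + of_real t * r))\<^sup>2)"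
    by (rule integral_lin2[OF integrable_kernel2(2,1)])
  finally show ?thesis .
qed

end

section \<open>Contraction at solutions and uniqueness\<close>

lemma rho_nonzero: "0 < c \<Longrightarrow> 0 < Re w \<Longrightarrow> rho c w \<noteq> 0" "0 < c \<Longrightarrow> 0 < Re w \<Longrightarrow> 0 < Re (rho c w)"
proof -
  assume a: "0 < c" "0 < Re w"
  then show "rho c w \<noteq> 0" using rho_eq[OF denoms_nonzero_Re[OF a]] denoms_nonzero_Re[OF a] by auto
  have "0 < Psq c w" unfolding Psq_def using rho_denoms_nonzero[OF denoms_nonzero_Re[OF a]] by (intro add_pos_pos) auto
  then show "0 < Re (rho c w)" unfolding Re_rho using a by simp
qed

text \<open>The minimising weight is s = sqrt b / sqrt a. Applied to integrated weighted
  inequalities it yields Cauchy-Schwarz for the complex integrals below.\<close>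

lemma geo_mean_le:
  assumes "\<And>s. 0 < s \<Longrightarrow> x \<le> (s * a + b / s) / 2" "0 < a" "0 < b"
  shows "x \<le> sqrt a * sqrt b"
proof -
  define s where "s = sqrt b / sqrt a"
  have s: "0 < s" using assms by (simp add: s_def)
  have "s * a = sqrt a * sqrt b" using assms by (simp add: s_def field_simps)
  moreover have "b / s = sqrt a * sqrt b"
    using assms by (simp add: s_def field_simps)
  ultimately show ?thesis using assms(1)[OF s] by simp
qed

text \<open>The quantity \<open>c * Psq c w * Bsq c H z w\<close> below controls the derivative of the fixed point map; it is
  smaller than one at every solution.\<close>
definition Bsq :: "real \<Rightarrow> real measure \<Rightarrow> complex \<Rightarrow> complex \<Rightarrow> real" where
  "Bsq c H z w = (LINT t|H. t\<^sup>2 / (cmod (- z + of_real t * rho c w))\<^sup>2)"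

text \<open>Take real parts in the equation: by \<open>Re_kernel_integral\<close> and
  \<open>Re_rho\<close>, Re w is a strictly positive term plus Re w times the factor; divide by Re
  w.\<close>

lemma contraction_factor:
  assumes H: "population_dist H" and z: "Re z < 0" and c: "0 < c" and w: "is_h c H z w"
  shows "c * Psq c w * Bsq c H z w < 1" "0 < Bsq c H z w" "0 < Psq c w"
proof -
  have H': "nonneg_dist H" using H by (simp add: population_dist_iff)
  have u: "0 < Re (- z)" using z by simp
  have rw: "0 < Re w" "w = h_map c H (- z) w" using w by (auto simp: is_h_h_map)
  have r: "0 \<le> Re (rho c w)" "rho c w \<noteq> 0" using rho_nonzero[OF c rw(1)] by auto
  have nz: "- z + of_real t * rho c w \<noteq> 0" if "0 \<le> t" for t using den_nonzero[OF u that r(1)] .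
  have P: "0 < (LINT t|H. t / (cmod (- z + of_real t * rho c w))\<^sup>2)"
    by (rule integral_pos_population[OF H integrable_kernel2(2)[OF H' u r]]) (use nz in \<open>auto intro!: divide_pos_pos\<close>)
  show B: "0 < Bsq c H z w" unfolding Bsq_def
    by (rule integral_pos_population[OF H integrable_kernel2(1)[OF H' u r]]) (use nz in \<open>auto intro!: divide_pos_pos\<close>)
  show "0 < Psq c w" unfolding Psq_def using rho_denoms_nonzero[OF denoms_nonzero_Re[OF c rw(1)]] by (intro add_pos_pos) auto
  have "Re w = Re (- z) * (LINT t|H. t / (cmod (- z + of_real t * rho c w))\<^sup>2) + Re (rho c w) * Bsq c H z w"
    by (subst rw(2)) (unfold h_map_def Bsq_def, rule Re_kernel_integral[OF H' u r])
  then have "Re (rho c w) * Bsq c H z w < Re w" using mult_pos_pos[OF u P] by linarith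
  then have "Re w * (c * Psq c w * Bsq c H z w) < Re w * 1" by (simp add: Re_rho mult_ac)
  then show "c * Psq c w * Bsq c H z w < 1" using rw(1) by (subst (asm) mult_less_cancel_left_pos) auto
qed

text \<open>\<open>Jint\<close>, \<open>Lint\<close> and \<open>Pbil\<close> are the divided
  differences that arise when the equations at (z1, w1) and (z2, w2) are subtracted. Equal arguments
  give uniqueness, z2 tending to z1 gives the derivative.\<close>

definition Jint :: "real \<Rightarrow> real measure \<Rightarrow> complex \<Rightarrow> complex \<Rightarrow> complex \<Rightarrow> complex \<Rightarrow> complex" where
  "Jint c H z1 w1 z2 w2 = (LINT t|H. of_real t / (- z1 + of_real t * rho c w1) * (of_real t / (- z2 + of_real t * rho c w2)))"

definition Lint :: "real \<Rightarrow> real measure \<Rightarrow> complex \<Rightarrow> complex \<Rightarrow> complex \<Rightarrow> complex \<Rightarrow> complex" where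
  "Lint c H z1 w1 z2 w2 = (LINT t|H. of_real t / (- z1 + of_real t * rho c w1) * (1 / (- z2 + of_real t * rho c w2)))"

definition Pbil :: "real \<Rightarrow> complex \<Rightarrow> complex \<Rightarrow> complex" where
  "Pbil c w1 w2 = 1 / ((\<i> + of_real c * w1) * (\<i> + of_real c * w2)) + 1 / ((- \<i> + of_real c * w1) * (- \<i> + of_real c * w2))"

lemma amgm_s: "0 < s \<Longrightarrow> x * y \<le> (s * x\<^sup>2 + y\<^sup>2 / s) / 2" for x y s :: real
proof -
  assume s: "0 < s"
  have "0 \<le> (s * x - y)\<^sup>2 / s" using s by simp
  also have "\<dots> = s * x\<^sup>2 + y\<^sup>2 / s - 2 * (x * y)" using s by (simp add: power2_eq_square field_simps)
  finally show ?thesis by simp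
qed

context
  fixes c H z1 w1 z2 w2
  assumes H: "population_dist H" and c: "0 < c" and z: "Re z1 < 0" "Re z2 < 0"
    and w: "is_h c H z1 w1" "is_h c H z2 w2"
begin

interpretation H: real_distribution H using H by (simp add: population_dist_def)

lemma H': "nonneg_dist H" using H by (simp add: population_dist_iff)
lemma us: "0 < Re (- z1)" "0 < Re (- z2)" using z by auto
lemma rw: "0 < Re w1" "0 < Re w2" using w by (auto simp: is_h_def)
lemma rs: "0 \<le> Re (rho c w1)" "rho c w1 \<noteq> 0" "0 \<le> Re (rho c w2)" "rho c w2 \<noteq> 0"
  using rho_nonzero[OF c rw(1)] rho_nonzero[OF c rw(2)] by auto

lemma integrable_J: "integrable H (\<lambda>t. of_real t / (- z1 + of_real t * rho c w1) * (of_real t / (- z2 + of_real t * rho c w2)))"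
proof (rule H.integrable_const_bound)
  show "AE t in H. cmod (of_real t / (- z1 + of_real t * rho c w1) * (of_real t / (- z2 + of_real t * rho c w2)))
     \<le> (2 * cmod (- z1) / (Re (- z1) * cmod (rho c w1))) * (2 * cmod (- z2) / (Re (- z2) * cmod (rho c w2)))"
    using AE_nonneg[OF H' us(1) rs(1,2)]
  proof eventually_elim
    case (elim t)
    show ?case unfolding norm_mult
      by (intro mult_mono' den_bound3 us elim rs norm_ge_zero)
  qed
qed simp

lemma integrable_L: "integrable H (\<lambda>t. of_real t / (- z1 + of_real t * rho c w1) * (1 / (- z2 + of_real t * rho c w2)))"
proof (rule H.integrable_const_bound)
  show "AE t in H. cmod (of_real t / (- z1 + of_real t * rho c w1) * (1 / (- z2 + of_real t * rho c w2)))
     \<le> (2 * cmod (- z1) / (Re (- z1) * cmod (rho c w1))) * (1 / Re (- z2))"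
    using AE_nonneg[OF H' us(1) rs(1,2)]
  proof eventually_elim
    case (elim t)
    have "cmod (1 / (- z2 + of_real t * rho c w2)) \<le> 1 / Re (- z2)"
      unfolding norm_divide norm_one
      by (rule frac_le[OF zero_le_one order_refl us(2) order_trans[OF den_Re[OF elim rs(3)] complex_Re_le_cmod]])
    then show ?case unfolding norm_mult
      by (intro mult_mono' den_bound3 us elim rs norm_ge_zero)
  qed
qed simp

lemma Jint_bound: "cmod (Jint c H z1 w1 z2 w2) \<le> sqrt (Bsq c H z1 w1) * sqrt (Bsq c H z2 w2)"
proof (rule geo_mean_le)
  fix s :: real assume s: "0 < s"
  note i = integrable_kernel2(1)[OF H' us(1) rs(1,2)] integrable_kernel2(1)[OF H' us(2) rs(3,4)]
  have "cmod (Jint c H z1 w1 z2 w2) \<le> (LINT t|H. cmod (of_real t / (- z1 + of_real t * rho c w1) * (of_real t / (- z2 + of_real t * rho c w2))))"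
    unfolding Jint_def by (rule integral_norm_bound)
  also have "\<dots> \<le> (LINT t|H. (s * (t\<^sup>2 / (cmod (- z1 + of_real t * rho c w1))\<^sup>2) + (t\<^sup>2 / (cmod (- z2 + of_real t * rho c w2))\<^sup>2) / s) / 2)"
  proof (rule integral_mono)
    show "integrable H (\<lambda>t. cmod (of_real t / (- z1 + of_real t * rho c w1) * (of_real t / (- z2 + of_real t * rho c w2))))"
      using integrable_J by (rule integrable_norm)
    show "integrable H (\<lambda>t. (s * (t\<^sup>2 / (cmod (- z1 + of_real t * rho c w1))\<^sup>2) + (t\<^sup>2 / (cmod (- z2 + of_real t * rho c w2))\<^sup>2) / s) / 2)"
      using i by (intro integrable_divide_zero Bochner_Integration.integrable_add integrable_mult_right) auto
    fix t
    show "cmod (of_real t / (- z1 + of_real t * rho c w1) * (of_real t / (- z2 + of_real t * rho c w2)))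
      \<le> (s * (t\<^sup>2 / (cmod (- z1 + of_real t * rho c w1))\<^sup>2) + (t\<^sup>2 / (cmod (- z2 + of_real t * rho c w2))\<^sup>2) / s) / 2"
      using amgm_s[OF s, of "cmod (of_real t / (- z1 + of_real t * rho c w1))" "cmod (of_real t / (- z2 + of_real t * rho c w2))"]
      by (simp add: norm_mult norm_divide power_divide)
  qed
  also have "\<dots> = (s * Bsq c H z1 w1 + Bsq c H z2 w2 / s) / 2"
  proof -
    have e: "(s * x + y / s) / 2 = (s / 2) * x + (1 / (2 * s)) * y" for x y :: real
      by (simp add: add_divide_distrib)
    show ?thesis unfolding e Bsq_def by (rule integral_lin2[OF i])
  qed
  finally show "cmod (Jint c H z1 w1 z2 w2) \<le> (s * Bsq c H z1 w1 + Bsq c H z2 w2 / s) / 2" .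
qed (use contraction_factor[OF H _ c] z w in auto)

lemma Pbil_bound: "cmod (Pbil c w1 w2) \<le> sqrt (Psq c w1) * sqrt (Psq c w2)"
proof (rule geo_mean_le)
  fix s :: real assume s: "0 < s"
  have "cmod (Pbil c w1 w2) \<le> cmod (1 / ((\<i> + of_real c * w1) * (\<i> + of_real c * w2))) + cmod (1 / ((- \<i> + of_real c * w1) * (- \<i> + of_real c * w2)))"
    unfolding Pbil_def by (rule norm_triangle_ineq)
  also have "\<dots> = (1 / cmod (\<i> + of_real c * w1)) * (1 / cmod (\<i> + of_real c * w2)) + (1 / cmod (- \<i> + of_real c * w1)) * (1 / cmod (- \<i> + of_real c * w2))"
    by (simp add: norm_divide norm_mult)
  also have "\<dots> \<le> (s * Psq c w1 + Psq c w2 / s) / 2"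
    using amgm_s[OF s, of "1 / cmod (\<i> + of_real c * w1)" "1 / cmod (\<i> + of_real c * w2)"]
      amgm_s[OF s, of "1 / cmod (- \<i> + of_real c * w1)" "1 / cmod (- \<i> + of_real c * w2)"]
    unfolding Psq_def by (simp add: power_divide distrib_left add_divide_distrib)
  finally show "cmod (Pbil c w1 w2) \<le> (s * Psq c w1 + Psq c w2 / s) / 2" .
qed (use contraction_factor[OF H _ c] z w in auto)

text \<open>Cauchy-Schwarz in both factors bounds the product by the geometric mean of the
  contraction factors at the two solutions, each below 1.\<close>

lemma PJ_less_1: "cmod (of_real c * Pbil c w1 w2 * Jint c H z1 w1 z2 w2) < 1"
proof -
  note k1 = contraction_factor[OF H z(1) c w(1)] and k2 = contraction_factor[OF H z(2) c w(2)]
  define x y where "x = c * Psq c w1 * Bsq c H z1 w1" and "y = c * Psq c w2 * Bsq c H z2 w2"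
  have xy: "0 < x" "x < 1" "0 < y" "y < 1" using k1 k2 c by (auto simp: x_def y_def)
  have "cmod (of_real c * Pbil c w1 w2 * Jint c H z1 w1 z2 w2)
     \<le> c * (sqrt (Psq c w1) * sqrt (Psq c w2)) * (sqrt (Bsq c H z1 w1) * sqrt (Bsq c H z2 w2))"
    unfolding norm_mult using c Jint_bound Pbil_bound k1 k2 by (intro mult_mono) auto
  also have "\<dots> = sqrt x * sqrt y"
    using c by (simp add: x_def y_def real_sqrt_mult)
  also have "\<dots> < 1 * 1" using xy by (intro mult_strict_mono) auto
  finally show ?thesis by simp
qed

lemma difference_identity:
  "(w1 - w2) * (1 - of_real c * Pbil c w1 w2 * Jint c H z1 w1 z2 w2) = (z1 - z2) * Lint c H z1 w1 z2 w2"
proof -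
  let ?d1 = "\<lambda>t. - z1 + of_real t * rho c w1" and ?d2 = "\<lambda>t. - z2 + of_real t * rho c w2"
  note k = integrable_kernel[OF H' us(1) rs(1,2)] integrable_kernel[OF H' us(2) rs(3,4)]
  have "w1 - w2 = (LINT t|H. of_real t / ?d1 t) - (LINT t|H. of_real t / ?d2 t)"
    using w unfolding is_h_h_map h_map_def by metis
  also have "\<dots> = (LINT t|H. of_real t / ?d1 t - of_real t / ?d2 t)" using k by simp
  also have "\<dots> = (LINT t|H. (z1 - z2) * (of_real t / ?d1 t * (1 / ?d2 t)) + (rho c w2 - rho c w1) * (of_real t / ?d1 t * (of_real t / ?d2 t)))"
  proof (rule integral_cong_AE)
    show "AE t in H. of_real t / ?d1 t - of_real t / ?d2 t
      = (z1 - z2) * (of_real t / ?d1 t * (1 / ?d2 t)) + (rho c w2 - rho c w1) * (of_real t / ?d1 t * (of_real t / ?d2 t))"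
      using AE_nonneg[OF H' us(1) rs(1,2)]
    proof eventually_elim
      case (elim t)
      have "?d1 t \<noteq> 0" "?d2 t \<noteq> 0" using den_nonzero[OF us(1) elim rs(1)] den_nonzero[OF us(2) elim rs(3)] .
      then have "of_real t / ?d1 t - of_real t / ?d2 t = of_real t * (?d2 t - ?d1 t) / (?d1 t * ?d2 t)"
        by (simp add: diff_frac_eq right_diff_distrib mult.commute)
      also have "?d2 t - ?d1 t = (z1 - z2) + of_real t * (rho c w2 - rho c w1)" by (simp add: algebra_simps)
      finally show ?case by (simp add: distrib_left add_divide_distrib mult_ac)
    qed
  qed simp_all
  also have "\<dots> = (z1 - z2) * Lint c H z1 w1 z2 w2 + (rho c w2 - rho c w1) * Jint c H z1 w1 z2 w2"
    unfolding Lint_def Jint_def by (rule integral_lin2[OF integrable_L integrable_J])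
  also have "rho c w2 - rho c w1 = of_real c * (w1 - w2) * Pbil c w1 w2"
    unfolding Pbil_def using denoms_nonzero_Re[OF c rw(1)] denoms_nonzero_Re[OF c rw(2)] by (rule rho_diff)
  finally show ?thesis by (simp add: algebra_simps)
qed

end

lemma is_h_unique:
  assumes "population_dist H" "0 < c" "Re z < 0" "is_h c H z w1" "is_h c H z w2"
  shows "w1 = w2"
proof -
  have "of_real c * Pbil c w1 w2 * Jint c H z w1 z w2 \<noteq> 1"
    using PJ_less_1[OF assms(1,2,3,3,4,5)] by auto
  then show ?thesis using difference_identity[OF assms(1,2,3,3,4,5)] by simp
qed

section \<open>Limits of approximate solutions\<close>

text \<open>Skorokhod's representation turns weak convergence into pointwise convergence on one
  space, where dominated convergence copes with an integrand that changes with
  \<open>n\<close>.\<close>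

lemma weak_conv_varying_integral:
  fixes f :: "nat \<Rightarrow> real \<Rightarrow> 'b :: {banach, second_countable_topology}"
  assumes \<mu>: "\<And>n. real_distribution (\<mu> n)" "real_distribution H" "weak_conv_m \<mu> H"
    and m: "\<And>n. f n \<in> borel_measurable borel" "g \<in> borel_measurable borel"
    and b: "\<And>n t. norm (f n t) \<le> B"
    and l: "\<And>s t. s \<longlonglongrightarrow> t \<Longrightarrow> (\<lambda>n. f n (s n)) \<longlonglongrightarrow> g t"
  shows "(\<lambda>n. LINT t|\<mu> n. f n t) \<longlonglongrightarrow> (LINT t|H. g t)"
proof -
  obtain \<Omega> :: "real measure" and Y' :: "nat \<Rightarrow> real \<Rightarrow> real" and Y :: "real \<Rightarrow> real"
    where \<Omega>: "prob_space \<Omega>" and Y': "\<And>n. Y' n \<in> measurable \<Omega> borel" "\<And>n. distr \<Omega> borel (Y' n) = \<mu> n"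
      and Y: "Y \<in> measurable \<Omega> lborel" "distr \<Omega> borel Y = H"
      and lim: "\<And>x. x \<in> space \<Omega> \<Longrightarrow> (\<lambda>n. Y' n x) \<longlonglongrightarrow> Y x"
    using Skorohod[OF \<mu>] by blast
  interpret \<Omega>: prob_space \<Omega> by fact
  have Yb: "Y \<in> borel_measurable \<Omega>" using Y(1) by simp
  have 1: "(LINT t|\<mu> n. f n t) = (LINT x|\<Omega>. f n (Y' n x))" for n
    unfolding Y'(2)[symmetric] by (rule integral_distr[OF Y'(1) m(1)])
  have 2: "(LINT t|H. g t) = (LINT x|\<Omega>. g (Y x))"
    unfolding Y(2)[symmetric] by (rule integral_distr[OF Yb m(2)])
  show ?thesis unfolding 1 2
  proof (rule integral_dominated_convergence[where w = "\<lambda>_. B"])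
    show "(\<lambda>x. g (Y x)) \<in> borel_measurable \<Omega>" using m(2) Yb by measurable
    show "(\<lambda>x. f n (Y' n x)) \<in> borel_measurable \<Omega>" for n using m(1) Y'(1) by measurable
    show "AE x in \<Omega>. (\<lambda>n. f n (Y' n x)) \<longlonglongrightarrow> g (Y x)" by (intro AE_I2 l lim)
  qed (use b in auto)
qed

text \<open>Replacing t by max 0 t extends the kernels to all reals together with their bounds; on
  the negative axis the denominators could vanish.\<close>

lemma nonneg_integral_max:
  fixes f :: "real \<Rightarrow> 'b :: {banach, second_countable_topology}"
  assumes H: "nonneg_dist H" and f: "f \<in> borel_measurable borel"
  shows "(LINT t|H. f (max 0 t)) = (LINT t|H. f t)"
proof -
  interpret real_distribution H using H by (simp add: nonneg_dist_def)
  show ?thesis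
  proof (rule integral_cong_AE)
    have "AE t in H. 0 \<le> t" using H by (simp add: nonneg_dist_def)
    then show "AE t in H. f (max 0 t) = f t" by (auto elim!: eventually_mono)
  qed (use f in measurable)
qed

lemma h_map_bound:
  assumes H: "nonneg_dist H" and u: "0 < Re u" and r: "0 \<le> Re (rho c w)" "rho c w \<noteq> 0"
  shows "cmod (h_map c H u w) \<le> 2 * cmod u / (Re u * cmod (rho c w))"
proof -
  interpret real_distribution H using H by (simp add: nonneg_dist_def)
  have "cmod (h_map c H u w) \<le> (LINT t|H. cmod (of_real t / (u + of_real t * rho c w)))"
    unfolding h_map_def by (rule integral_norm_bound)
  also have "\<dots> \<le> (LINT t|H. 2 * cmod u / (Re u * cmod (rho c w)))"
  proof (rule integral_mono_AE)
    show "AE t in H. cmod (of_real t / (u + of_real t * rho c w)) \<le> 2 * cmod u / (Re u * cmod (rho c w))"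
      using AE_nonneg[OF H u r] by eventually_elim (rule den_bound3[OF u _ r])
  qed (use integrable_kernel[OF H u r] in auto)
  finally show ?thesis using prob_space by simp
qed

lemma Re_kernel_nonneg:
  assumes "0 < Re u" "0 \<le> t" "0 \<le> Re r"
  shows "0 \<le> Re (of_real t / (u + of_real t * r))"
proof -
  have "Re (of_real t / (u + of_real t * r)) = t * Re (1 / (u + of_real t * r))"
    using Re_complex_div_gt_0 by (simp add: Re_divide)
  also have "\<dots> = t * (Re u + t * Re r) / (cmod (u + of_real t * r))\<^sup>2" unfolding Re_inverse_eq by simp
  finally show ?thesis using assms by simp
qed

lemma weak_conv_subseq: "weak_conv_m \<mu> H \<Longrightarrow> strict_mono r \<Longrightarrow> weak_conv_m (\<mu> \<circ> r) H"
  unfolding weak_conv_m_def weak_conv_def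
  by (auto intro: LIMSEQ_subseq_LIMSEQ[unfolded o_def])

lemma tendsto_rho:
  assumes "cs \<longlonglongrightarrow> c" "w \<longlonglongrightarrow> l" "1 + (of_real c * l)\<^sup>2 \<noteq> 0" "\<And>n. 1 + (of_real (cs n) * w n)\<^sup>2 \<noteq> 0"
  shows "(\<lambda>n. rho (cs n) (w n)) \<longlonglongrightarrow> rho c l"
  unfolding rho_eq[OF assms(3)] rho_eq[OF assms(4)]
  by (intro tendsto_intros assms)

text \<open>Ratio, argument and law all vary, so that one limit theorem serves existence,
  analyticity, continuity in the law and the random matrices. In the last case only Re w >= 0 is
  known. If w n = 0, then rho vanishes and the kernel is linear in t; this is why integrability is
  assumed.\<close>

locale approx_fixpoint =
  fixes cs :: "nat \<Rightarrow> real" and c :: real and us :: "nat \<Rightarrow> complex" and u :: complex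
    and Hs :: "nat \<Rightarrow> real measure" and H :: "real measure" and w :: "nat \<Rightarrow> complex"
  assumes cs: "cs \<longlonglongrightarrow> c" "\<And>n. 0 < cs n" "0 < c"
    and us: "us \<longlonglongrightarrow> u" "\<And>n. 0 < Re (us n)" "0 < Re u"
    and Hs: "\<And>n. nonneg_dist (Hs n)" "population_dist H" "weak_conv_m Hs H"
    and w: "\<And>n. 0 \<le> Re (w n)" "\<And>n. 1 + (of_real (cs n) * w n)\<^sup>2 \<noteq> 0"
    and int: "\<And>n. integrable (Hs n) (\<lambda>t. of_real t / (us n + of_real t * rho (cs n) (w n)))"
    and approx: "(\<lambda>n. w n - h_map (cs n) (Hs n) (us n) (w n)) \<longlonglongrightarrow> 0"
begin

lemma subseq: "strict_mono r \<Longrightarrow> approx_fixpoint (cs \<circ> r) c (us \<circ> r) u (Hs \<circ> r) H (w \<circ> r)"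
  using cs us Hs w int approx weak_conv_subseq[of Hs H r]
  by unfold_locales (auto intro: LIMSEQ_subseq_LIMSEQ dest: LIMSEQ_subseq_LIMSEQ[of _ _ r] simp: o_def)

lemma Hs': "\<And>n. real_distribution (Hs n)" "real_distribution H" "nonneg_dist H"
  using Hs by (auto simp: nonneg_dist_def population_dist_def)

lemma Re_rhos: "0 \<le> Re (rho (cs n) (w n))" using cs(2)[of n] w(1)[of n] by (intro Re_rho_nonneg) auto

lemma rhos_0: "rho (cs n) (w n) = 0 \<longleftrightarrow> w n = 0"
  unfolding rho_eq[OF w(2)] using w(2)[of n] cs(2)[of n] by auto

lemma us_nz: "us n \<noteq> 0" "u \<noteq> 0" using us(2)[of n] us(3) by auto

text \<open>As w tends to infinity, rho w tends to 2 / c, so the kernel divided by w is bounded and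
  tends to 0 pointwise. Hence h_map / w tends to 0, whereas the approximate equation wants
  1.\<close>

lemma no_escape:
  assumes v: "(\<lambda>n. 1 / (1 + w n)) \<longlonglongrightarrow> 0"
  shows False
proof -
  have nz: "1 + w n \<noteq> 0" for n using w(1)[of n] by (auto simp: complex_eq_iff)
  have "(\<lambda>n. (1 / (1 + w n)) / (1 - 1 / (1 + w n))) \<longlonglongrightarrow> 0 / (1 - 0)"
    by (intro tendsto_intros v) simp
  moreover have "(1 / (1 + w n)) / (1 - 1 / (1 + w n)) = 1 / w n" for n
    using nz[of n] by (simp add: divide_simps)
  ultimately have iw: "(\<lambda>n. 1 / w n) \<longlonglongrightarrow> 0" by simp
  have ev: "eventually (\<lambda>n. w n \<noteq> 0) sequentially"
  proof -
    have "(\<lambda>n. 1 / (1 + w n)) \<longlonglongrightarrow> 0" by fact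
    then have "eventually (\<lambda>n. dist (1 / (1 + w n)) 0 < 1) sequentially" by (rule tendstoD) simp
    then show ?thesis by eventually_elim auto
  qed
  let ?\<rho> = "\<lambda>n. rho (cs n) (w n)"
  have rw: "(\<lambda>n. ?\<rho> n * w n) \<longlonglongrightarrow> of_real (2 / c)"
  proof (rule Lim_transform_eventually)
    have "(\<lambda>n. 2 * of_real (cs n) / ((1 / w n)\<^sup>2 + (of_real (cs n))\<^sup>2)) \<longlonglongrightarrow> 2 * of_real c / (0\<^sup>2 + (of_real c)\<^sup>2)"
      using cs by (intro tendsto_intros iw tendsto_of_real) auto
    also have "2 * complex_of_real c / (0\<^sup>2 + (of_real c)\<^sup>2) = of_real (2 / c)"
      using cs(3) by (simp add: power2_eq_square)
    finally show "(\<lambda>n. 2 * of_real (cs n) / ((1 / w n)\<^sup>2 + (of_real (cs n))\<^sup>2)) \<longlonglongrightarrow> of_real (2 / c)" .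
    show "\<forall>\<^sub>F n in sequentially. 2 * of_real (cs n) / ((1 / w n)\<^sup>2 + (of_real (cs n))\<^sup>2) = ?\<rho> n * w n"
      using ev
    proof eventually_elim
      case (elim n)
      have "(1 / w n)\<^sup>2 + (of_real (cs n))\<^sup>2 = (1 + (of_real (cs n) * w n)\<^sup>2) / (w n)\<^sup>2"
        using elim by (simp add: power_divide power_mult_distrib add_divide_distrib)
      then show ?case unfolding rho_eq[OF w(2)] using elim by (simp add: power2_eq_square)
    qed
  qed
  have r0: "?\<rho> \<longlonglongrightarrow> 0"
  proof (rule Lim_transform_eventually)
    show "(\<lambda>n. (?\<rho> n * w n) * (1 / w n)) \<longlonglongrightarrow> 0" using tendsto_mult[OF rw iw] by simp
    show "\<forall>\<^sub>F n in sequentially. (?\<rho> n * w n) * (1 / w n) = ?\<rho> n" using ev by eventually_elim simp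
  qed
  define k where "k = (\<lambda>n t. of_real (max 0 t) / (us n + of_real (max 0 t) * ?\<rho> n) * (1 / w n))"
  have "(\<lambda>n. 2 * cmod (us n) / (Re (us n) * cmod (?\<rho> n * w n))) \<longlonglongrightarrow> 2 * cmod u / (Re u * cmod (of_real (2 / c)))"
    using cs us by (intro tendsto_intros us rw) auto
  then have "Bseq (\<lambda>n. 2 * cmod (us n) / (Re (us n) * cmod (?\<rho> n * w n)))" by (rule convergent_imp_Bseq[OF convergentI])
  then obtain B where B: "0 < B" "\<And>n. \<bar>2 * cmod (us n) / (Re (us n) * cmod (?\<rho> n * w n))\<bar> \<le> B"
    unfolding Bseq_def by auto
  have kB: "cmod (k n t) \<le> B" for n t
  proof (cases "w n = 0")
    case False
    have "cmod (k n t) \<le> 2 * cmod (us n) / (Re (us n) * cmod (?\<rho> n)) * (1 / cmod (w n))"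
      unfolding k_def norm_mult using False
      by (intro mult_mono' den_bound3 us(2) Re_rhos norm_ge_zero) (auto simp: rhos_0 norm_divide)
    also have "\<dots> = 2 * cmod (us n) / (Re (us n) * cmod (?\<rho> n * w n))" by (simp add: norm_mult)
    also have "\<dots> \<le> B" by (rule order_trans[OF abs_ge_self B(2)])
    finally show ?thesis .
  qed (use B(1) in \<open>simp add: k_def\<close>)
  have "(\<lambda>n. LINT t|Hs n. k n t) \<longlonglongrightarrow> (LINT t|H. 0)"
  proof (rule weak_conv_varying_integral[OF Hs'(1,2) Hs(3) _ _ kB])
    show "k n \<in> borel_measurable borel" for n unfolding k_def by measurable
    fix s :: "nat \<Rightarrow> real" and t assume s: "s \<longlonglongrightarrow> t"
    have "(\<lambda>n. k n (s n)) \<longlonglongrightarrow> of_real (max 0 t) / (u + of_real (max 0 t) * 0) * 0"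
      unfolding k_def using us_nz by (intro tendsto_intros s us r0 iw) auto
    then show "(\<lambda>n. k n (s n)) \<longlonglongrightarrow> 0" by simp
  qed simp
  moreover have "(LINT t|Hs n. k n t) = h_map (cs n) (Hs n) (us n) (w n) * (1 / w n)" for n
    unfolding k_def h_map_def using nonneg_integral_max[OF Hs(1), of "\<lambda>t. of_real t / (us n + of_real t * ?\<rho> n)" n]
    by (subst integral_mult_left_zero) simp
  ultimately have "(\<lambda>n. h_map (cs n) (Hs n) (us n) (w n) * (1 / w n)) \<longlonglongrightarrow> 0" by simp
  moreover have "(\<lambda>n. (w n - h_map (cs n) (Hs n) (us n) (w n)) * (1 / w n)) \<longlonglongrightarrow> 0"
    using tendsto_mult[OF approx iw] by simp
  ultimately have "(\<lambda>n. h_map (cs n) (Hs n) (us n) (w n) * (1 / w n) + (w n - h_map (cs n) (Hs n) (us n) (w n)) * (1 / w n)) \<longlonglongrightarrow> 0 + 0"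
    by (rule tendsto_add)
  moreover have "\<forall>\<^sub>F n in sequentially. h_map (cs n) (Hs n) (us n) (w n) * (1 / w n) + (w n - h_map (cs n) (Hs n) (us n) (w n)) * (1 / w n) = 1"
    using ev by eventually_elim (simp add: field_simps)
  ultimately have "(\<lambda>n. 1 :: complex) \<longlonglongrightarrow> 0" using Lim_transform_eventually by fastforce
  then show False using LIMSEQ_unique[OF tendsto_const] by fastforce
qed

text \<open>Besides infinity, the boundary points to exclude are the poles of rho and l = 0, where
  the uniform kernel bound fails. At any other limit the kernels are eventually bounded and the
  equation passes to the limit.\<close>

lemma limit_is_h:
  assumes l: "w \<longlonglongrightarrow> l"
  shows "is_h c H (- u) l"
proof -
  let ?\<rho> = "\<lambda>n. rho (cs n) (w n)"
  have Rel: "0 \<le> Re l" using tendsto_lowerbound[OF tendsto_Re[OF l]] w(1) by (simp add: always_eventually)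
  have Gl: "(\<lambda>n. h_map (cs n) (Hs n) (us n) (w n)) \<longlonglongrightarrow> l"
    using tendsto_diff[OF l approx] by simp
  \<comment> \<open>At a pole rho blows up, so the bound for \<open>h_map\<close> tends to 0 and
    forces l = 0, which is not a pole.\<close>
  have nz: "1 + (of_real c * l)\<^sup>2 \<noteq> 0"
  proof
    assume z: "1 + (of_real c * l)\<^sup>2 = 0"
    then have l0: "l \<noteq> 0" by auto
    have "(\<lambda>n. (1 + (of_real (cs n) * w n)\<^sup>2) / (2 * (of_real (cs n) * w n))) \<longlonglongrightarrow> (1 + (of_real c * l)\<^sup>2) / (2 * (of_real c * l))"
      using l0 cs by (intro tendsto_intros l tendsto_of_real cs) auto
    then have "(\<lambda>n. 1 / ?\<rho> n) \<longlonglongrightarrow> 0" unfolding rho_eq[OF w(2)] z by simp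
    then have "(\<lambda>n. 2 * cmod (us n) / Re (us n) * cmod (1 / ?\<rho> n)) \<longlonglongrightarrow> 2 * cmod u / Re u * cmod 0"
      using us by (intro tendsto_intros us) auto
    then have b0: "(\<lambda>n. 2 * cmod (us n) / Re (us n) * cmod (1 / ?\<rho> n)) \<longlonglongrightarrow> 0" by simp
    have ev: "\<forall>\<^sub>F n in sequentially. w n \<noteq> 0" using tendsto_imp_eventually_ne[OF l l0] .
    have "(\<lambda>n. h_map (cs n) (Hs n) (us n) (w n)) \<longlonglongrightarrow> 0"
    proof (rule Lim_null_comparison[OF _ b0])
      show "\<forall>\<^sub>F n in sequentially. cmod (h_map (cs n) (Hs n) (us n) (w n)) \<le> 2 * cmod (us n) / Re (us n) * cmod (1 / ?\<rho> n)"
        using ev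
      proof eventually_elim
        case (elim n)
        then show ?case using h_map_bound[OF Hs(1) us(2) Re_rhos, of n n n] by (simp add: rhos_0 norm_divide)
      qed
    qed
    then show False using Gl l0 LIMSEQ_unique by blast
  qed
  have rl: "?\<rho> \<longlonglongrightarrow> rho c l" by (rule tendsto_rho[OF cs(1) l nz w(2)])
  have Rr: "0 \<le> Re (rho c l)" using cs(3) Rel by (intro Re_rho_nonneg) auto
  have r0: "rho c l \<noteq> 0"
  proof
    assume r0: "rho c l = 0"
    then have l0: "l = 0" unfolding rho_eq[OF nz] using nz cs(3) by auto
    \<comment> \<open>Capping the real part at 1 gives a bounded minorant, although the kernels lose
      their bound as rho tends to 0. Its limit has a positive integral, while Re
      \<open>h_map\<close> would have to tend to 0.\<close>
    define g where "g = (\<lambda>n t. min 1 (Re (of_real (max 0 t) / (us n + of_real (max 0 t) * ?\<rho> n))))"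
    have g0: "0 \<le> g n t" for n t unfolding g_def using Re_kernel_nonneg[OF us(2) _ Re_rhos, of "max 0 t" n n] by simp
    define gl where "gl = (\<lambda>t. min 1 (Re (of_real (max 0 t) / u)))"
    have "(\<lambda>n. LINT t|Hs n. g n t) \<longlonglongrightarrow> (LINT t|H. gl t)"
    proof (rule weak_conv_varying_integral[OF Hs'(1,2) Hs(3)])
      show "g n \<in> borel_measurable borel" for n unfolding g_def by measurable
      show "gl \<in> borel_measurable borel" unfolding gl_def by measurable
      show "norm (g n t) \<le> 1" for n t using g0[of n t] by (simp add: g_def)
      fix s :: "nat \<Rightarrow> real" and t assume s: "s \<longlonglongrightarrow> t"
      have "(\<lambda>n. g n (s n)) \<longlonglongrightarrow> min 1 (Re (of_real (max 0 t) / (u + of_real (max 0 t) * rho c l)))"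
        unfolding g_def using us_nz r0 by (intro tendsto_intros s us rl) auto
      then show "(\<lambda>n. g n (s n)) \<longlonglongrightarrow> gl t" by (simp add: gl_def r0)
    qed
    moreover have "(LINT t|Hs n. g n t) \<le> Re (h_map (cs n) (Hs n) (us n) (w n))" for n
    proof -
      interpret real_distribution "Hs n" by (rule Hs')
      have "(LINT t|Hs n. g n t) \<le> (LINT t|Hs n. Re (of_real t / (us n + of_real t * ?\<rho> n)))"
      proof (rule integral_mono_AE)
        show "integrable (Hs n) (g n)" using g0[of n]
          by (intro integrable_const_bound[of _ 1]) (auto simp: g_def)
        show "AE t in Hs n. g n t \<le> Re (of_real t / (us n + of_real t * ?\<rho> n))"
          using Hs(1)[of n] unfolding nonneg_dist_def g_def by (auto elim!: eventually_mono)
      qed (use int in auto)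
      also have "\<dots> = Re (h_map (cs n) (Hs n) (us n) (w n))" unfolding h_map_def by (rule integral_Re[OF int])
      finally show ?thesis .
    qed
    moreover have "(\<lambda>n. Re (h_map (cs n) (Hs n) (us n) (w n))) \<longlonglongrightarrow> 0" using tendsto_Re[OF Gl] l0 by simp
    ultimately have "(LINT t|H. gl t) \<le> 0" by (meson LIMSEQ_le)
    moreover have "0 < (LINT t|H. gl t)"
    proof (rule integral_pos_population[OF Hs(2)])
      interpret real_distribution H by (rule Hs')
      define k where "k = Re u / (cmod u)\<^sup>2"
      have Reu: "Re (of_real t / u) = t * k" for t
        by (simp add: Re_divide cmod_power2 k_def)
      have p: "0 < k" unfolding k_def using us(3) us_nz by auto
      show "integrable H gl"
      proof (rule integrable_const_bound[of _ 1])
        have "0 \<le> max 0 t * k" for t using p by simp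
        then show "AE t in H. norm (gl t) \<le> 1" unfolding gl_def Reu by (auto simp: abs_le_iff min_def)
      qed (simp add: gl_def)
      show "0 \<le> t \<Longrightarrow> 0 \<le> gl t" "0 < t \<Longrightarrow> 0 < gl t" for t using p by (auto simp: gl_def Reu)
    qed
    ultimately show False by simp
  qed
  \<comment> \<open>The value 0 for vanishing rho concerns finitely many \<open>n\<close> only and
    keeps the bound \<open>B\<close> valid for all of them.\<close>
  define f where "f = (\<lambda>n t. if ?\<rho> n = 0 then 0 else of_real (max 0 t) / (us n + of_real (max 0 t) * ?\<rho> n))"
  have ev: "\<forall>\<^sub>F n in sequentially. ?\<rho> n \<noteq> 0" using tendsto_imp_eventually_ne[OF rl r0] .
  have "(\<lambda>n. 2 * cmod (us n) / (Re (us n) * cmod (?\<rho> n))) \<longlonglongrightarrow> 2 * cmod u / (Re u * cmod (rho c l))"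
    using us r0 by (intro tendsto_intros us rl) auto
  then have "Bseq (\<lambda>n. 2 * cmod (us n) / (Re (us n) * cmod (?\<rho> n)))" by (rule convergent_imp_Bseq[OF convergentI])
  then obtain B where B: "0 < B" "\<And>n. \<bar>2 * cmod (us n) / (Re (us n) * cmod (?\<rho> n))\<bar> \<le> B"
    unfolding Bseq_def by auto
  have "(\<lambda>n. LINT t|Hs n. f n t) \<longlonglongrightarrow> (LINT t|H. of_real (max 0 t) / (u + of_real (max 0 t) * rho c l))"
  proof (rule weak_conv_varying_integral[OF Hs'(1,2) Hs(3)])
    show "f n \<in> borel_measurable borel" for n unfolding f_def by measurable
    show "cmod (f n t) \<le> B" for n t
    proof (cases "?\<rho> n = 0")
      case False
      show ?thesis unfolding f_def using False
        by simp (rule order_trans[OF den_bound3[OF us(2) _ Re_rhos False] order_trans[OF abs_ge_self B(2)]], simp)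
    qed (use B(1) in \<open>simp add: f_def\<close>)
    fix s :: "nat \<Rightarrow> real" and t assume s: "s \<longlonglongrightarrow> t"
    show "(\<lambda>n. f n (s n)) \<longlonglongrightarrow> of_real (max 0 t) / (u + of_real (max 0 t) * rho c l)"
    proof (rule Lim_transform_eventually)
      show "(\<lambda>n. of_real (max 0 (s n)) / (us n + of_real (max 0 (s n)) * ?\<rho> n)) \<longlonglongrightarrow> of_real (max 0 t) / (u + of_real (max 0 t) * rho c l)"
        using den_nonzero[OF us(3) _ Rr, of "max 0 t"] by (intro tendsto_intros s us rl) auto
      show "\<forall>\<^sub>F n in sequentially. of_real (max 0 (s n)) / (us n + of_real (max 0 (s n)) * ?\<rho> n) = f n (s n)"
        using ev by eventually_elim (simp add: f_def)
    qed
  qed measurable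
  moreover have "(LINT t|H. of_real (max 0 t) / (u + of_real (max 0 t) * rho c l)) = h_map c H u l"
    unfolding h_map_def by (rule nonneg_integral_max[OF Hs'(3), of "\<lambda>t. of_real t / (u + of_real t * rho c l)"]) measurable
  moreover have "\<forall>\<^sub>F n in sequentially. (LINT t|Hs n. f n t) = h_map (cs n) (Hs n) (us n) (w n)"
    using ev
  proof eventually_elim
    case (elim n)
    then show ?case unfolding f_def h_map_def
      using nonneg_integral_max[OF Hs(1), of "\<lambda>t. of_real t / (us n + of_real t * ?\<rho> n)" n] by simp
  qed
  ultimately have "(\<lambda>n. h_map (cs n) (Hs n) (us n) (w n)) \<longlonglongrightarrow> h_map c H u l"
    using Lim_transform_eventually by force
  then have e: "l = h_map c H u l" using Gl LIMSEQ_unique by blast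
  \<comment> \<open>Strict positivity of the real part does not survive a limit; it is recovered
    from the exact equation for \<open>l\<close>.\<close>
  have P: "0 < (LINT t|H. t / (cmod (u + of_real t * rho c l))\<^sup>2)"
    by (rule integral_pos_population[OF Hs(2) integrable_kernel2(2)[OF Hs'(3) us(3) Rr r0]])
       (use den_nonzero[OF us(3) _ Rr] in \<open>auto intro!: divide_pos_pos\<close>)
  have P2: "0 \<le> (LINT t|H. t\<^sup>2 / (cmod (u + of_real t * rho c l))\<^sup>2)" by (intro integral_nonneg_AE) auto
  have "0 < Re (h_map c H u l)"
    unfolding h_map_def Re_kernel_integral[OF Hs'(3) us(3) Rr r0]
    using mult_pos_pos[OF us(3) P] mult_nonneg_nonneg[OF Rr P2] by linarith
  then show ?thesis unfolding is_h_h_map using e by simp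
qed

text \<open>The map from w to 1 / (1 + w) sends the closed right half-plane into the unit disc, with
  infinity corresponding to 0; this supplies the compactness.\<close>

lemma subseq_limit: "\<exists>r l. strict_mono r \<and> is_h c H (- u) l \<and> (w \<circ> r) \<longlonglongrightarrow> l"
proof -
  have nz: "1 \<le> cmod (1 + w n)" for n using complex_Re_le_cmod[of "1 + w n"] w(1)[of n] by simp
  have nz0: "1 + w n \<noteq> 0" for n
  proof
    assume "1 + w n = 0"
    then show False using nz[of n] by simp
  qed
  have "bounded (range (\<lambda>n. 1 / (1 + w n)))"
    by (rule boundedI[of _ 1]) (use nz in \<open>auto simp: norm_divide divide_le_eq_1\<close>)
  then obtain v r where r: "strict_mono r" "((\<lambda>n. 1 / (1 + w n)) \<circ> r) \<longlonglongrightarrow> v"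
    using bounded_imp_convergent_subsequence by blast
  interpret s: approx_fixpoint "cs \<circ> r" c "us \<circ> r" u "Hs \<circ> r" H "w \<circ> r" by (rule subseq[OF r(1)])
  have "v \<noteq> 0" using s.no_escape r(2) by (auto simp: o_def)
  have "(\<lambda>n. 1 / (1 / (1 + w (r n))) - 1) \<longlonglongrightarrow> 1 / v - 1"
    using r(2) \<open>v \<noteq> 0\<close> by (intro tendsto_intros) (auto simp: o_def)
  then have "(w \<circ> r) \<longlonglongrightarrow> 1 / v - 1" using nz0 by (simp add: o_def)
  then show ?thesis using s.limit_is_h r(1) by blast
qed

theorem limit: "is_h c H (- u) l \<Longrightarrow> w \<longlonglongrightarrow> l"
proof (rule ccontr)
  assume l: "is_h c H (- u) l" and n: "\<not> w \<longlonglongrightarrow> l"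
  then obtain e where e: "e > 0" "\<not> (\<forall>\<^sub>F n in sequentially. dist (w n) l < e)" unfolding tendsto_iff by blast
  then have inf: "infinite {n. \<not> dist (w n) l < e}"
    unfolding eventually_sequentially infinite_nat_iff_unbounded_le by auto
  then obtain r :: "nat \<Rightarrow> nat" where r: "strict_mono r" "\<And>n. \<not> dist (w (r n)) l < e"
    using infinite_enumerate[OF inf] by auto
  interpret s: approx_fixpoint "cs \<circ> r" c "us \<circ> r" u "Hs \<circ> r" H "w \<circ> r" by (rule subseq[OF r(1)])
  obtain r' l' where r': "strict_mono r'" "is_h c H (- u) l'" "(w \<circ> r \<circ> r') \<longlonglongrightarrow> l'"
    using s.subseq_limit by blast
  have "l' = l" by (rule is_h_unique[OF Hs(2) cs(3) _ r'(2) l]) (use us in simp)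
  then have "\<forall>\<^sub>F n in sequentially. dist ((w \<circ> r \<circ> r') n) l < e" using r'(3) e(1) by (auto dest: tendstoD)
  then show False using r(2) by (auto simp: eventually_sequentially)
qed

end

section \<open>Existence of solutions\<close>

context
  fixes H :: "real measure" and M :: real
  assumes H: "nonneg_dist H" and M: "0 < M"
begin

interpretation H: real_distribution H using H by (simp add: nonneg_dist_def)

text \<open>Capping at \<open>M\<close> makes the kernel bounded by M / Re u on the whole
  half-plane, also where rho is small.\<close>

definition "truncated_dist = distr H borel (\<lambda>t. min t M)"

lemma truncated_dist_dist: "nonneg_dist truncated_dist"
  unfolding nonneg_dist_def
proof
  show "real_distribution truncated_dist" unfolding truncated_dist_def by (rule H.real_distribution_distr) simp
  have "AE t in H. 0 \<le> min t M" using H M by (auto simp: nonneg_dist_def elim!: eventually_mono)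
  then show "AE t in truncated_dist. 0 \<le> t" unfolding truncated_dist_def by (subst AE_distr_iff) auto
qed

lemma cdf_truncated_dist: "x < M \<Longrightarrow> cdf truncated_dist x = cdf H x"
  unfolding cdf_def truncated_dist_def by (subst measure_distr) (auto intro!: arg_cong[of _ _ "measure H"])

lemma h_map_truncated_dist: "h_map c truncated_dist u w = (LINT t|H. of_real (min t M) / (u + of_real (min t M) * rho c w))"
  unfolding h_map_def truncated_dist_def by (subst integral_distr) auto

text \<open>Brouwer's theorem on the part Re w >= e of a disc: the kernel has non-negative real
  part, so adding \<open>e\<close> keeps the image there, away from the poles of rho, and the map is
  continuous.\<close>

lemma perturbed_fixpoint:
  assumes c: "0 < c" and u: "0 < Re u" and e: "0 < e" "e \<le> 1"
  shows "\<exists>w. e \<le> Re w \<and> w = h_map c truncated_dist u w + of_real e"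
proof -
  let ?S = "{w. e \<le> Re w} \<inter> cball 0 (M / Re u + 1)"
  let ?k = "\<lambda>w t. of_real (min t M) / (u + of_real (min t M) * rho c w)"
  have n: "AE t in H. 0 \<le> min t M" using H M by (auto simp: nonneg_dist_def elim!: eventually_mono)
  have b: "AE t in H. cmod (?k w t) \<le> M / Re u" if "0 \<le> Re w" for w
    using n
  proof eventually_elim
    case (elim t)
    have "cmod (?k w t) \<le> min t M / Re u" using Re_rho_nonneg[of c w] c that by (intro den_bound1 u elim) auto
    also have "\<dots> \<le> M / Re u" using u by (intro divide_right_mono) auto
    finally show ?case .
  qed
  have i: "integrable H (?k w)" if "0 \<le> Re w" for w
    using b[OF that] by (intro H.integrable_const_bound[of _ "M / Re u"]) auto
  have "continuous_on ?S (\<lambda>w. h_map c truncated_dist u w + of_real e)"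
    unfolding h_map_truncated_dist
  proof (intro continuous_on_add continuous_on_const, unfold continuous_on_sequentially, intro ballI allI impI, elim conjE)
    fix w and v :: "nat \<Rightarrow> complex"
    assume w: "w \<in> ?S" and v: "\<forall>n. v n \<in> ?S" "v \<longlonglongrightarrow> w"
    have rv: "0 < Re (v n)" for n using spec[OF v(1), of n] e(1) by auto
    have "0 < Re w" using w e(1) by auto
    then have r: "(\<lambda>n. rho c (v n)) \<longlonglongrightarrow> rho c w"
      by (intro tendsto_rho[OF tendsto_const v(2)] denoms_nonzero_Re[OF c] rv)
    show "((\<lambda>w. LINT t|H. ?k w t) \<circ> v) \<longlonglongrightarrow> (LINT t|H. ?k w t)"
      unfolding o_def
    proof (rule integral_dominated_convergence[where w = "\<lambda>_. M / Re u"])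
      show "AE t in H. (\<lambda>n. ?k (v n) t) \<longlonglongrightarrow> ?k w t" using n
      proof eventually_elim
        case (elim t)
        have "u + of_real (min t M) * rho c w \<noteq> 0"
          using w e c by (intro den_nonzero u elim Re_rho_nonneg) auto
        then show ?case by (intro tendsto_intros r)
      qed
      show "AE t in H. cmod (?k (v n) t) \<le> M / Re u" for n by (intro b less_imp_le rv)
    qed auto
  qed
  moreover have "h_map c truncated_dist u w + of_real e \<in> ?S" if w: "w \<in> ?S" for w
  proof -
    have rw: "0 \<le> Re w" using w e by auto
    have "Re (h_map c truncated_dist u w) = (LINT t|H. Re (?k w t))" unfolding h_map_truncated_dist by (rule integral_Re[OF i[OF rw], symmetric])
    also have "\<dots> \<ge> 0"
    proof (rule integral_nonneg_AE)
      show "AE t in H. 0 \<le> Re (?k w t)" using n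
        by eventually_elim (use rw c in \<open>auto intro!: Re_kernel_nonneg[OF u] Re_rho_nonneg\<close>)
    qed
    finally have "e \<le> Re (h_map c truncated_dist u w + of_real e)" by simp
    moreover have "cmod (h_map c truncated_dist u w) \<le> M / Re u"
    proof -
      have "cmod (h_map c truncated_dist u w) \<le> (LINT t|H. cmod (?k w t))" unfolding h_map_truncated_dist by (rule integral_norm_bound)
      also have "\<dots> \<le> (LINT t|H. M / Re u)" using b[OF rw] i[OF rw] by (intro integral_mono_AE) auto
      finally show ?thesis using H.prob_space by simp
    qed
    then have "cmod (h_map c truncated_dist u w + of_real e) \<le> M / Re u + 1"
      using norm_triangle_ineq[of "h_map c truncated_dist u w" "of_real e"] e by simp
    ultimately show ?thesis by simp
  qed
  moreover have "compact ?S" by (intro closed_Int_compact closed_halfspace_Re_ge compact_cball)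
  moreover have "convex ?S" by (intro convex_Int convex_halfspace_Re_ge convex_cball)
  moreover have "of_real e \<in> ?S" using e u M by (auto intro: order_trans[OF e(2)])
  ultimately obtain w where "w \<in> ?S" "h_map c truncated_dist u w + of_real e = w"
    using brouwer[of ?S "\<lambda>w. h_map c truncated_dist u w + of_real e"] by blast
  then show ?thesis by (intro exI[of _ w]) auto
qed

end

lemma is_h_exists:
  assumes H: "population_dist H" and c: "0 < c" and z: "Re z < 0"
  shows "\<exists>w. is_h c H z w"
proof -
  have H': "nonneg_dist H" using H by (simp add: population_dist_iff)
  \<comment> \<open>Cap and perturbation are removed together: the capped laws converge weakly to
    \<open>H\<close> and the defects \<open>?e\<close> tend to 0.\<close>
  let ?M = "\<lambda>n::nat. real n + 1" and ?e = "\<lambda>n::nat. 1 / (real n + 1)"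
  have "\<exists>w. ?e n \<le> Re w \<and> w = h_map c (truncated_dist H (?M n)) (- z) w + of_real (?e n)" for n
    using c z by (intro perturbed_fixpoint H') auto
  then obtain w where w: "\<And>n. ?e n \<le> Re (w n)" "\<And>n. w n = h_map c (truncated_dist H (?M n)) (- z) (w n) + of_real (?e n)"
    by metis
  have "0 < ?e n" for n by simp
  then have rw: "0 < Re (w n)" for n using w(1)[of n] less_le_trans by blast
  have T: "nonneg_dist (truncated_dist H (?M n))" for n by (rule truncated_dist_dist[OF H']) simp
  interpret approx_fixpoint "\<lambda>_. c" c "\<lambda>_. - z" "- z" "\<lambda>n. truncated_dist H (?M n)" H w
  proof
    show "weak_conv_m (\<lambda>n. truncated_dist H (?M n)) H"
      unfolding weak_conv_m_def weak_conv_def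
    proof (intro allI impI)
      fix x
      have "\<forall>\<^sub>F n in sequentially. x < ?M n"
        using real_arch_simple[of x] by (auto simp: eventually_sequentially) (meson less_add_one le_less_trans of_nat_mono order_trans)
      then show "(\<lambda>n. cdf (truncated_dist H (?M n)) x) \<longlonglongrightarrow> cdf H x"
        by (intro tendsto_eventually) (auto elim!: eventually_mono simp: cdf_truncated_dist[OF H'])
    qed
    show "0 \<le> Re (w n)" for n using rw[of n] by simp
    show "1 + (of_real c * w n)\<^sup>2 \<noteq> 0" for n by (rule denoms_nonzero_Re[OF c rw])
    show "integrable (truncated_dist H (?M n)) (\<lambda>t. of_real t / (- z + of_real t * rho c (w n)))" for n
      using rho_nonzero[OF c rw[of n]] z by (intro integrable_kernel[OF T]) auto
    have "(\<lambda>n. w n - h_map c (truncated_dist H (?M n)) (- z) (w n)) = (\<lambda>n. of_real (?e n))"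
      using w(2) by (metis add_diff_cancel_left')
    moreover have "(\<lambda>n. complex_of_real (?e n)) \<longlonglongrightarrow> of_real 0"
      by (intro tendsto_of_real) real_asymp
    ultimately show "(\<lambda>n. w n - h_map c (truncated_dist H (?M n)) (- z) (w n)) \<longlonglongrightarrow> 0" by simp
  qed (use c z T H in auto)
  show ?thesis using subseq_limit by auto
qed

lemma is_h_ex1:
  assumes "population_dist H" "0 < c" "Re z < 0"
  shows "\<exists>!w. is_h c H z w"
  using is_h_exists[OF assms] is_h_unique[OF assms] by blast

lemma is_h_h_fun:
  assumes "population_dist H" "0 < c" "Re z < 0"
  shows "is_h c H z (h_fun c H z)"
  unfolding h_fun_def by (rule theI'[OF is_h_ex1[OF assms]])

section \<open>Analyticity and continuity of the solution\<close>

lemma approx_fixpoint_exact: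
  assumes c: "0 < c" and zs: "zs \<longlonglongrightarrow> z" "\<And>n. Re (zs n) < 0" "Re z < 0"
    and Hs: "\<And>n. population_dist (Hs n)" "population_dist H" "weak_conv_m Hs H"
  shows "(\<lambda>n. h_fun c (Hs n) (zs n)) \<longlonglongrightarrow> h_fun c H z"
proof -
  let ?w = "\<lambda>n. h_fun c (Hs n) (zs n)"
  have h: "is_h c (Hs n) (zs n) (?w n)" for n by (rule is_h_h_fun[OF Hs(1) c zs(2)])
  then have rw: "0 < Re (?w n)" "?w n = h_map c (Hs n) (- zs n) (?w n)" for n unfolding is_h_h_map by blast+
  have T: "nonneg_dist (Hs n)" for n using Hs(1) by (simp add: population_dist_iff)
  interpret approx_fixpoint "\<lambda>_. c" c "\<lambda>n. - zs n" "- z" Hs H ?w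
  proof
    show "(\<lambda>n. - zs n) \<longlonglongrightarrow> - z" by (intro tendsto_intros zs)
    show "0 \<le> Re (?w n)" for n using rw(1)[of n] by simp
    show "1 + (of_real c * ?w n)\<^sup>2 \<noteq> 0" for n by (rule denoms_nonzero_Re[OF c rw(1)])
    show "integrable (Hs n) (\<lambda>t. of_real t / (- zs n + of_real t * rho c (?w n)))" for n
      using rho_nonzero[OF c rw(1)[of n]] zs(2) by (intro integrable_kernel[OF T]) auto
    show "(\<lambda>n. ?w n - h_map c (Hs n) (- zs n) (?w n)) \<longlonglongrightarrow> 0" using rw(2) by simp
  qed (use c zs T Hs in auto)
  show ?thesis using limit is_h_h_fun[OF Hs(2) c zs(3)] by simp
qed

lemma weak_conv_m_const: "weak_conv_m (\<lambda>_. H) H"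
  by (simp add: weak_conv_m_def weak_conv_def)

text \<open>By \<open>difference_identity\<close> the difference quotient is \<open>Lint\<close>
  over 1 - c \<open>Pbil\<close> \<open>Jint\<close>. It converges by dominated convergence, h being
  continuous by \<open>approx_fixpoint_exact\<close> with a constant law, and
  \<open>PJ_less_1\<close> keeps the limiting denominator nonzero.\<close>

lemma h_fun_holomorphic:
  assumes H: "population_dist H" and c: "0 < c"
  shows "h_fun c H analytic_on {z. Re z < 0}"
proof -
  interpret real_distribution H using H by (simp add: population_dist_def)
  have H': "nonneg_dist H" using H by (simp add: population_dist_iff)
  let ?h = "h_fun c H" and ?S = "{z. Re z < 0}"
  have "(?h has_field_derivative
      (Lint c H z (?h z) z (?h z) / (1 - of_real c * Pbil c (?h z) (?h z) * Jint c H z (?h z) z (?h z)))) (at z within ?S)"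
    if z: "Re z < 0" for z
    unfolding has_field_derivative_iff
  proof (unfold tendsto_at_iff_sequentially, intro allI impI)
    fix X :: "nat \<Rightarrow> complex" assume X: "\<forall>i. X i \<in> ?S - {z}" "X \<longlonglongrightarrow> z"
    have Xr: "Re (X n) < 0" for n using X(1) by auto
    have hX: "(\<lambda>n. ?h (X n)) \<longlonglongrightarrow> ?h z"
      by (rule approx_fixpoint_exact[OF c X(2) Xr z H H weak_conv_m_const])
    note hz = is_h_h_fun[OF H c z] and hXn = is_h_h_fun[OF H c Xr]
    have rz: "0 < Re (?h z)" "0 < Re (?h (X n))" for n using hz hXn by (auto simp: is_h_def)
    note nz = denoms_nonzero_Re[OF c rz(1)] denoms_nonzero_Re[OF c rz(2)]
    have r: "(\<lambda>n. rho c (?h (X n))) \<longlonglongrightarrow> rho c (?h z)"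
      by (rule tendsto_rho[OF tendsto_const hX nz])
    have q: "(?h (X n) - ?h z) / (X n - z) = Lint c H z (?h z) (X n) (?h (X n)) /
        (1 - of_real c * Pbil c (?h z) (?h (X n)) * Jint c H z (?h z) (X n) (?h (X n)))" for n
    proof -
      define k where "k = 1 - of_real c * Pbil c (?h z) (?h (X n)) * Jint c H z (?h z) (X n) (?h (X n))"
      have "k \<noteq> 0" using PJ_less_1[OF H c z Xr hz hXn, of n] unfolding k_def by (metis less_irrefl norm_one right_minus_eq)
      moreover have E: "(?h z - ?h (X n)) * k = (z - X n) * Lint c H z (?h z) (X n) (?h (X n))"
        unfolding k_def by (rule difference_identity[OF H c z Xr hz hXn])
      moreover have "X n - z \<noteq> 0" using X(1) by auto
      moreover have "(?h (X n) - ?h z) * k = Lint c H z (?h z) (X n) (?h (X n)) * (X n - z)"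
        using E by (metis minus_diff_eq minus_mult_left mult.commute)
      ultimately show ?thesis unfolding k_def[symmetric] by (metis frac_eq_eq)
    qed
    let ?d = "\<lambda>t. - z + of_real t * rho c (?h z)" and ?dn = "\<lambda>n t. - X n + of_real t * rho c (?h (X n))"
    have u: "0 < Re (- z)" "0 < Re (- X n)" for n using z Xr[of n] by auto
    have rr: "0 \<le> Re (rho c (?h z))" "rho c (?h z) \<noteq> 0" "0 \<le> Re (rho c (?h (X n)))" "rho c (?h (X n)) \<noteq> 0" for n
      using rho_nonzero[OF c rz(1)] rho_nonzero[OF c rz(2)[of n]] by auto
    let ?A = "2 * cmod (- z) / (Re (- z) * cmod (rho c (?h z)))"
    have lim_d: "(\<lambda>n. ?dn n t) \<longlonglongrightarrow> ?d t" for t by (intro tendsto_intros X(2) r)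
    have dz: "?d t \<noteq> 0" if "0 \<le> t" for t by (rule den_nonzero[OF u(1) that rr(1)])
    have J: "(\<lambda>n. Jint c H z (?h z) (X n) (?h (X n))) \<longlonglongrightarrow> Jint c H z (?h z) z (?h z)"
    proof -
      have "(\<lambda>n. 2 * cmod (- X n) / (Re (- X n) * cmod (rho c (?h (X n))))) \<longlonglongrightarrow> ?A"
        using u(1) rr(2) by (intro tendsto_intros X(2) r) auto
      then have "Bseq (\<lambda>n. 2 * cmod (- X n) / (Re (- X n) * cmod (rho c (?h (X n)))))" by (rule convergent_imp_Bseq[OF convergentI])
      then obtain B where B: "\<And>n. \<bar>2 * cmod (- X n) / (Re (- X n) * cmod (rho c (?h (X n))))\<bar> \<le> B"
        unfolding Bseq_def by auto
      show ?thesis unfolding Jint_def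
      proof (rule integral_dominated_convergence[where w = "\<lambda>_. ?A * B"])
        show "AE t in H. (\<lambda>n. of_real t / ?d t * (of_real t / ?dn n t)) \<longlonglongrightarrow> of_real t / ?d t * (of_real t / ?d t)"
          using AE_nonneg[OF H' u(1) rr(1,2)] by eventually_elim (intro tendsto_intros lim_d dz)
        show "AE t in H. cmod (of_real t / ?d t * (of_real t / ?dn n t)) \<le> ?A * B" for n
          using AE_nonneg[OF H' u(1) rr(1,2)]
        proof eventually_elim
          case (elim t)
          show ?case unfolding norm_mult
            by (intro mult_mono' den_bound3 u(1) rr elim norm_ge_zero order_trans[OF den_bound3[OF u(2) elim rr(3,4)] order_trans[OF abs_ge_self B]])
        qed
      qed auto
    qed
    have L: "(\<lambda>n. Lint c H z (?h z) (X n) (?h (X n))) \<longlonglongrightarrow> Lint c H z (?h z) z (?h z)"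
    proof -
      have "(\<lambda>n. 1 / Re (- X n)) \<longlonglongrightarrow> 1 / Re (- z)"
        using u(1) by (intro tendsto_intros X(2)) auto
      then have "Bseq (\<lambda>n. 1 / Re (- X n))" by (rule convergent_imp_Bseq[OF convergentI])
      then obtain B where B: "\<And>n. \<bar>1 / Re (- X n)\<bar> \<le> B"
        unfolding Bseq_def by auto
      show ?thesis unfolding Lint_def
      proof (rule integral_dominated_convergence[where w = "\<lambda>_. ?A * B"])
        show "AE t in H. (\<lambda>n. of_real t / ?d t * (1 / ?dn n t)) \<longlonglongrightarrow> of_real t / ?d t * (1 / ?d t)"
          using AE_nonneg[OF H' u(1) rr(1,2)] by eventually_elim (intro tendsto_intros lim_d dz)
        show "AE t in H. cmod (of_real t / ?d t * (1 / ?dn n t)) \<le> ?A * B" for n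
          using AE_nonneg[OF H' u(1) rr(1,2)]
        proof eventually_elim
          case (elim t)
          have "cmod (1 / ?dn n t) \<le> 1 / Re (- X n)"
            unfolding norm_divide norm_one
            by (rule frac_le[OF zero_le_one order_refl u(2) order_trans[OF den_Re[OF elim rr(3)] complex_Re_le_cmod]])
          also have "\<dots> \<le> B" by (rule order_trans[OF abs_ge_self B])
          finally show ?case unfolding norm_mult
            by (intro mult_mono' den_bound3 u(1) rr elim norm_ge_zero)
        qed
      qed auto
    qed
    have P: "(\<lambda>n. Pbil c (?h z) (?h (X n))) \<longlonglongrightarrow> Pbil c (?h z) (?h z)"
      unfolding Pbil_def using rho_denoms_nonzero[OF nz(1)] by (intro tendsto_intros hX) auto
    have "of_real c * Pbil c (?h z) (?h z) * Jint c H z (?h z) z (?h z) \<noteq> 1"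
      using PJ_less_1[OF H c z z hz hz] by auto
    then show "((\<lambda>y. (?h y - ?h z) / (y - z)) \<circ> X) \<longlonglongrightarrow>
      Lint c H z (?h z) z (?h z) / (1 - of_real c * Pbil c (?h z) (?h z) * Jint c H z (?h z) z (?h z))"
      unfolding o_def q by (intro tendsto_intros L P J) auto
  qed
  then have "?h holomorphic_on ?S" unfolding holomorphic_on_def field_differentiable_def by blast
  moreover have "open ?S" by (rule open_halfspace_Re_lt)
  ultimately show ?thesis by (simp add: analytic_on_open)
qed

text \<open>The second hypothesis makes the infimum in \<open>levy_dist\<close> one over a nonempty
  set. A shift below 1 / (n + 1) then exists and squeezes Fs between shifted copies of G.\<close>

lemma levy_imp_weak_conv:
  assumes "\<And>n. levy_dist (Fs n) G < 1 / (real n + 1)"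
    and ne: "\<And>n. \<exists>e>0. \<forall>x. Fs n (x - e) - e \<le> G x \<and> G x \<le> Fs n (x + e) + e"
  shows "weak_conv Fs G"
  unfolding weak_conv_def
proof (intro allI impI)
  fix x assume x: "isCont G x"
  have ex: "\<exists>e>0. e < 1 / (real n + 1) \<and> (\<forall>x. Fs n (x - e) - e \<le> G x \<and> G x \<le> Fs n (x + e) + e)" for n
  proof -
    let ?S = "{e. 0 < e \<and> (\<forall>x. Fs n (x - e) - e \<le> G x \<and> G x \<le> Fs n (x + e) + e)}"
    have "?S \<noteq> {}" "bdd_below ?S" using ne[of n] by (auto intro: bdd_belowI[of _ 0])
    then obtain e where "e \<in> ?S" "e < 1 / (real n + 1)"
      using assms(1)[of n] unfolding levy_dist_def by (subst (asm) cInf_less_iff) auto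
    then show ?thesis by auto
  qed
  then obtain e where e: "\<And>n. 0 < e n" "\<And>n. e n < 1 / (real n + 1)"
    "\<And>n x. Fs n (x - e n) - e n \<le> G x" "\<And>n x. G x \<le> Fs n (x + e n) + e n"
    by metis
  have e0: "e \<longlonglongrightarrow> 0"
  proof (rule real_tendsto_sandwich[of "\<lambda>_. 0" e _ "\<lambda>n. 1 / (real n + 1)"])
    show "(\<lambda>n. 1 / (real n + 1)) \<longlonglongrightarrow> 0" by real_asymp
  qed (use e(1,2) in \<open>auto intro!: always_eventually less_imp_le\<close>)
  have G: "(\<lambda>n. G (x + e n)) \<longlonglongrightarrow> G x" "(\<lambda>n. G (x - e n)) \<longlonglongrightarrow> G x"
    using isCont_tendsto_compose[OF x, of "\<lambda>n. x + e n"] isCont_tendsto_compose[OF x, of "\<lambda>n. x - e n"]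
      tendsto_add[OF tendsto_const[of x] e0] tendsto_diff[OF tendsto_const[of x] e0] by auto
  show "(\<lambda>n. Fs n x) \<longlonglongrightarrow> G x"
  proof (rule real_tendsto_sandwich)
    show "\<forall>\<^sub>F n in sequentially. G (x - e n) - e n \<le> Fs n x" 
    proof (intro always_eventually allI)
      fix n show "G (x - e n) - e n \<le> Fs n x" using e(4)[of "x - e n" n] by simp
    qed
    show "\<forall>\<^sub>F n in sequentially. Fs n x \<le> G (x + e n) + e n" 
    proof (intro always_eventually allI)
      fix n show "Fs n x \<le> G (x + e n) + e n" using e(3)[of n "x + e n"] by simp
    qed
    show "(\<lambda>n. G (x - e n) - e n) \<longlonglongrightarrow> G x" using tendsto_diff[OF G(2) e0] by simp
    show "(\<lambda>n. G (x + e n) + e n) \<longlonglongrightarrow> G x" using tendsto_add[OF G(1) e0] by simp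
  qed
qed

lemma h_fun_levy_continuous:
  assumes H: "population_dist H" and c: "0 < c" and z: "Re z < 0" and \<epsilon>: "0 < \<epsilon>"
  shows "\<exists>\<delta>>0. \<forall>H'. population_dist H' \<longrightarrow> levy_dist (cdf H') (cdf H) < \<delta> \<longrightarrow>
     (\<exists>!w. is_h c H' z w) \<and> dist (h_fun c H' z) (h_fun c H z) < \<epsilon>"
proof (rule ccontr)
  assume a: "\<not> ?thesis"
  have "\<exists>H'. population_dist H' \<and> levy_dist (cdf H') (cdf H) < 1 / (real n + 1) \<and> \<not> dist (h_fun c H' z) (h_fun c H z) < \<epsilon>" for n
  proof -
    have "0 < 1 / (real n + 1)" by simp
    then obtain H' where "population_dist H'" "levy_dist (cdf H') (cdf H) < 1 / (real n + 1)"
      "\<not> ((\<exists>!w. is_h c H' z w) \<and> dist (h_fun c H' z) (h_fun c H z) < \<epsilon>)" using a by blast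
    then show ?thesis using is_h_ex1[OF _ c z] by blast
  qed
  then obtain Hs where Hs: "\<And>n. population_dist (Hs n)" "\<And>n. levy_dist (cdf (Hs n)) (cdf H) < 1 / (real n + 1)"
    "\<And>n. \<not> dist (h_fun c (Hs n) z) (h_fun c H z) < \<epsilon>" by metis
  have "weak_conv_m Hs H" unfolding weak_conv_m_def
  proof (rule levy_imp_weak_conv[OF Hs(2)])
    fix n
    interpret A: real_distribution H using H by (simp add: population_dist_def)
    interpret B: real_distribution "Hs n" using Hs(1) by (simp add: population_dist_def)
    \<comment> \<open>The shift 1 always qualifies, as both functions take values in [0, 1].\<close>
    show "\<exists>e>0. \<forall>x. cdf (Hs n) (x - e) - e \<le> cdf H x \<and> cdf H x \<le> cdf (Hs n) (x + e) + e"
      using A.cdf_nonneg A.cdf_bounded_prob B.cdf_nonneg B.cdf_bounded_prob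
      by (intro exI[of _ 1]) (auto intro: order_trans add_increasing simp: add_increasing diff_le_eq)
  qed
  then have "(\<lambda>n. h_fun c (Hs n) z) \<longlonglongrightarrow> h_fun c H z"
    by (intro approx_fixpoint_exact[OF c tendsto_const z z Hs(1) H])
  then have "\<forall>\<^sub>F n in sequentially. dist (h_fun c (Hs n) z) (h_fun c H z) < \<epsilon>" using \<epsilon> by (rule tendstoD)
  then show False using Hs(3) by (auto simp: eventually_sequentially)
qed

subsection \<open>Stieltjes transforms on the imaginary axis\<close>

lemma stieltjes_kernel_bound: "Re z < 0 \<Longrightarrow> cmod (1 / (\<i> * of_real t - z)) \<le> 1 / (- Re z)"
  using complex_Re_le_cmod[of "\<i> * of_real t - z"] frac_le[of 1 1 "- Re z" "cmod (\<i> * of_real t - z)"]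
  by (simp add: norm_divide)

lemma stieltjes_kernel_nonzero: "Re z < 0 \<Longrightarrow> \<i> * of_real t - z \<noteq> 0"
  by (auto simp: complex_eq_iff)

lemma (in real_distribution) integrable_stieltjes: "Re z < 0 \<Longrightarrow> integrable M (\<lambda>t. 1 / (\<i> * of_real t - z))"
  by (rule integrable_const_bound[of _ "1 / (- Re z)"]) (blast intro: AE_I2 stieltjes_kernel_bound, simp)

lemma weak_conv_stieltjes:
  assumes "\<And>n. real_distribution (\<mu> n)" "real_distribution M" "weak_conv_m \<mu> M" "Re z < 0"
  shows "(\<lambda>n. stieltjes_imag (\<mu> n) z) \<longlonglongrightarrow> stieltjes_imag M z"
  unfolding stieltjes_imag_def
proof (rule weak_conv_varying_integral[OF assms(1-3) _ _ stieltjes_kernel_bound[OF assms(4)]])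
  fix s :: "nat \<Rightarrow> real" and t assume "s \<longlonglongrightarrow> t"
  then show "(\<lambda>n. 1 / (\<i> * complex_of_real (s n) - z)) \<longlonglongrightarrow> 1 / (\<i> * complex_of_real t - z)"
    by (intro tendsto_intros stieltjes_kernel_nonzero assms)
qed measurable

lemma Re_stieltjes_kernel: "0 < a \<Longrightarrow> Re (1 / (\<i> * of_real t - Complex (- a) y)) = a / (a\<^sup>2 + (y - t)\<^sup>2)"
  by (simp add: Re_divide power2_commute[of y t])

lemma Re_stieltjes:
  assumes "real_distribution M" "0 < a"
  shows "Re (stieltjes_imag M (Complex (- a) y)) = (LINT t|M. a / (a\<^sup>2 + (y - t)\<^sup>2))"
    and "integrable M (\<lambda>t. a / (a\<^sup>2 + (y - t)\<^sup>2))"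
proof -
  interpret real_distribution M by fact
  have i: "integrable M (\<lambda>t. 1 / (\<i> * of_real t - Complex (- a) y))" using assms(2) by (intro integrable_stieltjes) simp
  show "integrable M (\<lambda>t. a / (a\<^sup>2 + (y - t)\<^sup>2))"
    using integrable_Re[OF i] unfolding Re_stieltjes_kernel[OF assms(2)] .
  show "Re (stieltjes_imag M (Complex (- a) y)) = (LINT t|M. a / (a\<^sup>2 + (y - t)\<^sup>2))"
    unfolding stieltjes_imag_def using integral_Re[OF i] unfolding Re_stieltjes_kernel[OF assms(2)] by simp
qed

text \<open>A primitive in \<open>y\<close> of the real part of the transform at - a + i y, that is
  of a Poisson integral (\<open>arcint_deriv\<close>).\<close>

definition arcint :: "real measure \<Rightarrow> real \<Rightarrow> real \<Rightarrow> real" where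
  "arcint M a y = (LINT t|M. arctan ((y - t) / a))"

lemma abs_arctan_le: "\<bar>arctan x\<bar> \<le> pi / 2"
  using arctan_bounded[of x] by linarith

lemma integrable_arctan: "real_distribution M \<Longrightarrow> integrable M (\<lambda>t. arctan ((y - t) / a))"
proof -
  assume "real_distribution M"
  then interpret real_distribution M .
  show ?thesis by (rule integrable_const_bound[of _ "pi / 2"]) (simp_all only: real_norm_def abs_arctan_le, simp_all)
qed

lemma arctan_deriv: "0 < a \<Longrightarrow> ((\<lambda>y. arctan ((y - t) / a)) has_real_derivative a / (a\<^sup>2 + (y - t)\<^sup>2)) (at y)"
proof -
  assume a: "0 < a"
  have "inverse (1 + ((y - t) / a)\<^sup>2) * (1 / a) = a / (a\<^sup>2 + (y - t)\<^sup>2)"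
  proof -
    have "1 + ((y - t) / a)\<^sup>2 = (a\<^sup>2 + (y - t)\<^sup>2) / a\<^sup>2" using a by (simp add: power_divide add_divide_distrib)
    then show ?thesis using a by (simp add: power2_eq_square[of a])
  qed
  moreover have "((\<lambda>y. arctan ((y - t) / a)) has_real_derivative inverse (1 + ((y - t) / a)\<^sup>2) * (1 / a)) (at y)"
    using a by (intro derivative_eq_intros | simp)+
  ultimately show ?thesis by simp
qed

lemma arctan_lipschitz: assumes "0 < a" shows "\<bar>arctan ((x - t) / a) - arctan ((y - t) / a)\<bar> \<le> (1 / a) * \<bar>x - y\<bar>"
proof -
  have "norm (arctan ((x - t) / a) - arctan ((y - t) / a)) \<le> (1 / a) * norm (x - y)"
  proof (rule field_differentiable_bound[of UNIV "\<lambda>y. arctan ((y - t) / a)" "\<lambda>y. a / (a\<^sup>2 + (y - t)\<^sup>2)"])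
    show "((\<lambda>y. arctan ((y - t) / a)) has_field_derivative a / (a\<^sup>2 + (z - t)\<^sup>2)) (at z within UNIV)" for z
      using arctan_deriv[OF assms] by simp
    show "norm (a / (a\<^sup>2 + (z - t)\<^sup>2)) \<le> 1 / a" for z
    proof -
      have "a / (a\<^sup>2 + (z - t)\<^sup>2) \<le> a / a\<^sup>2" using assms by (intro divide_left_mono) (auto intro!: add_pos_nonneg mult_pos_pos)
      then show ?thesis using assms by (simp add: power2_eq_square[of a])
    qed
  qed auto
  then show ?thesis by simp
qed

lemma arcint_deriv:
  assumes M: "real_distribution M" and a: "0 < a"
  shows "(arcint M a has_real_derivative Re (stieltjes_imag M (Complex (- a) y))) (at y)"
  unfolding has_field_derivative_iff tendsto_at_iff_sequentially
proof (intro allI impI)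
  interpret real_distribution M by fact
  fix X :: "nat \<Rightarrow> real" assume X: "\<forall>i. X i \<in> UNIV - {y}" "X \<longlonglongrightarrow> y"
  have e: "(arcint M a (X n) - arcint M a y) / (X n - y) = (LINT t|M. (arctan ((X n - t) / a) - arctan ((y - t) / a)) / (X n - y))" for n
    unfolding arcint_def using integrable_arctan[OF M] by simp
  show "((\<lambda>x. (arcint M a x - arcint M a y) / (x - y)) \<circ> X) \<longlonglongrightarrow> Re (stieltjes_imag M (Complex (- a) y))"
    unfolding o_def e Re_stieltjes(1)[OF M a]
  proof (rule integral_dominated_convergence[where w = "\<lambda>_. 1 / a"])
    show "AE t in M. (\<lambda>n. (arctan ((X n - t) / a) - arctan ((y - t) / a)) / (X n - y)) \<longlonglongrightarrow> a / (a\<^sup>2 + (y - t)\<^sup>2)"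
    proof (intro AE_I2)
      fix t
      have "((\<lambda>x. (arctan ((x - t) / a) - arctan ((y - t) / a)) / (x - y)) \<longlongrightarrow> a / (a\<^sup>2 + (y - t)\<^sup>2)) (at y)"
        using arctan_deriv[OF a, of t y] unfolding has_field_derivative_iff .
      then show "(\<lambda>n. (arctan ((X n - t) / a) - arctan ((y - t) / a)) / (X n - y)) \<longlonglongrightarrow> a / (a\<^sup>2 + (y - t)\<^sup>2)"
        using X unfolding tendsto_at_iff_sequentially o_def by blast
    qed
    show "AE t in M. norm ((arctan ((X n - t) / a) - arctan ((y - t) / a)) / (X n - y)) \<le> 1 / a" for n
    proof (intro AE_I2)
      fix t
      have "X n \<noteq> y" using X(1) by auto
      then show "norm ((arctan ((X n - t) / a) - arctan ((y - t) / a)) / (X n - y)) \<le> 1 / a"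
        using arctan_lipschitz[OF a, of "X n" t y] by (simp add: pos_divide_le_eq)
    qed
  qed auto
qed

text \<open>Fixes the constant of integration: primitives with equal derivatives also agree at minus
  infinity.\<close>

lemma arcint_at_bot:
  assumes M: "real_distribution M" and a: "0 < a"
  shows "(\<lambda>n. arcint M a (- real n)) \<longlonglongrightarrow> - (pi / 2)"
proof -
  interpret real_distribution M by fact
  have "(\<lambda>n. LINT t|M. arctan ((- real n - t) / a)) \<longlonglongrightarrow> (LINT t|M. - (pi / 2))"
  proof (rule integral_dominated_convergence[where w = "\<lambda>_. pi / 2"])
    show "AE t in M. (\<lambda>n. arctan ((- real n - t) / a)) \<longlonglongrightarrow> - (pi / 2)"
    proof (intro AE_I2)
      fix t
      have "filterlim (\<lambda>n. (- real n - t) / a) at_bot sequentially" using a by real_asymp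
      then show "(\<lambda>n. arctan ((- real n - t) / a)) \<longlonglongrightarrow> - (pi / 2)"
        by (rule filterlim_compose[OF tendsto_arctan_at_bot])
    qed
  qed (simp_all only: real_norm_def abs_arctan_le AE_I2, simp_all)
  then show ?thesis unfolding arcint_def using prob_space by simp
qed

lemma arcint_small:
  assumes M: "real_distribution M"
  shows "(\<lambda>n. arcint M (1 / real (Suc n)) y) \<longlonglongrightarrow> (pi / 2) * (LINT t|M. sgn (y - t))"
proof -
  interpret real_distribution M by fact
  have "(\<lambda>n. LINT t|M. arctan ((y - t) / (1 / real (Suc n)))) \<longlonglongrightarrow> (LINT t|M. (pi / 2) * sgn (y - t))"
  proof (rule integral_dominated_convergence[where w = "\<lambda>_. pi / 2"])
    show "AE t in M. (\<lambda>n. arctan ((y - t) / (1 / real (Suc n)))) \<longlonglongrightarrow> (pi / 2) * sgn (y - t)"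
    proof (intro AE_I2)
      fix t
      consider "y - t > 0" | "y - t < 0" | "y - t = 0" by linarith
      then show "(\<lambda>n. arctan ((y - t) / (1 / real (Suc n)))) \<longlonglongrightarrow> (pi / 2) * sgn (y - t)"
      proof cases
        case 1
        have "filterlim (\<lambda>n. (y - t) / (1 / real (Suc n))) at_top sequentially" using 1 by real_asymp
        from filterlim_compose[OF tendsto_arctan_at_top this] show ?thesis using 1 by (simp only: sgn_pos) simp
      next
        case 2
        have "filterlim (\<lambda>n. (y - t) / (1 / real (Suc n))) at_bot sequentially" using 2 by real_asymp
        from filterlim_compose[OF tendsto_arctan_at_bot this] show ?thesis using 2 by (simp only: sgn_neg) simp
      qed simp
    qed
  qed (simp_all only: real_norm_def abs_arctan_le AE_I2, simp_all)
  then show ?thesis unfolding arcint_def by simp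
qed

lemma (in real_distribution) integrable_ind: "A \<in> sets borel \<Longrightarrow> integrable M (indicator A :: real \<Rightarrow> real)"
  by (rule integrable_real_indicator) (auto simp: emeasure_eq_measure)

lemma sgn_integral:
  assumes M: "real_distribution M"
  shows "(LINT t|M. sgn (y - t)) = 2 * cdf M y - 1 - measure M {y}"
proof -
  interpret real_distribution M by fact
  have e: "sgn (y - t) = 2 * indicator {..y} t - 1 - indicator {y} t" for t :: real
    by (simp add: indicator_def sgn_real_def)
  have "(LINT t|M. sgn (y - t)) = (LINT t|M. 2 * indicator {..y} t - 1 - indicator {y} t)" unfolding e ..
  also have "\<dots> = 2 * measure M {..y} - 1 - measure M {y}"
    using integrable_ind[of "{..y}"] integrable_ind[of "{y}"] prob_space by (simp add: Bochner_Integration.integral_diff)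
  finally show ?thesis unfolding cdf_def .
qed

text \<open>The real part of the transform is a Poisson integral; its primitive is \<open>arcint\<close>, which
  converges to the symmetrised distribution function as the smoothing parameter tends to zero.\<close>
lemma stieltjes_unique:
  assumes M: "real_distribution M" and N: "real_distribution N"
    and eq: "\<And>z. Re z < 0 \<Longrightarrow> stieltjes_imag M z = stieltjes_imag N z"
  shows "M = N"
proof (rule cdf_unique[OF M N])
  interpret A: real_distribution M by fact
  interpret B: real_distribution N by fact
  have ac: "arcint M a y = arcint N a y" if a: "0 < a" for a y
  proof -
    let ?g = "\<lambda>y. arcint M a y - arcint N a y"
    have "(?g has_real_derivative 0) (at y)" for y
      using DERIV_diff[OF arcint_deriv[OF M a] arcint_deriv[OF N a], of y] eq[of "Complex (- a) y"] a by simp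
    then have "\<forall>y. (?g has_real_derivative 0) (at y)" by blast
    from DERIV_isconst_all[OF this] have c: "?g y = ?g x" for x y .
    have lm: "(\<lambda>n. ?g (- real n)) \<longlonglongrightarrow> - (pi / 2) - - (pi / 2)"
      by (intro tendsto_diff arcint_at_bot M N a)
    have "?g (- real n) = ?g y" for n by (rule c)
    then have "(\<lambda>n::nat. ?g y) \<longlonglongrightarrow> 0" using lm by simp
    then have "?g y = 0" by (rule LIMSEQ_unique[OF tendsto_const])
    then show ?thesis by simp
  qed
  have s: "2 * cdf M y - 1 - measure M {y} = 2 * cdf N y - 1 - measure N {y}" for y
  proof -
    have "(\<lambda>n. arcint M (1 / real (Suc n)) y) \<longlonglongrightarrow> (pi / 2) * (LINT t|N. sgn (y - t))"
    proof (rule Lim_transform_eventually[OF arcint_small[OF N, of y]], intro always_eventually allI)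
      show "arcint N (1 / real (Suc n)) y = arcint M (1 / real (Suc n)) y" for n by (rule ac[symmetric]) simp
    qed
    from LIMSEQ_unique[OF arcint_small[OF M] this]
    have "(pi / 2) * (LINT t|M. sgn (y - t)) = (pi / 2) * (LINT t|N. sgn (y - t))" .
    then have "(LINT t|M. sgn (y - t)) = (LINT t|N. sgn (y - t))" by simp
    then show ?thesis unfolding sgn_integral[OF M] sgn_integral[OF N] .
  qed
  show "cdf M = cdf N"
  proof
    fix x
    have cnt: "countable ({y. measure M {y} \<noteq> 0} \<union> {y. measure N {y} \<noteq> 0})"
      using A.countable_atoms B.countable_atoms by (simp add: zero_less_measure_iff[symmetric])
    \<comment> \<open>Points close to the right of \<open>x\<close> that are atoms of neither law:
      there the symmetrised function determines the distribution function, and right-continuity then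
      reaches \<open>x\<close>.\<close>
    have "\<exists>y. x < y \<and> y < x + 1 / real (Suc n) \<and> measure M {y} = 0 \<and> measure N {y} = 0" for n
    proof -
      have "uncountable {x<..<x + 1 / real (Suc n)}" unfolding uncountable_open_interval by simp
      then have "\<not> {x<..<x + 1 / real (Suc n)} \<subseteq> {y. measure M {y} \<noteq> 0} \<union> {y. measure N {y} \<noteq> 0}"
        using countable_subset[OF _ cnt] by blast
      then show ?thesis unfolding subset_iff by (simp only: not_all not_imp Un_iff mem_Collect_eq greaterThanLessThan_iff de_Morgan_disj not_not) blast
    qed
    then obtain Y where Y: "\<And>n. x < Y n" "\<And>n. Y n < x + 1 / real (Suc n)" "\<And>n. measure M {Y n} = 0" "\<And>n. measure N {Y n} = 0"
      by (metis (no_types))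
    have "Y \<longlonglongrightarrow> x"
    proof (rule real_tendsto_sandwich[of "\<lambda>_. x" Y _ "\<lambda>n. x + 1 / real (Suc n)"])
      show "(\<lambda>n. x + 1 / real (Suc n)) \<longlonglongrightarrow> x" using tendsto_add[OF tendsto_const LIMSEQ_inverse_real_of_nat, of x] by (simp only: inverse_eq_divide add_0_right)
    qed (intro always_eventually allI less_imp_le Y tendsto_const)+
    then have Yr: "filterlim Y (at_right x) sequentially"
      unfolding filterlim_at using Y(1) \<open>Y \<longlonglongrightarrow> x\<close> by (auto intro!: always_eventually simp: less_imp_neq[symmetric] less_imp_neq)
    have "(\<lambda>n. cdf M (Y n)) \<longlonglongrightarrow> cdf M x" "(\<lambda>n. cdf N (Y n)) \<longlonglongrightarrow> cdf N x"
      by (rule filterlim_compose[OF _ Yr]; use A.cdf_is_right_cont[of x] B.cdf_is_right_cont[of x] in \<open>simp add: continuous_within\<close>)+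
    moreover have "cdf M (Y n) = cdf N (Y n)" for n using s[of "Y n"] Y(3,4) by simp
    ultimately have "(\<lambda>n. cdf N (Y n)) \<longlonglongrightarrow> cdf M x" by simp
    then show "cdf M x = cdf N x" using \<open>(\<lambda>n. cdf N (Y n)) \<longlonglongrightarrow> cdf N x\<close> by (rule LIMSEQ_unique)
  qed
qed

section \<open>Tightness and the continuity theorem\<close>

text \<open>T times the real part of the transform at - T is the mean of T^2 / (T^2 + t^2), which is
  at most 1 everywhere and at most 1/2 off the interval.\<close>

lemma tail_stieltjes:
  assumes M: "real_distribution M" and T: "0 < T"
  shows "1 - 2 * (1 - T * Re (stieltjes_imag M (of_real (- T)))) \<le> measure M {- T<..T}"
proof -
  interpret real_distribution M by fact
  have z: "complex_of_real (- T) = Complex (- T) 0" by (simp add: complex_eq_iff)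
  note R = Re_stieltjes[OF M T, of 0]
  have "T * Re (stieltjes_imag M (of_real (- T))) = (LINT t|M. T * (T / (T\<^sup>2 + (0 - t)\<^sup>2)))"
    unfolding z R(1) by (rule Bochner_Integration.integral_mult_right[OF R(2), symmetric])
  also have "\<dots> \<le> (LINT t|M. (1 + indicator {- T<..T} t) / 2)"
  proof (rule integral_mono)
    show "integrable M (\<lambda>t. T * (T / (T\<^sup>2 + (0 - t)\<^sup>2)))" using R(2) by (rule integrable_mult_right)
    show "integrable M (\<lambda>t. (1 + indicator {- T<..T} t) / 2 :: real)" using integrable_ind[of "{- T<..T}"] by simp
    fix t
    have p: "0 < T\<^sup>2 + t\<^sup>2" using T by (simp add: add_pos_nonneg)
    have "T * (T / (T\<^sup>2 + t\<^sup>2)) \<le> 1" using p by (simp add: power2_eq_square)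
    moreover have "T * (T / (T\<^sup>2 + t\<^sup>2)) \<le> 1 / 2" if "t \<notin> {- T<..T}"
    proof -
      have "T \<le> \<bar>t\<bar>" using that by (simp only: greaterThanAtMost_iff) linarith
      then have "T\<^sup>2 \<le> t\<^sup>2" using T abs_le_square_iff[of T t] by simp
      then show ?thesis using p by (simp add: power2_eq_square divide_le_eq)
    qed
    ultimately show "T * (T / (T\<^sup>2 + (0 - t)\<^sup>2)) \<le> (1 + indicator {- T<..T} t) / 2"
      by (cases "t \<in> {- T<..T}") (simp_all only: indicator_simps, simp_all)
  qed
  also have "\<dots> = (1 + measure M {- T<..T}) / 2"
    using integrable_ind[of "{- T<..T}"] prob_space by (simp add: Bochner_Integration.integral_add)
  finally show ?thesis by simp
qed

lemma (in real_distribution) tail_exists: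
  assumes "0 < \<epsilon>" shows "\<exists>S. 0 < S \<and> 1 - \<epsilon> < measure M {- S<..S}"
proof -
  have U: "(\<Union>k::nat. {- real k<..real k}) = (UNIV :: real set)"
  proof (intro equalityI subset_UNIV subsetI)
    fix x :: real
    obtain k :: nat where "\<bar>x\<bar> < real k" using reals_Archimedean2[of "\<bar>x\<bar>"] by (elim exE)
    then have "x \<in> {- real k<..real k}" unfolding greaterThanAtMost_iff by linarith
    then show "x \<in> (\<Union>k::nat. {- real k<..real k})" by blast
  qed
  have "(\<lambda>k::nat. measure M {- real k<..real k}) \<longlonglongrightarrow> measure M (\<Union>k. {- real k<..real k})"
  proof (rule finite_Lim_measure_incseq)
    show "range (\<lambda>k::nat. {- real k<..real k}) \<subseteq> sets M" by auto
    show "incseq (\<lambda>k::nat. {- real k<..real k})" unfolding incseq_def by (intro allI impI subsetI) simp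
  qed
  then have "(\<lambda>k::nat. measure M {- real k<..real k}) \<longlonglongrightarrow> 1"
    unfolding U using prob_space unfolding space_eq_univ by metis
  then have "\<forall>\<^sub>F k in sequentially. 1 - \<epsilon> < measure M {- real k<..real k}"
    by (rule order_tendstoD(1)) (use assms in simp)
  then obtain N where N: "\<And>k. N \<le> k \<Longrightarrow> 1 - \<epsilon> < measure M {- real k<..real k}"
    unfolding eventually_sequentially by blast
  have "0 < real (Suc N) \<and> 1 - \<epsilon> < measure M {- real (Suc N)<..real (Suc N)}" using N[of "Suc N"] by (simp del: of_nat_Suc)
  then show ?thesis by blast
qed

lemma tight_stieltjes:
  assumes \<mu>: "\<And>n. real_distribution (\<mu> n)"
    and lim: "\<And>T. 0 < T \<Longrightarrow> (\<lambda>n. stieltjes_imag (\<mu> n) (of_real (- T))) \<longlonglongrightarrow> g (of_real (- T))"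
    and g: "((\<lambda>T. T * Re (g (of_real (- T)))) \<longlongrightarrow> 1) at_top"
  shows "tight \<mu>"
  unfolding tight_def
proof (intro conjI allI impI \<mu>)
  fix \<epsilon> :: real assume \<epsilon>: "0 < \<epsilon>"
  \<comment> \<open>\<open>tail_stieltjes\<close> doubles the deficit, so a quarter of \<epsilon>
    leaves a mass above 1 - \<epsilon> / 2.\<close>
  have "\<forall>\<^sub>F T in at_top. 1 - \<epsilon> / 4 < T * Re (g (of_real (- T)))"
    using \<epsilon> by (intro order_tendstoD(1)[OF g]) simp
  moreover have "\<forall>\<^sub>F T in at_top. (0::real) < T" by (rule eventually_gt_at_top)
  ultimately have "\<forall>\<^sub>F T in at_top. 0 < T \<and> 1 - \<epsilon> / 4 < T * Re (g (of_real (- T)))"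
    by eventually_elim auto
  then obtain T where T: "0 < T" "1 - \<epsilon> / 4 < T * Re (g (of_real (- T)))"
    unfolding eventually_at_top_linorder by blast
  have "(\<lambda>n. T * Re (stieltjes_imag (\<mu> n) (of_real (- T)))) \<longlonglongrightarrow> T * Re (g (of_real (- T)))"
    by (intro tendsto_intros lim T)
  then have "\<forall>\<^sub>F n in sequentially. 1 - \<epsilon> / 4 < T * Re (stieltjes_imag (\<mu> n) (of_real (- T)))"
    using T(2) by (rule order_tendstoD(1))
  then obtain N where N: "\<And>n. N \<le> n \<Longrightarrow> 1 - \<epsilon> / 4 < T * Re (stieltjes_imag (\<mu> n) (of_real (- T)))"
    unfolding eventually_sequentially by blast
  have "\<exists>S. 0 < S \<and> 1 - \<epsilon> < measure (\<mu> n) {- S<..S}" for n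
    by (rule real_distribution.tail_exists[OF \<mu> \<epsilon>])
  then obtain S where S: "\<And>n. 0 < S n" "\<And>n. 1 - \<epsilon> < measure (\<mu> n) {- S n<..S n}" by (metis (no_types))
  \<comment> \<open>The finitely many laws before \<open>N\<close> are not reached by the limit;
    each has its own interval, and \<open>U\<close> covers them all.\<close>
  define U where "U = Max (insert T (S ` {..<N}))"
  have U: "T \<le> U" "\<And>n. n < N \<Longrightarrow> S n \<le> U" by (auto simp: U_def intro!: Max_ge)
  have "1 - \<epsilon> < measure (\<mu> n) {- U<..U}" for n
  proof -
    interpret real_distribution "\<mu> n" by (rule \<mu>)
    show ?thesis
    proof (cases "n < N")
      case True
      have "measure (\<mu> n) {- S n<..S n} \<le> measure (\<mu> n) {- U<..U}" using U(2)[OF True] by (intro finite_measure_mono) (simp_all add: subset_iff)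
      then show ?thesis using S(2)[of n] by simp
    next
      case False
      have "measure (\<mu> n) {- T<..T} \<le> measure (\<mu> n) {- U<..U}" using U(1) by (intro finite_measure_mono) (simp_all add: subset_iff)
      then show ?thesis using tail_stieltjes[OF \<mu> T(1), of n] N[of n] False \<epsilon> by (simp add: not_less algebra_simps)
    qed
  qed
  then show "\<exists>a b. a < b \<and> (\<forall>n. 1 - \<epsilon> < measure (\<mu> n) {a<..b})"
    using U(1) T(1) by (intro exI[of _ "- U"] exI[of _ U] conjI allI) linarith+
qed

text \<open>The analogue of Levy's continuity theorem: the behaviour of g along the negative real
  axis replaces continuity of a characteristic function at the origin and prevents a loss of
  mass.\<close>

theorem stieltjes_continuity:
  assumes \<mu>: "\<And>n. real_distribution (\<mu> n)"
    and lim: "\<And>z. Re z < 0 \<Longrightarrow> (\<lambda>n. stieltjes_imag (\<mu> n) z) \<longlonglongrightarrow> g z"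
    and g: "((\<lambda>T. T * Re (g (of_real (- T)))) \<longlongrightarrow> 1) at_top"
  shows "\<exists>F. real_distribution F \<and> (\<forall>z. Re z < 0 \<longrightarrow> stieltjes_imag F z = g z)"
    and "real_distribution F \<Longrightarrow> (\<And>z. Re z < 0 \<Longrightarrow> stieltjes_imag F z = g z) \<Longrightarrow> weak_conv_m \<mu> F"
proof -
  have t: "tight \<mu>" by (rule tight_stieltjes[OF \<mu> lim g]) simp
  have *: "stieltjes_imag \<nu> z = g z" if s: "strict_mono s" "real_distribution \<nu>" "weak_conv_m (\<mu> \<circ> s) \<nu>" "Re z < 0" for s \<nu> z
  proof -
    have "(\<lambda>n. stieltjes_imag ((\<mu> \<circ> s) n) z) \<longlonglongrightarrow> stieltjes_imag \<nu> z"
      by (rule weak_conv_stieltjes) (use \<mu> s in \<open>simp_all add: o_def\<close>)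
    moreover have "(\<lambda>n. stieltjes_imag ((\<mu> \<circ> s) n) z) \<longlonglongrightarrow> g z"
      using LIMSEQ_subseq_LIMSEQ[OF lim[OF s(4)] s(1)] unfolding o_def .
    ultimately show ?thesis by (rule LIMSEQ_unique)
  qed
  show "\<exists>F. real_distribution F \<and> (\<forall>z. Re z < 0 \<longrightarrow> stieltjes_imag F z = g z)"
    proof -
    obtain r \<nu> where r: "strict_mono r" "real_distribution \<nu>" "weak_conv_m (\<mu> \<circ> id \<circ> r) \<nu>"
      using tight_imp_convergent_subsubsequence[OF t strict_mono_id] by blast
    then show ?thesis using *[OF r(1,2)] unfolding comp_id by blast
  qed
  show "weak_conv_m \<mu> F" if F: "real_distribution F" "\<And>z. Re z < 0 \<Longrightarrow> stieltjes_imag F z = g z"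
  proof (rule tight_subseq_weak_converge[OF \<mu> F(1) t])
    fix s \<nu> assume s: "strict_mono s" "real_distribution \<nu>" "weak_conv_m (\<mu> \<circ> s) \<nu>"
    have "\<nu> = F" by (rule stieltjes_unique[OF s(2) F(1)]) (use *[OF s] F(2) in presburger)
    show "weak_conv_m (\<mu> \<circ> s) F" using s(3) unfolding \<open>\<nu> = F\<close> .
  qed
qed

subsection \<open>The limit of the mean Stieltjes transform\<close>

lemma unit_col_unit_col: "unit_col q * adj (unit_col q) = diag_fmat p (\<lambda>i. if i = q then 1 else 0)" if "q < p"
proof (rule fmat_eqI)
  fix i j
  have "dims p 1 (unit_col q)" using that by (rule dims_unit_col)
  then show "ent (unit_col q * adj (unit_col q)) i j = ent (diag_fmat p (\<lambda>i. if i = q then 1 else 0)) i j"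
    using that by (subst ent_mult_dims[of p 1]) auto
qed

text \<open>Deleting one eigendirection changes the compression by a commutator term and a rank one term.\<close>
lemma compression_ineq:
  assumes S: "skew p S" and V: "unitary p V" and u: "Re u > 0" and J: "finite J" "J \<subseteq> {..<p}"
  defines "P \<equiv> \<lambda>J. spectral_fun p V (\<lambda>i. if i \<in> J then 0 else 1)"
  shows "cmod (tr (res p u S) - tr (res p u (P J * S * P J))) \<le> 3 * real (card J) / Re u"
  using J
proof (induction J)
  case empty
  have "P {} = proj p" unfolding P_def by (simp add: spectral_fun_one[OF V])
  then show ?case using skew_dims[OF S] by (simp add: dims_projL dims_projR)
next
  case (insert q J)
  then have q: "q < p" by auto
  have triangle: "cmod (a - b) \<le> cmod (a - c) + cmod (b - e) + cmod (e - c)" for a b c e :: complex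
  proof -
    have "a - b = (a - c) - (b - e) - (e - c)" by simp
    then show ?thesis using norm_triangle_ineq4[of "(a - c) - (b - e)" "e - c"] norm_triangle_ineq4[of "a - c" "b - e"] by simp
  qed
  define v where "v = V * unit_col q"
  have v: "dims p 1 v" unfolding v_def by (rule dims_mult[OF unitary_dims[OF V] dims_unit_col[OF q]])
  let ?P = "P (insert q J)"
  have P: "dims p p (P J)" "adj (P J) = P J" for J
    unfolding P_def spectral_fun_adj by (rule dims_spectral_fun[OF V]) (rule spectral_fun_cong, simp)
  have "v * adj v = spectral_fun p V (\<lambda>i. if i = q then 1 else 0)"
    unfolding v_def spectral_fun_def unit_col_unit_col[OF q, symmetric] by (simp add: mult.assoc)
  then have PJ: "P J = ?P + v * adj v"
    unfolding P_def using insert.hyps by (simp add: spectral_fun_add) (rule spectral_fun_cong, auto)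
  define x where "x = ?P * S * v"
  have x: "dims p 1 x" unfolding x_def by (rule dims_mult[OF dims_mult[OF P(1) skew_dims[OF S]] v])
  define k where "k = Im (tr (adj v * (S * v)))"
  have aS: "adj S = - S" using S by (simp add: skew_def)
  have sP: "skew p (?P * S * ?P)"
    unfolding skew_def using P(2) aS dims_mult[OF dims_mult[OF P(1) skew_dims[OF S]] P(1)] by (simp add: mult.assoc)
  have "tr (adj v * (S * v)) = \<i> * of_real k"
    using Re_tr_skew[OF aS, of v] by (simp add: complex_eq_iff k_def)
  then have t: "adj v * (S * v) = sm (\<i> * of_real k) (proj 1)"
    using dims11[OF dims_mult[OF dims_adj[OF v] dims_mult[OF skew_dims[OF S] v]]] by simp
  have "adj x = - (adj v * S * ?P)" unfolding x_def using P(2) aS by (simp add: mult.assoc)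
  moreover have "v * (adj v * (S * v)) * adj v = sm (\<i> * of_real k) (v * adj v)"
    unfolding t using v by (simp add: dims_projR)
  \<comment> \<open>The diagonal entry of \<open>S\<close> in direction \<open>v\<close> is purely
    imaginary and gives a rank one term, the mixed entries form a \<open>skew_pair\<close>. Their
    costs 1 and 2 add up to the factor 3.\<close>
  ultimately have e: "P J * S * P J = ?P * S * ?P + sm (of_real 1) (skew_pair x v) + sm (\<i> * of_real k) (v * adj v)"
    unfolding PJ skew_pair_def x_def by (simp add: ring_distribs mult.assoc)
  let ?A = "?P * S * ?P"
  have o: "op_bound 1 (proj p)" by (rule op_bound_proj)
  have sp: "skew p (?A + sm (of_real 1) (skew_pair x v))"
    by (intro skew_add skew_sm skew_skew_pair[of _ 1] sP x v)
  have "cmod (tr (res p u ?A) - tr (res p u (?A + sm (of_real 1) (skew_pair x v)))) \<le> 2 / Re u"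
    using rank2_ineq[OF sP u x v o, of 1] proj_res(1)[OF sP u] proj_res(1)[OF sp u] by (simp add: ring_distribs)
  moreover have "cmod (tr (res p u (?A + sm (of_real 1) (skew_pair x v))) - tr (res p u (P J * S * P J))) \<le> 1 / Re u"
  proof -
    have "skew p (P J * S * P J)" unfolding e by (rule skew_add[OF sp skew_rank1[OF v]])
    then show ?thesis
      using rank1_ineq[OF sp u v o, of k] proj_res(1)[OF sp u] proj_res(1)[OF _ u, of p "P J * S * P J"] unfolding e[symmetric]
      by (simp add: ring_distribs)
  qed
  moreover have "cmod (tr (res p u S) - tr (res p u (P J * S * P J))) \<le> 3 * real (card J) / Re u"
    using insert by simp
  moreover have "3 * real (card (insert q J)) / Re u = 3 * real (card J) / Re u + 1 / Re u + 2 / Re u"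
    using insert.hyps by (simp add: add_divide_distrib)
  ultimately show ?case using triangle[of "tr (res p u S)" "tr (res p u ?A)" "tr (res p u (P J * S * P J))" "tr (res p u (?A + sm (of_real 1) (skew_pair x v)))"] by linarith
qed

context rmt begin

text \<open>Setting the eigenvalues above \<tau> to 0 multiplies \<open>R\<close> by a spectral
  projection that commutes with it, so the new \<open>S\<close> is a compression of the old one and
  \<open>compression_ineq\<close> applies.\<close>

lemma truncation:
  fixes \<tau> :: real
  defines "d' \<equiv> \<lambda>i. if d i \<le> \<tau> then d i else 0"
  shows "rmt p n u V d' C z1 z2 K"
    and "cmod (tr (Q w) - tr (rmt.Q p n u V d' z1 z2 w)) \<le> 3 * card {i. i < p \<and> \<tau> < d i} / Re u"
proof -
  show t: "rmt p n u V d' C z1 z2 K"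
    by (rule rmt.intro) ((rule p n u V prob_C K z1 z2 | erule q11 q22 q12 | simp add: d'_def d)+)
  interpret t: rmt p n u V d' C z1 z2 K by (rule t)
  let ?J = "{i. i < p \<and> \<tau> < d i}"
  let ?P = "spectral_fun p V (\<lambda>i. if i \<in> ?J then 0 else 1)"
  have r: "t.R = ?P * R" "t.R = R * ?P"
    unfolding t.R_def R_def spectral_fun_mult[OF V] by (rule spectral_fun_cong, auto simp: d'_def)+
  have "skew_pair (t.xc j w) (t.yc j w) = ?P * skew_pair (xc j w) (yc j w) * ?P" for j
  proof -
    have "skew_pair (t.xc j w) (t.yc j w) = t.R * skew_pair (z1 j (w j)) (z2 j (w j)) * t.R"
      unfolding skew_pair_def t.xc_def t.yc_def using t.adj_R by (simp add: ring_distribs mult.assoc)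
    moreover have "skew_pair (xc j w) (yc j w) = R * skew_pair (z1 j (w j)) (z2 j (w j)) * R"
      unfolding skew_pair_def xc_def yc_def using adj_R by (simp add: ring_distribs mult.assoc)
    moreover have "t.R * X * t.R = (?P * R) * X * (R * ?P)" for X by (simp only: r(1)[symmetric] r(2)[symmetric])
    ultimately show ?thesis by (simp only: mult.assoc)
  qed
  then have "t.S w = ?P * S w * ?P"
    unfolding t.S_def S_def by (simp add: sum_distrib_left sum_distrib_right)
  then show "cmod (tr (Q w) - tr (t.Q w)) \<le> 3 * card ?J / Re u"
    unfolding Q_def t.Q_def using compression_ineq[OF skew_S V u, of ?J w] by (simp add: subset_iff)
qed

end

section \<open>The two test matrices\<close>

context rmt begin

text \<open>Writing tr (Sg Q) as tr (R Q R) bounds it by the trace of \<open>Sg\<close> rather than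
  its largest eigenvalue, so \<open>mm\<close> stays bounded along the sequence.\<close>

lemma mm_bounds: "0 \<le> Re mm" "cmod mm \<le> (\<Sum>i<p. d i) / (n * Re u)"
proof -
  have i: "integrable PC (\<lambda>w. tr (Sg * Q w))"
    by (rule integrable_trAQ[OF op_bound_spectral_fun[OF V, of "\<lambda>i. of_real (d i)" "\<Sum>i<p. d i", folded Sg_def] dims_Sg])
       (use d in \<open>auto intro!: member_le_sum sum_nonneg\<close>)
  have "0 \<le> PC.expectation (\<lambda>w. Re (tr (Sg * Q w)))" by (rule integral_nonneg_AE) (simp add: Re_tr_SgQ)
  also have "\<dots> = Re (PC.expectation (\<lambda>w. tr (Sg * Q w)))" by (rule integral_Re[OF i])
  finally show "0 \<le> Re mm" using n unfolding mm_def by (simp add: Re_divide_of_nat)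
  have "cmod (PC.expectation (\<lambda>w. tr (Sg * Q w))) \<le> PC.expectation (\<lambda>w. cmod (tr (Sg * Q w)))" by (rule integral_norm_bound)
  also have "\<dots> \<le> PC.expectation (\<lambda>w. (\<Sum>i<p. d i) / Re u)"
    by (rule integral_mono) (use i tr_SgQ_bound in auto)
  finally have "cmod (PC.expectation (\<lambda>w. tr (Sg * Q w))) \<le> (\<Sum>i<p. d i) / Re u" by (simp add: PC.prob_space)
  then have "cmod mm \<le> (\<Sum>i<p. d i) / Re u / n"
    unfolding mm_def norm_divide norm_of_nat by (rule divide_right_mono) simp
  then show "cmod mm \<le> (\<Sum>i<p. d i) / (n * Re u)" by (simp add: mult.commute)
qed

text \<open>The test matrix is 1, with 634 = 38 + 596. The estimate links \<open>mm\<close> to the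
  normalised mean trace of the resolvent.\<close>

lemma estimate_one:
  assumes \<tau>: "\<And>i. i < p \<Longrightarrow> d i \<le> \<tau>" "0 < \<tau>"
  shows "cmod ((1 + mm\<^sup>2) * (p / n * (1 - u * (PC.expectation (\<lambda>w. tr (Q w)) / p))) - 2 * mm\<^sup>2)
     \<le> (1 + cmod mm) * (634 * W \<tau> + 4) / sqrt n"
proof -
  have "(1 + mm\<^sup>2) * (tr (proj p) - u * PC.expectation (\<lambda>w. tr (proj p * Q w))) / n - 2 * mm * PC.expectation (\<lambda>w. tr (proj p * Sg * Q w)) / n
     = (1 + mm\<^sup>2) * (p / n * (1 - u * (PC.expectation (\<lambda>w. tr (Q w)) / p))) - 2 * mm\<^sup>2"
    unfolding dims_projL[OF dims_Q] dims_projL[OF dims_Sg] tr_proj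
    using p by (simp add: mm_def power2_eq_square right_diff_distrib diff_divide_distrib)
  then show ?thesis using core_estimate[OF \<tau> op_bound_proj dims_proj] by simp
qed

text \<open>The test matrix A = Sg (u + r Sg)^(-1) satisfies Sg = u A + r A Sg, so the two unknown
  traces in \<open>core_estimate\<close> recombine to n \<open>mm\<close>, which leaves an equation
  for \<open>mm\<close> alone.\<close>

lemma estimate_two:
  fixes r :: complex
  assumes \<tau>: "\<And>i. i < p \<Longrightarrow> d i \<le> \<tau>" "0 < \<tau>" and nz: "1 + mm\<^sup>2 \<noteq> 0" and r: "r = 2 * mm / (1 + mm\<^sup>2)" "0 \<le> Re r"
  shows "cmod ((1 + mm\<^sup>2) * ((\<Sum>i<p. d i / (u + d i * r)) / n - mm))
     \<le> (1 + cmod mm) * ((38 * (\<tau> / Re u)\<^sup>2 + 596) * W \<tau> + 4) / sqrt n"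
proof -
  define A where "A = spectral_fun p V (\<lambda>i. d i / (u + d i * r))"
  have re: "Re u \<le> cmod (u + d i * r)" for i
  proof -
    have "Re u \<le> Re (u + d i * r)" using d r(2) by simp
    also have "\<dots> \<le> cmod (u + d i * r)" by (rule complex_Re_le_cmod)
    finally show ?thesis .
  qed
  have den: "u + d i * r \<noteq> 0" for i using re[of i] u by auto
  have "cmod (d i / (u + d i * r)) \<le> \<tau> / Re u" if "i < p" for i
    using re[of i] u d \<tau>(1)[OF that] \<tau>(2) by (simp add: norm_divide frac_le)
  then have oA: "op_bound (\<tau> / Re u) A" unfolding A_def using u \<tau> by (intro op_bound_spectral_fun[OF V]) auto
  have dA: "dims p p A" unfolding A_def by (rule dims_spectral_fun[OF V])
  have Sg: "Sg = sm u A + sm r (A * Sg)"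
    unfolding A_def Sg_def spectral_fun_mult[OF V] spectral_fun_sm spectral_fun_add
    by (rule spectral_fun_cong) (use den in \<open>simp add: divide_simps, simp add: algebra_simps\<close>)
  have i1: "integrable PC (\<lambda>w. tr (A * Q w))" by (rule integrable_trAQ[OF oA dA])
  have i2: "integrable PC (\<lambda>w. tr (A * Sg * Q w))"
    by (rule integrable_trAQ[OF op_bound_mult[OF oA oSg[OF \<tau> oA dA]] dims_mult[OF dA dims_Sg]])
  have "tr (Sg * Q w) = u * tr (A * Q w) + r * tr (A * Sg * Q w)" for w
    by (subst Sg) (simp add: ring_distribs)
  then have m: "n * mm = u * PC.expectation (\<lambda>w. tr (A * Q w)) + r * PC.expectation (\<lambda>w. tr (A * Sg * Q w))"
    unfolding mm_def using n i1 i2 by simp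
  have r': "2 * mm = (1 + mm\<^sup>2) * r" using nz r(1) by simp
  have "(1 + mm\<^sup>2) * (tr A - u * PC.expectation (\<lambda>w. tr (A * Q w))) / n - 2 * mm * PC.expectation (\<lambda>w. tr (A * Sg * Q w)) / n
    = (1 + mm\<^sup>2) * (tr A - (u * PC.expectation (\<lambda>w. tr (A * Q w)) + r * PC.expectation (\<lambda>w. tr (A * Sg * Q w)))) / n"
    unfolding r' diff_divide_distrib[symmetric] by (simp only: algebra_simps)
  also have "\<dots> = (1 + mm\<^sup>2) * (tr A / n - mm)" unfolding m[symmetric] using n by (simp add: field_simps)
  finally show ?thesis using core_estimate[OF \<tau> oA dA] by (simp add: A_def tr_spectral_fun[OF V])
qed

end

text \<open>Partial fractions reconcile the transform as stated in the theorem, at z = - u, with the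
  form obtained by solving \<open>estimate_one\<close> for the trace, where m = c h.\<close>

lemma sigma_formula:
  assumes "u \<noteq> 0" "c \<noteq> 0" "1 + (of_real c * h)\<^sup>2 \<noteq> 0"
  shows "1 / (- u) * (2 / of_real c - 1) + 1 / (\<i> * of_real c * (- u)) * (1 / (\<i> + of_real c * h) - 1 / (- \<i> + of_real c * h))
     = (1 - 2 * (of_real c * h)\<^sup>2 / (1 + (of_real c * h)\<^sup>2) / of_real c) / u"
proof -
  define m where "m = of_real c * h"
  have f: "(\<i> + m) * (- \<i> + m) = 1 + m\<^sup>2" by (simp add: algebra_simps power2_eq_square)
  have nz: "1 + m\<^sup>2 \<noteq> 0" "\<i> + m \<noteq> 0" "- \<i> + m \<noteq> 0" using assms(3) rho_denoms_nonzero[OF assms(3)] by (auto simp: m_def)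
  define q where "q = 1 / (1 + m\<^sup>2)"
  have e1: "1 / (\<i> + m) - 1 / (- \<i> + m) = - 2 * \<i> * q"
    unfolding diff_frac_eq[OF nz(2,3)] f q_def by simp
  have e2: "2 * m\<^sup>2 / (1 + m\<^sup>2) = 2 - 2 * q" unfolding q_def using nz(1) by (simp add: field_simps)
  show ?thesis unfolding m_def[symmetric] e1 e2 using assms(1,2) by (simp add: field_simps)
qed


section \<open>Sequences of fixed population matrices\<close>

locale rmt_seq =
  fixes p N :: "nat \<Rightarrow> nat" and u :: complex and V :: "nat \<Rightarrow> fmat" and d :: "nat \<Rightarrow> nat \<Rightarrow> real"
    and C :: "nat \<Rightarrow> nat \<Rightarrow> 'b measure" and z1 z2 :: "nat \<Rightarrow> nat \<Rightarrow> 'b \<Rightarrow> fmat" and K c b :: real and H :: "real measure"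
  assumes rmt: "\<And>k. rmt (p k) (N k) u (V k) (d k) (C k) (z1 k) (z2 k) K"
    and N: "filterlim N at_top sequentially"
    and c: "(\<lambda>k. p k / N k) \<longlonglongrightarrow> c" "0 < c"
    and H: "population_dist H" "weak_conv_m (\<lambda>k. emp (p k) (d k)) H"
    and b: "\<forall>\<^sub>F k in sequentially. (\<Sum>i<p k. d k i) \<le> b * p k" "0 < b"
begin

definition "sg k = (LINT w|rmt.PC (N k) (C k). tr (rmt.Q (p k) (N k) u (V k) (d k) (z1 k) (z2 k) w)) / p k"
definition "m k = rmt.mm (p k) (N k) u (V k) (d k) (C k) (z1 k) (z2 k)"
definition "cs k = real (p k) / real (N k)"
text \<open>The level at which eigenvalues of the population matrix are truncated: it has to tend to infinity,
  and its fourth power has to be negligible against \<open>sqrt (N k)\<close>.\<close>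
definition "\<tau> k = real (N k) powr (1 / 16)"
definition "h = h_fun c H (- u)"
definition "lim_sg = (1 - 2 * (of_real c * h)\<^sup>2 / (1 + (of_real c * h)\<^sup>2) / of_real c) / u"

lemma u: "0 < Re u" and K: "0 \<le> K" and p: "0 < p k" and N0: "0 < N k" and d: "0 \<le> d k i"
  using rmt[of 0] rmt[of k] by (auto simp: rmt_def)
lemma cs: "cs \<longlonglongrightarrow> c" "0 < cs k" using c p[of k] N0[of k] by (auto simp: cs_def[abs_def])
lemma \<tau>0: "0 < \<tau> k" using N0[of k] by (simp add: \<tau>_def)

lemma is_h: "is_h c H (- u) h"
  unfolding h_def by (rule is_h_h_fun[OF H(1) c(2)]) (use u in simp)
lemma h_nonzero: "1 + (of_real c * h)\<^sup>2 \<noteq> 0"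
  by (rule denoms_nonzero_Re[OF c(2)]) (use is_h in \<open>simp add: is_h_def\<close>)

lemma sg_bound: "cmod (sg k) \<le> 1 / Re u"
proof -
  interpret rmt "p k" "N k" u "V k" "d k" "C k" "z1 k" "z2 k" K by (rule rmt)
  have b: "cmod (tr (Q w)) \<le> p k / Re u" for w
    using tr_AQ_bound[OF op_bound_proj dims_proj, of w] by (simp add: dims_projL[OF dims_Q])
  have i: "integrable PC (\<lambda>w. tr (Q w))"
    using integrable_trAQ[OF op_bound_proj dims_proj] by (simp add: dims_projL[OF dims_Q])
  have "cmod (PC.expectation (\<lambda>w. tr (Q w))) \<le> PC.expectation (\<lambda>w. cmod (tr (Q w)))" by (rule integral_norm_bound)
  also have "\<dots> \<le> PC.expectation (\<lambda>w. p k / Re u)" by (rule integral_mono) (use i b in auto)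
  finally have "cmod (PC.expectation (\<lambda>w. tr (Q w))) \<le> p k / Re u" by (simp add: PC.prob_space)
  from divide_right_mono[OF this, of "real (p k)"] show ?thesis unfolding sg_def using p by (simp add: norm_divide)
qed

definition "B0 = b * (c + 1) / Re u"
text \<open>One bound for the errors of both estimates, valid once |m| <= \<open>B0\<close> and p /
  N <= c + 1. The norm \<tau> / Re u belongs to the second test matrix, and 634 covers both additive
  constants.\<close>

definition "er k = (1 + B0) * ((38 * (\<tau> k / Re u)\<^sup>2 + 634) * ((\<tau> k)\<^sup>2 / (Re u)\<^sup>2 * (K + 1) * (c + 2)\<^sup>2) + 4) / sqrt (real (N k))"

lemma B0: "0 < B0" unfolding B0_def using b c u by simp

text \<open>The leading term is of order \<tau>^4 / sqrt N = N^(1/4 - 1/2).\<close>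

lemma er: "er \<longlonglongrightarrow> 0"
proof -
  have N': "filterlim (\<lambda>k. real (N k)) at_top sequentially"
    by (rule filterlim_compose[OF filterlim_real_sequentially N])
  define a1 a2 where "a1 = 1 / (Re u)\<^sup>2" and "a2 = (K + 1) * (c + 2)\<^sup>2"
  have "((\<lambda>x::real. (1 + B0) * ((38 * ((x powr (1 / 16))\<^sup>2 * a1) + 634) * ((x powr (1 / 16))\<^sup>2 * a1 * a2) + 4) / sqrt x) \<longlongrightarrow> 0) at_top"
    by real_asymp
  from filterlim_compose[OF this N'] show ?thesis
    unfolding er_def \<tau>_def a1_def a2_def by (simp add: power_divide mult.assoc)
qed

lemma ev_cs: "\<forall>\<^sub>F k in sequentially. cs k \<le> c + 1"
  using order_tendstoD(2)[OF cs(1), of "c + 1"] by (auto elim: eventually_mono)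

lemma ev_m: "\<forall>\<^sub>F k in sequentially. cmod (m k) \<le> B0"
  using b(1) ev_cs
proof eventually_elim
  case (elim k)
  interpret rmt "p k" "N k" u "V k" "d k" "C k" "z1 k" "z2 k" K by (rule rmt)
  have "cmod (m k) \<le> (\<Sum>i<p k. d k i) / (N k * Re u)" unfolding m_def by (rule mm_bounds)
  also have "\<dots> \<le> b * p k / (N k * Re u)" using elim(1) u by (intro divide_right_mono) auto
  also have "\<dots> = b * cs k / Re u" by (simp add: cs_def)
  also have "\<dots> \<le> B0" unfolding B0_def using elim(2) b(2) u by (intro divide_right_mono mult_left_mono) auto
  finally show ?case .
qed

context
  assumes trunc: "\<And>k i. i < p k \<Longrightarrow> d k i \<le> \<tau> k"
begin

lemma W_le: assumes "cs k \<le> c + 1" "cmod (m k) \<le> B0" "0 \<le> x" "x \<le> 38 * (\<tau> k / Re u)\<^sup>2 + 634"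
  shows "(1 + cmod (m k)) * (x * rmt.W (p k) (N k) u K (\<tau> k) + 4) / sqrt (N k) \<le> er k"
proof -
  interpret rmt "p k" "N k" u "V k" "d k" "C k" "z1 k" "z2 k" K by (rule rmt)
  have "W (\<tau> k) \<le> (\<tau> k)\<^sup>2 / (Re u)\<^sup>2 * (K + 1) * (c + 2)\<^sup>2"
    unfolding W_def cs_def[symmetric] using cs(2)[of k] assms(1) K by (intro mult_left_mono power_mono) auto
  moreover have "0 \<le> W (\<tau> k)" unfolding W_def using K by simp
  ultimately show ?thesis unfolding er_def using assms B0
    by (intro divide_right_mono mult_mono add_mono) auto
qed

lemma ev_one: "\<forall>\<^sub>F k in sequentially. cmod ((1 + (m k)\<^sup>2) * (cs k * (1 - u * sg k)) - 2 * (m k)\<^sup>2) \<le> er k"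
  using ev_cs ev_m
proof eventually_elim
  case (elim k)
  interpret rmt "p k" "N k" u "V k" "d k" "C k" "z1 k" "z2 k" K by (rule rmt)
  show ?case using estimate_one[OF trunc[of _ k] \<tau>0[of k]] W_le[OF elim, of 634]
    by (simp add: m_def sg_def cs_def)
qed

definition "\<delta> = 1 / (2 + (c + 1) * (1 + cmod u / Re u))"

lemma \<delta>: "0 < \<delta>" unfolding \<delta>_def using c u by (intro divide_pos_pos add_pos_nonneg mult_nonneg_nonneg) auto

text \<open>If 1 + m^2 were small, 2 m^2 would be near -2, yet \<open>ev_one\<close> bounds |2 m^2|
  by |1 + m^2| B + \<open>er\<close>. As \<open>er\<close> is eventually below 1, this yields 1 <=
  |1 + m^2| (2 + B), and \<open>\<delta>\<close> is the reciprocal of 2 + B.\<close>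

lemma ev_\<delta>: "\<forall>\<^sub>F k in sequentially. \<delta> \<le> cmod (1 + (m k)\<^sup>2)"
proof -
  have one: "(0::real) < 1" by simp
  show ?thesis
  using ev_one ev_cs order_tendstoD(2)[OF er one]
proof eventually_elim
  case (elim k)
  define x where "x = cmod (1 + (m k)\<^sup>2)"
  define B where "B = (c + 1) * (1 + cmod u / Re u)"
  have B: "0 \<le> B" unfolding B_def using c u by (intro mult_nonneg_nonneg) auto
  have "cmod (1 - u * sg k) \<le> 1 + cmod u * (1 / Re u)"
    by (rule order.trans[OF norm_triangle_ineq4]) (use sg_bound[of k] in \<open>simp add: norm_mult mult_left_mono del: times_divide_eq_right\<close>)
  then have "cmod (cs k * (1 - u * sg k)) \<le> B"
    unfolding B_def norm_mult norm_of_real using elim(2) cs(2)[of k] c by (intro mult_mono) auto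
  then have "cmod ((1 + (m k)\<^sup>2) * (cs k * (1 - u * sg k))) \<le> x * B"
    unfolding norm_mult[of "1 + (m k)\<^sup>2"] x_def by (intro mult_left_mono) auto
  moreover have "cmod (2 * (m k)\<^sup>2) \<le> cmod ((1 + (m k)\<^sup>2) * (cs k * (1 - u * sg k))) + er k"
    using elim(1) norm_triangle_ineq4[of "(1 + (m k)\<^sup>2) * (cs k * (1 - u * sg k))" "(1 + (m k)\<^sup>2) * (cs k * (1 - u * sg k)) - 2 * (m k)\<^sup>2"] by simp
  moreover have "2 \<le> 2 * x + cmod (2 * (m k)\<^sup>2)"
    using norm_triangle_ineq4[of "1 + (m k)\<^sup>2" "(m k)\<^sup>2"] by (simp add: norm_mult x_def)
  ultimately have "1 \<le> x * (2 + B)" using elim(3) by (simp add: distrib_left)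
  then show ?case unfolding \<delta>_def B_def[symmetric] x_def[symmetric] using B by (simp add: divide_le_eq)
qed
qed

definition "w k = m k / of_real (cs k)"

lemma cs_w: "of_real (cs k) * w k = m k" using cs(2)[of k] by (simp add: w_def)

text \<open>For w = m / cs, rho at (cs, w) is the \<open>r\<close> of \<open>estimate_two\<close>,
  and the normalised sum over the eigenvalues is cs times \<open>h_map\<close> of their empirical
  law. Dividing by 1 + m^2 costs 1 / \<open>\<delta>\<close>.\<close>

lemma ev_two: "\<forall>\<^sub>F k in sequentially. cmod (w k - h_map (cs k) (emp (p k) (d k)) u (w k)) \<le> er k / (\<delta> * cs k)"
  using ev_cs ev_m ev_\<delta>
proof eventually_elim
  case (elim k)
  interpret rmt "p k" "N k" u "V k" "d k" "C k" "z1 k" "z2 k" K by (rule rmt)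
  have nz: "1 + (m k)\<^sup>2 \<noteq> 0" using elim(3) \<delta> by auto
  define r where "r = rho (cs k) (w k)"
  have r: "r = 2 * mm / (1 + mm\<^sup>2)" unfolding r_def using rho_eq[of "cs k" "w k"] nz by (simp add: cs_w m_def)
  have "0 \<le> Re r" unfolding r_def by (rule Re_rho_nonneg) (use cs(2)[of k] mm_bounds(1) in \<open>auto simp: w_def m_def\<close>)
  have "cmod ((1 + (m k)\<^sup>2) * ((\<Sum>i<p k. d k i / (u + d k i * r)) / N k - m k)) \<le> er k"
    unfolding m_def
    by (rule order.trans[OF estimate_two[OF trunc \<tau>0 _ r \<open>0 \<le> Re r\<close>]])
       (use nz W_le[OF elim(1,2), of "38 * (\<tau> k / Re u)\<^sup>2 + 596"] in \<open>auto simp: m_def\<close>)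
  moreover have "\<delta> * cmod ((\<Sum>i<p k. d k i / (u + d k i * r)) / N k - m k) \<le> cmod ((1 + (m k)\<^sup>2) * ((\<Sum>i<p k. d k i / (u + d k i * r)) / N k - m k))"
    unfolding norm_mult using elim(3) by (intro mult_right_mono) auto
  ultimately have "\<delta> * cmod ((\<Sum>i<p k. d k i / (u + d k i * r)) / N k - m k) \<le> er k" by simp
  moreover have "(\<Sum>i<p k. d k i / (u + d k i * r)) / N k - m k = - (of_real (cs k) * (w k - h_map (cs k) (emp (p k) (d k)) u (w k)))"
  proof -
    have "(\<Sum>i<p k. d k i / (u + d k i * r)) / N k = of_real (cs k) * h_map (cs k) (emp (p k) (d k)) u (w k)"
      unfolding h_map_def r_def[symmetric] using p by (subst integral_emp) (auto simp: cs_def scaleR_conv_of_real divide_inverse)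
    then show ?thesis by (simp add: right_diff_distrib cs_w)
  qed
  ultimately have "\<delta> * (cs k * cmod (w k - h_map (cs k) (emp (p k) (d k)) u (w k))) \<le> er k"
    using cs(2)[of k] by (simp add: norm_mult)
  then show ?case using \<delta> cs(2)[of k] by (simp add: pos_le_divide_eq mult_ac)
qed

lemma w_tendsto: "w \<longlonglongrightarrow> h"
proof -
  have "\<forall>\<^sub>F k in sequentially. cmod (w k - h_map (cs k) (emp (p k) (d k)) u (w k)) \<le> er k / (\<delta> * cs k) \<and> 1 + (m k)\<^sup>2 \<noteq> 0"
    using ev_two ev_\<delta> by eventually_elim (use \<delta> in auto)
  \<comment> \<open>\<open>approx_fixpoint\<close> excludes the poles at every index, so the first
    \<open>k0\<close> terms are dropped.\<close>
  then obtain k0 where k0: "\<And>k. k0 \<le> k \<Longrightarrow> cmod (w k - h_map (cs k) (emp (p k) (d k)) u (w k)) \<le> er k / (\<delta> * cs k) \<and> 1 + (m k)\<^sup>2 \<noteq> 0"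
    unfolding eventually_sequentially by blast
  interpret a: approx_fixpoint "\<lambda>k. cs (k + k0)" c "\<lambda>_. u" u "\<lambda>k. emp (p (k + k0)) (d (k + k0))" H "\<lambda>k. w (k + k0)"
  proof
    show "(\<lambda>k. cs (k + k0)) \<longlonglongrightarrow> c" by (rule LIMSEQ_ignore_initial_segment[OF cs(1)])
    show "weak_conv_m (\<lambda>k. emp (p (k + k0)) (d (k + k0))) H"
      unfolding weak_conv_m_def weak_conv_def
    proof (intro allI impI)
      fix x assume "isCont (cdf H) x"
      then have "(\<lambda>k. cdf (emp (p k) (d k)) x) \<longlonglongrightarrow> cdf H x" using H(2) unfolding weak_conv_m_def weak_conv_def by simp
      then show "(\<lambda>k. cdf (emp (p (k + k0)) (d (k + k0))) x) \<longlonglongrightarrow> cdf H x" by (rule LIMSEQ_ignore_initial_segment)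
    qed
    show "nonneg_dist (emp (p (k + k0)) (d (k + k0)))" for k
      unfolding nonneg_dist_def by (rule conjI[OF real_distribution_emp], unfold emp_def, subst AE_distr_iff) (auto simp: d)
    show "0 \<le> Re (w (k + k0))" for k
      using cs(2)[of "k + k0"] rmt.mm_bounds(1)[OF rmt[of "k + k0"]] by (simp add: w_def m_def)
    show "1 + (of_real (cs (k + k0)) * w (k + k0))\<^sup>2 \<noteq> 0" for k unfolding cs_w using k0[of "k + k0"] by simp
    show "integrable (emp (p (k + k0)) (d (k + k0))) (\<lambda>t. of_real t / (u + of_real t * rho (cs (k + k0)) (w (k + k0))))" for k
      by (rule integrable_emp[OF p]) simp
    have "(\<lambda>k. er k / (\<delta> * cs k)) \<longlonglongrightarrow> 0 / (\<delta> * c)"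
      by (intro tendsto_intros er cs) (use \<delta> c in auto)
    then have "(\<lambda>k. er (k + k0) / (\<delta> * cs (k + k0))) \<longlonglongrightarrow> 0"
      using LIMSEQ_ignore_initial_segment[of "\<lambda>k. er k / (\<delta> * cs k)" 0 k0] by simp
    then show "(\<lambda>k. w (k + k0) - h_map (cs (k + k0)) (emp (p (k + k0)) (d (k + k0))) u (w (k + k0))) \<longlonglongrightarrow> 0"
      by (rule Lim_null_comparison[rotated]) (intro always_eventually allI, use k0 in simp)
  qed (simp_all add: u c cs H tendsto_const)
  show ?thesis using a.limit[OF is_h] by (rule LIMSEQ_offset)
qed

lemma sg_tendsto_truncated: "sg \<longlonglongrightarrow> lim_sg"
proof -
  have m: "m \<longlonglongrightarrow> of_real c * h"
    using tendsto_mult[OF tendsto_of_real[OF cs(1)] w_tendsto] unfolding cs_w .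
  have l: "(\<lambda>k. 2 * (m k)\<^sup>2 / (1 + (m k)\<^sup>2)) \<longlonglongrightarrow> 2 * (of_real c * h)\<^sup>2 / (1 + (of_real c * h)\<^sup>2)"
    by (intro tendsto_intros m h_nonzero)
  have "(\<lambda>k. cs k * (1 - u * sg k) - 2 * (m k)\<^sup>2 / (1 + (m k)\<^sup>2)) \<longlonglongrightarrow> 0"
  proof (rule Lim_null_comparison)
    show "(\<lambda>k. er k / \<delta>) \<longlonglongrightarrow> 0" using tendsto_divide[OF er tendsto_const, of \<delta>] \<delta> by simp
    show "\<forall>\<^sub>F k in sequentially. cmod (cs k * (1 - u * sg k) - 2 * (m k)\<^sup>2 / (1 + (m k)\<^sup>2)) \<le> er k / \<delta>"
      using ev_one ev_\<delta>
    proof eventually_elim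
      case (elim k)
      let ?X = "cs k * (1 - u * sg k) - 2 * (m k)\<^sup>2 / (1 + (m k)\<^sup>2)"
      have nz: "1 + (m k)\<^sup>2 \<noteq> 0" using elim(2) \<delta> by auto
      then have "(1 + (m k)\<^sup>2) * (cs k * (1 - u * sg k)) - 2 * (m k)\<^sup>2 = (1 + (m k)\<^sup>2) * ?X" by (simp add: right_diff_distrib)
      then have "cmod (1 + (m k)\<^sup>2) * cmod ?X \<le> er k" using elim(1) by (simp only: norm_mult)
      moreover have "\<delta> * cmod ?X \<le> cmod (1 + (m k)\<^sup>2) * cmod ?X" using elim(2) by (intro mult_right_mono) auto
      ultimately show ?case using \<delta> by (simp add: pos_le_divide_eq mult.commute)
    qed
  qed
  from tendsto_add[OF this l] have "(\<lambda>k. cs k * (1 - u * sg k)) \<longlonglongrightarrow> 2 * (of_real c * h)\<^sup>2 / (1 + (of_real c * h)\<^sup>2)" by simp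
  then have "(\<lambda>k. (1 - cs k * (1 - u * sg k) / cs k) / u) \<longlonglongrightarrow> lim_sg"
    unfolding lim_sg_def by (intro tendsto_intros tendsto_of_real cs(1)) (use c u in auto)
  moreover have "(1 - cs k * (1 - u * sg k) / cs k) / u = sg k" for k using cs(2)[of k] u by auto
  ultimately show ?thesis by simp
qed

end

end

section \<open>From truncated to original population eigenvalues\<close>

lemma card_diff_le:
  assumes "finite A" "finite B" "finite J" "A \<subseteq> B \<union> J" "B \<subseteq> A \<union> J"
  shows "\<bar>real (card A) - real (card B)\<bar> \<le> card J"
proof -
  have "card A \<le> card B + card J" by (rule order.trans[OF card_mono[OF _ assms(4)] card_Un_le]) (use assms in auto)
  moreover have "card B \<le> card A + card J" by (rule order.trans[OF card_mono[OF _ assms(5)] card_Un_le]) (use assms in auto)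
  ultimately show ?thesis by linarith
qed

context rmt begin

lemma tail_tr_Q:
  fixes e :: real
  assumes "e > 0"
  shows "PC.prob {w \<in> space PC. cmod (tr (Q w) / p - PC.expectation (\<lambda>w. tr (Q w)) / p) \<ge> e} \<le> 4 * exp (- (e * p)\<^sup>2 / (8 * (n * (4 / Re u)\<^sup>2)))"
proof -
  have "cmod (tr (Q w) / p - PC.expectation (\<lambda>w. tr (Q w)) / p) = cmod (tr (Q w) - PC.expectation (\<lambda>w. tr (Q w))) / p" for w
    by (simp add: norm_divide flip: diff_divide_distrib)
  then show ?thesis
    using concentration_trAQ(2)[OF op_bound_proj dims_proj _, of "e * p"] p assms
    by (simp add: dims_projL[OF dims_Q] pos_le_divide_eq)
qed

end

context rmt_seq begin

lemma \<tau>_at_top: "filterlim \<tau> at_top sequentially"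
proof -
  have N': "filterlim (\<lambda>k. real (N k)) at_top sequentially"
    by (rule filterlim_compose[OF filterlim_real_sequentially N])
  have "filterlim (\<lambda>x::real. x powr (1 / 16)) at_top at_top" by real_asymp
  from filterlim_compose[OF this N'] show ?thesis unfolding \<tau>_def[abs_def] .
qed

definition "J k = {i. i < p k \<and> \<tau> k < d k i}"
definition "d' k i = (if d k i \<le> \<tau> k then d k i else 0)"

lemma J: "finite (J k)" by (simp add: J_def)

text \<open>Markov's inequality for the eigenvalues: each one counted by \<open>J\<close> exceeds
  \<tau>, while their sum is at most b p.\<close>

lemma card_J: "\<forall>\<^sub>F k in sequentially. real (card (J k)) / p k \<le> b / \<tau> k"
  using b(1)
proof eventually_elim
  case (elim k)
  have "real (card (J k)) * \<tau> k = (\<Sum>i\<in>J k. \<tau> k)" by simp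
  also have "\<dots> \<le> (\<Sum>i\<in>J k. d k i)" by (rule sum_mono) (auto simp: J_def)
  also have "\<dots> \<le> (\<Sum>i<p k. d k i)" by (rule sum_mono2) (auto simp: J_def d)
  finally show ?case using elim \<tau>0[of k] p[of k] by (simp add: field_simps)
qed

lemma card_J_tendsto: "(\<lambda>k. real (card (J k)) / p k) \<longlonglongrightarrow> 0"
proof (rule tendsto_sandwich[OF _ card_J tendsto_const])
  show "(\<lambda>k. b / \<tau> k) \<longlonglongrightarrow> 0" by (rule real_tendsto_divide_at_top[OF tendsto_const \<tau>_at_top])
qed simp

text \<open>Truncation moves the empirical distribution function by at most |J| / p and the mean
  trace by at most 3 |J| / (p Re u). Both tend to 0, so the truncated sequence has the same
  \<open>H\<close> and the same limit.\<close>

theorem sg_tendsto: "sg \<longlonglongrightarrow> lim_sg"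
proof -
  have wc: "weak_conv_m (\<lambda>k. emp (p k) (d' k)) H"
    unfolding weak_conv_m_def weak_conv_def
  proof (intro allI impI)
    fix x assume "isCont (cdf H) x"
    then have l: "(\<lambda>k. cdf (emp (p k) (d k)) x) \<longlonglongrightarrow> cdf H x" using H(2) unfolding weak_conv_m_def weak_conv_def by simp
    have "(\<lambda>k. cdf (emp (p k) (d' k)) x - cdf (emp (p k) (d k)) x) \<longlonglongrightarrow> 0"
    proof (rule Lim_null_comparison[OF always_eventually card_J_tendsto], intro allI)
      fix k
      have "\<bar>real (card {i. i < p k \<and> d' k i \<le> x}) - real (card {i. i < p k \<and> d k i \<le> x})\<bar> \<le> card (J k)"
        by (rule card_diff_le) (auto simp: J_def d'_def split: if_splits)
      then show "norm (cdf (emp (p k) (d' k)) x - cdf (emp (p k) (d k)) x) \<le> real (card (J k)) / p k"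
        using p[of k] by (simp add: cdf_emp divide_right_mono flip: diff_divide_distrib)
    qed
    from tendsto_add[OF this l] show "(\<lambda>k. cdf (emp (p k) (d' k)) x) \<longlonglongrightarrow> cdf H x" by simp
  qed
  have r: "rmt (p k) (N k) u (V k) (d' k) (C k) (z1 k) (z2 k) K" for k
    using rmt.truncation(1)[OF rmt[of k], of "\<tau> k"] unfolding d'_def[abs_def] .
  interpret t: rmt_seq p N u V d' C z1 z2 K c b H
  proof (rule rmt_seq.intro[OF r N c H(1) wc _ b(2)])
    show "\<forall>\<^sub>F k in sequentially. (\<Sum>i<p k. d' k i) \<le> b * p k"
      using b(1)
    proof eventually_elim
      case (elim k)
      have "(\<Sum>i<p k. d' k i) \<le> (\<Sum>i<p k. d k i)" by (rule sum_mono) (simp add: d'_def d)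
      then show ?case using elim by simp
    qed
  qed
  have "(\<lambda>k. sg k - t.sg k) \<longlonglongrightarrow> 0"
  proof (rule Lim_null_comparison[OF always_eventually], intro allI)
    show "(\<lambda>k. 3 / Re u * (real (card (J k)) / p k)) \<longlonglongrightarrow> 0" by (rule tendsto_mult_right_zero[OF card_J_tendsto])
    fix k
    interpret a: rmt "p k" "N k" u "V k" "d k" "C k" "z1 k" "z2 k" K by (rule rmt)
    interpret b: rmt "p k" "N k" u "V k" "d' k" "C k" "z1 k" "z2 k" K by (rule r)
    have i: "integrable a.PC (\<lambda>w. tr (a.Q w))" "integrable a.PC (\<lambda>w. tr (b.Q w))"
      using a.integrable_trAQ[OF op_bound_proj dims_proj] b.integrable_trAQ[OF op_bound_proj dims_proj]
      by (simp_all add: dims_projL[OF a.dims_Q] dims_projL[OF b.dims_Q])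
    have "cmod (a.PC.expectation (\<lambda>w. tr (a.Q w) - tr (b.Q w))) \<le> a.PC.expectation (\<lambda>w. cmod (tr (a.Q w) - tr (b.Q w)))"
      by (rule integral_norm_bound)
    also have "\<dots> \<le> a.PC.expectation (\<lambda>w. 3 * card (J k) / Re u)"
    proof (rule integral_mono)
      fix w show "cmod (tr (a.Q w) - tr (b.Q w)) \<le> 3 * card (J k) / Re u"
        using a.truncation(2)[of w "\<tau> k"] unfolding J_def d'_def[abs_def] .
    qed (use i in auto)
    finally have "cmod (a.PC.expectation (\<lambda>w. tr (a.Q w)) - a.PC.expectation (\<lambda>w. tr (b.Q w))) \<le> 3 * card (J k) / Re u"
      using i by (simp add: a.PC.prob_space)
    from divide_right_mono[OF this, of "real (p k)"]
    show "norm (sg k - t.sg k) \<le> 3 / Re u * (real (card (J k)) / p k)"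
      unfolding sg_def t.sg_def by (simp add: norm_divide flip: diff_divide_distrib)
  qed
  moreover have "t.sg \<longlonglongrightarrow> t.lim_sg"
    by (rule t.sg_tendsto_truncated) (simp add: d'_def t.\<tau>_def \<tau>_def less_imp_le)
  ultimately have "(\<lambda>k. (sg k - t.sg k) + t.sg k) \<longlonglongrightarrow> 0 + t.lim_sg" by (rule tendsto_add)
  then show ?thesis by (simp add: t.lim_sg_def lim_sg_def t.h_def h_def)
qed

end

subsection \<open>Concentration for a random population matrix\<close>

lemma (in prob_space) indep_vars_reindex:
  assumes "indep_vars M' X (f ` I)" "inj_on f I"
  shows "indep_vars (\<lambda>i. M' (f i)) (\<lambda>i. X (f i)) I"
  unfolding indep_vars_def2 indep_sets_def
proof (intro conjI ballI allI impI)
  fix i assume i: "i \<in> I"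
  show "X (f i) \<in> M \<rightarrow>\<^sub>M M' (f i)" using assms(1) i by (auto simp: indep_vars_def2)
  then show "{X (f i) -` A \<inter> space M |A. A \<in> sets (M' (f i))} \<subseteq> events" by (auto dest: measurable_sets)
next
  fix J A assume J: "J \<subseteq> I" "J \<noteq> {}" "finite J"
    and A: "A \<in> (\<Pi> j\<in>J. {X (f j) -` A \<inter> space M |A. A \<in> sets (M' (f j))})"
  define g where "g = inv_into J f"
  have inj: "inj_on f J" using assms(2) J(1) by (rule inj_on_subset)
  have g: "g (f j) = j" if "j \<in> J" for j unfolding g_def using inj that by (rule inv_into_f_f)
  have ind: "indep_sets (\<lambda>i. {X i -` A \<inter> space M |A. A \<in> sets (M' i)}) (f ` I)"
    using assms(1) by (simp add: indep_vars_def2)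
  have "prob (\<Inter>j\<in>f ` J. A (g j)) = (\<Prod>j\<in>f ` J. prob (A (g j)))"
  proof (rule indep_setsD[OF ind])
    show "\<forall>j\<in>f ` J. A (g j) \<in> {X j -` A \<inter> space M |A. A \<in> sets (M' j)}"
    proof
      fix l assume "l \<in> f ` J"
      then obtain j where j: "j \<in> J" "l = f j" by blast
      then show "A (g l) \<in> {X l -` A \<inter> space M |A. A \<in> sets (M' l)}"
        using Pi_mem[OF A j(1)] g[OF j(1)] by simp
    qed
  qed (use J in auto)
  moreover have "(\<Inter>j\<in>f ` J. A (g j)) = (\<Inter>j\<in>J. A j)" using g by auto
  moreover have "(\<Prod>j\<in>f ` J. prob (A (g j))) = (\<Prod>j\<in>J. prob (A j))"
    unfolding prod.reindex[OF inj] using g by (intro prod.cong) auto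
  ultimately show "prob (\<Inter> (A ` J)) = (\<Prod>j\<in>J. prob (A j))" by simp
qed

lemma space_mat_borel: "space (mat_borel r c) = carrier_mat r c"
  by (simp add: mat_borel_def)

lemma measurable_mat_entry:
  assumes "i < r" "j < c"
  shows "(\<lambda>A. A $$ (i, j)) \<in> borel_measurable (mat_borel r c)"
proof -
  have "(\<lambda>A. \<lambda>ij\<in>{..<r} \<times> {..<c}. A $$ ij) \<in> mat_borel r c \<rightarrow>\<^sub>M Pi\<^sub>M ({..<r} \<times> {..<c}) (\<lambda>_. borel)"
    unfolding mat_borel_def by (rule measurable_vimage_algebra1) (auto simp: space_PiM)
  from measurable_compose[OF this measurable_component_singleton[of "(i, j)"]] show ?thesis
    using assms by (simp cong: measurable_cong)
qed

locale entries = prob_space M for M :: "'w measure" +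
  fixes p n :: nat and Z1 Z2 :: "'w \<Rightarrow> complex mat" and K :: real
  assumes p: "0 < p" and n: "0 < n"
    and indep: "indep_var (mat_borel p n) Z1 (mat_borel p n) Z2"
    and indep_entries: "\<And>Z. Z \<in> {Z1, Z2} \<Longrightarrow> indep_vars (\<lambda>_. borel) (\<lambda>ij \<omega>. Z \<omega> $$ ij) ({..<p} \<times> {..<n})"
    and moments: "\<And>Z i j. Z \<in> {Z1, Z2} \<Longrightarrow> i < p \<Longrightarrow> j < n \<Longrightarrow> std_moments K (distr M borel (\<lambda>\<omega>. Z \<omega> $$ (i, j)))"
begin

text \<open>Outside the index range all entries are the one at \<open>(0, 0)\<close>, so that every index carries a
  standardised law.\<close>
definition X :: "nat \<times> nat \<times> nat \<Rightarrow> 'w \<Rightarrow> complex" where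
  "X = (\<lambda>(k, i, j) \<omega>. if i < p \<and> j < n then (if k = 0 then Z1 \<omega> else Z2 \<omega>) $$ (i, j) else Z1 \<omega> $$ (0, 0))"
text \<open>Indices are triples (matrix, row, column): \<open>L k\<close> collects one matrix,
  \<open>col_index j\<close> the \<open>j\<close>-th column of both. Regrouping by columns produces
  the product space that \<open>rmt\<close> works on.\<close>

definition "L k = {k :: nat} \<times> {..<p} \<times> {..<n}"
definition "col_index j = {0, 1::nat} \<times> {..<p} \<times> {j::nat}"
definition "N t = distr M borel (X t)"
definition "Col j = Pi\<^sub>M (col_index j) N"
definition "entry_cols \<omega> = (\<lambda>j\<in>{..<n}. \<lambda>t\<in>col_index j. X t \<omega>)"

lemma measurable_Z: "Z1 \<in> M \<rightarrow>\<^sub>M mat_borel p n" "Z2 \<in> M \<rightarrow>\<^sub>M mat_borel p n"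
  using indep_var_rv1[OF indep] indep_var_rv2[OF indep] .

lemma X_entry: "\<exists>Z\<in>{Z1, Z2}. \<exists>i<p. \<exists>j<n. X t = (\<lambda>\<omega>. Z \<omega> $$ (i, j))"
proof -
  obtain k i j where t: "t = (k, i, j)" by (cases t)
  show ?thesis
  proof (cases "i < p \<and> j < n")
    case True
    then have "X t = (\<lambda>\<omega>. (if k = 0 then Z1 else Z2) \<omega> $$ (i, j))" by (auto simp: t X_def)
    then show ?thesis using True by (cases "k = 0") auto
  next
    case False
    then have "X t = (\<lambda>\<omega>. Z1 \<omega> $$ (0, 0))" by (auto simp: t X_def)
    then show ?thesis using p n by blast
  qed
qed

lemma measurable_X [measurable]: "X t \<in> borel_measurable M"
proof -
  obtain Z i j where Z: "Z \<in> {Z1, Z2}" "i < p" "j < n" "X t = (\<lambda>\<omega>. Z \<omega> $$ (i, j))" using X_entry[of t] by blast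
  show ?thesis unfolding Z(4)
    using measurable_compose[OF _ measurable_mat_entry[OF Z(2,3)]] measurable_Z Z(1) by auto
qed

lemma std_N: "std_moments K (N t)"
proof -
  obtain Z i j where Z: "Z \<in> {Z1, Z2}" "i < p" "j < n" "X t = (\<lambda>\<omega>. Z \<omega> $$ (i, j))" using X_entry[of t] by blast
  show ?thesis unfolding N_def Z(4) by (rule moments[OF Z(1-3)])
qed

sublocale std_product N K by unfold_locales (rule std_N)

lemma indep_L: "k < 2 \<Longrightarrow> indep_vars (\<lambda>_. borel) X (L k)"
proof -
  assume k: "k < 2"
  let ?Z = "if k = 0 then Z1 else Z2"
  have "snd ` L k = {..<p} \<times> {..<n}" by (force simp: L_def)
  then have "indep_vars (\<lambda>_. borel) (\<lambda>t \<omega>. ?Z \<omega> $$ (snd t)) (L k)"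
    using indep_vars_reindex[of "\<lambda>_. borel" "\<lambda>ij \<omega>. ?Z \<omega> $$ ij" snd "L k"] indep_entries[of ?Z]
    by (auto simp: L_def inj_on_def)
  moreover have "\<And>t. t \<in> L k \<Longrightarrow> (\<lambda>\<omega>. ?Z \<omega> $$ (snd t)) = X t" by (auto simp: L_def X_def)
  ultimately show ?thesis by (subst indep_vars_cong[OF refl _ refl]) auto
qed

lemma L_ne: "L k \<noteq> {}" "finite (L k)" using p n by (auto simp: L_def)

lemma distr_L: "k < 2 \<Longrightarrow> distr M (Pi\<^sub>M (L k) N) (\<lambda>\<omega>. \<lambda>t\<in>L k. X t \<omega>) = Pi\<^sub>M (L k) N"
proof -
  assume k: "k < 2"
  have "distr M (Pi\<^sub>M (L k) (\<lambda>_. borel)) (\<lambda>\<omega>. \<lambda>t\<in>L k. X t \<omega>) = Pi\<^sub>M (L k) N"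
    using indep_L[OF k] unfolding indep_vars_iff_distr_eq_PiM[OF L_ne(1) measurable_X] N_def .
  moreover have "distr M (Pi\<^sub>M (L k) (\<lambda>_. borel)) (\<lambda>\<omega>. \<lambda>t\<in>L k. X t \<omega>) = distr M (Pi\<^sub>M (L k) N) (\<lambda>\<omega>. \<lambda>t\<in>L k. X t \<omega>)"
    by (intro distr_cong sets_PiM_cong) (auto simp: sets_N)
  ultimately show ?thesis by simp
qed

lemma measurable_restrict_X: "(\<lambda>\<omega>. \<lambda>t\<in>A. X t \<omega>) \<in> M \<rightarrow>\<^sub>M Pi\<^sub>M A N"
  by (rule measurable_restrict) (simp cong: measurable_cong_sets add: sets_N)

text \<open>Independence within each matrix and between the two is given separately; on the level of
  laws, the product of the two product measures merges into one over all 2 p n entries.\<close>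

lemma indep_X: "indep_vars (\<lambda>_. borel) X (L 0 \<union> L 1)"
proof -
  let ?E = "\<lambda>k \<omega>. \<lambda>t\<in>L k. X t \<omega>"
  have disj: "L 0 \<inter> L (1::nat) = {}" and ne: "L 0 \<union> L 1 \<noteq> {}" using L_ne(1)[of 0] by (auto simp: L_def)
  have NN: "(\<lambda>i. distr M borel (X i)) = N" by (simp add: N_def fun_eq_iff)
  have e: "?E 0 \<omega> = (\<lambda>A. \<lambda>t\<in>L 0. A $$ (snd t)) (Z1 \<omega>)" "?E 1 \<omega> = (\<lambda>A. \<lambda>t\<in>L 1. A $$ (snd t)) (Z2 \<omega>)" for \<omega>
    by (auto simp: X_def L_def fun_eq_iff)
  have m: "(\<lambda>A. \<lambda>t\<in>L k. A $$ (snd t)) \<in> mat_borel p n \<rightarrow>\<^sub>M Pi\<^sub>M (L k) N" for k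
    by (rule measurable_restrict) (auto simp: L_def sets_N cong: measurable_cong_sets intro: measurable_mat_entry)
  have "indep_var (Pi\<^sub>M (L 0) N) (?E 0) (Pi\<^sub>M (L 1) N) (?E 1)"
    using indep_var_compose[OF indep m[of 0] m[of 1]] unfolding e o_def .
  then have "Pi\<^sub>M (L 0) N \<Otimes>\<^sub>M Pi\<^sub>M (L 1) N = distr M (Pi\<^sub>M (L 0) N \<Otimes>\<^sub>M Pi\<^sub>M (L 1) N) (\<lambda>\<omega>. (?E 0 \<omega>, ?E 1 \<omega>))"
    unfolding indep_var_distribution_eq using distr_L[of 0] distr_L[of 1] by (simp del: One_nat_def)
  then have "Pi\<^sub>M (L 0 \<union> L 1) N = distr (distr M (Pi\<^sub>M (L 0) N \<Otimes>\<^sub>M Pi\<^sub>M (L 1) N) (\<lambda>\<omega>. (?E 0 \<omega>, ?E 1 \<omega>))) (Pi\<^sub>M (L 0 \<union> L 1) N) (merge (L 0) (L 1))"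
    using distr_merge[OF disj L_ne(2) L_ne(2)] by (simp only:)
  also have "\<dots> = distr M (Pi\<^sub>M (L 0 \<union> L 1) N) (\<lambda>\<omega>. merge (L 0) (L 1) (?E 0 \<omega>, ?E 1 \<omega>))"
    by (subst distr_distr) (auto simp: o_def intro!: measurable_merge measurable_Pair measurable_restrict_X)
  also have "(\<lambda>\<omega>. merge (L 0) (L 1) (?E 0 \<omega>, ?E 1 \<omega>)) = (\<lambda>\<omega>. \<lambda>t\<in>L 0 \<union> L 1. X t \<omega>)"
    by (auto simp: merge_def fun_eq_iff)
  also have "distr M (Pi\<^sub>M (L 0 \<union> L 1) N) (\<lambda>\<omega>. \<lambda>t\<in>L 0 \<union> L 1. X t \<omega>) = distr M (Pi\<^sub>M (L 0 \<union> L 1) (\<lambda>_. borel)) (\<lambda>\<omega>. \<lambda>t\<in>L 0 \<union> L 1. X t \<omega>)"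
    by (intro distr_cong sets_PiM_cong) (auto simp: sets_N)
  finally show ?thesis
    unfolding indep_vars_iff_distr_eq_PiM[OF ne measurable_X] NN by (rule sym)
qed

lemma distr_entry_cols: "distr M (Pi\<^sub>M {..<n} Col) entry_cols = Pi\<^sub>M {..<n} Col"
proof -
  have col_index: "col_index j \<subseteq> L 0 \<union> L 1" if "j < n" for j using that by (auto simp: col_index_def L_def)
  have ne: "col_index j \<noteq> {}" for j using p by (auto simp: col_index_def)
  have D: "distr M (Pi\<^sub>M (col_index j) (\<lambda>_. borel)) (\<lambda>\<omega>. \<lambda>t\<in>col_index j. X t \<omega>) = Col j" if "j < n" for j
    using indep_vars_subset[OF indep_X col_index[OF that]] unfolding indep_vars_iff_distr_eq_PiM[OF ne measurable_X] N_def Col_def .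
  have "indep_vars (\<lambda>j. Pi\<^sub>M (col_index j) (\<lambda>_. borel)) (\<lambda>j \<omega>. \<lambda>t\<in>col_index j. X t \<omega>) {..<n}"
    by (rule indep_vars_restrict[OF indep_X]) (auto simp: col_index_def L_def disjoint_family_on_def)
  then have "distr M (Pi\<^sub>M {..<n} (\<lambda>j. Pi\<^sub>M (col_index j) (\<lambda>_. borel))) entry_cols = Pi\<^sub>M {..<n} (\<lambda>j. distr M (Pi\<^sub>M (col_index j) (\<lambda>_. borel)) (\<lambda>\<omega>. \<lambda>t\<in>col_index j. X t \<omega>))"
    by (subst (asm) indep_vars_iff_distr_eq_PiM') (use n in \<open>auto simp: entry_cols_def[abs_def] intro!: measurable_restrict\<close>)
  also have "\<dots> = Pi\<^sub>M {..<n} Col"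
    by (rule PiM_cong[OF refl]) (simp add: D)
  finally have "distr M (Pi\<^sub>M {..<n} (\<lambda>j. Pi\<^sub>M (col_index j) (\<lambda>_. borel))) entry_cols = Pi\<^sub>M {..<n} Col" .
  moreover have "distr M (Pi\<^sub>M {..<n} (\<lambda>j. Pi\<^sub>M (col_index j) (\<lambda>_. borel))) entry_cols = distr M (Pi\<^sub>M {..<n} Col) entry_cols"
    by (intro distr_cong sets_PiM_cong refl) (auto simp: Col_def sets_N intro!: sets_PiM_cong)
  ultimately show ?thesis by simp
qed

lemma measurable_entry_cols: "entry_cols \<in> M \<rightarrow>\<^sub>M Pi\<^sub>M {..<n} Col"
  unfolding entry_cols_def Col_def by (intro measurable_restrict measurable_restrict_X)

definition "entry_col k j b = Abs_fmat (\<lambda>i l. if i < p \<and> l = 0 then b (k, i, j) else (0::complex))" for k j :: nat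

lemma ent_entry_col: "ent (entry_col k j b) i l = (if i < p \<and> l = 0 then b (k, i, j) else 0)"
  unfolding entry_col_def by (subst ent_Abs[of _ "Suc p"]) (auto split: if_splits)

lemma dims_entry_col: "dims p 1 (entry_col k j b)" by (auto simp: dims_def ent_entry_col split: if_splits)

lemma random_fmat_entry_col: "k < 2 \<Longrightarrow> random_fmat (Col j) p 1 (entry_col k j)"
  unfolding random_fmat_def Col_def
proof (intro conjI allI dims_entry_col)
  fix i l assume k: "k < 2"
  show "(\<lambda>\<omega>. ent (entry_col k j \<omega>) i l) \<in> borel_measurable (Pi\<^sub>M (col_index j) N)"
  proof (cases "i < p \<and> l = 0")
    case True
    then have "(k, i, j) \<in> col_index j" using k by (auto simp: col_index_def)
    then show ?thesis unfolding ent_entry_col using True by simp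
  qed (auto simp: ent_entry_col)
qed

lemma quad_entry_col:
  assumes "dims p p B"
  shows "tr (adj (entry_col k j b) * (B * entry_col k' j b)) = (\<Sum>i<p. \<Sum>l<p. cnj (b (k, i, j)) * ent B i l * b (k', l, j))"
proof -
  have e: "ent (B * entry_col k' j b) i 0 = (\<Sum>l<p. ent B i l * b (k', l, j))" for i
    by (subst ent_mult_dims[OF assms]) (simp add: ent_entry_col)
  have "tr (adj (entry_col k j b) * (B * entry_col k' j b)) = ent (adj (entry_col k j b) * (B * entry_col k' j b)) 0 0"
    by (subst tr_dims[OF dims_mult[OF dims_adj[OF dims_entry_col] dims_mult[OF assms dims_entry_col]]]) simp
  also have "\<dots> = (\<Sum>i<p. cnj (b (k, i, j)) * ent (B * entry_col k' j b) i 0)"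
    by (subst ent_mult_dims[OF dims_adj[OF dims_entry_col]]) (simp add: ent_entry_col)
  finally show ?thesis unfolding e by (simp add: sum_distrib_left mult.assoc)
qed

text \<open>One quadratic form in the 2 p entries of a column pair covers all cases:
  \<open>B\<close> is put into block (k, k') of a 2 x 2 block matrix. Only a diagonal block
  contributes to the trace, so the mixed forms are centred at 0.\<close>

lemma quad_Col:
  assumes B: "dims p p B" and k: "k < 2" "k' < 2"
  shows "(\<integral>\<^sup>+b. ennreal ((cmod (tr (adj (entry_col k j b) * (B * entry_col k' j b)) - (if k = k' then tr B else 0)))\<^sup>2) \<partial>Col j) \<le> ennreal (3 * K * nrm2 B)"
proof -
  define b :: "nat \<times> nat \<times> nat \<Rightarrow> nat \<times> nat \<times> nat \<Rightarrow> complex" where "b = (\<lambda>s t. if fst s = k \<and> fst t = k' then ent B (fst (snd s)) (fst (snd t)) else 0)"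
  have s: "(\<Sum>t\<in>col_index j. f t) = (\<Sum>i<p. f (0, i, j)) + (\<Sum>i<p. f (1, i, j))" for f :: "_ \<Rightarrow> 'z :: comm_monoid_add"
  proof -
    have "col_index j = (\<lambda>i. (0, i, j)) ` {..<p} \<union> (\<lambda>i. (1, i, j)) ` {..<p}" by (auto simp: col_index_def)
    then show ?thesis
      by (simp only:) (subst sum.union_disjoint, auto simp: sum.reindex inj_on_def)
  qed
  have kk: "k = 0 \<or> k = 1" "k' = 0 \<or> k' = 1" using k by auto
  have "(\<Sum>i\<in>col_index j. \<Sum>l\<in>col_index j. cnj (x i) * b i l * x l) = tr (adj (entry_col k j x) * (B * entry_col k' j x))" for x
    unfolding quad_entry_col[OF B] s b_def using kk by auto
  moreover have "(\<Sum>i\<in>col_index j. b i i) = (if k = k' then tr B else 0)"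
    unfolding s b_def tr_dims[OF B] using kk by auto
  moreover have "(\<Sum>i\<in>col_index j. \<Sum>l\<in>col_index j. (cmod (b i l))\<^sup>2) = nrm2 B"
    unfolding s b_def nrm2_eq[OF B] using kk by auto
  ultimately show ?thesis using quad_form[of "col_index j" b] by (simp add: Col_def col_index_def)
qed

lemma rmt_Col:
  assumes "Re u > 0" "unitary p V" "\<And>i. 0 \<le> d i"
  shows "rmt p n u V d Col (entry_col 0) (entry_col 1) (3 * K)"
proof (rule rmt.intro[OF p n assms])
  show "prob_space (Col j)" for j unfolding Col_def by (intro prob_space_PiM prob_M)
  show "0 \<le> 3 * K" using std_moments_ge_1[OF std_N] by simp
  show "random_fmat (Col j) p 1 (entry_col 0 j)" "random_fmat (Col j) p 1 (entry_col 1 j)" for j by (rule random_fmat_entry_col, simp)+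
qed (use quad_Col[of _ 0 0] quad_Col[of _ 1 1] quad_Col[of _ 0 1] in auto)

end

section \<open>The resolvent trace as a function of the population matrix\<close>

context rmt begin

definition "Wt w = sm (of_real (1 / n)) (\<Sum>j<n. skew_pair (z1 j (w j)) (z2 j (w j)))"

lemma S_Wt: "S w = R * Wt w * R"
proof -
  have "skew_pair (xc j w) (yc j w) = R * skew_pair (z1 j (w j)) (z2 j (w j)) * R" for j
    unfolding skew_pair_def xc_def yc_def using adj_R by (simp add: ring_distribs mult.assoc)
  then show ?thesis unfolding S_def Wt_def by (simp add: sum_distrib_left sum_distrib_right)
qed

lemma dims_Wt: "dims p p (Wt w)"
  unfolding Wt_def by (intro dims_sm dims_sum skew_dims[OF skew_skew_pair[of p 1]] random_fmat_dims[OF z1] random_fmat_dims[OF z2])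

text \<open>Cyclically moving the square root turns the resolvent into a rational function of \<open>Sg\<close>,
  which makes its trace a measurable function of the population matrix.\<close>
lemma tr_Q_cyclic:
  defines "T \<equiv> \<lambda>w. tomat p (Wt w * Sg + sm u (proj p))"
  shows "tr (ofmat ((1 / Determinant.det (T w)) \<cdot>\<^sub>m adj_mat (T w))) = tr (Q w)"
proof -
  \<comment> \<open>The inverse of Wt Sg + u by the push-through identity, which expresses it by the
    resolvent of R Wt R.\<close>
  define Y where "Y = sm (1 / u) (proj p - Wt w * R * Q w * R)"
  have u0: "u \<noteq> 0" using u by auto
  have dT: "dims p p (Wt w * Sg + sm u (proj p))"
    by (intro dims_add dims_mult[OF dims_Wt dims_Sg] dims_sm dims_proj)
  have dY: "dims p p Y"
    unfolding Y_def by (intro dims_sm dims_diff dims_proj dims_mult[OF dims_mult[OF dims_mult[OF dims_Wt dims_R] dims_Q] dims_R])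
  have SQ: "S w * Q w = proj p - sm u (Q w)" unfolding Q_def by (rule S_res[OF skew_S u])
  have "Wt w * Sg * (Wt w * R * Q w * R) = Wt w * R * (S w * Q w) * R"
    unfolding S_Wt R_R[symmetric] by (simp only: mult.assoc)
  also have "\<dots> = Wt w * Sg - sm u (Wt w * R * Q w * R)"
    unfolding SQ R_R[symmetric] by (simp add: ring_distribs dims_projL[OF dims_R] mult.assoc)
  finally have e: "Wt w * Sg * (Wt w * R * Q w * R) = Wt w * Sg - sm u (Wt w * R * Q w * R)" .
  define X where "X = Wt w * R * Q w * R"
  have dX: "dims p p X"
    unfolding X_def by (intro dims_mult[OF dims_mult[OF dims_mult[OF dims_Wt dims_R] dims_Q] dims_R])
  have "(Wt w * Sg + sm u (proj p)) * (proj p - X) = Wt w * Sg - Wt w * Sg * X + sm u (proj p) - sm u X"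
    unfolding ring_distribs sm_mult_left dims_projR[OF dims_mult[OF dims_Wt dims_Sg]] dims_projL[OF dX] dims_projL[OF dims_proj]
    by (simp add: algebra_simps)
  also have "\<dots> = sm u (proj p)" using e unfolding X_def[symmetric] by simp
  finally have TY: "(Wt w * Sg + sm u (proj p)) * Y = proj p"
    unfolding Y_def X_def[symmetric] using u0 by simp
  have m: "T w * tomat p Y = 1\<^sub>m p"
    by (rule ofmat_inject[of _ p]) (simp_all add: T_def ofmat_mult[of _ p p _ p] ofmat_tomat dT dY TY ofmat_one mult_carrier_mat[of _ p p])
  have c: "T w \<in> carrier_mat p p" by (simp add: T_def)
  have "Determinant.det (T w) * Determinant.det (tomat p Y) = 1"
    using det_mult[OF c, of "tomat p Y"] m by simp
  then have d: "Determinant.det (T w) \<noteq> 0" by auto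
  have "(1 / Determinant.det (T w)) \<cdot>\<^sub>m adj_mat (T w) = (1 / Determinant.det (T w)) \<cdot>\<^sub>m (adj_mat (T w) * (T w * tomat p Y))"
    unfolding m using adj_mat(1)[OF c] by simp
  also have "\<dots> = (1 / Determinant.det (T w)) \<cdot>\<^sub>m ((Determinant.det (T w) \<cdot>\<^sub>m 1\<^sub>m p) * tomat p Y)"
    using adj_mat(1,3)[OF c] c by (subst assoc_mult_mat[symmetric, of _ p p _ p _ p]) auto
  also have "\<dots> = tomat p Y" by (rule eq_matI) (use d in \<open>auto simp: mult_smult_assoc_mat[of _ p p _ p]\<close>)
  finally have "tr (ofmat ((1 / Determinant.det (T w)) \<cdot>\<^sub>m adj_mat (T w))) = tr Y" by (simp add: ofmat_tomat dY)
  also have "\<dots> = (1 / u) * (p - tr (S w * Q w))"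
    unfolding Y_def S_Wt by (simp add: tr_proj) (metis mult.assoc tr_commute)
  also have "\<dots> = tr (Q w)" unfolding SQ using u0 by (simp add: tr_proj)
  finally show ?thesis .
qed

end

context entries begin

definition "Wm w = sm (of_real (1 / n)) (\<Sum>j<n. skew_pair (entry_col 0 j (w j)) (entry_col 1 j (w j)))"
text \<open>On \<open>p \<times> p\<close> matrices this is \<^const>\<open>ofmat\<close>; the projections only enforce the dimensions elsewhere.\<close>
definition "embed_fmat A = proj p * ofmat A * proj p"
definition "Tm u A w = tomat p (Wm w * embed_fmat A + sm u (proj p))"
definition "res_trace u A w = tr (ofmat ((1 / Determinant.det (Tm u A w)) \<cdot>\<^sub>m adj_mat (Tm u A w))) / p"
abbreviation "PC \<equiv> Pi\<^sub>M {..<n} Col"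

lemma prob_PC: "prob_space PC" by (intro prob_space_PiM) (simp add: Col_def prob_space_PiM prob_M)
sublocale PC: prob_space PC by (rule prob_PC)

lemma embed_fmat: "A \<in> carrier_mat p p \<Longrightarrow> embed_fmat A = ofmat A"
  unfolding embed_fmat_def by (simp add: dims_projL[OF dims_ofmat] dims_projR[OF dims_ofmat])

lemma random_fmat_embed_fmat: "random_fmat (mat_borel p p) p p embed_fmat"
  unfolding random_fmat_def
proof (intro conjI allI)
  show "dims p p (embed_fmat A)" for A
    unfolding embed_fmat_def by (auto simp: dims_def ent_mult_dims[OF dims_proj] ent_mult_dims'[OF dims_proj])
  fix i j
  show "(\<lambda>A. ent (embed_fmat A) i j) \<in> borel_measurable (mat_borel p p)"
  proof (cases "i < p \<and> j < p")
    case True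
    have "(\<lambda>A. A $$ (i, j)) \<in> borel_measurable (mat_borel p p)" using True by (intro measurable_mat_entry) auto
    moreover have "ent (embed_fmat A) i j = A $$ (i, j)" if "A \<in> space (mat_borel p p)" for A
      using that True embed_fmat[of A] by (auto simp: space_mat_borel ent_ofmat)
    ultimately show ?thesis by (simp cong: measurable_cong)
  next
    case False
    have "ent (embed_fmat A) i j = 0" if "A \<in> space (mat_borel p p)" for A
      using that False embed_fmat[of A] by (auto simp: space_mat_borel ent_ofmat)
    then show ?thesis by (simp cong: measurable_cong)
  qed
qed

lemma random_fmat_Wm: "random_fmat PC p p Wm"
proof -
  have "random_fmat PC p 1 (\<lambda>w. entry_col k j (w j))" if "k < 2" "j < n" for k j
    by (rule random_fmat_compose[OF random_fmat_entry_col[OF that(1)]], rule measurable_component_singleton) (use that in simp)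
  then have "random_fmat PC p p (\<lambda>w. skew_pair (entry_col 0 j (w j)) (entry_col 1 j (w j)))" if "j < n" for j
    unfolding skew_pair_def using that by (intro random_fmat_diff random_fmat_mult[of _ _ 1] random_fmat_adj) auto
  then show ?thesis unfolding Wm_def by (intro random_fmat_sm random_fmat_sum) auto
qed

text \<open>Joint measurability in the population matrix and the entries is what Fubini's theorem
  needs in \<open>tail_res_trace\<close>.\<close>

lemma measurable_res_trace: "(\<lambda>(A, w). res_trace u A w) \<in> borel_measurable (mat_borel p p \<Otimes>\<^sub>M PC)"
proof -
  have "random_fmat (mat_borel p p \<Otimes>\<^sub>M PC) p p (\<lambda>x. Wm (snd x) * embed_fmat (fst x) + sm u (proj p))"
    by (intro random_fmat_add random_fmat_mult[of _ p p _ p] random_fmat_compose[OF random_fmat_Wm measurable_snd] random_fmat_compose[OF random_fmat_embed_fmat measurable_fst] random_fmat_const dims_sm dims_proj)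
  from random_fmat_tr[OF random_fmat_inv(1)[OF this]] show ?thesis
    unfolding res_trace_def Tm_def split_def by (intro borel_measurable_divide) auto
qed

lemma res_trace_eq:
  assumes "A \<in> carrier_mat p p" "Re u > 0" "unitary p V" "\<And>i. 0 \<le> d i" "ofmat A = spectral_fun p V (\<lambda>i. of_real (d i))"
  shows "res_trace u A w = tr (rmt.Q p n u V d (entry_col 0) (entry_col 1) w) / p"
proof -
  interpret r: rmt p n u V d Col "entry_col 0" "entry_col 1" "3 * K" by (rule rmt_Col[OF assms(2-4)])
  have "Tm u A w = tomat p (r.Wt w * r.Sg + sm u (proj p))"
    unfolding Tm_def Wm_def r.Wt_def r.Sg_def embed_fmat[OF assms(1)] assms(5) ..
  then show ?thesis unfolding res_trace_def using r.tr_Q_cyclic[of w] by simp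
qed

lemma ofmat_Z: "Z1 \<omega> \<in> carrier_mat p n \<Longrightarrow> Z2 \<omega> \<in> carrier_mat p n \<Longrightarrow>
   (\<Sum>j<n. skew_pair (entry_col 0 j (entry_cols \<omega> j)) (entry_col 1 j (entry_cols \<omega> j))) = skew_pair (ofmat (Z1 \<omega>)) (ofmat (Z2 \<omega>))"
proof (rule fmat_eqI)
  fix i l
  assume Z: "Z1 \<omega> \<in> carrier_mat p n" "Z2 \<omega> \<in> carrier_mat p n"
  have z: "ent (entry_col k j (entry_cols \<omega> j)) i 0 = ent (ofmat (if k = 0 then Z1 \<omega> else Z2 \<omega>)) i j" if "j < n" "k < 2" for k j i
  proof -
    have "k = 0 \<or> k = 1" using that(2) by auto
    then show ?thesis using that(1) Z by (auto simp: ent_entry_col entry_cols_def col_index_def X_def ent_ofmat)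
  qed
  have a: "ent (entry_col k j (entry_cols \<omega> j) * adj (entry_col k' j (entry_cols \<omega> j))) i l
     = ent (entry_col k j (entry_cols \<omega> j)) i 0 * cnj (ent (entry_col k' j (entry_cols \<omega> j)) l 0)" for k k' j
    by (subst ent_mult_dims[OF dims_entry_col]) simp
  have b: "ent (ofmat A * adj (ofmat B)) i l = (\<Sum>j<n. ent (ofmat A) i j * cnj (ent (ofmat B) l j))"
    if "A \<in> carrier_mat p n" "B \<in> carrier_mat p n" for A B
    by (subst ent_mult_dims[OF dims_ofmat[OF that(1)]]) simp
  show "ent (\<Sum>j<n. skew_pair (entry_col 0 j (entry_cols \<omega> j)) (entry_col 1 j (entry_cols \<omega> j))) i l = ent (skew_pair (ofmat (Z1 \<omega>)) (ofmat (Z2 \<omega>))) i l"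
    unfolding skew_pair_def ent_sum ent_diff a b[OF Z] b[OF Z(2,1)] sum_subtractf[symmetric]
    by (rule sum.cong) (auto simp: z)
qed

lemma commutator_S:
  assumes \<omega>: "\<omega> \<in> space M" and A: "A \<in> carrier_mat p p" "unitary p V" "\<And>i. 0 \<le> d i" "ofmat A = spectral_fun p V (\<lambda>i. of_real (d i))"
  shows "ofmat (commutator_mat n A (Z1 \<omega>) (Z2 \<omega>)) = rmt.S p n V d (entry_col 0) (entry_col 1) (entry_cols \<omega>)"
    and "commutator_mat n A (Z1 \<omega>) (Z2 \<omega>) \<in> carrier_mat p p"
proof -
  \<comment> \<open>The parameter \<open>u\<close> does not enter \<open>S\<close>; 1 is an
    admissible value.\<close>
  interpret r: rmt p n 1 V d Col "entry_col 0" "entry_col 1" "3 * K" by (rule rmt_Col) (use A in auto)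
  have Z: "Z1 \<omega> \<in> carrier_mat p n" "Z2 \<omega> \<in> carrier_mat p n"
    using measurable_space[OF measurable_Z(1) \<omega>] measurable_space[OF measurable_Z(2) \<omega>] by (auto simp: space_mat_borel)
  have sq: "mat_sqrt A = tomat p r.R" using mat_sqrt_spectral_fun[OF A] by (simp add: r.R_def)
  have c: "mat_sqrt A \<in> carrier_mat p p" and o: "ofmat (mat_sqrt A) = r.R" by (simp_all add: sq ofmat_tomat r.dims_R)
  have x: "mat_sqrt A * Z1 \<omega> \<in> carrier_mat p n" "mat_sqrt A * Z2 \<omega> \<in> carrier_mat p n" using c Z by auto
  have y: "mat_sqrt A * Z1 \<omega> * mat_adjoint (mat_sqrt A * Z2 \<omega>) \<in> carrier_mat p p" "mat_sqrt A * Z2 \<omega> * mat_adjoint (mat_sqrt A * Z1 \<omega>) \<in> carrier_mat p p"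
    using x mat_adjoint_carrier by (meson mult_carrier_mat)+
  show "commutator_mat n A (Z1 \<omega>) (Z2 \<omega>) \<in> carrier_mat p p"
    unfolding commutator_mat_def Let_def using y by (intro smult_carrier_mat minus_carrier_mat) auto
  have p1: "ofmat (mat_sqrt A * Z1 \<omega> * mat_adjoint (mat_sqrt A * Z2 \<omega>)) = r.R * ofmat (Z1 \<omega>) * adj (r.R * ofmat (Z2 \<omega>))"
    using ofmat_mult[OF x(1) mat_adjoint_carrier[OF x(2)]] by (simp only: ofmat_adjoint ofmat_mult[OF c Z(1)] ofmat_mult[OF c Z(2)] o)
  have p2: "ofmat (mat_sqrt A * Z2 \<omega> * mat_adjoint (mat_sqrt A * Z1 \<omega>)) = r.R * ofmat (Z2 \<omega>) * adj (r.R * ofmat (Z1 \<omega>))"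
    using ofmat_mult[OF x(2) mat_adjoint_carrier[OF x(1)]] by (simp only: ofmat_adjoint ofmat_mult[OF c Z(1)] ofmat_mult[OF c Z(2)] o)
  have "ofmat (commutator_mat n A (Z1 \<omega>) (Z2 \<omega>)) = sm (of_real (1 / n)) (r.R * skew_pair (ofmat (Z1 \<omega>)) (ofmat (Z2 \<omega>)) * r.R)"
    unfolding commutator_mat_def Let_def ofmat_smult ofmat_diff[OF y] p1 p2 skew_pair_def using r.adj_R
    by (simp add: ring_distribs mult.assoc)
  also have "\<dots> = r.S (entry_cols \<omega>)"
    unfolding r.S_Wt r.Wt_def ofmat_Z[OF Z] by simp
  finally show "ofmat (commutator_mat n A (Z1 \<omega>) (Z2 \<omega>)) = r.S (entry_cols \<omega>)" .
qed

text \<open>Exhibits the regrouped entries as a measurable function of the pair of matrices, so that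
  the independence of \<open>Sig\<close> from the pair carries over to
  \<open>entry_cols\<close>.\<close>

definition "cols_of_mats = (\<lambda>(A :: complex mat, B :: complex mat). \<lambda>j\<in>{..<n}. \<lambda>(k, i, j')\<in>col_index j. (if k = 0 then A else B) $$ (i, j'))"

lemma entry_cols_cols_of_mats: "entry_cols \<omega> = cols_of_mats (Z1 \<omega>, Z2 \<omega>)"
  by (auto simp: entry_cols_def cols_of_mats_def X_def col_index_def fun_eq_iff)

lemma measurable_cols_of_mats: "cols_of_mats \<in> mat_borel p n \<Otimes>\<^sub>M mat_borel p n \<rightarrow>\<^sub>M PC"
  unfolding cols_of_mats_def split_def Col_def
proof (intro measurable_restrict)
  fix j t assume j: "j \<in> {..<n}" and "t \<in> col_index j"
  then obtain k i where t: "t = (k, i, j)" "i < p" by (auto simp: col_index_def)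
  have "(\<lambda>x. fst x $$ (i, j)) \<in> borel_measurable (mat_borel p n \<Otimes>\<^sub>M mat_borel p n)" "(\<lambda>x. snd x $$ (i, j)) \<in> borel_measurable (mat_borel p n \<Otimes>\<^sub>M mat_borel p n)"
    using j t(2) by (auto intro: measurable_compose[OF measurable_fst measurable_mat_entry] measurable_compose[OF measurable_snd measurable_mat_entry])
  then show "(\<lambda>x. (if fst t = 0 then fst x else snd x) $$ (fst (snd t), snd (snd t))) \<in> mat_borel p n \<Otimes>\<^sub>M mat_borel p n \<rightarrow>\<^sub>M N t"
    by (cases "k = 0") (simp_all add: t(1) sets_N cong: measurable_cong_sets)
qed

text \<open>As \<open>Sig\<close> is independent of the entries, this is the conditional mean of the
  trace given the value \<open>A\<close> of the population matrix.\<close>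

definition "mean_res_trace u A = PC.expectation (res_trace u A)"

context
  fixes Sig :: "'w \<Rightarrow> complex mat" and u :: complex
  assumes psd: "\<And>\<omega>. \<omega> \<in> space M \<Longrightarrow> psd_mat (Sig \<omega>)"
    and indep_Sig: "indep_elems M (mat_borel p p) Sig (mat_borel p n \<Otimes>\<^sub>M mat_borel p n) (\<lambda>\<omega>. (Z1 \<omega>, Z2 \<omega>))"
    and u: "Re u > 0"
begin

lemma measurable_Sig: "Sig \<in> M \<rightarrow>\<^sub>M mat_borel p p" using indep_Sig by (simp add: indep_elems_def)

lemma joint_law: "distr M (mat_borel p p) Sig \<Otimes>\<^sub>M PC = distr M (mat_borel p p \<Otimes>\<^sub>M PC) (\<lambda>\<omega>. (Sig \<omega>, entry_cols \<omega>))"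
proof (rule pair_measure_eqI)
  interpret D: prob_space "distr M (mat_borel p p) Sig" by (rule prob_space_distr[OF measurable_Sig])
  show "sigma_finite_measure (distr M (mat_borel p p) Sig)" "sigma_finite_measure PC" by unfold_locales
  fix A B assume A: "A \<in> sets (distr M (mat_borel p p) Sig)" and B: "B \<in> sets PC"
  have m: "(\<lambda>\<omega>. (Sig \<omega>, entry_cols \<omega>)) \<in> M \<rightarrow>\<^sub>M mat_borel p p \<Otimes>\<^sub>M PC" by (intro measurable_Pair measurable_Sig measurable_entry_cols)
  have Z: "(\<lambda>\<omega>. (Z1 \<omega>, Z2 \<omega>)) \<in> M \<rightarrow>\<^sub>M mat_borel p n \<Otimes>\<^sub>M mat_borel p n" by (intro measurable_Pair measurable_Z)
  have e: "entry_cols -` B \<inter> space M = (\<lambda>\<omega>. (Z1 \<omega>, Z2 \<omega>)) -` (cols_of_mats -` B \<inter> space (mat_borel p n \<Otimes>\<^sub>M mat_borel p n)) \<inter> space M"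
    using measurable_space[OF Z] by (auto simp: entry_cols_cols_of_mats)
  have "prob ((Sig -` A \<inter> space M) \<inter> (entry_cols -` B \<inter> space M)) = prob (Sig -` A \<inter> space M) * prob (entry_cols -` B \<inter> space M)"
  proof (rule indep_setD)
    show "indep_set {Sig -` A \<inter> space M | A. A \<in> sets (mat_borel p p)} {(\<lambda>\<omega>. (Z1 \<omega>, Z2 \<omega>)) -` B \<inter> space M | B. B \<in> sets (mat_borel p n \<Otimes>\<^sub>M mat_borel p n)}"
      using indep_Sig by (simp add: indep_elems_def)
    show "Sig -` A \<inter> space M \<in> {Sig -` A \<inter> space M | A. A \<in> sets (mat_borel p p)}" using A by auto
    show "entry_cols -` B \<inter> space M \<in> {(\<lambda>\<omega>. (Z1 \<omega>, Z2 \<omega>)) -` B \<inter> space M | B. B \<in> sets (mat_borel p n \<Otimes>\<^sub>M mat_borel p n)}"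
      unfolding e using measurable_sets[OF measurable_cols_of_mats B] by blast
  qed
  moreover have "emeasure PC B = emeasure M (entry_cols -` B \<inter> space M)"
    using emeasure_distr[OF measurable_entry_cols B] unfolding distr_entry_cols .
  moreover have "(\<lambda>\<omega>. (Sig \<omega>, entry_cols \<omega>)) -` (A \<times> B) \<inter> space M = (Sig -` A \<inter> space M) \<inter> (entry_cols -` B \<inter> space M)" by auto
  ultimately show "emeasure (distr M (mat_borel p p) Sig) A * emeasure PC B = emeasure (distr M (mat_borel p p \<Otimes>\<^sub>M PC) (\<lambda>\<omega>. (Sig \<omega>, entry_cols \<omega>))) (A \<times> B)"
    using A B by (simp add: emeasure_distr[OF measurable_Sig] emeasure_distr[OF m] emeasure_eq_measure ennreal_mult')
qed (simp cong: sets_pair_measure_cong)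

lemma measurable_mean_res_trace: "mean_res_trace u \<in> borel_measurable (mat_borel p p)"
  unfolding mean_res_trace_def[abs_def] using PC.borel_measurable_lebesgue_integral[OF measurable_res_trace] .

lemma measurable_diff: "(\<lambda>(A, w). res_trace u A w - mean_res_trace u A) \<in> borel_measurable (mat_borel p p \<Otimes>\<^sub>M PC)"
  using measurable_res_trace[of u] measurable_compose[OF measurable_fst measurable_mean_res_trace, of PC] by (simp add: split_def borel_measurable_diff)

text \<open>By \<open>joint_law\<close> and Fubini the probability is an average over the law of
  \<open>Sig\<close> of probabilities with frozen population matrix, and \<open>tail_tr_Q\<close>
  bounds each of them by a number free of eigenvalues and eigenbasis.\<close>

lemma tail_res_trace:
  fixes e :: real
  assumes e: "e > 0"
  shows "{\<omega> \<in> space M. e \<le> cmod (res_trace u (Sig \<omega>) (entry_cols \<omega>) - mean_res_trace u (Sig \<omega>))} \<in> events"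
    and "prob {\<omega> \<in> space M. e \<le> cmod (res_trace u (Sig \<omega>) (entry_cols \<omega>) - mean_res_trace u (Sig \<omega>))} \<le> 4 * exp (- (e * p)\<^sup>2 / (8 * (n * (4 / Re u)\<^sup>2)))"
proof -
  let ?P = "mat_borel p p \<Otimes>\<^sub>M PC" and ?b = "4 * exp (- (e * p)\<^sup>2 / (8 * (n * (4 / Re u)\<^sup>2)))"
  define Bd where "Bd = {x \<in> space ?P. e \<le> cmod (case x of (A, w) \<Rightarrow> res_trace u A w - mean_res_trace u A)}"
  have Bd: "Bd \<in> sets ?P" unfolding Bd_def using measurable_diff by measurable
  have m: "(\<lambda>\<omega>. (Sig \<omega>, entry_cols \<omega>)) \<in> M \<rightarrow>\<^sub>M ?P" by (intro measurable_Pair measurable_Sig measurable_entry_cols)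
  have eq: "(\<lambda>\<omega>. (Sig \<omega>, entry_cols \<omega>)) -` Bd \<inter> space M = {\<omega> \<in> space M. e \<le> cmod (res_trace u (Sig \<omega>) (entry_cols \<omega>) - mean_res_trace u (Sig \<omega>))}"
    using measurable_space[OF m] by (auto simp: Bd_def)
  show "{\<omega> \<in> space M. e \<le> cmod (res_trace u (Sig \<omega>) (entry_cols \<omega>) - mean_res_trace u (Sig \<omega>))} \<in> events"
    unfolding eq[symmetric] by (rule measurable_sets[OF m Bd])
  have "emeasure M ((\<lambda>\<omega>. (Sig \<omega>, entry_cols \<omega>)) -` Bd \<inter> space M) = emeasure (distr M (mat_borel p p) Sig \<Otimes>\<^sub>M PC) Bd"
    unfolding joint_law by (rule emeasure_distr[OF m Bd, symmetric])
  also have "\<dots> = (\<integral>\<^sup>+A. emeasure PC (Pair A -` Bd) \<partial>distr M (mat_borel p p) Sig)"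
    using Bd by (intro PC.emeasure_pair_measure_alt) (simp cong: sets_pair_measure_cong)
  also have "\<dots> = (\<integral>\<^sup>+\<omega>. emeasure PC (Pair (Sig \<omega>) -` Bd) \<partial>M)"
    using PC.measurable_emeasure_Pair[OF Bd] by (intro nn_integral_distr measurable_Sig) simp
  also have "\<dots> \<le> (\<integral>\<^sup>+\<omega>. ennreal ?b \<partial>M)"
  proof (rule nn_integral_mono)
    fix \<omega> assume \<omega>: "\<omega> \<in> space M"
    have A: "Sig \<omega> \<in> carrier_mat p p" using measurable_space[OF measurable_Sig \<omega>] by (simp add: space_mat_borel)
    obtain V d where V: "unitary p V" "\<And>i. 0 \<le> d i" "ofmat (Sig \<omega>) = spectral_fun p V (\<lambda>i. complex_of_real (d i))"
      using psd_spectral[OF A psd[OF \<omega>]] by blast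
    interpret r: rmt p n u V d Col "entry_col 0" "entry_col 1" "3 * K" by (rule rmt_Col[OF u V(1,2)])
    have f: "res_trace u (Sig \<omega>) w = tr (r.Q w) / p" for w by (rule res_trace_eq[OF A u V])
    have G: "mean_res_trace u (Sig \<omega>) = r.PC.expectation (\<lambda>w. tr (r.Q w)) / p" unfolding mean_res_trace_def f r.PC_def by simp
    have "Pair (Sig \<omega>) -` Bd = {w \<in> space r.PC. cmod (tr (r.Q w) / p - r.PC.expectation (\<lambda>w. tr (r.Q w)) / p) \<ge> e}"
      unfolding Bd_def f[symmetric] G[symmetric] unfolding r.PC_def using A by (auto simp: space_pair_measure space_mat_borel)
    then have "emeasure PC (Pair (Sig \<omega>) -` Bd) = ennreal (r.PC.prob {w \<in> space r.PC. cmod (tr (r.Q w) / p - r.PC.expectation (\<lambda>w. tr (r.Q w)) / p) \<ge> e})"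
      by (simp add: r.PC_def[symmetric] r.PC.emeasure_eq_measure)
    also have "\<dots> \<le> ennreal ?b" by (intro ennreal_leI r.tail_tr_Q e)
    finally show "emeasure PC (Pair (Sig \<omega>) -` Bd) \<le> ennreal ?b" .
  qed
  also have "\<dots> = ennreal ?b" by (simp add: emeasure_space_1)
  finally show "prob {\<omega> \<in> space M. e \<le> cmod (res_trace u (Sig \<omega>) (entry_cols \<omega>) - mean_res_trace u (Sig \<omega>))} \<le> ?b"
    unfolding eq emeasure_eq_measure by (subst (asm) ennreal_le_iff) auto
qed

end

end

subsection \<open>Almost sure convergence\<close>

definition limit_stieltjes :: "real \<Rightarrow> real measure \<Rightarrow> complex \<Rightarrow> complex" where
  "limit_stieltjes c H z = 1 / z * (2 / complex_of_real c - 1) +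
     1 / (\<i> * complex_of_real c * z) * (1 / (\<i> + complex_of_real c * h_fun c H z) - 1 / (- \<i> + complex_of_real c * h_fun c H z))"

lemma h_fun_nonzero_den:
  assumes "population_dist H" "0 < c" "Re z < 0"
  shows "1 + (of_real c * h_fun c H z)\<^sup>2 \<noteq> 0"
  by (rule denoms_nonzero_Re) (use is_h_h_fun[OF assms] assms in \<open>auto simp: is_h_def\<close>)

lemma limit_stieltjes_eq:
  assumes "population_dist H" "0 < c" "Re z < 0"
  shows "limit_stieltjes c H z = (1 - 2 * (of_real c * h_fun c H z)\<^sup>2 / (1 + (of_real c * h_fun c H z)\<^sup>2) / of_real c) / (- z)"
proof -
  have "- z \<noteq> 0" "c \<noteq> 0" using assms by auto
  from sigma_formula[OF this h_fun_nonzero_den[OF assms]] show ?thesis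
    unfolding limit_stieltjes_def minus_minus .
qed

lemma continuous_on_limit_stieltjes:
  assumes "population_dist H" "0 < c"
  shows "continuous_on {z. Re z < 0} (limit_stieltjes c H)"
proof -
  have h: "continuous_on {z. Re z < 0} (h_fun c H)"
    using h_fun_holomorphic[OF assms] by (intro holomorphic_on_imp_continuous_on analytic_imp_holomorphic)
  have "continuous_on {z. Re z < 0} (\<lambda>z. (1 - 2 * (of_real c * h_fun c H z)\<^sup>2 / (1 + (of_real c * h_fun c H z)\<^sup>2) / of_real c) / (- z))"
    using h_fun_nonzero_den[OF assms] assms(2) by (intro continuous_intros h) auto
  then show ?thesis
    by (rule continuous_on_cong[THEN iffD1, rotated 2]) (use limit_stieltjes_eq[OF assms] in auto)
qed

lemma h_fun_bound:
  assumes H: "population_dist H" and c: "0 < c" and T: "0 < T" and i: "integrable H (\<lambda>t. t)"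
  shows "cmod (h_fun c H (of_real (- T))) \<le> (LINT t|H. t) / T"
proof -
  let ?h = "h_fun c H (of_real (- T))"
  have h: "is_h c H (of_real (- T)) ?h" by (rule is_h_h_fun[OF H c]) (use T in simp)
  then have R: "0 \<le> Re (rho c ?h)" using c by (intro Re_rho_nonneg) (auto simp: is_h_def)
  have "cmod ?h = cmod (h_map c H (of_real T) ?h)" using h by (simp add: is_h_h_map)
  also have "\<dots> \<le> (LINT t|H. cmod (of_real t / (of_real T + of_real t * rho c ?h)))"
    unfolding h_map_def by (rule integral_norm_bound)
  also have "\<dots> \<le> (LINT t|H. t / T)"
  proof (rule integral_mono_AE)
    have AE: "AE t in H. 0 \<le> t" using H by (simp add: population_dist_def)
    show i2: "integrable H (\<lambda>t. t / T)" using i by simp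
    show "AE t in H. cmod (of_real t / (of_real T + of_real t * rho c ?h)) \<le> t / T"
      using AE by eventually_elim (use den_bound1[of "of_real T", OF _ _ R] T in simp)
    show "integrable H (\<lambda>t. cmod (of_real t / (of_real T + of_real t * rho c ?h)))"
    proof (rule integrable_norm, rule Bochner_Integration.integrable_bound[OF i2])
      show "(\<lambda>t. of_real t / (of_real T + of_real t * rho c ?h)) \<in> borel_measurable H"
        using H by (simp add: population_dist_def real_distribution_def real_distribution_axioms_def cong: measurable_cong_sets)
      show "AE t in H. cmod (of_real t / (of_real T + of_real t * rho c ?h)) \<le> norm (t / T)"
        using AE by eventually_elim (use den_bound1[of "of_real T", OF _ _ R] T in simp)
    qed
  qed
  finally show ?thesis by simp
qed

lemma limit_stieltjes_at_infinity:
  assumes H: "population_dist H" and c: "0 < c" and i: "integrable H (\<lambda>t. t)"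
  shows "((\<lambda>T. T * Re (limit_stieltjes c H (of_real (- T)))) \<longlongrightarrow> 1) at_top"
proof -
  let ?h = "\<lambda>T. h_fun c H (of_real (- T))"
  have "(?h \<longlongrightarrow> 0) at_top"
  proof (rule Lim_null_comparison)
    show "\<forall>\<^sub>F T in at_top. norm (?h T) \<le> (LINT t|H. t) / T"
      using eventually_gt_at_top[of 0] by eventually_elim (rule h_fun_bound[OF H c _ i])
    show "((\<lambda>T. (LINT t|H. t) / T) \<longlongrightarrow> 0) at_top" by (rule real_tendsto_divide_at_top[OF tendsto_const filterlim_ident])
  qed
  then have "((\<lambda>T. Re (1 - 2 * (of_real c * ?h T)\<^sup>2 / (1 + (of_real c * ?h T)\<^sup>2) / of_real c)) \<longlongrightarrow> Re (1 - 2 * (of_real c * 0)\<^sup>2 / (1 + (of_real c * 0)\<^sup>2) / of_real c)) at_top"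
    by (intro tendsto_intros) (use c in auto)
  then have l: "((\<lambda>T. Re (1 - 2 * (of_real c * ?h T)\<^sup>2 / (1 + (of_real c * ?h T)\<^sup>2) / of_real c)) \<longlongrightarrow> 1) at_top" by simp
  show ?thesis
  proof (rule Lim_transform_eventually[OF l])
    show "\<forall>\<^sub>F T in at_top. Re (1 - 2 * (of_real c * ?h T)\<^sup>2 / (1 + (of_real c * ?h T)\<^sup>2) / of_real c) = T * Re (limit_stieltjes c H (of_real (- T)))"
      using eventually_gt_at_top[of 0]
    proof eventually_elim
      case (elim T)
      have "limit_stieltjes c H (of_real (- T)) = (1 - 2 * (of_real c * ?h T)\<^sup>2 / (1 + (of_real c * ?h T)\<^sup>2) / of_real c) / of_real T"
        using limit_stieltjes_eq[OF H c, of "of_real (- T)"] elim by simp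
      then show ?case using elim by (simp only: Re_divide_of_real) simp
    qed
  qed
qed

text \<open>Bounded truncations of t pass to the weak limit with integral at most \<open>b\<close>;
  Fatou's lemma removes the truncation.\<close>

lemma integrable_mean:
  assumes \<mu>: "\<And>n. real_distribution (\<mu> n)" "\<And>n. AE t in \<mu> n. 0 \<le> t" "\<And>n. integrable (\<mu> n) (\<lambda>t. t)"
    and H: "real_distribution H" "AE t in H. 0 \<le> t" and w: "weak_conv_m \<mu> H"
    and b: "\<forall>\<^sub>F n in sequentially. (LINT t|\<mu> n. t) \<le> b"
  shows "integrable H (\<lambda>t. t)"
proof -
  interpret H: real_distribution H by fact
  define f where "f = (\<lambda>k t. min (max t 0) (real k))"
  have f: "isCont (f k) t" "norm (f k t) \<le> real k" for k t
    unfolding f_def by (auto intro!: continuous_intros)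
  have random_fmat [measurable]: "f k \<in> borel_measurable borel" for k unfolding f_def by measurable
  have fi: "integrable N (f k)" if "real_distribution N" for N k
  proof -
    interpret N: real_distribution N by fact
    show ?thesis by (rule N.integrable_const_bound[of _ "real k"]) (use f in auto)
  qed
  have "(LINT t|H. f k t) \<le> b" for k
  proof (rule tendsto_upperbound)
    show "(\<lambda>n. LINT t|\<mu> n. f k t) \<longlonglongrightarrow> (LINT t|H. f k t)"
      by (rule weak_conv_imp_integral_bdd_continuous_conv[OF \<mu>(1) H(1) w f])
    show "\<forall>\<^sub>F n in sequentially. (LINT t|\<mu> n. f k t) \<le> b"
      using b
    proof eventually_elim
      case (elim n)
      have "(LINT t|\<mu> n. f k t) \<le> (LINT t|\<mu> n. t)"
        by (rule integral_mono_AE[OF fi[OF \<mu>(1)] \<mu>(3)]) (use \<mu>(2)[of n] in \<open>auto simp: f_def elim!: eventually_mono\<close>)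
      then show ?case using elim by simp
    qed
  qed simp
  then have bd: "(\<integral>\<^sup>+t. ennreal (f k t) \<partial>H) \<le> ennreal b" for k
    using fi[OF H(1)] by (subst nn_integral_eq_integral) (auto simp: f_def intro!: ennreal_leI)
  have "(\<integral>\<^sup>+t. ennreal (max t 0) \<partial>H) = (\<integral>\<^sup>+t. liminf (\<lambda>k. ennreal (f k t)) \<partial>H)"
  proof (rule nn_integral_cong)
    fix t
    obtain k0 :: nat where "t \<le> real k0" using real_arch_simple by blast
    then have "\<forall>\<^sub>F k in sequentially. ennreal (f k t) = ennreal (max t 0)"
      unfolding eventually_sequentially by (intro exI[of _ k0]) (auto simp: f_def min_def max_def)
    then have "(\<lambda>k. ennreal (f k t)) \<longlonglongrightarrow> ennreal (max t 0)" by (rule tendsto_eventually)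
    then show "ennreal (max t 0) = liminf (\<lambda>k. ennreal (f k t))" by (simp add: lim_imp_Liminf)
  qed
  also have "\<dots> \<le> liminf (\<lambda>k. \<integral>\<^sup>+t. ennreal (f k t) \<partial>H)" by (rule nn_integral_liminf) measurable
  also have "\<dots> \<le> liminf (\<lambda>k::nat. ennreal b)" by (intro Liminf_mono always_eventually allI bd)
  also have "\<dots> < \<infinity>" by (simp add: Liminf_const)
  finally have fin: "(\<integral>\<^sup>+t. ennreal (max t 0) \<partial>H) < \<infinity>" .
  have "integrable H (\<lambda>t. max t 0)" by (rule integrableI_nonneg) (use fin in auto)
  then show ?thesis
    by (rule integrable_cong_AE_imp) (use H(2) in \<open>auto elim!: eventually_mono\<close>)
qed

lemma stieltjes_lipschitz:
  assumes M: "real_distribution M" and z: "Re z \<le> - a" "Re z' \<le> - a" "0 < a"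
  shows "cmod (stieltjes_imag M z - stieltjes_imag M z') \<le> cmod (z - z') / a\<^sup>2"
proof -
  interpret real_distribution M by fact
  have i: "integrable M (\<lambda>t. 1 / (\<i> * of_real t - z))" "integrable M (\<lambda>t. 1 / (\<i> * of_real t - z'))"
    by (rule integrable_stieltjes, use z in linarith)+
  have "cmod (stieltjes_imag M z - stieltjes_imag M z') = cmod (LINT t|M. 1 / (\<i> * of_real t - z) - 1 / (\<i> * of_real t - z'))"
    unfolding stieltjes_imag_def using i by simp
  also have "\<dots> \<le> (LINT t|M. cmod (1 / (\<i> * of_real t - z) - 1 / (\<i> * of_real t - z')))"
    by (rule integral_norm_bound)
  also have "\<dots> \<le> (LINT t|M. cmod (z - z') / a\<^sup>2)"
  proof (rule integral_mono)
    show "integrable M (\<lambda>t. cmod (1 / (\<i> * of_real t - z) - 1 / (\<i> * of_real t - z')))" using i by simp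
    fix t
    have a: "a \<le> cmod (\<i> * of_real t - z)" "a \<le> cmod (\<i> * of_real t - z')"
      using complex_Re_le_cmod[of "\<i> * of_real t - z"] complex_Re_le_cmod[of "\<i> * of_real t - z'"] z by auto
    then have nz: "\<i> * of_real t - z \<noteq> 0" "\<i> * of_real t - z' \<noteq> 0" using z(3) by auto
    have "1 / (\<i> * of_real t - z) - 1 / (\<i> * of_real t - z') = (z - z') / ((\<i> * of_real t - z) * (\<i> * of_real t - z'))"
      unfolding diff_frac_eq[OF nz] by simp
    moreover have "a * a \<le> cmod (\<i> * of_real t - z) * cmod (\<i> * of_real t - z')"
      using a z(3) by (intro mult_mono) auto
    ultimately show "cmod (1 / (\<i> * of_real t - z) - 1 / (\<i> * of_real t - z')) \<le> cmod (z - z') / a\<^sup>2"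
      using z(3) nz by (simp only: norm_divide norm_mult power2_eq_square) (intro divide_left_mono mult_pos_pos; simp)
  qed simp
  finally show ?thesis by (simp add: prob_space[unfolded space_eq_univ])
qed

text \<open>Transforms of probability laws are equi-Lipschitz on Re z <= - a, so convergence on a
  dense set and continuity of the limit suffice.\<close>

lemma stieltjes_limit_dense:
  assumes \<mu>: "\<And>n. real_distribution (\<mu> n)" and g: "continuous_on {z. Re z < 0} g"
    and D: "\<And>X. open X \<Longrightarrow> X \<noteq> {} \<Longrightarrow> \<exists>d\<in>D. d \<in> X"
    and lim: "\<And>z. z \<in> D \<Longrightarrow> Re z < 0 \<Longrightarrow> (\<lambda>n. stieltjes_imag (\<mu> n) z) \<longlonglongrightarrow> g z"
    and z: "Re z < 0"
  shows "(\<lambda>n. stieltjes_imag (\<mu> n) z) \<longlonglongrightarrow> g z"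
proof (rule LIMSEQ_I)
  fix e :: real assume e: "0 < e"
  have op: "open {z. Re z < 0}" by (rule open_halfspace_Re_lt)
  \<comment> \<open>Half the distance to the imaginary axis: points within \<open>a\<close> of
    \<open>z\<close> still have real part at most - a.\<close>
  define a where "a = - Re z / 2"
  have a: "0 < a" using z by (simp add: a_def)
  have "isCont g z" using g op z by (simp add: continuous_on_eq_continuous_at)
  then obtain d where d: "0 < d" "\<And>z'. dist z' z < d \<Longrightarrow> dist (g z') (g z) < e / 3"
    unfolding continuous_at_eps_delta by (metis divide_pos_pos e zero_less_numeral)
  let ?B = "ball z (min a (min d (a\<^sup>2 * e / 3)))"
  have "0 < a\<^sup>2 * e / 3" using a e by simp
  then have "z \<in> ?B" using a d(1) by simp
  then have "open ?B" "?B \<noteq> {}" by blast+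
  then obtain z' where z': "z' \<in> D" "z' \<in> ?B" using D by meson
  then have n: "cmod (z - z') < a" "cmod (z - z') < d" "cmod (z - z') < a\<^sup>2 * e / 3" by (auto simp: dist_norm)
  have r: "Re z \<le> - a" "Re z' \<le> - a" using n(1) abs_Re_le_cmod[of "z - z'"] z by (auto simp: a_def)
  then have "Re z' < 0" using a by simp
  from LIMSEQ_D[OF lim[OF z'(1) this], of "e / 3"] e
  obtain N where N: "\<And>n. N \<le> n \<Longrightarrow> norm (stieltjes_imag (\<mu> n) z' - g z') < e / 3" by auto
  have l: "cmod (stieltjes_imag (\<mu> n) z - stieltjes_imag (\<mu> n) z') < e / 3" for n
  proof -
    have "cmod (z - z') / a\<^sup>2 < e / 3" using n(3) a by (simp add: divide_less_eq mult.commute)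
    then show ?thesis using stieltjes_lipschitz[OF \<mu> r a, of n] by (rule le_less_trans[rotated])
  qed
  have gz: "cmod (g z' - g z) < e / 3" using d(2)[of z'] n(2) by (simp add: dist_norm norm_minus_commute)
  show "\<exists>N. \<forall>n\<ge>N. norm (stieltjes_imag (\<mu> n) z - g z) < e"
  proof (intro exI allI impI)
    fix n assume "N \<le> n"
    let ?s = "stieltjes_imag (\<mu> n)"
    have "?s z - g z = (?s z - ?s z') + ((?s z' - g z') + (g z' - g z))" by simp
    then have "norm (?s z - g z) = norm ((?s z - ?s z') + ((?s z' - g z') + (g z' - g z)))" by simp
    then show "norm (?s z - g z) < e"
      using norm_triangle_ineq[of "?s z - ?s z'" "(?s z' - g z') + (g z' - g z)"] norm_triangle_ineq[of "?s z' - g z'" "g z' - g z"] l[of n] N[OF \<open>N \<le> n\<close>] gz by linarith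
  qed
qed

lemma powr_moment_bound: "0 < \<eta> \<Longrightarrow> 0 \<le> x \<Longrightarrow> x ^ 4 \<le> 1 + x powr (4 + \<eta>)" for x \<eta> :: real
proof (cases "x \<le> 1")
  case True
  assume "0 \<le> x"
  then have "x ^ 4 \<le> 1" using True by (simp add: power_le_one)
  then show ?thesis using powr_ge_zero[of x "4 + \<eta>"] by linarith
next
  case False
  assume "0 < \<eta>"
  have "x ^ 4 = x powr 4" using False by (simp add: powr_numeral)
  also have "\<dots> \<le> x powr (4 + \<eta>)" using False \<open>0 < \<eta>\<close> by (intro powr_mono) auto
  finally show ?thesis by simp
qed

lemma (in prob_space) std_moments_distr:
  fixes Y :: "'a \<Rightarrow> complex"
  assumes Y: "Y \<in> borel_measurable M" and \<eta>: "0 < \<eta>" and m: "(LINT \<omega>|M. Y \<omega>) = 0" "(LINT \<omega>|M. (cmod (Y \<omega>))\<^sup>2) = 1"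
    "integrable M (\<lambda>\<omega>. cmod (Y \<omega>) powr (4 + \<eta>))" "(LINT \<omega>|M. cmod (Y \<omega>) powr (4 + \<eta>)) \<le> K"
  shows "std_moments (1 + K) (distr M borel Y)"
proof -
  have b: "(cmod (Y \<omega>)) ^ 4 \<le> 1 + cmod (Y \<omega>) powr (4 + \<eta>)" for \<omega> by (rule powr_moment_bound[OF \<eta>]) simp
  have i: "integrable M (\<lambda>\<omega>. 1 + cmod (Y \<omega>) powr (4 + \<eta>))" using m(3) by simp
  have i4: "integrable M (\<lambda>\<omega>. (cmod (Y \<omega>)) ^ 4)"
  proof (rule Bochner_Integration.integrable_bound[OF i])
    show "(\<lambda>\<omega>. cmod (Y \<omega>) ^ 4) \<in> borel_measurable M" using Y by measurable
    show "AE \<omega> in M. norm (cmod (Y \<omega>) ^ 4) \<le> norm (1 + cmod (Y \<omega>) powr (4 + \<eta>))"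
      by (rule AE_I2) (use b in \<open>auto intro: order.trans[OF _ abs_ge_self]\<close>)
  qed
  have "(LINT \<omega>|M. (cmod (Y \<omega>)) ^ 4) \<le> (LINT \<omega>|M. 1 + cmod (Y \<omega>) powr (4 + \<eta>))"
    by (rule integral_mono[OF i4 i b])
  also have "\<dots> \<le> 1 + K" using m(3,4) by (simp add: prob_space)
  finally show ?thesis
    unfolding std_moments_def using prob_space_distr[OF Y] m(1,2) i4 Y
    by (simp add: integrable_distr_eq integral_distr)
qed

text \<open>Eventually p >= (c / 2) n, so the exponent is at least a fixed multiple of n and the
  series is dominated by a geometric one. The shift by one reflects that the matrices are given for
  n >= 1.\<close>

lemma summable_tail:
  assumes c: "(\<lambda>n. real (p n) / real n) \<longlonglongrightarrow> c" "0 < c" and e: "0 < e" and r: "0 < r"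
  shows "summable (\<lambda>k. 4 * exp (- (e * p (Suc k))\<^sup>2 / (8 * (Suc k * (4 / r)\<^sup>2))))"
proof -
  define a where "a = (e * c / 2)\<^sup>2 / (8 * (4 / r)\<^sup>2)"
  have a: "0 < a" unfolding a_def using e c(2) r by (intro divide_pos_pos mult_pos_pos zero_less_power) auto
  have "\<forall>\<^sub>F n in sequentially. c / 2 < real (p n) / real n" using c by (intro order_tendstoD(1)[OF c(1)]) auto
  then have "\<forall>\<^sub>F k in sequentially. c / 2 < real (p (Suc k)) / real (Suc k)" by (rule eventually_sequentially_Suc[THEN iffD2])
  then have ev: "\<forall>\<^sub>F k in sequentially. norm (4 * exp (- (e * p (Suc k))\<^sup>2 / (8 * (Suc k * (4 / r)\<^sup>2)))) \<le> 4 * exp (- a) ^ k"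
  proof eventually_elim
    case (elim k)
    have "e * c / 2 * Suc k \<le> e * p (Suc k)" using elim e by (simp add: less_divide_eq mult.assoc[symmetric])
    then have "(e * c / 2 * Suc k)\<^sup>2 \<le> (e * p (Suc k))\<^sup>2" using e c(2) by (intro power_mono) auto
    then have "(e * c / 2 * Suc k)\<^sup>2 / (8 * (Suc k * (4 / r)\<^sup>2)) \<le> (e * p (Suc k))\<^sup>2 / (8 * (Suc k * (4 / r)\<^sup>2))"
      by (rule divide_right_mono) simp
    moreover have "(e * c / 2 * Suc k)\<^sup>2 / (8 * (Suc k * (4 / r)\<^sup>2)) = a * Suc k"
      unfolding a_def power_mult_distrib[of _ "real (Suc k)"] using r by (simp add: power2_eq_square[of "real (Suc k)"] del: of_nat_Suc)
    moreover have "a * k \<le> a * Suc k" using a by simp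
    ultimately have "exp (- (e * p (Suc k))\<^sup>2 / (8 * (Suc k * (4 / r)\<^sup>2))) \<le> exp (- (a * k))" by simp
    also have "\<dots> = exp (- a) ^ k" by (simp add: exp_of_nat_mult[symmetric] mult.commute)
    finally show ?case by simp
  qed
  have "summable (\<lambda>k. 4 * exp (- a) ^ k)" using a by (intro summable_mult summable_geometric) simp
  from summable_comparison_test_ev[OF ev this] show ?thesis .
qed

section \<open>Assembly in the random model\<close>

locale commutator_model = prob_space M for M :: "'w measure" +
  fixes p :: "nat \<Rightarrow> nat" and c K C :: real and Z1 Z2 Sig :: "nat \<Rightarrow> 'w \<Rightarrow> complex mat" and H :: "real measure"
  assumes ent: "\<And>n. 1 \<le> n \<Longrightarrow> entries M (p n) n (Z1 n) (Z2 n) K"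
    and c: "(\<lambda>n. real (p n) / real n) \<longlonglongrightarrow> c" "0 < c"
    and psd: "\<And>n \<omega>. 1 \<le> n \<Longrightarrow> \<omega> \<in> space M \<Longrightarrow> psd_mat (Sig n \<omega>)"
    and indep_Sig: "\<And>n. 1 \<le> n \<Longrightarrow> indep_elems M (mat_borel (p n) (p n)) (Sig n) (mat_borel (p n) n \<Otimes>\<^sub>M mat_borel (p n) n) (\<lambda>\<omega>. (Z1 n \<omega>, Z2 n \<omega>))"
    and H: "population_dist H" and esd: "AE \<omega> in M. weak_conv (\<lambda>n. esd_herm (Sig n \<omega>)) (cdf H)"
    and C: "0 < C" and tr: "AE \<omega> in M. limsup (\<lambda>n. ereal (Re (mat_tr (Sig n \<omega>)) / real (p n))) < ereal C"
begin

definition "sample_stieltjes u n \<omega> = entries.res_trace (p n) n u (Sig n \<omega>) (entries.entry_cols (p n) n (Z1 n) (Z2 n) \<omega>)"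
definition "mean_stieltjes u n \<omega> = entries.mean_res_trace M (p n) n (Z1 n) (Z2 n) u (Sig n \<omega>)"

text \<open>Borel-Cantelli gives an almost sure bound for each threshold, and the countably many
  thresholds 1 / (m + 1) suffice.\<close>

lemma concentration_AE:
  assumes u: "0 < Re u"
  shows "AE \<omega> in M. (\<lambda>k. sample_stieltjes u (Suc k) \<omega> - mean_stieltjes u (Suc k) \<omega>) \<longlonglongrightarrow> 0"
proof -
  have *: "AE \<omega> in M. \<forall>\<^sub>F k in sequentially. cmod (sample_stieltjes u (Suc k) \<omega> - mean_stieltjes u (Suc k) \<omega>) < e" if e: "0 < e" for e
  proof -
    define A where "A k = {\<omega> \<in> space M. e \<le> cmod (sample_stieltjes u (Suc k) \<omega> - mean_stieltjes u (Suc k) \<omega>)}" for k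
    have A: "A k \<in> events \<and> prob (A k) \<le> 4 * exp (- (e * p (Suc k))\<^sup>2 / (8 * (Suc k * (4 / Re u)\<^sup>2)))" for k
    proof -
      interpret entries M "p (Suc k)" "Suc k" "Z1 (Suc k)" "Z2 (Suc k)" K by (rule ent) simp
      have ps: "\<And>\<omega>. \<omega> \<in> space M \<Longrightarrow> psd_mat (Sig (Suc k) \<omega>)" by (rule psd) simp
      have ii: "indep_elems M (mat_borel (p (Suc k)) (p (Suc k))) (Sig (Suc k)) (mat_borel (p (Suc k)) (Suc k) \<Otimes>\<^sub>M mat_borel (p (Suc k)) (Suc k)) (\<lambda>\<omega>. (Z1 (Suc k) \<omega>, Z2 (Suc k) \<omega>))"
        by (rule indep_Sig) simp
      show ?thesis unfolding A_def sample_stieltjes_def mean_stieltjes_def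
        by (intro conjI tail_res_trace[OF ps ii u e])
    qed
    have "AE \<omega> in M. \<forall>\<^sub>F k in sequentially. \<omega> \<in> space M - A k"
    proof (rule borel_cantelli_AE1)
      show "summable (\<lambda>k. prob (A k))"
        by (rule summable_comparison_test'[OF summable_tail[OF c e u], of 0]) (use A in simp)
      show "A k \<in> events" for k using A by blast
      show "emeasure M (A k) < \<infinity>" for k by (simp add: emeasure_eq_measure)
    qed
    then show ?thesis
      by (rule AE_mp) (intro AE_I2 impI, auto simp: A_def not_le elim!: eventually_mono)
  qed
  have "AE \<omega> in M. \<forall>m::nat. \<forall>\<^sub>F k in sequentially. cmod (sample_stieltjes u (Suc k) \<omega> - mean_stieltjes u (Suc k) \<omega>) < 1 / Suc m"
    unfolding AE_all_countable by (intro allI *) simp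
  then show ?thesis
  proof eventually_elim
    case (elim \<omega>)
    show ?case unfolding tendsto_iff
    proof (intro allI impI)
      fix e :: real assume "0 < e"
      then obtain m where "1 / Suc m < e" using nat_approx_posE by blast
      then show "\<forall>\<^sub>F k in sequentially. dist (sample_stieltjes u (Suc k) \<omega> - mean_stieltjes u (Suc k) \<omega>) 0 < e"
        using elim[rule_format, of m] by (auto simp: dist_norm elim!: eventually_mono)
    qed
  qed
qed

lemma carrier_Sig: "1 \<le> n \<Longrightarrow> \<omega> \<in> space M \<Longrightarrow> Sig n \<omega> \<in> carrier_mat (p n) (p n)"
  using indep_Sig[of n] measurable_space[of "Sig n" M "mat_borel (p n) (p n)" \<omega>] by (simp add: indep_elems_def space_mat_borel)

lemma p_pos: "1 \<le> n \<Longrightarrow> 0 < p n"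
  using ent[of n] by (simp add: entries_def entries_axioms_def)

lemma spectral_Sig: "1 \<le> n \<Longrightarrow> \<omega> \<in> space M \<Longrightarrow>
    \<exists>V d. unitary (p n) V \<and> (\<forall>i. 0 \<le> d i) \<and> ofmat (Sig n \<omega>) = spectral_fun (p n) V (\<lambda>i. complex_of_real (d i))"
  by (rule psd_spectral[OF carrier_Sig psd])

context
  fixes \<omega>
  assumes \<omega>: "\<omega> \<in> space M" and esd\<omega>: "weak_conv (\<lambda>n. esd_herm (Sig n \<omega>)) (cdf H)"
    and tr\<omega>: "limsup (\<lambda>n. ereal (Re (mat_tr (Sig n \<omega>)) / real (p n))) < ereal C"
begin

text \<open>The outcome is fixed, so eigenbases may be chosen freely for each \<open>k\<close>; no
  measurable choice is involved.\<close>

lemma spectral_seq: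
  "\<exists>V d. (\<forall>k. unitary (p (Suc k)) (V k)) \<and> (\<forall>k i. 0 \<le> d k i) \<and>
    (\<forall>k. ofmat (Sig (Suc k) \<omega>) = spectral_fun (p (Suc k)) (V k) (\<lambda>i. complex_of_real (d k i))) \<and>
    weak_conv_m (\<lambda>k. emp (p (Suc k)) (d k)) H \<and> (\<forall>\<^sub>F k in sequentially. (\<Sum>i<p (Suc k). d k i) \<le> C * p (Suc k))"
proof -
  have "\<forall>k. \<exists>x. unitary (p (Suc k)) (fst x) \<and> (\<forall>i. 0 \<le> snd x i) \<and> ofmat (Sig (Suc k) \<omega>) = spectral_fun (p (Suc k)) (fst x) (\<lambda>i. complex_of_real (snd x i))"
    using spectral_Sig[OF _ \<omega>] by (metis fst_conv snd_conv le_add1 plus_1_eq_Suc)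
  then obtain x where x: "\<And>k. unitary (p (Suc k)) (fst (x k))" "\<And>k i. 0 \<le> snd (x k) i"
    "\<And>k. ofmat (Sig (Suc k) \<omega>) = spectral_fun (p (Suc k)) (fst (x k)) (\<lambda>i. complex_of_real (snd (x k) i))" by metis
  have esd_eq: "esd_herm (Sig (Suc k) \<omega>) = cdf (emp (p (Suc k)) (snd (x k)))" for k
    by (rule esd_herm_spectral_fun[OF carrier_Sig[OF _ \<omega>] x(1,3) p_pos]) simp_all
  then have w: "weak_conv_m (\<lambda>k. emp (p (Suc k)) (snd (x k))) H"
    unfolding weak_conv_m_def weak_conv_def
  proof (intro allI impI)
    fix y assume "isCont (cdf H) y"
    then have "(\<lambda>n. esd_herm (Sig n \<omega>) y) \<longlonglongrightarrow> cdf H y" using esd\<omega> unfolding weak_conv_def by simp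
    from LIMSEQ_Suc[OF this] show "(\<lambda>k. cdf (emp (p (Suc k)) (snd (x k))) y) \<longlonglongrightarrow> cdf H y" unfolding esd_eq .
  qed
  have "\<forall>\<^sub>F n in sequentially. ereal (Re (mat_tr (Sig n \<omega>)) / real (p n)) < ereal C" using tr\<omega> by (rule Limsup_lessD)
  then have "\<forall>\<^sub>F k in sequentially. ereal (Re (mat_tr (Sig (Suc k) \<omega>)) / real (p (Suc k))) < ereal C"
    by (rule eventually_sequentially_Suc[THEN iffD2])
  then have "\<forall>\<^sub>F k in sequentially. (\<Sum>i<p (Suc k). snd (x k) i) \<le> C * p (Suc k)"
  proof eventually_elim
    case (elim k)
    have "mat_tr (Sig (Suc k) \<omega>) = (\<Sum>i<p (Suc k). complex_of_real (snd (x k) i))"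
      unfolding mat_tr_ofmat[OF carrier_Sig[OF _ \<omega>, of "Suc k", simplified]] x(3) by (rule tr_spectral_fun[OF x(1)])
    then show ?case using elim p_pos[of "Suc k"] by (simp add: divide_less_eq)
  qed
  then show ?thesis using x w by (intro exI[of _ "\<lambda>k. fst (x k)"] exI[of _ "\<lambda>k. snd (x k)"] conjI allI)
qed

lemma mean_stieltjes_tendsto:
  assumes u: "0 < Re u"
  shows "(\<lambda>k. mean_stieltjes u (Suc k) \<omega>) \<longlonglongrightarrow> limit_stieltjes c H (- u)"
proof -
  obtain V d where V: "\<And>k. unitary (p (Suc k)) (V k)" "\<And>k i. 0 \<le> d k i"
    "\<And>k. ofmat (Sig (Suc k) \<omega>) = spectral_fun (p (Suc k)) (V k) (\<lambda>i. complex_of_real (d k i))"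
    and w: "weak_conv_m (\<lambda>k. emp (p (Suc k)) (d k)) H" and t: "\<forall>\<^sub>F k in sequentially. (\<Sum>i<p (Suc k). d k i) \<le> C * p (Suc k)"
    using spectral_seq by blast
  define Cc where "Cc k = entries.Col M (p (Suc k)) (Suc k) (Z1 (Suc k)) (Z2 (Suc k))" for k
  have ek: "entries M (p (Suc k)) (Suc k) (Z1 (Suc k)) (Z2 (Suc k)) K" for k by (rule ent) simp
  interpret r: rmt_seq "\<lambda>k. p (Suc k)" Suc u V d Cc "\<lambda>k. entries.entry_col (p (Suc k)) 0" "\<lambda>k. entries.entry_col (p (Suc k)) 1" "3 * K" c C H
  proof (rule rmt_seq.intro)
    show "rmt (p (Suc k)) (Suc k) u (V k) (d k) (Cc k) (entries.entry_col (p (Suc k)) 0) (entries.entry_col (p (Suc k)) 1) (3 * K)" for k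
      unfolding Cc_def by (rule entries.rmt_Col[OF ek u V(1,2)])
    show "(\<lambda>k. real (p (Suc k)) / real (Suc k)) \<longlonglongrightarrow> c" by (rule LIMSEQ_Suc[OF c(1)])
  qed (rule filterlim_Suc c H w t C)+
  have "mean_stieltjes u (Suc k) \<omega> = r.sg k" for k
  proof -
    interpret entries M "p (Suc k)" "Suc k" "Z1 (Suc k)" "Z2 (Suc k)" K by (rule ek)
    interpret q: rmt "p (Suc k)" "Suc k" u "V k" "d k" Col "entry_col 0" "entry_col 1" "3 * K" by (rule rmt_Col[OF u V(1,2)])
    have f: "res_trace u (Sig (Suc k) \<omega>) w = tr (q.Q w) / p (Suc k)" for w
      by (rule res_trace_eq[OF carrier_Sig[OF _ \<omega>] u V(1,2,3)]) simp
    have "mean_res_trace u (Sig (Suc k) \<omega>) = q.PC.expectation (\<lambda>w. tr (q.Q w)) / p (Suc k)"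
      unfolding mean_res_trace_def f q.PC_def by simp
    then show ?thesis unfolding mean_stieltjes_def r.sg_def Cc_def .
  qed
  then have "(\<lambda>k. mean_stieltjes u (Suc k) \<omega>) \<longlonglongrightarrow> r.lim_sg" using r.sg_tendsto by simp
  also have "r.lim_sg = limit_stieltjes c H (- u)"
    unfolding r.lim_sg_def r.h_def using limit_stieltjes_eq[OF H c(2), of "- u"] u by simp
  finally show ?thesis .
qed

lemma integrable_H: "integrable H (\<lambda>t. t)"
proof -
  obtain V d where V: "\<And>k. unitary (p (Suc k)) (V k)" "\<And>k i. 0 \<le> d k i"
    "\<And>k. ofmat (Sig (Suc k) \<omega>) = spectral_fun (p (Suc k)) (V k) (\<lambda>i. complex_of_real (d k i))"
    and w: "weak_conv_m (\<lambda>k. emp (p (Suc k)) (d k)) H" and t: "\<forall>\<^sub>F k in sequentially. (\<Sum>i<p (Suc k). d k i) \<le> C * p (Suc k)"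
    using spectral_seq by blast
  have p: "0 < p (Suc k)" for k by (rule p_pos) simp
  show ?thesis
  proof (rule integrable_mean[OF real_distribution_emp _ _ _ _ w])
    show "AE t in emp (p (Suc k)) (d k). 0 \<le> t" for k unfolding emp_def by (subst AE_distr_iff) (auto simp: V(2))
    show "integrable (emp (p (Suc k)) (d k)) (\<lambda>t. t)" for k by (rule integrable_emp[OF p]) simp
    show "\<forall>\<^sub>F k in sequentially. (LINT t|emp (p (Suc k)) (d k). t) \<le> C"
      using t
    proof eventually_elim
      case (elim k)
      have "(LINT t|emp (p (Suc k)) (d k). t) = (\<Sum>i<p (Suc k). d k i) / p (Suc k)"
        by (subst integral_emp[OF p]) (simp_all add: divide_inverse mult.commute)
      then show ?case using elim p[of k] by (simp add: divide_le_eq)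
    qed
  qed (use H in \<open>simp_all add: population_dist_def\<close>)
qed

end

definition "Sk n \<omega> = commutator_mat n (Sig n \<omega>) (Z1 n \<omega>) (Z2 n \<omega>)"

lemma stieltjes_commutator:
  assumes n1: "1 \<le> n" and \<omega>: "\<omega> \<in> space M"
  shows "\<exists>\<mu>. real_distribution \<mu> \<and> esd_skew (Sk n \<omega>) = cdf \<mu> \<and> (\<forall>z. Re z < 0 \<longrightarrow> stieltjes_imag \<mu> z = sample_stieltjes (- z) n \<omega>)"
proof -
  interpret entries M "p n" n "Z1 n" "Z2 n" K by (rule ent[OF n1])
  obtain V d where V: "unitary (p n) V" "\<And>i. 0 \<le> d i" "ofmat (Sig n \<omega>) = spectral_fun (p n) V (\<lambda>i. complex_of_real (d i))"
    using spectral_Sig[OF n1 \<omega>] by blast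
  note A = carrier_Sig[OF n1 \<omega>]
  interpret r: rmt "p n" n 1 V d Col "entry_col 0" "entry_col 1" "3 * K" by (rule rmt_Col) (use V in auto)
  have S: "ofmat (Sk n \<omega>) = r.S (entry_cols \<omega>)" "Sk n \<omega> \<in> carrier_mat (p n) (p n)"
    unfolding Sk_def using commutator_S[OF \<omega> A V] by blast+
  obtain e where e: "esd_skew (Sk n \<omega>) = cdf (emp (p n) e)"
    "\<And>z. Re z < 0 \<Longrightarrow> stieltjes_imag (emp (p n) e) z = tr (res (p n) (- z) (ofmat (Sk n \<omega>))) / p n"
    using stieltjes_esd[OF S(2)] r.skew_S S(1) p_pos[OF n1] by metis
  have "stieltjes_imag (emp (p n) e) z = sample_stieltjes (- z) n \<omega>" if z: "Re z < 0" for z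
  proof -
    interpret q: rmt "p n" n "- z" V d Col "entry_col 0" "entry_col 1" "3 * K" by (rule rmt_Col) (use V z in auto)
    have "sample_stieltjes (- z) n \<omega> = tr (q.Q (entry_cols \<omega>)) / p n" unfolding sample_stieltjes_def by (rule res_trace_eq[OF A _ V]) (use z in simp)
    then show ?thesis unfolding e(2)[OF z] S(1) q.Q_def by (rule sym)
  qed
  then show ?thesis using e(1) real_distribution_emp by blast
qed

theorem esd_commutator_limit:
  "\<exists>F. real_distribution F \<and> (AE \<omega> in M. weak_conv (\<lambda>n. esd_skew (Sk n \<omega>)) (cdf F)) \<and>
     (\<forall>z. Re z < 0 \<longrightarrow> stieltjes_imag F z = limit_stieltjes c H z)"
proof -
  \<comment> \<open>A countable dense set keeps the number of exceptional events countable.\<close>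
  obtain D :: "complex set" where D: "countable D" "\<And>X. open X \<Longrightarrow> X \<noteq> {} \<Longrightarrow> \<exists>d\<in>D. d \<in> X"
    using countable_dense_exists by blast
  have "AE \<omega> in M. \<forall>z\<in>D \<inter> {z. Re z < 0}. (\<lambda>k. sample_stieltjes (- z) (Suc k) \<omega> - mean_stieltjes (- z) (Suc k) \<omega>) \<longlonglongrightarrow> 0"
    unfolding AE_ball_countable[OF countable_Int1[OF D(1)]] by (intro ballI concentration_AE) auto
  then have AE: "AE \<omega> in M. \<omega> \<in> space M \<and> integrable H (\<lambda>t. t) \<and> (\<forall>z\<in>D. Re z < 0 \<longrightarrow> (\<lambda>k. sample_stieltjes (- z) (Suc k) \<omega>) \<longlonglongrightarrow> limit_stieltjes c H z)"
    using esd tr AE_space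
  proof eventually_elim
    case (elim \<omega>)
    have "(\<lambda>k. sample_stieltjes (- z) (Suc k) \<omega>) \<longlonglongrightarrow> limit_stieltjes c H z" if z: "z \<in> D" "Re z < 0" for z
    proof -
      have "(\<lambda>k. sample_stieltjes (- z) (Suc k) \<omega> - mean_stieltjes (- z) (Suc k) \<omega>) \<longlonglongrightarrow> 0" using elim(1) z by blast
      from tendsto_add[OF this mean_stieltjes_tendsto[OF elim(4,2,3), of "- z"]] z show ?thesis by simp
    qed
    then show ?case using elim(4) integrable_H[OF elim(4,2,3)] by blast
  qed
  \<comment> \<open>The finite mean of \<open>H\<close> and the existence of \<open>F\<close> are
    not random: one good outcome yields both, and this \<open>F\<close> then serves for almost every
    outcome.\<close>
  have "\<exists>\<omega>. \<omega> \<in> space M \<and> integrable H (\<lambda>t. t) \<and> (\<forall>z\<in>D. Re z < 0 \<longrightarrow> (\<lambda>k. sample_stieltjes (- z) (Suc k) \<omega>) \<longlonglongrightarrow> limit_stieltjes c H z)"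
  proof (rule ccontr)
    assume n: "\<not> ?thesis"
    have "AE \<omega> in M. False" using AE by (rule AE_mp, intro AE_I2) (use n in blast)
    then show False by simp
  qed
  then obtain \<omega>0 where \<omega>0: "\<omega>0 \<in> space M" "\<And>z. z \<in> D \<Longrightarrow> Re z < 0 \<Longrightarrow> (\<lambda>k. sample_stieltjes (- z) (Suc k) \<omega>0) \<longlonglongrightarrow> limit_stieltjes c H z"
    and iH: "integrable H (\<lambda>t. t)" by blast
  note g = limit_stieltjes_at_infinity[OF H c(2) iH]
  have conv: "\<exists>\<mu>. (\<forall>k. real_distribution (\<mu> k)) \<and> (\<forall>k. esd_skew (Sk (Suc k) \<omega>) = cdf (\<mu> k)) \<and>
      (\<forall>z. Re z < 0 \<longrightarrow> (\<lambda>k. stieltjes_imag (\<mu> k) z) \<longlonglongrightarrow> limit_stieltjes c H z)"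
    if w: "\<omega> \<in> space M" "\<And>z. z \<in> D \<Longrightarrow> Re z < 0 \<Longrightarrow> (\<lambda>k. sample_stieltjes (- z) (Suc k) \<omega>) \<longlonglongrightarrow> limit_stieltjes c H z" for \<omega>
  proof -
    have "\<forall>k. \<exists>\<mu>. real_distribution \<mu> \<and> esd_skew (Sk (Suc k) \<omega>) = cdf \<mu> \<and> (\<forall>z. Re z < 0 \<longrightarrow> stieltjes_imag \<mu> z = sample_stieltjes (- z) (Suc k) \<omega>)"
      by (intro allI stieltjes_commutator w(1)) simp
    then obtain \<mu> where \<mu>: "\<And>k. real_distribution (\<mu> k)" "\<And>k. esd_skew (Sk (Suc k) \<omega>) = cdf (\<mu> k)"
      "\<And>k z. Re z < 0 \<Longrightarrow> stieltjes_imag (\<mu> k) z = sample_stieltjes (- z) (Suc k) \<omega>" by metis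
    have "(\<lambda>k. stieltjes_imag (\<mu> k) z) \<longlonglongrightarrow> limit_stieltjes c H z" if z: "Re z < 0" for z
    proof (rule stieltjes_limit_dense[OF \<mu>(1) continuous_on_limit_stieltjes[OF H c(2)] D(2) _ z])
      fix z' assume "z' \<in> D" "Re z' < 0"
      then show "(\<lambda>k. stieltjes_imag (\<mu> k) z') \<longlonglongrightarrow> limit_stieltjes c H z'" using w(2)[of z'] \<mu>(3)[of z'] by simp
    qed
    then show ?thesis using \<mu>(1,2) by blast
  qed
  obtain \<mu> where "\<And>k. real_distribution (\<mu> k)" "\<And>z. Re z < 0 \<Longrightarrow> (\<lambda>k. stieltjes_imag (\<mu> k) z) \<longlonglongrightarrow> limit_stieltjes c H z"
    using conv[OF \<omega>0] by blast
  from stieltjes_continuity(1)[OF this g] obtain F where F: "real_distribution F" "\<And>z. Re z < 0 \<Longrightarrow> stieltjes_imag F z = limit_stieltjes c H z" by blast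
  have "AE \<omega> in M. weak_conv (\<lambda>n. esd_skew (Sk n \<omega>)) (cdf F)"
    using AE
  proof eventually_elim
    case (elim \<omega>)
    then obtain \<mu> where \<mu>: "\<And>k. real_distribution (\<mu> k)" "\<And>k. esd_skew (Sk (Suc k) \<omega>) = cdf (\<mu> k)"
      "\<And>z. Re z < 0 \<Longrightarrow> (\<lambda>k. stieltjes_imag (\<mu> k) z) \<longlonglongrightarrow> limit_stieltjes c H z"
      using conv[of \<omega>] by blast
    have w: "weak_conv_m \<mu> F" by (rule stieltjes_continuity(2)[OF \<mu>(1,3) g F])
    show ?case unfolding weak_conv_def
    proof (intro allI impI)
      fix x assume "isCont (cdf F) x"
      then have "(\<lambda>k. cdf (\<mu> k) x) \<longlonglongrightarrow> cdf F x" using w unfolding weak_conv_m_def weak_conv_def by simp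
      then show "(\<lambda>n. esd_skew (Sk n \<omega>) x) \<longlonglongrightarrow> cdf F x" unfolding \<mu>(2)[symmetric] by (rule LIMSEQ_imp_Suc)
    qed
  qed
  then show ?thesis using F by blast
qed

end

theorem theorem4p1:
  fixes M :: "'w measure"
    and p :: "nat \<Rightarrow> nat"
    and c \<eta>\<^sub>0 K C :: real
    and Z1 Z2 \<Sigma> :: "nat \<Rightarrow> 'w \<Rightarrow> complex mat"
    and H :: "real measure"
  assumes "prob_space M"
    and p_pos: "\<And>n. n \<ge> 1 \<Longrightarrow> p n \<ge> 1"
    and T1: "(\<lambda>n. real (p n) / real n) \<longlonglongrightarrow> c" "c > 0"
    and T2_indep: "\<And>n. n \<ge> 1 \<Longrightarrow>
          prob_space.indep_var M (mat_borel (p n) n) (Z1 n) (mat_borel (p n) n) (Z2 n)"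
    and T2_entries: "\<And>n Z. n \<ge> 1 \<Longrightarrow> Z \<in> {Z1 n, Z2 n} \<Longrightarrow>
          prob_space.indep_vars M (\<lambda>_. borel) (\<lambda>ij \<omega>. Z \<omega> $$ ij) ({..<p n} \<times> {..<n})"
    and T2_moments: "\<eta>\<^sub>0 > 0"
        "\<And>n Z i j. n \<ge> 1 \<Longrightarrow> Z \<in> {Z1 n, Z2 n} \<Longrightarrow> i < p n \<Longrightarrow> j < n \<Longrightarrow>
          (LINT \<omega>|M. Z \<omega> $$ (i, j)) = 0 \<and>
          (LINT \<omega>|M. (cmod (Z \<omega> $$ (i, j)))\<^sup>2) = 1 \<and>
          integrable M (\<lambda>\<omega>. cmod (Z \<omega> $$ (i, j)) powr (4 + \<eta>\<^sub>0)) \<and>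
          (LINT \<omega>|M. cmod (Z \<omega> $$ (i, j)) powr (4 + \<eta>\<^sub>0)) \<le> K"
    and T3_psd: "\<And>n \<omega>. n \<ge> 1 \<Longrightarrow> \<omega> \<in> space M \<Longrightarrow> psd_mat (\<Sigma> n \<omega>)"
    and T3_indep: "\<And>n. n \<ge> 1 \<Longrightarrow>
          indep_elems M (mat_borel (p n) (p n)) (\<Sigma> n)
            (mat_borel (p n) n \<Otimes>\<^sub>M mat_borel (p n) n) (\<lambda>\<omega>. (Z1 n \<omega>, Z2 n \<omega>))"
    and T3_limit: "population_dist H"
        "AE \<omega> in M. weak_conv (\<lambda>n. esd_herm (\<Sigma> n \<omega>)) (cdf H)"
    and T4: "C > 0"
        "AE \<omega> in M. limsup (\<lambda>n. ereal (Re (mat_tr (\<Sigma> n \<omega>)) / real (p n))) < ereal C"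
  shows "(\<exists>F. real_distribution F \<and>
           (AE \<omega> in M. weak_conv
              (\<lambda>n. esd_skew (commutator_mat n (\<Sigma> n \<omega>) (Z1 n \<omega>) (Z2 n \<omega>))) (cdf F)) \<and>
           (\<forall>z. Re z < 0 \<longrightarrow> stieltjes_imag F z =
              1 / z * (2 / complex_of_real c - 1) +
              1 / (\<i> * complex_of_real c * z) *
                (1 / (\<i> + complex_of_real c * h_fun c H z) -
                 1 / (- \<i> + complex_of_real c * h_fun c H z)))) \<and>
         (\<forall>z. Re z < 0 \<longrightarrow> (\<exists>!w. is_h c H z w)) \<and>
         h_fun c H analytic_on {z. Re z < 0} \<and>
         (\<forall>z. Re z < 0 \<longrightarrow> (\<forall>\<epsilon>>0. \<exists>\<delta>>0. \<forall>H'. population_dist H' \<longrightarrow>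
           levy_dist (cdf H') (cdf H) < \<delta> \<longrightarrow>
           (\<exists>!w. is_h c H' z w) \<and> dist (h_fun c H' z) (h_fun c H z) < \<epsilon>))"
proof -
  interpret prob_space M by fact
  \<comment> \<open>1 + K bounds the fourth moments because x^4 <= 1 + x^(4 + \<eta>) for x >=
    0.\<close>
  have ent: "entries M (p n) n (Z1 n) (Z2 n) (1 + K)" if n: "n \<ge> 1" for n
  proof
    show "0 < p n" "0 < n" using p_pos[OF n] n by auto
    show "indep_var (mat_borel (p n) n) (Z1 n) (mat_borel (p n) n) (Z2 n)" by (rule T2_indep[OF n])
    show "indep_vars (\<lambda>_. borel) (\<lambda>ij \<omega>. Z \<omega> $$ ij) ({..<p n} \<times> {..<n})" if "Z \<in> {Z1 n, Z2 n}" for Z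
      by (rule T2_entries[OF n that])
    fix Z i j assume Z: "Z \<in> {Z1 n, Z2 n}" "i < p n" "j < n"
    have "(\<lambda>\<omega>. Z \<omega> $$ (i, j)) \<in> borel_measurable M"
      using T2_entries[OF n Z(1)] Z(2,3) unfolding indep_vars_def2 by blast
    then show "std_moments (1 + K) (distr M borel (\<lambda>\<omega>. Z \<omega> $$ (i, j)))"
      using T2_moments(2)[OF n Z] by (intro std_moments_distr[OF _ T2_moments(1)]) auto
  qed
  interpret commutator_model M p c "1 + K" C Z1 Z2 \<Sigma> H
  proof (rule commutator_model.intro[OF prob_space_axioms commutator_model_axioms.intro])
    show "entries M (p n) n (Z1 n) (Z2 n) (1 + K)" if "1 \<le> n" for n by (rule ent[OF that])
    show "psd_mat (\<Sigma> n \<omega>)" if "1 \<le> n" "\<omega> \<in> space M" for n \<omega> by (rule T3_psd[OF that])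
    show "indep_elems M (mat_borel (p n) (p n)) (\<Sigma> n) (mat_borel (p n) n \<Otimes>\<^sub>M mat_borel (p n) n) (\<lambda>\<omega>. (Z1 n \<omega>, Z2 n \<omega>))"
      if "1 \<le> n" for n by (rule T3_indep[OF that])
  qed (rule T1 T3_limit T4)+
  show ?thesis
  proof (intro conjI)
    show "\<forall>z. Re z < 0 \<longrightarrow> (\<exists>!w. is_h c H z w)"
      using is_h_ex1[OF T3_limit(1) T1(2)] by simp
    show "h_fun c H analytic_on {z. Re z < 0}" by (rule h_fun_holomorphic[OF T3_limit(1) T1(2)])
    show "\<forall>z. Re z < 0 \<longrightarrow> (\<forall>\<epsilon>>0. \<exists>\<delta>>0. \<forall>H'. population_dist H' \<longrightarrow>
           levy_dist (cdf H') (cdf H) < \<delta> \<longrightarrow>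
           (\<exists>!w. is_h c H' z w) \<and> dist (h_fun c H' z) (h_fun c H z) < \<epsilon>)"
      by (intro allI impI h_fun_levy_continuous[OF T3_limit(1) T1(2)])
  qed (rule esd_commutator_limit[unfolded Sk_def limit_stieltjes_def])
qed

end
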